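(* Let $\widehat{\boldsymbol{x}}$ be obtained from an almost-$C^1$ spline geometry $\boldsymbol{x}\in\mathscr{B}^d$ on $\mathcal{T}$ via the refinement process described in the context. Then the following hold true. (a) Translation and rotation invariance: let $A$ be the matrix mapping the coarse control points $\boldsymbol{x}_\phi$, $\phi\in\mathscr{I}$, to the refined control points $\widehat{\boldsymbol{x}}_\phi$, $\phi\in\widehat{\mathscr{I}}$. If $T$ and $R$ denote a translation and a rotation, then $$A\circ T=T\circ A,\qquad A\circ R=R\circ A .$$ In particular, the rows of $A$ sum to $1$. (b) Boundary preservation: let $\tau$ be a boundary edge of $\mathcal{T}$, parameterized by $[0,1]$, let $\boldsymbol{x}_\tau$ be the local representation of $\boldsymbol{x}$ restricted to $\tau$, and let $\widehat\tau_L,\widehat\tau_R$ be the refined edges corresponding to $[0,0.5]$ and $[0.5,1]$. Then $$\widehat{\boldsymbol{x}}|_{\widehat\tau_L}=\boldsymbol{x}_\tau|_{[0,0.5]},\qquad \widehat{\boldsymbol{x}}|_{\widehat\tau_R}=\boldsymbol{x}_\tau|_{[0.5,1]} .$$ (c) Structured quadrilateral preservation: let $\sigma$ be a quadrilateral of $\mathcal{T}$ that contains no extraordinary vertices and no corner vertices of valence $>1$, let $\boldsymbol{x}_\sigma$ be the local polynomial representation of $\boldsymbol{x}$ on $\sigma\cong[0,1]^2$, and let $\widehat\sigma_i,\widehat\sigma_j,\widehat\sigma_k,\widehat\sigma_\ell$ be its four refined faces. Then $$\widehat{\boldsymbol{x}}|_{\widehat\sigma_i}=\boldsymbol{x}_\sigma|_{[0,0.5]^2},\quad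 \widehat{\boldsymbol{x}}|_{\widehat\sigma_j}=\boldsymbol{x}_\sigma|_{[0.5,1]\times[0,0.5]},\quad \widehat{\boldsymbol{x}}|_{\widehat\sigma_k}=\boldsymbol{x}_\sigma|_{[0.5,1]^2},\quad \widehat{\boldsymbol{x}}|_{\widehat\sigma_\ell}=\boldsymbol{x}_\sigma|_{[0,0.5]\times[0.5,1]} .$$ (d) Midpoint interpolation on interior spoke edges: let $\gamma\in\mathcal{T}_0^E$ be an extraordinary vertex such that each face containing $\gamma$ contains no other extraordinary vertex. Let $\tau$ be an interior edge containing $\gamma$, parameterized by $[0,1]$ with $\gamma$ as its first endpoint, refined into edges $\widehat\tau_a$ and $\widehat\tau_b$ such that $\gamma$ is the first endpoint of $\widehat\tau_a$. With $\boldsymbol{x}_\tau$ the local representation of $\boldsymbol{x}$ restricted to $\tau$, $$\widehat{\boldsymbol{x}}|_{\widehat\tau_a}(1)=\boldsymbol{x}_\tau(0.5).$$ (e) Normal vector preservation: the refined geometry $\widehat{\boldsymbol{x}}$ has well-defined normal vectors at all vertices, and these are identical to the normal vectors for the coarse geometry $\boldsymbol{x}$. (f) Dimension of the refined spline space: $\widehat{\mathscr{I}}=\widehat{\mathscr{I}}^*\cup(\widehat{\mathcal{T}}_0^E\times\{1,2,3\})$ and $$\widehat{\mathfrak{n}}:=|\widehat{\mathscr{I}}|=|\widehat{\mathcal{T}}_2|+|\widehat{\mathcal{T}}_1^B|+|\widehat{\mathcal{T}}_0^C|+3|\widehat{\mathcal{T}}_0^E| .$$ (g) Convergent refinement scheme: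 the limit surface of the repeated refinement process exists and has a well-defined tangent plane at all points.
   Context: **Mesh.** $\mathcal{T}$ is a finite topological (not necessarily planar) mesh of quadrilaterals with vertices $\mathcal{T}_0$, edges $\mathcal{T}_1$ and faces $\mathcal{T}_2$ (edges and faces are closed sets), without hanging nodes, with disjoint face interiors, each edge lying in at most two faces. An edge in exactly one face is a boundary edge (set $\mathcal{T}_1^B$), otherwise interior; vertices on boundary edges are boundary vertices, all others are interior. There are no "kissing vertices": two faces sharing a vertex $\gamma$ are joined by a chain of faces all containing $\gamma$, consecutive ones sharing an interior edge. The valence $\mu_\gamma$ of a vertex is the number of faces containing it. A vertex is extraordinary (set $\mathcal{T}_0^E$) if it is interior with $\mu_\gamma\ne4$, or boundary with $\mu_\gamma>2$. Corner vertices (set $\mathcal{T}_0^C$) are the vertices of valence 1. $\mathcal{T}_2^E$ is the set of faces containing at least one extraordinary vertex. Edges containing an extraordinary vertex are spoke edges. The 1-ring of a vertex is the union of the faces containing it. Each face is identified with $[0,1]^2$ with coordinates $(u,v)$; its vertices are numbered $1,\dots,4$ counter-clockwise starting from $(0,0)$. Functions on $\mathcal{T}$ are defined face by face. **Splines $B^*_\phi$.** Let $\mathscr{I}^*=\mathcal{T}_2\cup\mathcal{T}_1^B\cup\mathcal{T}_0^C$. For a function $f$ that is biquadratic on $\sigma$, write $f|_\sigma=\sum_{j,k=0}^2c_{jk}[f;\sigma]\,b^0_{jk}$ with $b^0_{jk}(u,v)=\binom2j\binom2k u^j(1-u)^{2-j}v^k(1-v)^{2-k}$. Here $c_{11}$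 is the face coefficient, $c_{10},c_{01},c_{21},c_{12}$ are the coefficients of the four edges of $\sigma$, and $c_{00},c_{20},c_{22},c_{02}$ those of its four vertices. $B^*_\phi$, $\phi\in\mathscr{I}^*$, is the continuous piecewise biquadratic function with these coefficients (all unlisted ones are $0$): - $\phi\in\mathcal{T}_2$: face coefficient $1$ on $\phi$; $\tfrac12$ at each interior edge of $\phi$; $1/\mu_\gamma$ at each interior vertex $\gamma$ of $\phi$. - $\phi\in\mathcal{T}_1^B$: $1$ at the edge $\phi$; $\tfrac12$ at each endpoint of $\phi$ that is not a corner vertex. - $\phi\in\mathcal{T}_0^C$: $1$ at the vertex $\phi$. $\mathscr{B}^*=\mathrm{span}(B^*_\phi:\phi\in\mathscr{I}^* )$. **Subdivided coefficients.** Let $b^1_{jk}$, $0\le j,k\le3$, be the tensor-product $C^1$ biquadratic B-splines on $[0,1]^2$ with knot vector $(0,0,0,\frac12,1,1,1)$ in each direction. Any $f$ that is biquadratic on $\sigma$, or lies on $\sigma$ in the span of the $b^1_{jk}$, is written uniquely as $f|_\sigma=\sum_{j,k=0}^3\hat c_{jk}[f;\sigma]b^1_{jk}$ (vector-valued functions: $\hat{\boldsymbol{c}}_{jk}$). **Almost-$C^1$ construction.** Input: a mesh $\mathcal{T}$, a geometry $\boldsymbol{x}^*=\sum_{\phi\in\mathscr{I}^*}\boldsymbol{x}^*_\phi B^*_\phi$ with $\boldsymbol{x}^*_\phi\in\mathbb{R}^d$ ($d=3$; planar geometries, $d=2$, are regarded as lying in $\mathbb{R}^2\times\{0\}$ with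 normals $(0,0,1)$), and normals $\boldsymbol{n}_\gamma\ne\boldsymbol{0}$, $\gamma\in\mathcal{T}_0^E$. $P_\gamma$ denotes the orthogonal projection onto the plane through $\boldsymbol{x}^*(\gamma)$ orthogonal to $\boldsymbol{n}_\gamma$; it is assumed that $P_\gamma(\boldsymbol{x}^* )$ is regular in a neighbourhood of $\gamma$. Degrees of freedom: $$\mathscr{I}=\{\sigma\in\mathcal{T}_2:\exists\gamma\in\mathcal{T}_0\setminus\mathcal{T}_0^E,\ \gamma\in\sigma\}\cup\{\tau\in\mathcal{T}_1^B:\exists\gamma\in\mathcal{T}_0\setminus\mathcal{T}_0^E,\ \gamma\in\tau\}\cup\mathcal{T}_0^C\cup(\mathcal{T}_0^E\times\{1,2,3\}).$$ For $\phi\in\mathscr{I}\cap\mathscr{I}^*$: $B_\phi|_\sigma=B^*_\phi|_\sigma$ if $\sigma\notin\mathcal{T}_2^E$; if $\sigma\in\mathcal{T}_2^E$, $B_\phi|_\sigma=\sum_{j,k}\hat c_{jk}[B_\phi;\sigma]b^1_{jk}$ where $\hat c[B_\phi;\sigma]$ is obtained from $\hat c[B^*_\phi;\sigma]$ by setting to zero, for each extraordinary vertex of $\sigma$, the $2\times2$ block of coefficients nearest to it: indices $(j,k)\in\{0,1\}^2$ for vertex 1, $\{2,3\}\times\{0,1\}$ for vertex 2, $\{2,3\}^2$ for vertex 3, $\{0,1\}\times\{2,3\}$ for vertex 4. For $\gamma\in\mathcal{T}_0^E$ with faces $\sigma_1,\dots,\sigma_\mu$ containing it (local origin at $\gamma$),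 set $\boldsymbol{c}^i_{jk}=P_\gamma(\hat{\boldsymbol{c}}_{jk}[\boldsymbol{x}^*;\sigma_i])$, $(j,k)\in\{0,1\}^2$. In the projection plane, the control triangle $(\boldsymbol{x}_{(\gamma,1)},\boldsymbol{x}_{(\gamma,2)},\boldsymbol{x}_{(\gamma,3)})$ is selected to be the smallest triangle that contains all points $\boldsymbol{c}^i_{jk}$ in its interior (or a containing triangle of similar size to the smallest one); points on the edges of the triangle are allowed. Let $\lambda_1,\lambda_2,\lambda_3$ be the barycentric coordinates with respect to it, so $\lambda_\nu(\boldsymbol{c}^i_{jk})\ge0$. Then $B_{(\gamma,\nu)}|_{\sigma_i}=\sum_{(j,k)\in\{0,1\}^2}\lambda_\nu(\boldsymbol{c}^i_{jk})b^1_{jk}$ and $B_{(\gamma,\nu)}=0$ on all other faces. Output: $\mathscr{B}=\mathrm{span}(B_\phi:\phi\in\mathscr{I})$ and $\boldsymbol{x}=\sum_{\phi\in\mathscr{I}}\boldsymbol{x}_\phi B_\phi$, where $\boldsymbol{x}_\phi=\boldsymbol{x}^*_\phi$ for $\phi\in\mathscr{I}\cap\mathscr{I}^*$ and $\boldsymbol{x}_{(\gamma,\nu)}$ are the triangle vertices. An almost-$C^1$ spline geometry is a geometry $\boldsymbol{x}$ obtained in this way. **Refinement process.** 1. *Mesh.* Every face of $\mathcal{T}$ is split into $2\times2$ faces, giving $\widehat{\mathcal{T}}$ (hatted symbols denote the corresponding objects for $\widehat{\mathcal{T}}$). Old vertices keep their labels, and $\widehat{\mathcal{T}}_0^C=\mathcal{T}_0^C$,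 $\widehat{\mathcal{T}}_0^E=\mathcal{T}_0^E$. For a face $\sigma\cong[0,1]^2$ the new faces are $\widehat\sigma_i=[0,0.5]^2$, $\widehat\sigma_j=[0.5,1]\times[0,0.5]$, $\widehat\sigma_k=[0.5,1]^2$, $\widehat\sigma_\ell=[0,0.5]\times[0.5,1]$. Restrictions such as $\widehat{\boldsymbol{x}}|_{\widehat\sigma_i}=\boldsymbol{x}_\sigma|_{[0,0.5]^2}$ are understood up to the affine identification of the subdomain with the parameter domain of the new face or edge. 2. *Refined control points* $\widehat{\boldsymbol{x}}^*_\phi$, $\phi\in\widehat{\mathscr{I}}^*$, with $\hat{\boldsymbol{c}}_{jk}=\hat{\boldsymbol{c}}_{jk}[\boldsymbol{x};\sigma]$: - Corner vertex $\gamma$ of $\sigma$ (local origin at $\gamma$): $\widehat{\boldsymbol{x}}^*_\gamma=\hat{\boldsymbol{c}}_{00}$. - Boundary edge $\tau$ of $\sigma$ (local coordinates such that $\tau=\{v=0\}$), refined into $\widehat\tau_L$ ($u\in[0,0.5]$) and $\widehat\tau_R$ ($u\in[0.5,1]$): the control points are $\hat{\boldsymbol{c}}_{10}$ and $\hat{\boldsymbol{c}}_{20}$, respectively. - Face $\sigma$ that contains no extraordinary vertex, or contains more than one extraordinary vertex, or contains an extraordinary vertex lying in the 1-ring of another extraordinary vertex: the control points of $\widehat\sigma_i,\widehat\sigma_j,\widehat\sigma_k,\widehat\sigma_\ell$ are $\hat{\boldsymbol{c}}_{11},\hat{\boldsymbol{c}}_{21},\hat{\boldsymbol{c}}_{22},\hat{\boldsymbol{c}}_{12}$,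 respectively. - Faces around an extraordinary vertex $\gamma$ of valence $\mu$ not in the 1-ring of any other extraordinary vertex: let $\sigma_1,\dots,\sigma_\mu$ be the faces containing $\gamma$ in counter-clockwise order, with local origin at $\gamma$ and such that the edge $\{u=0\}$ of $\sigma_r$ is shared with $\sigma_{r+1}$ (cyclically if $\gamma$ is interior; for $1\le r\le\mu-1$ if $\gamma$ is a boundary vertex). Let $\widehat{\boldsymbol{c}}^r_{jk}=\hat{\boldsymbol{c}}_{jk}[\boldsymbol{x};\sigma_r]$. The control points of the $j,k,\ell$ subfaces of $\sigma_r$ are $\widehat{\boldsymbol{c}}^r_{21},\widehat{\boldsymbol{c}}^r_{22},\widehat{\boldsymbol{c}}^r_{12}$, and those, $\widehat{\boldsymbol{x}}^*_{r,i}$, of the $i$ subfaces are $$(\widehat{\boldsymbol{x}}^*_{1,i},\dots,\widehat{\boldsymbol{x}}^*_{\mu,i})^T=S\,(\widehat{\boldsymbol{c}}^1_{01},\dots,\widehat{\boldsymbol{c}}^m_{01})^T+Q\,(\widehat{\boldsymbol{c}}^1_{11},\dots,\widehat{\boldsymbol{c}}^\mu_{11})^T .$$ If $\gamma$ is interior, then $m=\mu$ and, with $\mathrm{circulant}(\cdot)$ the circulant matrix with the given first row (each next row shifted cyclically to the right): for $\mu$ odd, $S=\mathrm{circulant}(1,-1,1,\dots,-1,1)$ and $Q=0$; for $\mu$ even, $S=\mathrm{circulant}(s_1,\dots,s_\mu)$ with $s_k=(-1)^{k+1}(2-\frac{2k}{\mu})$ and $Q=\frac1\mu\mathrm{circulant}(1,-1,\dots,1,-1)$.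 If $\gamma$ is a boundary vertex, then $m=\mu-1$, $Q=\frac1\mu\big((-1)^{j+k}\big)_{j,k=1}^{\mu}$, $S=\frac12(R_\mu+J_\mu R_\mu J_{\mu-1})$, where $J_k$ is the $k\times k$ anti-diagonal permutation matrix and $R_\mu$ is the $\mu\times(\mu-1)$ matrix with entries $(R_\mu)_{kj}=(-1)^{j-k}(4-\frac{4j}{\mu})$ for $j\ge k$ and $0$ otherwise. 3. Set $\widehat{\boldsymbol{x}}^*=\sum_{\phi\in\widehat{\mathscr{I}}^*}\widehat{\boldsymbol{x}}^*_\phi\widehat B^*_\phi$. Then $\widehat{\mathscr{B}}$ and $\widehat{\boldsymbol{x}}=\sum_{\phi\in\widehat{\mathscr{I}}}\widehat{\boldsymbol{x}}_\phi\widehat B_\phi$ are the output of the almost-$C^1$ construction applied to $\widehat{\mathcal{T}}$, $\widehat{\boldsymbol{x}}^*$ and the same normals $\boldsymbol{n}_\gamma$. **Conventions.** In (a), $A$ is the matrix of the linear refinement rule with respect to the constructed bases of $\mathscr{B}$ and $\widehat{\mathscr{B}}$ (kept fixed), and $T$, $R$ act simultaneously on all control points. In (g), the limit surface is the limit, as $k\to\infty$, of the geometries $\boldsymbol{x}^{(k)}$ with $\boldsymbol{x}^{(0)}=\boldsymbol{x}$ and $\boldsymbol{x}^{(k+1)}=\widehat{\boldsymbol{x}^{(k)}}$, viewed as maps on the same underlying topological surface (faces subdivided dyadically). Standing assumption: the parameterizations are regular wherever normals/tangent planes are considered. *)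

theory Defs
  imports "HOL-Analysis.Analysis"
begin

section \<open>Quadrilateral meshes\<close>

text \<open>
  The faces of a mesh are closed subsets of a set of points \<open>'p\<close>, each identified with the unit
  square.  A face is therefore represented by its parametrization \<open>F\<close> of the unit square; the face
  as a closed set is \<open>F ` unit_square\<close>, its edges are the images of the sides, its vertices the
  images of the corners (numbered 1 to 4: \<open>(0,0), (1,0), (1,1), (0,1)\<close>).  The faces of a refined
  mesh are again parametrizations into the same point set, so that all refinements of a mesh live
  on one underlying surface and old vertices keep their names.
\<close>

type_synonym 'p face = "real \<times> real \<Rightarrow> 'p"
type_synonym 'p mesh = "'p face set"
type_synonym frame = "real \<times> real \<Rightarrow> real \<times> real"

definition unit_square :: "(real \<times> real) set" where
  "unit_square = {0..1} \<times> {0..1}"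

definition corners :: "(real \<times> real) set" where
  "corners = {(0,0), (1,0), (1,1), (0,1)}"

definition carrier_of :: "'p face \<Rightarrow> 'p set" where
  "carrier_of F = F ` unit_square"

text \<open>
  The eight symmetries of the square.  Passing from \<open>F\<close> to \<open>F \<circ> d\<close> is the choice of a local
  coordinate system on the face: \<open>F (d (0, 0))\<close> is the local origin, \<open>side F d\<close> the local edge
  \<open>{v = 0}\<close>.  Both orientations are admitted, since the mesh need not be orientable.
\<close>

definition frames :: "frame set" where
  "frames = {d. \<exists>a\<in>{0,1}. \<exists>b\<in>{0,1}.
      d = (\<lambda>(u,v). (a + (1 - 2*a) * u, b + (1 - 2*b) * v)) \<or>
      d = (\<lambda>(u,v). (a + (1 - 2*a) * v, b + (1 - 2*b) * u))}"

definition side :: "'p face \<Rightarrow> frame \<Rightarrow> 'p set" where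
  "side F d = (\<lambda>t. F (d (t, 0))) ` {0..1}"

definition vertices :: "'p mesh \<Rightarrow> 'p set" where
  "vertices T = {F q | F q. F \<in> T \<and> q \<in> corners}"

definition edges :: "'p mesh \<Rightarrow> 'p set set" where
  "edges T = {side F d | F d. F \<in> T \<and> d \<in> frames}"

definition boundary_edges :: "'p mesh \<Rightarrow> 'p set set" where
  "boundary_edges T = {\<tau> \<in> edges T. card {F \<in> T. \<tau> \<subseteq> carrier_of F} = 1}"

definition interior_edges :: "'p mesh \<Rightarrow> 'p set set" where
  "interior_edges T = edges T - boundary_edges T"

definition boundary_vertices :: "'p mesh \<Rightarrow> 'p set" where
  "boundary_vertices T = {\<gamma> \<in> vertices T. \<exists>\<tau>\<in>boundary_edges T. \<gamma> \<in> \<tau>}"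

definition interior_vertices :: "'p mesh \<Rightarrow> 'p set" where
  "interior_vertices T = vertices T - boundary_vertices T"

definition faces_at :: "'p mesh \<Rightarrow> 'p \<Rightarrow> 'p face set" where
  "faces_at T \<gamma> = {F \<in> T. \<gamma> \<in> carrier_of F}"

definition valence :: "'p mesh \<Rightarrow> 'p \<Rightarrow> nat" where
  "valence T \<gamma> = card (faces_at T \<gamma>)"

definition extraordinary :: "'p mesh \<Rightarrow> 'p set" where
  "extraordinary T = {\<gamma> \<in> interior_vertices T. valence T \<gamma> \<noteq> 4} \<union>
                     {\<gamma> \<in> boundary_vertices T. valence T \<gamma> > 2}"

definition corner_vertices :: "'p mesh \<Rightarrow> 'p set" where
  "corner_vertices T = {\<gamma> \<in> vertices T. valence T \<gamma> = 1}"

definition one_ring :: "'p mesh \<Rightarrow> 'p \<Rightarrow> 'p set" where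
  "one_ring T \<gamma> = (\<Union>F\<in>faces_at T \<gamma>. carrier_of F)"

text \<open>
  The second condition says that distinct faces meet only in common vertices and common (entire)
  edges, on which the two parametrizations agree up to reversal; this comprises disjoint face
  interiors and the absence of hanging nodes.  The last one excludes kissing vertices.
\<close>

definition quad_mesh :: "'p mesh \<Rightarrow> bool" where
  "quad_mesh T \<longleftrightarrow>
     finite T \<and>
     (\<forall>F\<in>T. inj_on F unit_square) \<and>
     (\<forall>F\<in>T. \<forall>G\<in>T. \<forall>s\<in>unit_square. \<forall>t\<in>unit_square. F \<noteq> G \<longrightarrow> F s = G t \<longrightarrow>
        (s \<in> corners \<and> t \<in> corners) \<or>
        (\<exists>d\<in>frames. \<exists>e\<in>frames.
           (\<forall>r\<in>{0..1}. F (d (r, 0)) = G (e (r, 0))) \<and>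
           (\<exists>r\<in>{0..1}. s = d (r, 0) \<and> t = e (r, 0)))) \<and>
     (\<forall>\<tau>\<in>edges T. card {F \<in> T. \<tau> \<subseteq> carrier_of F} \<le> 2) \<and>
     (\<forall>\<gamma>\<in>vertices T. \<forall>F\<in>faces_at T \<gamma>. \<forall>G\<in>faces_at T \<gamma>.
        (F, G) \<in> {(F, G). F \<in> faces_at T \<gamma> \<and> G \<in> faces_at T \<gamma> \<and>
                   (\<exists>\<tau>\<in>interior_edges T. \<gamma> \<in> \<tau> \<and> \<tau> \<subseteq> carrier_of F \<and> \<tau> \<subseteq> carrier_of G)}\<^sup>*)"

text \<open>
  \<open>quad q\<close> maps the unit square onto its quarter at the corner \<open>q\<close>; the subfaces i, j, k, l of \<open>F\<close>
  are \<open>F \<circ> quad q\<close> for \<open>q = (0,0), (1,0), (1,1), (0,1)\<close>.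
\<close>

definition quad :: "real \<times> real \<Rightarrow> real \<times> real \<Rightarrow> real \<times> real" where
  "quad q s = (1/2) *\<^sub>R (q + s)"

definition refine :: "'p mesh \<Rightarrow> 'p mesh" where
  "refine T = {F \<circ> quad q | F q. F \<in> T \<and> q \<in> corners}"

section \<open>Splines\<close>

text \<open>Functions on a mesh are defined face by face, in the coordinates of the face.\<close>

type_synonym ('p, 'a) mesh_fun = "'p face \<Rightarrow> real \<times> real \<Rightarrow> 'a"

datatype 'p dof = Face "real \<times> real \<Rightarrow> 'p" | BEdge "'p set" | Corner 'p | Tri 'p nat

definition dof_star :: "'p mesh \<Rightarrow> 'p dof set" where
  "dof_star T = Face ` T \<union> BEdge ` boundary_edges T \<union> Corner ` corner_vertices T"

definition dof :: "'p mesh \<Rightarrow> 'p dof set" where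
  "dof T = Face ` {F \<in> T. \<exists>\<gamma>\<in>vertices T - extraordinary T. \<gamma> \<in> carrier_of F} \<union>
           BEdge ` {\<tau> \<in> boundary_edges T. \<exists>\<gamma>\<in>vertices T - extraordinary T. \<gamma> \<in> \<tau>} \<union>
           Corner ` corner_vertices T \<union>
           {Tri \<gamma> \<nu> | \<gamma> \<nu>. \<gamma> \<in> extraordinary T \<and> \<nu> \<in> {1,2,3}}"

definition spline ::
  "'p dof set \<Rightarrow> ('p dof \<Rightarrow> ('p, real) mesh_fun) \<Rightarrow> ('p dof \<Rightarrow> 'a::real_vector) \<Rightarrow> ('p, 'a) mesh_fun"
where
  "spline I B c F s = (\<Sum>\<phi>\<in>I. B \<phi> F s *\<^sub>R c \<phi>)"

text \<open>
  The face, edge or vertex of \<open>F\<close> that carries the Bernstein coefficient with index \<open>(j,k)\<close>,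
  \<open>j, k \<le> 2\<close>.
\<close>

definition cell :: "'p face \<Rightarrow> nat \<Rightarrow> nat \<Rightarrow> 'p set" where
  "cell F j k = F ` {(u,v) \<in> unit_square. (j \<noteq> 1 \<longrightarrow> u = real j / 2) \<and> (k \<noteq> 1 \<longrightarrow> v = real k / 2)}"

definition coeff_star :: "'p mesh \<Rightarrow> 'p dof \<Rightarrow> 'p face \<Rightarrow> nat \<Rightarrow> nat \<Rightarrow> real" where
  "coeff_star T \<phi> F j k =
     (let \<gamma> = F (real j / 2, real k / 2); \<tau> = cell F j k in
      if j = 1 \<and> k = 1 then
        (case \<phi> of Face G \<Rightarrow> if F = G then 1 else 0 | _ \<Rightarrow> 0)
      else if j = 1 \<or> k = 1 then
        (case \<phi> of
           Face G \<Rightarrow> if \<tau> \<in> interior_edges T \<and> \<tau> \<subseteq> carrier_of G then 1/2 else 0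
         | BEdge \<rho> \<Rightarrow> if \<tau> = \<rho> then 1 else 0
         | _ \<Rightarrow> 0)
      else
        (case \<phi> of
           Face G \<Rightarrow> if \<gamma> \<in> interior_vertices T \<and> \<gamma> \<in> carrier_of G
                     then 1 / real (valence T \<gamma>) else 0
         | BEdge \<rho> \<Rightarrow> if \<gamma> \<in> \<rho> \<and> \<gamma> \<notin> corner_vertices T then 1/2 else 0
         | Corner \<delta> \<Rightarrow> if \<gamma> = \<delta> then 1 else 0
         | _ \<Rightarrow> 0))"

definition basis_star :: "'p mesh \<Rightarrow> 'p dof \<Rightarrow> ('p, real) mesh_fun" where
  "basis_star T \<phi> F s =
     (\<Sum>j\<le>2. \<Sum>k\<le>2. coeff_star T \<phi> F j k * Bernstein 2 j (fst s) * Bernstein 2 k (snd s))"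

text \<open>
  The quadratic B-splines for the knot vector (0, 0, 0, 1/2, 1, 1, 1) on [0, 1], as given by the
  Cox-de Boor recursion (continuous from the left at the right end point).
\<close>

definition bspline :: "nat \<Rightarrow> real \<Rightarrow> real" where
  "bspline j t =
     (if j = 0 then (if t \<le> 1/2 then (1 - 2*t)^2 else 0)
      else if j = 1 then (if t \<le> 1/2 then 2*t*(2 - 3*t) else 2*(1 - t)^2)
      else if j = 2 then (if t \<le> 1/2 then 2*t^2 else 2*(1 - t)*(3*t - 1))
      else if j = 3 then (if t \<le> 1/2 then 0 else (2*t - 1)^2)
      else 0)"

definition bspline2 :: "nat \<Rightarrow> nat \<Rightarrow> real \<times> real \<Rightarrow> real" where
  "bspline2 j k s = bspline j (fst s) * bspline k (snd s)"

text \<open>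
  The subdivided coefficients of a function on one face; in local coordinates \<open>d\<close> they are
  \<open>subdiv_coeff (f F \<circ> d)\<close>.
\<close>

definition subdiv_coeff :: "(real \<times> real \<Rightarrow> 'a::real_vector) \<Rightarrow> nat \<Rightarrow> nat \<Rightarrow> 'a" where
  "subdiv_coeff g =
     (THE c. (\<forall>j k. j > 3 \<or> k > 3 \<longrightarrow> c j k = 0) \<and>
             (\<forall>s\<in>unit_square. g s = (\<Sum>j\<le>3. \<Sum>k\<le>3. bspline2 j k s *\<^sub>R c j k)))"

text \<open>The corner of the unit square whose \<open>2 \<times> 2\<close> block contains the index \<open>(j,k)\<close>, \<open>j, k \<le> 3\<close>.\<close>

definition block_corner :: "nat \<Rightarrow> nat \<Rightarrow> real \<times> real" where
  "block_corner j k = (real (j div 2), real (k div 2))"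

section \<open>Regularity\<close>

text \<open>One-sided partial derivatives at the boundary of the unit square.\<close>

definition has_partials :: "(real \<times> real \<Rightarrow> real^3) \<Rightarrow> real \<times> real \<Rightarrow> real^3 \<Rightarrow> real^3 \<Rightarrow> bool" where
  "has_partials g s a b \<longleftrightarrow>
     ((\<lambda>t. g (t, snd s)) has_vector_derivative a) (at (fst s) within {0..1}) \<and>
     ((\<lambda>t. g (fst s, t)) has_vector_derivative b) (at (snd s) within {0..1})"

text \<open>
  Regularity only occurs as a hypothesis.  The existence of the partial derivatives is deliberately
  not part of it, so that it has to be established where it matters.
\<close>

definition regular :: "(real \<times> real \<Rightarrow> real^3) \<Rightarrow> real \<times> real \<Rightarrow> bool" where
  "regular g s \<longleftrightarrow> (\<forall>a b. has_partials g s a b \<longrightarrow> cross3 a b \<noteq> 0)"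

definition regular_at :: "'p mesh \<Rightarrow> ('p, real^3) mesh_fun \<Rightarrow> 'p \<Rightarrow> bool" where
  "regular_at T x p \<longleftrightarrow> (\<forall>F\<in>T. \<forall>s\<in>unit_square. F s = p \<longrightarrow> regular (x F) s)"

section \<open>The almost-C1 construction\<close>

text \<open>
  Geometries are in 3-space; planar ones are those with third coordinate 0 and normals (0, 0, 1).
\<close>

definition value_at :: "'p mesh \<Rightarrow> ('p, 'a) mesh_fun \<Rightarrow> 'p \<Rightarrow> 'a" where
  "value_at T x p = (THE y. \<forall>F\<in>T. \<forall>s\<in>unit_square. F s = p \<longrightarrow> x F s = y)"

definition plane_proj :: "real^3 \<Rightarrow> real^3 \<Rightarrow> real^3 \<Rightarrow> real^3" where
  "plane_proj x0 n y = y - (((y - x0) \<bullet> n) / (n \<bullet> n)) *\<^sub>R n"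

definition geometry_star :: "'p mesh \<Rightarrow> ('p dof \<Rightarrow> real^3) \<Rightarrow> ('p, real^3) mesh_fun" where
  "geometry_star T xs = spline (dof_star T) (basis_star T) xs"

definition vertex_proj ::
  "'p mesh \<Rightarrow> ('p dof \<Rightarrow> real^3) \<Rightarrow> ('p \<Rightarrow> real^3) \<Rightarrow> 'p \<Rightarrow> real^3 \<Rightarrow> real^3"
where
  "vertex_proj T xs n \<gamma> = plane_proj (value_at T (geometry_star T xs) \<gamma>) (n \<gamma>)"

text \<open>
  The points \<open>c\<^sub>j\<^sub>k = P\<^sub>\<gamma>(\<dots>)\<close> on \<open>F\<close>, where \<open>(j,k)\<close> lies in the block nearest to \<open>\<gamma>\<close>.  Instead of passing to
  local coordinates with origin \<open>\<gamma>\<close>, the block is addressed in the coordinates of \<open>F\<close>; this is the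
  same thing because the B-splines are invariant under the symmetries of the square.
\<close>

definition proj_coeff ::
  "'p mesh \<Rightarrow> ('p dof \<Rightarrow> real^3) \<Rightarrow> ('p \<Rightarrow> real^3) \<Rightarrow> 'p \<Rightarrow> 'p face \<Rightarrow> nat \<Rightarrow> nat \<Rightarrow> real^3"
where
  "proj_coeff T xs n \<gamma> F j k = vertex_proj T xs n \<gamma> (subdiv_coeff (geometry_star T xs F) j k)"

text \<open>
  Admissible input of the construction together with an admissible choice of the control triangles
  \<open>tri \<gamma> 1, tri \<gamma> 2, tri \<gamma> 3\<close>.  As the size of the triangle is not specified exactly (smallest, or of
  similar size), every nondegenerate triangle in the projection plane containing the points is
  admitted.
\<close>

definition almost_C1_input ::
  "'p mesh \<Rightarrow> ('p dof \<Rightarrow> real^3) \<Rightarrow> ('p \<Rightarrow> real^3) \<Rightarrow> ('p \<Rightarrow> nat \<Rightarrow> real^3) \<Rightarrow> bool"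
where
  "almost_C1_input T xs n tri \<longleftrightarrow>
     (\<forall>\<gamma>\<in>extraordinary T.
        n \<gamma> \<noteq> 0 \<and>
        (\<exists>\<epsilon>>0. \<forall>F\<in>T. \<forall>q\<in>corners. F q = \<gamma> \<longrightarrow>
           (\<forall>s\<in>unit_square. dist s q < \<epsilon> \<longrightarrow>
              regular (vertex_proj T xs n \<gamma> \<circ> geometry_star T xs F) s)) \<and>
        (\<forall>\<nu>\<in>{1,2,3}. (tri \<gamma> \<nu> - value_at T (geometry_star T xs) \<gamma>) \<bullet> n \<gamma> = 0) \<and>
        \<not> collinear {tri \<gamma> 1, tri \<gamma> 2, tri \<gamma> 3} \<and>
        (\<forall>F\<in>T. \<forall>j\<le>3. \<forall>k\<le>3. F (block_corner j k) = \<gamma> \<longrightarrow>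
           proj_coeff T xs n \<gamma> F j k \<in> convex hull {tri \<gamma> 1, tri \<gamma> 2, tri \<gamma> 3}))"

definition barycentric :: "(nat \<Rightarrow> real^3) \<Rightarrow> real^3 \<Rightarrow> nat \<Rightarrow> real" where
  "barycentric t y =
     (THE l. (\<forall>\<nu>. \<nu> \<notin> {1,2,3} \<longrightarrow> l \<nu> = 0) \<and>
             (\<Sum>\<nu>\<in>{1,2,3}. l \<nu>) = 1 \<and> (\<Sum>\<nu>\<in>{1,2,3}. l \<nu> *\<^sub>R t \<nu>) = y)"

definition basis ::
  "'p mesh \<Rightarrow> ('p dof \<Rightarrow> real^3) \<Rightarrow> ('p \<Rightarrow> real^3) \<Rightarrow> ('p \<Rightarrow> nat \<Rightarrow> real^3) \<Rightarrow>
   'p dof \<Rightarrow> ('p, real) mesh_fun"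
where
  "basis T xs n tri \<phi> F s =
     (case \<phi> of
        Tri \<gamma> \<nu> \<Rightarrow>
          (\<Sum>j\<le>3. \<Sum>k\<le>3.
             (if F (block_corner j k) = \<gamma>
              then barycentric (tri \<gamma>) (proj_coeff T xs n \<gamma> F j k) \<nu> else 0) * bspline2 j k s)
      | _ \<Rightarrow>
          if carrier_of F \<inter> extraordinary T = {} then basis_star T \<phi> F s
          else (\<Sum>j\<le>3. \<Sum>k\<le>3.
             (if F (block_corner j k) \<in> extraordinary T then 0
              else subdiv_coeff (basis_star T \<phi> F) j k) * bspline2 j k s))"

definition control_point ::
  "('p dof \<Rightarrow> real^3) \<Rightarrow> ('p \<Rightarrow> nat \<Rightarrow> real^3) \<Rightarrow> 'p dof \<Rightarrow> real^3"
where
  "control_point xs tri \<phi> = (case \<phi> of Tri \<gamma> \<nu> \<Rightarrow> tri \<gamma> \<nu> | _ \<Rightarrow> xs \<phi>)"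

definition almost_C1_geometry ::
  "'p mesh \<Rightarrow> ('p dof \<Rightarrow> real^3) \<Rightarrow> ('p \<Rightarrow> real^3) \<Rightarrow> ('p \<Rightarrow> nat \<Rightarrow> real^3) \<Rightarrow> ('p, real^3) mesh_fun"
where
  "almost_C1_geometry T xs n tri = spline (dof T) (basis T xs n tri) (control_point xs tri)"

section \<open>Refinement\<close>

definition isolated :: "'p mesh \<Rightarrow> 'p \<Rightarrow> bool" where
  "isolated T \<gamma> \<longleftrightarrow> (\<forall>\<delta>\<in>extraordinary T. \<delta> \<noteq> \<gamma> \<longrightarrow> \<gamma> \<notin> one_ring T \<delta>)"

text \<open>
  An enumeration of the faces containing \<open>\<gamma>\<close> in cyclic order, with local coordinates having their
  origin at \<open>\<gamma>\<close>: the local edge \<open>{u = 0}\<close> of each face is the local edge \<open>{v = 0}\<close> of the next one.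
\<close>

definition is_fan :: "'p mesh \<Rightarrow> 'p \<Rightarrow> ('p face \<times> frame) list \<Rightarrow> bool" where
  "is_fan T \<gamma> L \<longleftrightarrow>
     distinct (map fst L) \<and> fst ` set L = faces_at T \<gamma> \<and>
     (\<forall>(F, d)\<in>set L. d \<in> frames \<and> F (d (0, 0)) = \<gamma>) \<and>
     (\<forall>r < length L. \<gamma> \<in> interior_vertices T \<or> r + 1 < length L \<longrightarrow>
        (\<forall>t\<in>{0..1}. fst (L ! r) (snd (L ! r) (0, t)) =
           fst (L ! ((r + 1) mod length L)) (snd (L ! ((r + 1) mod length L)) (t, 0))))"

text \<open>The entry in row \<open>r\<close> and column \<open>k\<close> (both counted from 1) of the \<open>\<mu> \<times> \<mu>\<close> circulant matrix
  with first row \<open>a 1, \<dots>, a \<mu>\<close>.\<close>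

definition circulant :: "nat \<Rightarrow> (nat \<Rightarrow> real) \<Rightarrow> nat \<Rightarrow> nat \<Rightarrow> real" where
  "circulant \<mu> a r k = a ((k + \<mu> - r) mod \<mu> + 1)"

definition R_mat :: "nat \<Rightarrow> nat \<Rightarrow> nat \<Rightarrow> real" where
  "R_mat \<mu> k j = (if k \<le> j then (-1)^(j - k) * (4 - 4 * real j / real \<mu>) else 0)"

text \<open>
  \<open>cyc\<close> tells whether the extraordinary vertex is interior (otherwise it is a boundary vertex).
  In the boundary case, multiplication with the anti-diagonal permutation matrices from the left
  and from the right reverses the order of the \<open>\<mu>\<close> rows and of the \<open>\<mu> - 1\<close> columns of \<open>R_mat\<close>.
\<close>

definition S_mat :: "bool \<Rightarrow> nat \<Rightarrow> nat \<Rightarrow> nat \<Rightarrow> real" where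
  "S_mat cyc \<mu> r k =
     (if \<not> cyc then (R_mat \<mu> r k + R_mat \<mu> (\<mu> + 1 - r) (\<mu> - k)) / 2
      else if odd \<mu> then circulant \<mu> (\<lambda>i. (-1)^(i + 1)) r k
      else circulant \<mu> (\<lambda>i. (-1)^(i + 1) * (2 - 2 * real i / real \<mu>)) r k)"

definition Q_mat :: "bool \<Rightarrow> nat \<Rightarrow> nat \<Rightarrow> nat \<Rightarrow> real" where
  "Q_mat cyc \<mu> r k =
     (if \<not> cyc then (-1)^(r + k) / real \<mu>
      else if odd \<mu> then 0
      else circulant \<mu> (\<lambda>i. (-1)^(i + 1)) r k / real \<mu>)"

text \<open>
  \<open>refine_rule T fan f \<phi> y\<close>: the rule assigns to \<open>\<phi> \<in> dof_star (refine T)\<close> the refined control point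
  \<open>y\<close>, computed from the subdivided coefficients of \<open>f\<close>.  It is stated for functions with values in
  an arbitrary vector space, so that it applies to geometries and to scalar splines alike.
  Note that \<open>F \<circ> quad (d (a, b))\<close> is the subface of \<open>F\<close> at the corner with local coordinates \<open>(a, b)\<close>.
\<close>

inductive refine_rule ::
  "'p mesh \<Rightarrow> ('p \<Rightarrow> ('p face \<times> frame) list) \<Rightarrow> ('p, 'a::real_vector) mesh_fun \<Rightarrow>
   'p dof \<Rightarrow> 'a \<Rightarrow> bool"
  for T :: "'p mesh" and fan :: "'p \<Rightarrow> ('p face \<times> frame) list" and f :: "('p, 'a) mesh_fun"
where
  corner: "refine_rule T fan f (Corner \<gamma>) (subdiv_coeff (f F \<circ> d) 0 0)"
    if "\<gamma> \<in> corner_vertices T" "F \<in> T" "d \<in> frames" "F (d (0, 0)) = \<gamma>"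
| edge_left: "refine_rule T fan f (BEdge (side (F \<circ> quad (d (0, 0))) d)) (subdiv_coeff (f F \<circ> d) 1 0)"
    if "F \<in> T" "d \<in> frames" "side F d \<in> boundary_edges T"
| edge_right: "refine_rule T fan f (BEdge (side (F \<circ> quad (d (1, 0))) d)) (subdiv_coeff (f F \<circ> d) 2 0)"
    if "F \<in> T" "d \<in> frames" "side F d \<in> boundary_edges T"
| face: "refine_rule T fan f (Face (F \<circ> quad (real a, real b))) (subdiv_coeff (f F) (1 + a) (1 + b))"
    if "F \<in> T" "a \<le> 1" "b \<le> 1"
       "carrier_of F \<inter> extraordinary T = {} \<or>
        card (carrier_of F \<inter> extraordinary T) > 1 \<or>
        (\<exists>\<gamma>\<in>carrier_of F \<inter> extraordinary T. \<not> isolated T \<gamma>)"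
| extraordinary_outer:
    "refine_rule T fan f (Face (F \<circ> quad (d (real a, real b)))) (subdiv_coeff (f F \<circ> d) (1 + a) (1 + b))"
    if "\<gamma> \<in> extraordinary T" "isolated T \<gamma>" "(F, d) \<in> set (fan \<gamma>)"
       "(a, b) \<in> {(1,0), (1,1), (0,1)}"
| extraordinary_inner:
    "refine_rule T fan f (Face (F \<circ> quad (d (0, 0))))
       ((\<Sum>k = 1..m. S_mat cyc \<mu> r k *\<^sub>R
            subdiv_coeff (f (fst (fan \<gamma> ! (k - 1))) \<circ> snd (fan \<gamma> ! (k - 1))) 0 1) +
        (\<Sum>k = 1..\<mu>. Q_mat cyc \<mu> r k *\<^sub>R
            subdiv_coeff (f (fst (fan \<gamma> ! (k - 1))) \<circ> snd (fan \<gamma> ! (k - 1))) 1 1))"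
    if "\<gamma> \<in> extraordinary T" "isolated T \<gamma>"
       "cyc = (\<gamma> \<in> interior_vertices T)" "\<mu> = valence T \<gamma>"
       "m = (if cyc then \<mu> else \<mu> - 1)"
       "r \<in> {1..\<mu>}" "(F, d) = fan \<gamma> ! (r - 1)"

definition refined_points ::
  "'p mesh \<Rightarrow> ('p \<Rightarrow> ('p face \<times> frame) list) \<Rightarrow> ('p, 'a::real_vector) mesh_fun \<Rightarrow> 'p dof \<Rightarrow> 'a"
where
  "refined_points T fan f \<phi> = (THE y. refine_rule T fan f \<phi> y)"

text \<open>
  The linear refinement rule on functions.  For \<open>f\<close> in the span of the almost-C1 basis on \<open>T\<close> the
  matrix of the rule with respect to the bases \<open>B\<close> and \<open>B'\<close> (on \<open>refine T\<close>) sends the coefficients of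
  \<open>f\<close> to those of the refined function.  Matrices are normalized to vanish outside the index sets.
\<close>

definition refine_fun ::
  "'p mesh \<Rightarrow> ('p \<Rightarrow> ('p face \<times> frame) list) \<Rightarrow> ('p, 'a::real_vector) mesh_fun \<Rightarrow> ('p, 'a) mesh_fun"
where
  "refine_fun T fan f = spline (dof_star (refine T)) (basis_star (refine T)) (refined_points T fan f)"

definition apply_matrix ::
  "'p mesh \<Rightarrow> ('p dof \<Rightarrow> 'p dof \<Rightarrow> real) \<Rightarrow> ('p dof \<Rightarrow> 'a::real_vector) \<Rightarrow> 'p dof \<Rightarrow> 'a"
where
  "apply_matrix T A z \<phi> = (\<Sum>\<psi>\<in>dof T. A \<phi> \<psi> *\<^sub>R z \<psi>)"

definition refinement_matrix ::
  "'p mesh \<Rightarrow> ('p \<Rightarrow> ('p face \<times> frame) list) \<Rightarrow>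
   ('p dof \<Rightarrow> ('p, real) mesh_fun) \<Rightarrow> ('p dof \<Rightarrow> ('p, real) mesh_fun) \<Rightarrow>
   ('p dof \<Rightarrow> 'p dof \<Rightarrow> real) \<Rightarrow> bool"
where
  "refinement_matrix T fan B B' A \<longleftrightarrow>
     (\<forall>\<phi> \<psi>. \<phi> \<notin> dof (refine T) \<or> \<psi> \<notin> dof T \<longrightarrow> A \<phi> \<psi> = 0) \<and>
     (\<forall>z :: 'p dof \<Rightarrow> real. \<forall>G\<in>refine T. \<forall>s\<in>unit_square.
        refine_fun T fan (spline (dof T) B z) G s =
        spline (dof (refine T)) B' (apply_matrix T A z) G s)"

section \<open>Normals and tangent planes\<close>

text \<open>
  The unit normal vectors at \<open>p\<close>, determined up to sign: the mesh need not be orientable, and the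
  sign of the cross product depends on the orientation of the local coordinates.
\<close>

definition normal_vector :: "'p mesh \<Rightarrow> ('p, real^3) mesh_fun \<Rightarrow> 'p \<Rightarrow> real^3 \<Rightarrow> bool" where
  "normal_vector T x p \<nu> \<longleftrightarrow>
     norm \<nu> = 1 \<and>
     (\<forall>F\<in>T. \<forall>s\<in>unit_square. F s = p \<longrightarrow>
        (\<exists>a b. has_partials (x F) s a b \<and> cross3 a b \<noteq> 0 \<and>
               (sgn (cross3 a b) = \<nu> \<or> sgn (cross3 a b) = - \<nu>)))"

text \<open>
  In every face containing \<open>p\<close> the partial derivatives exist and span \<open>W\<close>, and \<open>x(p) + W\<close> touches the
  surface to first order.  (Differentiability is not required; at extraordinary vertices a limit
  surface is in general not differentiable in the coordinates of the faces.)
\<close>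

definition tangent_plane :: "'p mesh \<Rightarrow> ('p, real^3) mesh_fun \<Rightarrow> 'p \<Rightarrow> (real^3) set \<Rightarrow> bool" where
  "tangent_plane T x p W \<longleftrightarrow>
     subspace W \<and> dim W = 2 \<and>
     (\<forall>F\<in>T. \<forall>s\<in>unit_square. F s = p \<longrightarrow>
        (\<exists>a b. has_partials (x F) s a b \<and> span {a, b} = W) \<and>
        ((\<lambda>t. infdist (x F t - x F s) W / dist t s) \<longlongrightarrow> 0) (at s within unit_square))"

section \<open>Repeated refinement\<close>

definition mesh_seq :: "'p mesh \<Rightarrow> nat \<Rightarrow> 'p mesh" where
  "mesh_seq T k = (refine ^^ k) T"

text \<open>
  The process may use different orderings \<open>fan k\<close> and control triangles \<open>tri k\<close> in each step; the
  normals are the same throughout.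
\<close>

definition refinement_process ::
  "'p mesh \<Rightarrow> ('p \<Rightarrow> real^3) \<Rightarrow> (nat \<Rightarrow> 'p dof \<Rightarrow> real^3) \<Rightarrow> (nat \<Rightarrow> 'p \<Rightarrow> nat \<Rightarrow> real^3) \<Rightarrow>
   (nat \<Rightarrow> 'p \<Rightarrow> ('p face \<times> frame) list) \<Rightarrow> bool"
where
  "refinement_process T n xs tri fan \<longleftrightarrow>
     (\<forall>k. almost_C1_input (mesh_seq T k) (xs k) n (tri k) \<and>
          (\<forall>\<gamma>\<in>extraordinary (mesh_seq T k). is_fan (mesh_seq T k) \<gamma> (fan k \<gamma>)) \<and>
          xs (Suc k) = refined_points (mesh_seq T k) (fan k)
                         (almost_C1_geometry (mesh_seq T k) (xs k) n (tri k)))"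

text \<open>
  Convergence of \<open>x 0, x 1, \<dots>\<close> on the successive refinements of \<open>T\<close> to the map \<open>y\<close> on the underlying
  point set, uniformly.  Evaluating \<open>x k\<close> at all parameters of all faces of \<open>mesh_seq T k\<close> amounts to
  evaluating it at all points of the surface.
\<close>

definition converges_to ::
  "'p mesh \<Rightarrow> (nat \<Rightarrow> ('p, real^3) mesh_fun) \<Rightarrow> ('p \<Rightarrow> real^3) \<Rightarrow> bool"
where
  "converges_to T x y \<longleftrightarrow>
     (\<forall>\<epsilon>>0. \<exists>K. \<forall>k\<ge>K. \<forall>F\<in>mesh_seq T k. \<forall>s\<in>unit_square. dist (x k F s) (y (F s)) < \<epsilon>)"

end

theory Submission
  imports Defs
begin

text \<open>
  Near a vertex, a spline is governed by the \<open>2 \<times> 2\<close> block of its B-spline coefficients there.  The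
  rule with \<open>S\<close> and \<open>Q\<close> is made such that neighbouring inner control points average to the coefficient
  on the spoke between them.  Hence the continuous biquadratic spline of the refined control points is,
  on each old face, a B-spline with the same blocks as the old geometry (\<open>joint_lc\<close>), except for the
  diagonal coefficients at extraordinary vertices, and there its blocks already lie in the plane
  orthogonal to the normal.  So the next projection changes nothing, which yields (b) to (e).
  For (a), a function of the coarse space is, on the blocks at an extraordinary vertex, an affine
  function of the geometry, and the rule commutes with affine maps.
  For (g), consecutive geometries differ by multiples of a bump on squares of size \<open>2\<^sup>-\<^sup>k\<close> at the
  extraordinary vertices, with coefficients that decay like \<open>2\<^sup>-\<^sup>k\<close> and are orthogonal to the normal.
  The limit therefore exists; near any other point it is one of the geometries, and at an
  extraordinary vertex its height over the tangent plane is that of the first refinement.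
\<close>

section \<open>Symmetries of the square\<close>

text \<open>The inner control points y_r are to satisfy y_r + y_(r+1) = 2 e_r with the spoke
  coefficients e_r. For odd valence in the interior this determines them. For even valence, and at a
  boundary vertex, the alternating vector solves the homogeneous system; this free component is
  where the diagonal coefficients enter through Q. For even interior valence the system is solvable
  only if the alternating sum of the e_r vanishes, which holds because edge coefficients are means
  of consecutive face points. The obstacle is a coarse mesh in which extraordinary vertices lie in
  each other's 1-rings. There the rule does not keep the spokes; what survives is that the new
  blocks lie in the old plane, and that is enough for (a) and (e). One refinement isolates all
  extraordinary vertices, so the estimates for (g) start at the first refined mesh. The decay in (g)
  is elementary: spokes halve exactly, while the diagonals enter an inner point through Q with total
  weight at most 1 and are then divided by 4. If the bound for the diagonals exceeds that for the
  spokes by a suitable factor, both bounds halve in every step.\<close>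

abbreviation sq :: "(real \<times> real) set" where "sq \<equiv> unit_square"

text \<open>\<open>w\<close> swaps the coordinates, then \<open>a\<close> and \<open>b\<close> reflect them.\<close>

definition fr :: "bool \<Rightarrow> bool \<Rightarrow> bool \<Rightarrow> frame" where
  "fr a b w = (\<lambda>(u,v). (if a then 1 - (if w then v else u) else (if w then v else u),
                        if b then 1 - (if w then u else v) else (if w then u else v)))"

text \<open>Trades the real offsets in {0,1} for booleans: every later fact about local coordinates
  becomes a case split over the eight values of \<open>fr a b w\<close>.\<close>

lemma frames_fr: "frames = {fr a b w | a b w. True}"
proof -
  have "d \<in> frames \<longleftrightarrow> (\<exists>a b w. d = fr a b w)" for d
    unfolding frames_def fr_def ex_bool_eq
    by (simp add: bex_simps case_prod_unfold cong: if_cong) blast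
  then show ?thesis by blast
qed

lemma frameE:
  assumes "d \<in> frames"
  obtains a b w where "d = fr a b w"
  using assms unfolding frames_fr by blast

lemma fr_frames [simp, intro]: "fr a b w \<in> frames"
  unfolding frames_fr by blast

abbreviation flip :: frame where "flip \<equiv> fr True False False"
abbreviation swp :: frame where "swp \<equiv> fr False False True"

lemma fr_simps [simp]:
  "fr a b w (u, v) = (if a then 1 - (if w then v else u) else (if w then v else u),
                      if b then 1 - (if w then u else v) else (if w then u else v))"
  by (simp add: fr_def)

lemma frames_comp:
  assumes "d \<in> frames" "e \<in> frames"
  shows "d \<circ> e \<in> frames"
proof -
  obtain a b w where d: "d = fr a b w" by (rule frameE[OF assms(1)])
  obtain a' b' w' where e: "e = fr a' b' w'" by (rule frameE[OF assms(2)])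
  have "d \<circ> e = fr (if w then a \<noteq> b' else a \<noteq> a') (if w then b \<noteq> a' else b \<noteq> b') (w \<noteq> w')"
    unfolding d e by (rule ext) (auto split: if_splits)
  then show ?thesis by simp
qed

lemma frames_inverse:
  assumes "d \<in> frames"
  obtains e where "e \<in> frames" "\<And>s. e (d s) = s" "\<And>s. d (e s) = s"
proof -
  obtain a b w where d: "d = fr a b w" by (rule frameE[OF assms])
  let ?e = "fr (if w then b else a) (if w then a else b) w"
  have "?e (d s) = s" "d (?e s) = s" for s
    unfolding d by (cases s; auto split: if_splits)+
  then show ?thesis using that[of ?e] by blast
qed

lemma frame_inj: "d \<in> frames \<Longrightarrow> d s = d t \<longleftrightarrow> s = t"
  by (metis frames_inverse)

lemma frame_square [simp]: "d \<in> frames \<Longrightarrow> d s \<in> sq \<longleftrightarrow> s \<in> sq"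
  by (erule frameE, cases s) (auto simp: unit_square_def)

lemma frame_corners [simp]: "d \<in> frames \<Longrightarrow> d s \<in> corners \<longleftrightarrow> s \<in> corners"
  by (erule frameE, cases s) (auto simp: corners_def)

lemma frame_image_square: "d \<in> frames \<Longrightarrow> d ` sq = sq"
proof -
  assume d: "d \<in> frames"
  obtain e where e: "e \<in> frames" "\<And>s. d (e s) = s" by (metis frames_inverse d)
  show ?thesis using d e by (auto simp: image_iff) (metis frame_square)
qed

lemma corners_square [simp]: "q \<in> corners \<Longrightarrow> q \<in> sq"
  by (auto simp: corners_def unit_square_def)

lemma sq_iff: "(u,v) \<in> sq \<longleftrightarrow> 0 \<le> u \<and> u \<le> 1 \<and> 0 \<le> v \<and> v \<le> 1"
  by (auto simp: unit_square_def)

lemma corners_iff: "(u,v) \<in> corners \<longleftrightarrow> (u = 0 \<or> u = 1) \<and> (v = 0 \<or> v = 1)"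
  by (auto simp: corners_def)

lemma corner_frame:
  assumes "q \<in> corners" obtains d where "d \<in> frames" "d (0,0) = q"
proof -
  have "fr (fst q = 1) (snd q = 1) False (0,0) = q" using assms by (auto simp: corners_def)
  then show ?thesis using that fr_frames by blast
qed

text \<open>With the origin fixed only the transposition is left. This is why symmetric data of a
  corner, such as the diagonal coefficient, depend on the corner alone.\<close>

lemma frame_same_origin:
  assumes "d \<in> frames" "e \<in> frames" "d (0,0) = e (0,0)"
  shows "e = d \<or> e = d \<circ> swp"
proof -
  obtain a b w where d: "d = fr a b w" by (rule frameE[OF assms(1)])
  obtain a' b' w' where e: "e = fr a' b' w'" by (rule frameE[OF assms(2)])
  have "a = a'" "b = b'" using assms(3) by (auto simp: d e split: if_splits)
  moreover have "fr a b True \<circ> swp = fr a b False" "fr a b False \<circ> swp = fr a b True"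
    by (rule ext; auto)+
  ultimately show ?thesis unfolding d e by (cases w; cases w') auto
qed

lemma frame_swp_swp [simp]: "d \<circ> swp \<circ> swp = d" by (rule ext) auto
lemma frame_flip_flip [simp]: "d \<circ> flip \<circ> flip = d" by (rule ext) auto
lemma frame_swp_frames [simp]: "d \<in> frames \<Longrightarrow> d \<circ> swp \<in> frames" by (rule frames_comp) auto
lemma frame_flip_frames [simp]: "d \<in> frames \<Longrightarrow> d \<circ> flip \<in> frames" by (rule frames_comp) auto
lemma id_frames [simp]: "id \<in> frames" "(\<lambda>x. x) \<in> frames"
proof -
  have "fr False False False = id" by (rule ext) auto
  then show "id \<in> frames" by (metis fr_frames)
  then show "(\<lambda>x. x) \<in> frames" by (simp add: id_def)
qed

text \<open>The restriction to inner points is essential: a corner lies on two sides, an inner point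
  of a side on one, which leaves only the direction of travel open.\<close>

lemma frame_side_point:
  assumes d: "d \<in> frames" and e: "e \<in> frames" and eq: "d (r,0) = e (t,0)" and r: "0 < r" "r < 1"
  shows "e = d \<and> t = r \<or> e = d \<circ> flip \<and> t = 1 - r"
proof -
  obtain d' where d': "d' \<in> frames" "\<And>s. d' (d s) = s" "\<And>s. d (d' s) = s" by (metis frames_inverse d)
  have f: "d' \<circ> e \<in> frames" using d' e frames_comp by blast
  then obtain a b w where abw: "d' \<circ> e = fr a b w" by (rule frameE)
  have ee: "e = d \<circ> fr a b w" using abw d'(3) by (metis comp_apply ext)
  have "fr a b w (t,0) = (r,0)" using eq d'(2) by (metis abw comp_apply)
  then have "\<not> w \<and> \<not> b \<and> (if a then t = 1 - r else t = r)" using r by (auto split: if_splits)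
  moreover have "fr False False False = id" by (rule ext) auto
  ultimately show ?thesis unfolding ee by (cases a) (auto simp: comp_id)
qed

lemma frame_affine:
  assumes "d \<in> frames" shows "d ((1/2) *\<^sub>R (s + t)) = (1/2) *\<^sub>R (d s + d t)"
proof -
  obtain a b w where d: "d = fr a b w" by (rule frameE[OF assms])
  show ?thesis unfolding d by (cases s; cases t; cases a; cases b; cases w) (auto simp: field_simps)
qed

text \<open>Frames are affine and \<open>quad\<close> takes midpoints, so one and the same
  \<open>d\<close> serves as local coordinates of a face and of its subfaces. All comparisons
  between coarse and refined coefficients rest on this.\<close>

lemma quad_frame: "d \<in> frames \<Longrightarrow> quad (d q) (d s) = d (quad q s)"
  unfolding quad_def by (simp add: frame_affine)

lemma quad_simp: "quad (a,b) (u,v) = ((a+u)/2, (b+v)/2)"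
  by (simp add: quad_def)

lemma quad_square [simp]: "q \<in> corners \<Longrightarrow> s \<in> sq \<Longrightarrow> quad q s \<in> sq"
  by (cases q; cases s) (auto simp: quad_simp corners_iff sq_iff)

lemma quad_inj [simp]: "quad q s = quad q t \<longleftrightarrow> s = t"
  by (auto simp: quad_def)

lemma quad_cover:
  assumes "s \<in> sq"
  obtains q t where "q \<in> corners" "t \<in> sq" "s = quad q t"
proof -
  obtain u v where s: "s = (u,v)" by (cases s)
  let ?a = "if u \<le> 1/2 then 0 else 1::real" and ?b = "if v \<le> 1/2 then 0 else 1::real"
  have "(?a,?b) \<in> corners" "(2 * u - ?a, 2 * v - ?b) \<in> sq" "s = quad (?a,?b) (2 * u - ?a, 2 * v - ?b)"
    using assms unfolding s by (auto simp: corners_iff sq_iff quad_simp)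
  then show ?thesis using that by blast
qed

lemma side_flip: "side F (d \<circ> flip) = side F d"
proof -
  have "(\<lambda>t::real. 1 - t) ` {0..1} = {0..1}" by auto
  then have "side F (d \<circ> flip) = (\<lambda>t. F (d (t,0))) ` ((\<lambda>t. 1 - t) ` {0..1})"
    unfolding side_def image_image by (simp cong: image_cong)
  then show ?thesis by (simp add: side_def)
qed

lemma side_subset_carrier: "d \<in> frames \<Longrightarrow> side F d \<subseteq> carrier_of F"
  unfolding side_def carrier_of_def by (auto simp: sq_iff intro!: imageI)

section \<open>Meshes\<close>

text \<open>Equality of sides as sets would leave the direction open; here both parametrizations run
  together, so the two local origins are the same vertex. The pair of a face with itself is
  allowed.\<close>

definition glued :: "'p face \<Rightarrow> frame \<Rightarrow> 'p face \<Rightarrow> frame \<Rightarrow> bool" where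
  "glued F d G e \<longleftrightarrow> (\<forall>r\<in>{0..1}. F (d (r, 0)) = G (e (r, 0)))"

definition incident :: "'p mesh \<Rightarrow> 'p set \<Rightarrow> 'p face set" where
  "incident T \<tau> = {F \<in> T. \<tau> \<subseteq> carrier_of F}"

lemma glued_refl [simp]: "glued F d F d" by (simp add: glued_def)

lemma glued_sym: "glued F d G e \<Longrightarrow> glued G e F d" by (simp add: glued_def)

lemma glued_side: "glued F d G e \<Longrightarrow> side F d = side G e"
  unfolding glued_def side_def by (auto intro!: image_cong)

lemma glued_flip: "glued F d G e \<Longrightarrow> glued F (d \<circ> flip) G (e \<circ> flip)"
  by (auto simp: glued_def)

lemma glued_origin: "glued F d G e \<Longrightarrow> F (d (0,0)) = G (e (0,0))"
  by (auto simp: glued_def)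

lemma side_origin: "F (d (0,0)) \<in> side F d"
  by (auto simp: side_def)

lemma boundary_edges_incident:
  "boundary_edges T = {\<tau> \<in> edges T. card (incident T \<tau>) = 1}"
  by (simp add: boundary_edges_def incident_def)

lemma origin_corner [simp]: "(0,0) \<in> corners"
  by (simp add: corners_def)

lemma frame_origin_vertex: "F \<in> T \<Longrightarrow> d \<in> frames \<Longrightarrow> F (d (0,0)) \<in> vertices T"
  unfolding vertices_def using frame_corners[of d "(0,0)"] origin_corner by blast

section \<open>How two faces of a mesh can meet\<close>

locale qmesh =
  fixes T :: "'p mesh"
  assumes quad_mesh: "quad_mesh T"
begin

abbreviation (input) "EV \<equiv> extraordinary T"
abbreviation (input) "BE \<equiv> boundary_edges T"
abbreviation (input) "IV \<equiv> interior_vertices T"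
abbreviation (input) "BV \<equiv> boundary_vertices T"
abbreviation (input) "IE \<equiv> interior_edges T"

lemma finite_faces [simp]: "finite T"
  using quad_mesh by (simp add: quad_mesh_def)

lemma face_eq:
  "F \<in> T \<Longrightarrow> s \<in> sq \<Longrightarrow> t \<in> sq \<Longrightarrow> F s = F t \<longleftrightarrow> s = t"
  using quad_mesh unfolding quad_mesh_def inj_on_def by metis

lemma meet:
  assumes "F \<in> T" "G \<in> T" "s \<in> sq" "t \<in> sq" "F s = G t" "F \<noteq> G"
    "\<not> (s \<in> corners \<and> t \<in> corners)"
  obtains d e r where "d \<in> frames" "e \<in> frames" "glued F d G e" "0 \<le> r" "r \<le> 1"
    "s = d (r, 0)" "t = e (r, 0)"
proof -
  have "(s \<in> corners \<and> t \<in> corners) \<or>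
        (\<exists>d\<in>frames. \<exists>e\<in>frames. (\<forall>r\<in>{0..1}. F (d (r, 0)) = G (e (r, 0))) \<and>
           (\<exists>r\<in>{0..1}. s = d (r, 0) \<and> t = e (r, 0)))"
    using quad_mesh assms(1-6) unfolding quad_mesh_def by blast
  then show ?thesis using assms(7) that unfolding glued_def by fastforce
qed

text \<open>The frame \<open>d\<close> is prescribed here, whereas \<open>meet\<close> yields some
  common side. As the point is inner to the side, the frame found by \<open>meet\<close> is
  \<open>d\<close> or \<open>d \<circ> flip\<close>, and reversing both sides repairs the second
  case.\<close>

lemma meet_side:
  assumes F: "F \<in> T" and G: "G \<in> T" and d: "d \<in> frames" and r: "0 < r" "r < 1"
    and t: "t \<in> sq" and eq: "F (d (r,0)) = G t" and ne: "F \<noteq> G"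
  obtains e where "e \<in> frames" "glued F d G e" "t = e (r,0)"
proof -
  have "(r,0) \<notin> corners" using r by (auto simp: corners_def)
  then have nc: "d (r,0) \<notin> corners" using d by simp
  have sq: "d (r,0) \<in> sq" using d r by (simp add: sq_iff)
  obtain d' e' r' where *: "d' \<in> frames" "e' \<in> frames" "glued F d' G e'" "0 \<le> r'" "r' \<le> 1"
    "d (r,0) = d' (r', 0)" "t = e' (r', 0)"
    using meet[OF F G sq t eq ne] nc by metis
  from frame_side_point[OF d *(1,6) r] show ?thesis
  proof
    assume "d' = d \<and> r' = r"
    then show ?thesis using that[of e'] * by simp
  next
    assume h: "d' = d \<circ> flip \<and> r' = 1 - r"
    then have "glued F d G (e' \<circ> flip)" using glued_flip[OF *(3)] by simp
    then show ?thesis using that[of "e' \<circ> flip"] * h by simp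
  qed
qed

lemma meet_interior:
  assumes F: "F \<in> T" and G: "G \<in> T" and uv: "0 < u" "u < 1" "0 < v" "v < 1"
    and t: "t \<in> sq" and eq: "F (u,v) = G t"
  shows "F = G \<and> t = (u,v)"
proof -
  have sq: "(u,v) \<in> sq" using uv by (simp add: sq_iff)
  have "F = G"
  proof (rule ccontr)
    assume ne: "F \<noteq> G"
    have "(u,v) \<notin> corners" using uv by (auto simp: corners_def)
    then obtain d e r where "d \<in> frames" "(u,v) = d (r, 0)"
      using meet[OF F G sq t eq ne] by metis
    then show False using uv by (elim frameE) (auto split: if_splits)
  qed
  then show ?thesis using face_eq[OF F sq t] eq by auto
qed

text \<open>This is the absence of hanging nodes: a gluing identifies (r,0) in both frames, and
  whether that is a corner depends on r alone, so a corner of one face cannot sit in the middle of a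
  side of another.\<close>

lemma vertex_corner:
  assumes pt: "pt \<in> vertices T" and F: "F \<in> T" and s: "s \<in> sq" and eq: "F s = pt"
  shows "s \<in> corners"
proof -
  obtain G q where G: "G \<in> T" "q \<in> corners" "pt = G q" using pt by (auto simp: vertices_def)
  show ?thesis
  proof (cases "F = G")
    case True
    then show ?thesis using G face_eq[OF F s, of q] eq by simp
  next
    case False
    show ?thesis
    proof (rule ccontr)
      assume "s \<notin> corners"
      then obtain d e r where *: "d \<in> frames" "e \<in> frames" "s = d (r, 0)" "q = e (r, 0)"
        using meet[OF F G(1) s, of q] G eq False by (metis corners_square)
      then have "(r,0) \<in> corners" using G(2) by simp
      then show False using * \<open>s \<notin> corners\<close> by simp
    qed
  qed
qed

lemma vertex_frame:
  assumes "pt \<in> vertices T" "F \<in> faces_at T pt"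
  obtains d where "d \<in> frames" "F (d (0,0)) = pt"
proof -
  obtain s where "s \<in> sq" "F s = pt" "F \<in> T"
    using assms(2) by (auto simp: faces_at_def carrier_of_def)
  then have "s \<in> corners" using vertex_corner assms(1) by blast
  then show ?thesis using that \<open>F s = pt\<close> by (metis corner_frame)
qed

lemma origin_eq:
  assumes "F \<in> T" "d \<in> frames" "e \<in> frames" "F (d (0,0)) = F (e (0,0))"
  shows "e = d \<or> e = d \<circ> swp"
proof -
  have "d (0,0) = e (0,0)"
    using face_eq[OF assms(1), of "d (0,0)" "e (0,0)"] assms by (simp add: sq_iff)
  then show ?thesis using frame_same_origin assms by blast
qed

lemma faces_at_origin: "F \<in> T \<Longrightarrow> d \<in> frames \<Longrightarrow> F \<in> faces_at T (F (d (0,0)))"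
  by (simp add: faces_at_def carrier_of_def sq_iff)

lemma finite_faces_at [simp]: "finite (faces_at T pt)"
  by (simp add: faces_at_def)

lemma finite_incident [simp]: "finite (incident T \<tau>)"
  by (simp add: incident_def)

text \<open>One point suffices: the midpoint of the side is not a corner, so
  \<open>meet_side\<close> glues the whole side as soon as the midpoint lies in
  \<open>G\<close>.\<close>

lemma side_subset_glued:
  assumes F: "F \<in> T" and G: "G \<in> T" and d: "d \<in> frames" and s: "side F d \<subseteq> carrier_of G"
  obtains e where "e \<in> frames" "glued F d G e"
proof (cases "F = G")
  case True
  then show ?thesis using that[of d] d by simp
next
  case False
  have "F (d (1/2,0)) \<in> carrier_of G" using s by (force simp: side_def)
  then obtain t where "t \<in> sq" "F (d (1/2,0)) = G t" by (auto simp: carrier_of_def)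
  then show ?thesis using meet_side[OF F G d _ _ _ _ False, of "1/2" t] that by auto
qed

lemma incident_side:
  assumes "F \<in> T" "d \<in> frames"
  shows "incident T (side F d) = {G \<in> T. \<exists>e\<in>frames. glued F d G e}"
proof -
  have "G \<in> T \<Longrightarrow> side F d \<subseteq> carrier_of G \<longleftrightarrow> (\<exists>e\<in>frames. glued F d G e)" for G
    using side_subset_glued[OF assms(1) _ assms(2)] glued_side side_subset_carrier by metis
  then show ?thesis by (auto simp: incident_def)
qed

lemma side_edges: "F \<in> T \<Longrightarrow> d \<in> frames \<Longrightarrow> side F d \<in> edges T"
  by (auto simp: edges_def)

lemma card_incident_le: "\<tau> \<in> edges T \<Longrightarrow> card (incident T \<tau>) \<le> 2"
  using quad_mesh by (simp add: quad_mesh_def incident_def)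

lemma self_incident: "F \<in> T \<Longrightarrow> d \<in> frames \<Longrightarrow> F \<in> incident T (side F d)"
  by (simp add: incident_def side_subset_carrier)

lemma boundary_side_iff:
  assumes "F \<in> T" "d \<in> frames"
  shows "side F d \<in> BE \<longleftrightarrow> incident T (side F d) = {F}"
  using side_edges[OF assms] self_incident[OF assms]
  by (auto simp: boundary_edges_incident card_1_singleton_iff)

lemma glued_incident:
  assumes "F \<in> T" "G \<in> T" "d \<in> frames" "e \<in> frames" "glued F d G e" "F \<noteq> G"
  shows "incident T (side F d) = {F, G}" "side F d \<in> IE"
proof -
  have "{F,G} \<subseteq> incident T (side F d)"
    using assms glued_refl[of F d] by (auto simp: incident_side simp del: glued_refl)
  moreover have "card (incident T (side F d)) \<le> card {F,G}"
    using card_incident_le[OF side_edges[OF assms(1,3)]] assms(6) by simp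
  ultimately show *: "incident T (side F d) = {F, G}"
    by (metis card_seteq finite_incident)
  then show "side F d \<in> IE"
    using assms boundary_side_iff[of F d] side_edges[of F d] by (auto simp: interior_edges_def)
qed

lemma interior_side_glued:
  assumes "F \<in> T" "d \<in> frames" "side F d \<in> IE"
  obtains G e where "G \<in> T" "G \<noteq> F" "e \<in> frames" "glued F d G e"
proof -
  have "incident T (side F d) \<noteq> {F}"
    using assms boundary_side_iff[of F d] by (auto simp: interior_edges_def)
  then obtain G where "G \<in> incident T (side F d)" "G \<noteq> F"
    using self_incident[OF assms(1,2)] by blast
  then show ?thesis using that assms by (auto simp: incident_side)
qed

lemma side_eq_iff:
  assumes F: "F \<in> T" and d: "d \<in> frames" and e: "e \<in> frames"
  shows "side F d = side F e \<longleftrightarrow> e = d \<or> e = d \<circ> flip"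
proof
  assume "side F d = side F e"
  then have "F (d (1/2,0)) \<in> side F e" by (force simp: side_def)
  then obtain t where t: "0 \<le> t" "t \<le> 1" "F (d (1/2,0)) = F (e (t,0))" by (auto simp: side_def)
  then have "d (1/2,0) = e (t,0)" using face_eq[OF F] d e by (simp add: sq_iff)
  then show "e = d \<or> e = d \<circ> flip" using frame_side_point[OF d e] by auto
qed (auto simp: side_flip)

lemma side_swp_ne:
  assumes F: "F \<in> T" and d: "d \<in> frames"
  shows "side F (d \<circ> swp) \<noteq> side F d"
proof
  assume "side F (d \<circ> swp) = side F d"
  then have "d \<circ> swp = d \<or> d \<circ> swp = d \<circ> flip" using side_eq_iff[OF F d, of "d \<circ> swp"] d by simp
  then have "d (0, 1/2) = d (1/2, 0) \<or> d (1,0) = d (0,0)"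
  proof
    assume "d \<circ> swp = d"
    from fun_cong[OF this, of "(1/2,0)"] show ?thesis by simp
  next
    assume "d \<circ> swp = d \<circ> flip"
    from fun_cong[OF this, of "(0,0)"] show ?thesis by simp
  qed
  then show False using d by (simp add: frame_inj)
qed

section \<open>Edges and faces around a vertex\<close>

lemma edge_at_vertex:
  assumes \<tau>: "\<tau> \<in> edges T" and pt: "pt \<in> vertices T" "pt \<in> \<tau>" and F: "F \<in> T" "\<tau> \<subseteq> carrier_of F"
  obtains d where "d \<in> frames" "F (d (0,0)) = pt" "\<tau> = side F d"
proof -
  obtain G e where G: "G \<in> T" "e \<in> frames" "\<tau> = side G e" using \<tau> by (auto simp: edges_def)
  obtain d where d: "d \<in> frames" "glued G e F d" using side_subset_glued[OF G(1) F(1) G(2)] F G by auto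
  have \<tau>F: "\<tau> = side F d" using glued_side d G by metis
  then obtain t where t: "0 \<le> t" "t \<le> 1" "pt = F (d (t,0))" using pt by (auto simp: side_def)
  then have "d (t,0) \<in> corners" using vertex_corner[OF pt(1) F(1), of "d (t,0)"] d by (simp add: sq_iff)
  then have "t = 0 \<or> t = 1" using d by (auto simp: corners_iff)
  then show ?thesis
  proof
    assume "t = 0" then show ?thesis using that[of d] d \<tau>F t by simp
  next
    assume "t = 1" then show ?thesis using that[of "d \<circ> flip"] d \<tau>F t by (simp add: side_flip)
  qed
qed

text \<open>Excluding kissing vertices makes the crossing of edges at \<open>pt\<close> transitive
  on the faces there. This becomes an induction principle: to know a whole star, or to transport a
  property around it, single crossings are enough. Valence counts, refined stars and normal
  directions are obtained this way.\<close>

lemma star_closed: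
  assumes pt: "pt \<in> vertices T" and C: "C \<subseteq> faces_at T pt" "C \<noteq> {}"
    and closed: "\<And>F d G e. F \<in> C \<Longrightarrow> d \<in> frames \<Longrightarrow> F (d (0,0)) = pt \<Longrightarrow> G \<in> T \<Longrightarrow>
        e \<in> frames \<Longrightarrow> glued F d G e \<Longrightarrow> G \<in> C"
  shows "C = faces_at T pt"
proof
  show "faces_at T pt \<subseteq> C"
  proof
    fix G assume G: "G \<in> faces_at T pt"
    obtain F where F: "F \<in> C" using C by blast
    let ?R = "{(F, G). F \<in> faces_at T pt \<and> G \<in> faces_at T pt \<and>
                   (\<exists>\<tau>\<in>IE. pt \<in> \<tau> \<and> \<tau> \<subseteq> carrier_of F \<and> \<tau> \<subseteq> carrier_of G)}"
    have "\<forall>pt\<in>vertices T. \<forall>F\<in>faces_at T pt. \<forall>G\<in>faces_at T pt.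
        (F, G) \<in> {(F, G). F \<in> faces_at T pt \<and> G \<in> faces_at T pt \<and>
                   (\<exists>\<tau>\<in>IE. pt \<in> \<tau> \<and> \<tau> \<subseteq> carrier_of F \<and> \<tau> \<subseteq> carrier_of G)}\<^sup>*"
      using quad_mesh unfolding quad_mesh_def by (elim conjE)
    from this[rule_format, OF pt subsetD[OF C(1) F] G] have "(F, G) \<in> ?R\<^sup>*" .
    then show "G \<in> C"
    proof (induction rule: rtrancl_induct)
      case base
      then show ?case by (rule F)
    next
      case (step G H)
      then obtain \<tau> where \<tau>: "\<tau> \<in> IE" "pt \<in> \<tau>" "\<tau> \<subseteq> carrier_of G" "\<tau> \<subseteq> carrier_of H"
        "G \<in> T" "H \<in> T" by (auto simp: faces_at_def)
      obtain d where d: "d \<in> frames" "G (d (0,0)) = pt" "\<tau> = side G d"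
        using edge_at_vertex[of \<tau> pt G] \<tau> pt by (auto simp: interior_edges_def)
      obtain e where "e \<in> frames" "glued G d H e" using side_subset_glued[of G H d] d \<tau> by auto
      then show ?case using closed[of G d H e] step d \<tau> by auto
    qed
  qed
qed (use C in blast)

lemma faces_at_glued:
  assumes "G \<in> T" "e \<in> frames" "glued F d G e"
  shows "G \<in> faces_at T (F (d (0,0)))"
  using assms faces_at_origin[of G e] glued_origin by metis

text \<open>The two edges of \<open>F\<close> at \<open>pt\<close> are \<open>d\<close> and \<open>d \<circ> swp\<close>, so a local step from \<open>F\<close> goes through one of them.\<close>

lemma glued_same_frame:
  assumes "F \<in> T" "G \<in> T" "d \<in> frames" "e \<in> frames" "e' \<in> frames" "glued F d G e" "glued F d G e'"
  shows "e' = e"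
proof -
  have "G (e (1/2,0)) = G (e' (1/2,0))" "G (e (0,0)) = G (e' (0,0))"
    using assms(6,7) by (auto simp: glued_def)
  then have h: "e (1/2,0) = e' (1/2,0)" "e (0,0) = e' (0,0)"
    using face_eq[OF assms(2)] assms(4,5) by (simp_all add: sq_iff)
  from frame_side_point[OF assms(4,5) h(1)] show ?thesis
  proof
    assume "e' = e \<circ> flip \<and> 1/2 = 1 - (1/2::real)"
    then have "e (0,0) = e (1,0)" using h(2) by simp
    then show ?thesis using assms(4) by (simp add: frame_inj)
  qed auto
qed

lemma glued_step:
  assumes "F \<in> T" "G \<in> T" "H \<in> T" "d \<in> frames" "e \<in> frames" "h \<in> frames"
    "glued F d G e" "glued F (d \<circ> swp) H h" "G \<noteq> F" "H \<noteq> F"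
    "K \<in> T" "k \<in> frames" "x \<in> frames" "F (x (0,0)) = F (d (0,0))" "glued F x K k"
  shows "K \<in> {F, G, H}"
proof -
  have K: "K \<in> incident T (side F x)" using assms by (auto simp: incident_side)
  have "x = d \<or> x = d \<circ> swp" using origin_eq[of F d x] assms by auto
  then show ?thesis
    using K glued_incident(1)[of F G d e] glued_incident(1)[of F H "d \<circ> swp" h] assms by auto
qed

text \<open>Two faces glued along both edges at a common vertex close up: no crossing leads out of
  the pair, so the vertex has valence 2. Ordinary interior vertices rule out this pocket by valence
  4, and at a boundary vertex it would leave no room for a boundary edge.\<close>

lemma opposite_interior_aux:
  assumes "F \<in> T" "G \<in> T" "d \<in> frames" "e \<in> frames" "glued F d G e" "F \<noteq> G"
    and h: "h \<in> frames" "glued F (d \<circ> swp) G h"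
  shows "faces_at T (F (d (0,0))) = {F, G}" "h = e \<circ> swp"
proof -
  have "G (e (0,0)) = G (h (0,0))"
    using glued_origin[OF h(2)] glued_origin[OF assms(5)] by simp
  then have "h = e \<or> h = e \<circ> swp" using origin_eq assms h by blast
  moreover have "h \<noteq> e"
    using side_swp_ne[OF assms(1,3)] glued_side[OF h(2)] glued_side[OF assms(5)] by metis
  ultimately show he: "h = e \<circ> swp" by blast
  have "{F, G} = faces_at T (F (d (0,0)))"
  proof (rule star_closed)
    show "F (d (0,0)) \<in> vertices T" using assms frame_origin_vertex by blast
    show "{F,G} \<subseteq> faces_at T (F (d (0,0)))"
      using faces_at_origin faces_at_glued assms by auto
    fix X x K k assume X: "X \<in> {F,G}" "x \<in> frames" "X (x (0,0)) = F (d (0,0))" "K \<in> T" "k \<in> frames"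
      "glued X x K k"
    from X(1) show "K \<in> {F, G}"
    proof
      assume "X = F"
      then show ?thesis using glued_step[of F G G d e h K k x] assms X by auto
    next
      assume "X \<in> {G}"
      then show ?thesis
        using glued_step[of G F F e d "d \<circ> swp" K k x] assms X he glued_sym[OF assms(5)] glued_sym[OF h(2)]
          glued_origin[OF assms(5)] by auto
    qed
  qed simp
  then show "faces_at T (F (d (0,0))) = {F, G}" by simp
qed

lemma interior_vertex_side:
  assumes "F \<in> T" "d \<in> frames" "F (d (0,0)) \<in> IV"
  shows "side F d \<in> IE"
  using assms side_origin[of F d] side_edges[of F d]
  by (auto simp: interior_vertices_def interior_edges_def boundary_vertices_def)

text \<open>Crossing the remaining edges of \<open>F\<close> and \<open>G\<close> at the vertex
  gives \<open>H\<close> and \<open>H'\<close>. Any coincidence among the four closes the star too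
  early, with valence 2 or 3; being four distinct faces, they exhaust the star by counting.\<close>

lemma opposite_interior:
  assumes F: "F \<in> T" and G: "G \<in> T" and d: "d \<in> frames" and e: "e \<in> frames"
    and g: "glued F d G e" and ne: "F \<noteq> G" and val: "card (faces_at T (F (d (0,0)))) = 4"
    and int: "F (d (0,0)) \<in> IV"
  obtains H h H' h' where "H \<in> T" "H' \<in> T" "h \<in> frames" "h' \<in> frames"
    "glued F (d \<circ> swp) H h" "glued G (e \<circ> swp) H' h'" "distinct [F, G, H, H']"
    "faces_at T (F (d (0,0))) = {F, G, H, H'}"
proof -
  let ?pt = "F (d (0,0))"
  have ptG: "G (e (0,0)) = ?pt" using glued_origin[OF g] by simp
  obtain H h where H: "H \<in> T" "H \<noteq> F" "h \<in> frames" "glued F (d \<circ> swp) H h"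
    using interior_side_glued[of F "d \<circ> swp"] interior_vertex_side[of F "d \<circ> swp"] F d int by auto
  obtain H' h' where H': "H' \<in> T" "H' \<noteq> G" "h' \<in> frames" "glued G (e \<circ> swp) H' h'"
    using interior_side_glued[of G "e \<circ> swp"] interior_vertex_side[of G "e \<circ> swp"] G e int ptG by auto
  have "H \<noteq> G"
    using opposite_interior_aux(1)[OF F G d e g ne, of h] H val ne by auto
  moreover have "H' \<noteq> F"
    using opposite_interior_aux(1)[OF G F e d glued_sym[OF g] ne[symmetric], of h'] H' val ne ptG by auto
  moreover have "H \<noteq> H'"
  proof
    assume eq: "H = H'"
    have o: "H (h (0,0)) = H (h' (0,0))" using glued_origin[OF H(4)] glued_origin[OF H'(4)] eq ptG by simp
    then have "h' = h \<or> h' = h \<circ> swp" using origin_eq[OF H(1,3)] H' by blast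
    moreover have "h' \<noteq> h"
    proof
      assume "h' = h"
      then have "side F (d \<circ> swp) = side G (e \<circ> swp)"
        using glued_side[OF H(4)] glued_side[OF H'(4)] eq by simp
      then have "G \<in> incident T (side F (d \<circ> swp))" using self_incident[OF G, of "e \<circ> swp"] e by simp
      then show False using glued_incident(1)[of F H "d \<circ> swp" h] F d H ne \<open>H \<noteq> G\<close> by auto
    qed
    ultimately have h': "h' = h \<circ> swp" by blast
    \<comment> \<open>If the walks through \<open>F\<close> and through \<open>G\<close> end in the
      same face, it is entered through its two different edges at the vertex, and the three faces
      are closed under crossing.\<close>
    have "{F, G, H} = faces_at T ?pt"
    proof (rule star_closed)
      show "?pt \<in> vertices T" using F d frame_origin_vertex by blast
      show "{F, G, H} \<subseteq> faces_at T ?pt"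
        using faces_at_origin[OF F d] faces_at_glued[OF G e g] faces_at_glued[OF H(1,3,4)] by auto
      fix X x K k assume X: "X \<in> {F,G,H}" "x \<in> frames" "X (x (0,0)) = ?pt" "K \<in> T" "k \<in> frames"
        "glued X x K k"
      consider "X = F" | "X = G" | "X = H" using X(1) by blast
      then show "K \<in> {F, G, H}"
      proof cases
        case 1
        then show ?thesis using glued_step[of F G H d e h K k x] F G d e g ne H X by auto
      next
        case 2
        then show ?thesis
          using glued_step[of G F H e d h' K k x] F G d e glued_sym[OF g] ne H H' X eq ptG by auto
      next
        case 3
        have "glued H h F (d \<circ> swp)" "glued H (h \<circ> swp) G (e \<circ> swp)"
          using glued_sym[OF H(4)] glued_sym[OF H'(4)] eq h' by simp_all
        then show ?thesis
          using glued_step[of H F G h "d \<circ> swp" "e \<circ> swp" K k x] F G d e H H' eq X 3 glued_origin[OF H(4)]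
          by auto
      qed
    qed simp
    moreover have "card {F, G, H} \<le> 3" by (simp add: card_insert_if)
    ultimately show False using val by simp
  qed
  ultimately have dist: "distinct [F, G, H, H']" using ne H H' by auto
  have "{F, G, H, H'} \<subseteq> faces_at T ?pt"
    using faces_at_origin[OF F d] faces_at_glued[OF G e g] faces_at_glued[OF H(1,3,4)]
      faces_at_glued[OF H'(1,3,4)] ptG by auto
  moreover have "card {F, G, H, H'} = 4" using dist by simp
  ultimately have "{F, G, H, H'} = faces_at T ?pt"
    using val by (metis card_subset_eq finite_faces_at)
  then show ?thesis using that[OF H(1) H'(1) H(3) H'(3) H(4) H'(4) dist] by simp
qed

lemma boundary_edge_at_vertex:
  assumes "pt \<in> vertices T" "\<rho> \<in> BE" "pt \<in> \<rho>"
  obtains F d where "F \<in> faces_at T pt" "F \<in> T" "d \<in> frames" "F (d (0,0)) = pt" "\<rho> = side F d"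
proof -
  obtain F e where F: "F \<in> T" "e \<in> frames" "\<rho> = side F e"
    using assms(2) by (auto simp: boundary_edges_def edges_def)
  obtain d where "d \<in> frames" "F (d (0,0)) = pt" "\<rho> = side F d"
    using edge_at_vertex[of \<rho> pt F] side_subset_carrier[of e F] assms F side_edges[of F e] by auto
  then show ?thesis using that F faces_at_origin by blast
qed

lemma opposite_boundary:
  assumes F: "F \<in> T" and G: "G \<in> T" and d: "d \<in> frames" and e: "e \<in> frames"
    and g: "glued F d G e" and ne: "F \<noteq> G" and val: "card (faces_at T (F (d (0,0)))) \<le> 2"
    and bd: "F (d (0,0)) \<in> BV"
  shows "faces_at T (F (d (0,0))) = {F, G}"
    "{\<rho> \<in> BE. F (d (0,0)) \<in> \<rho>} = {side F (d \<circ> swp), side G (e \<circ> swp)}"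
    "side F (d \<circ> swp) \<noteq> side G (e \<circ> swp)"
proof -
  let ?pt = "F (d (0,0))"
  have ptG: "G (e (0,0)) = ?pt" using glued_origin[OF g] by simp
  have pt: "?pt \<in> vertices T" using F d frame_origin_vertex by blast
  have "{F, G} \<subseteq> faces_at T ?pt"
    using faces_at_origin[OF F d] faces_at_glued[OF G e g] by auto
  then have "{F, G} = faces_at T ?pt"
    by (rule card_seteq[rotated]) (use val ne in auto)
  then show at: "faces_at T ?pt = {F, G}" by simp
  have int: "side F d \<notin> BE" "side G e \<notin> BE"
    using glued_incident(2)[OF F G d e g ne] glued_side[OF g] by (auto simp: interior_edges_def)
  have sub: "\<rho> \<in> {side F (d \<circ> swp), side G (e \<circ> swp)}" if \<rho>: "\<rho> \<in> BE" "?pt \<in> \<rho>" for \<rho>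
  proof -
    obtain X x where X: "X \<in> faces_at T ?pt" "x \<in> frames" "X (x (0,0)) = ?pt" "\<rho> = side X x"
      using boundary_edge_at_vertex[OF pt \<rho>] by metis
    have "X = F \<Longrightarrow> x = d \<or> x = d \<circ> swp" "X = G \<Longrightarrow> x = e \<or> x = e \<circ> swp"
      using origin_eq[OF F d X(2)] origin_eq[OF G e X(2)] X ptG by auto
    then show ?thesis using X at int \<rho> by auto
  qed
  obtain \<rho> where \<rho>: "\<rho> \<in> BE" "?pt \<in> \<rho>" using bd by (auto simp: boundary_vertices_def)
  have edgesFG: "side F (d \<circ> swp) \<in> edges T" "side G (e \<circ> swp) \<in> edges T"
    using F G d e side_edges by auto
  \<comment> \<open>If one outer edge were interior, the face behind it could only be the other one
    of the two. Then the outer edges coincide, and no edge at the vertex is left for the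
    boundary.\<close>
  have *: "side F (d \<circ> swp) = side G (e \<circ> swp) \<and> side F (d \<circ> swp) \<in> IE"
    if "side F (d \<circ> swp) \<notin> BE \<or> side G (e \<circ> swp) \<notin> BE"
    using that
  proof
    assume "side F (d \<circ> swp) \<notin> BE"
    then have "side F (d \<circ> swp) \<in> IE" using edgesFG by (simp add: interior_edges_def)
    then obtain H h where H: "H \<in> T" "H \<noteq> F" "h \<in> frames" "glued F (d \<circ> swp) H h"
      using interior_side_glued[of F "d \<circ> swp"] F d by auto
    then have "H = G" using faces_at_glued[OF H(1,3,4)] at by auto
    then have "h = e \<circ> swp" using opposite_interior_aux(2)[OF F G d e g ne H(3)] H by simp
    then show ?thesis using glued_side[OF H(4)] \<open>H = G\<close> \<open>side F (d \<circ> swp) \<in> IE\<close> by simp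
  next
    assume "side G (e \<circ> swp) \<notin> BE"
    then have i: "side G (e \<circ> swp) \<in> IE" using edgesFG by (simp add: interior_edges_def)
    then obtain H h where H: "H \<in> T" "H \<noteq> G" "h \<in> frames" "glued G (e \<circ> swp) H h"
      using interior_side_glued[of G "e \<circ> swp"] G e by auto
    then have "H = F" using faces_at_glued[OF H(1,3,4)] at ptG by auto
    then have "h = d \<circ> swp"
      using opposite_interior_aux(2)[OF G F e d glued_sym[OF g] ne[symmetric] H(3)] H by simp
    then show ?thesis using glued_side[OF H(4)] \<open>H = F\<close> i by simp
  qed
  have both: "side F (d \<circ> swp) \<in> BE" "side G (e \<circ> swp) \<in> BE"
    using * sub[OF \<rho>] \<rho>(1) unfolding interior_edges_def by (metis DiffD2 insertE singletonD)+
  have "?pt \<in> side F (d \<circ> swp)" "?pt \<in> side G (e \<circ> swp)"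
    using side_origin[of F "d \<circ> swp"] side_origin[of G "e \<circ> swp"] ptG by simp_all
  then show "{\<rho> \<in> BE. ?pt \<in> \<rho>} = {side F (d \<circ> swp), side G (e \<circ> swp)}"
    using sub both by blast
  show "side F (d \<circ> swp) \<noteq> side G (e \<circ> swp)"
    using both boundary_side_iff[OF F, of "d \<circ> swp"] boundary_side_iff[OF G, of "e \<circ> swp"] d e ne by auto
qed

lemma ordinary_cases:
  assumes "pt \<in> vertices T" "pt \<notin> EV"
  obtains "pt \<in> IV" "card (faces_at T pt) = 4"
  | "pt \<in> BV" "card (faces_at T pt) \<le> 2"
  using assms by (auto simp: extraordinary_def interior_vertices_def valence_def not_less)

end

section \<open>Refined meshes\<close>

abbreviation sub :: "'p face \<Rightarrow> frame \<Rightarrow> 'p face" where "sub F d \<equiv> F \<circ> quad (d (0,0))"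

text \<open>The half of the side at the local origin, introduced as a side of a subface so that it
  is visibly an edge of the refined mesh; \<open>half_eq\<close> gives it as a piece of the old
  side. The other half is \<open>half F (d \<circ> flip)\<close>.\<close>

definition half :: "'p face \<Rightarrow> frame \<Rightarrow> 'p set" where
  "half F d = side (sub F d) d"

text \<open>These segments, from the midpoint of a side to the centre of the face, are the other
  kind of edges of the refined mesh besides the halves; each face has four of them.\<close>

definition inner_edge :: "'p face \<Rightarrow> frame \<Rightarrow> 'p set" where
  "inner_edge F d = (\<lambda>t. F (d (1/2, t/2))) ` {0..1}"

lemma subface_frame: "d \<in> frames \<Longrightarrow> (F \<circ> quad (d q)) (d s) = F (d (quad q s))"
  by (simp add: quad_frame)

lemma half_eq: "d \<in> frames \<Longrightarrow> half F d = (\<lambda>t. F (d (t/2, 0))) ` {0..1}"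
  unfolding half_def side_def using subface_frame[of d F "(0,0)"] by (simp add: quad_simp)

lemma refineE:
  assumes "K \<in> refine T"
  obtains F q where "F \<in> T" "q \<in> corners" "K = F \<circ> quad q"
  using assms by (auto simp: refine_def)

lemma refineI [intro]: "F \<in> T \<Longrightarrow> q \<in> corners \<Longrightarrow> F \<circ> quad q \<in> refine T"
  unfolding refine_def by blast

lemma glued_half: "glued F d G e \<Longrightarrow> d \<in> frames \<Longrightarrow> e \<in> frames \<Longrightarrow> half F d = half G e"
  by (auto simp: half_eq glued_def intro!: image_cong)

lemma frame_corner_local:
  assumes "d \<in> frames" "q \<in> corners"
  obtains q0 where "q0 \<in> corners" "q = d q0"
  using assms by (metis frames_inverse frame_corners)

lemma corner_cases:
  assumes "q \<in> corners"
  obtains "q = (0,0)" | "q = (1,0)" | "q = (0,1)" | "q = (1,1)"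
  using assms by (auto simp: corners_def)

lemma quad_corner_iff: "q \<in> corners \<Longrightarrow> s \<in> sq \<Longrightarrow> quad q s \<in> corners \<longleftrightarrow> s = q"
  by (cases q; cases s) (auto simp: quad_simp corners_iff sq_iff)

lemma quad_self [simp]: "quad q q = q"
  by (cases q) (simp add: quad_simp)

text \<open>In the coordinates \<open>e\<close> the corner of the subface has four possible
  positions relative to the side: the two on the side give halves, the two opposite give inner
  edges.\<close>

lemma refined_side:
  assumes "e \<in> frames" "q \<in> corners"
  obtains d where "d \<in> frames" "side (F \<circ> quad q) e = half F d"
  | d where "d \<in> frames" "side (F \<circ> quad q) e = inner_edge F d"
proof -
  obtain q0 where q0: "q0 \<in> corners" "q = e q0" using frame_corner_local assms by metis
  have s: "side (F \<circ> quad q) e = (\<lambda>t. F (e (quad q0 (t,0)))) ` {0..1}"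
    unfolding side_def q0(2) by (simp add: quad_frame assms(1))
  have r: "(\<lambda>t::real. 1 - t) ` {0..1} = {0..1}" by auto
  from q0(1) show ?thesis
  proof (cases rule: corner_cases)
    case 1
    then have "side (F \<circ> quad q) e = half F e" unfolding s by (simp add: half_eq assms quad_simp)
    then show ?thesis using that(1) assms by blast
  next
    case 2
    have "half F (e \<circ> flip) = (\<lambda>t. F (e (1 - t/2, 0))) ` ((\<lambda>t. 1 - t) ` {0..1})"
      unfolding r by (simp add: half_eq assms)
    also have "\<dots> = side (F \<circ> quad q) e"
      unfolding s 2 image_image by (simp add: quad_simp field_simps)
    finally show ?thesis using that(1)[of "e \<circ> flip"] assms by simp
  next
    case 3
    then have "side (F \<circ> quad q) e = inner_edge F (e \<circ> swp)"
      unfolding s inner_edge_def by (simp add: quad_simp)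
    then show ?thesis using that(2)[of "e \<circ> swp"] assms by simp
  next
    case 4
    have "inner_edge F (e \<circ> flip \<circ> swp) = (\<lambda>t. F (e (1 - t/2, 1/2))) ` ((\<lambda>t. 1 - t) ` {0..1})"
      unfolding r by (simp add: inner_edge_def)
    also have "\<dots> = side (F \<circ> quad q) e"
      unfolding s 4 image_image by (simp add: quad_simp field_simps)
    finally show ?thesis using that(2)[of "e \<circ> flip \<circ> swp"] assms by simp
  qed
qed

lemma refine_edgesE:
  assumes "\<tau> \<in> edges (refine T)"
  obtains F d where "F \<in> T" "d \<in> frames" "\<tau> = half F d"
  | F d where "F \<in> T" "d \<in> frames" "\<tau> = inner_edge F d"
proof -
  obtain F q e where "F \<in> T" "q \<in> corners" "e \<in> frames" "\<tau> = side (F \<circ> quad q) e"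
    using assms by (auto simp: edges_def elim!: refineE)
  then show ?thesis using refined_side[of e q F] that by metis
qed

lemma half_refine_edge: "F \<in> T \<Longrightarrow> d \<in> frames \<Longrightarrow> half F d \<in> edges (refine T)"
  unfolding half_def edges_def using refineI[of F T "d (0,0)"] by auto

lemma inner_edge_side: "d \<in> frames \<Longrightarrow> inner_edge F d = side (sub F d) (d \<circ> flip \<circ> swp)"
proof -
  assume d: "d \<in> frames"
  have "(sub F d) ((d \<circ> flip \<circ> swp) (t,0)) = F (d (1/2, t/2))" for t
    using subface_frame[OF d, of F "(0,0)" "(1,t)"] by (simp add: quad_simp)
  then show ?thesis by (simp add: inner_edge_def side_def)
qed

lemma inner_edge_flip: "inner_edge F (d \<circ> flip) = inner_edge F d"
  by (auto simp: inner_edge_def intro!: image_cong)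

lemma inner_refine_edge: "F \<in> T \<Longrightarrow> d \<in> frames \<Longrightarrow> inner_edge F d \<in> edges (refine T)"
  unfolding inner_edge_side edges_def
  using refineI[of F T "d (0,0)"] frame_swp_frames[OF frame_flip_frames[of d]] frame_corners[of d "(0,0)"] origin_corner
  by blast

lemma refine_verticesE:
  assumes "pt \<in> vertices (refine T)"
  obtains "pt \<in> vertices T"
  | F d where "F \<in> T" "d \<in> frames" "pt = F (d (1/2,0))"
  | F where "F \<in> T" "pt = F (1/2,1/2)"
proof -
  obtain F q q' where F: "F \<in> T" "q \<in> corners" "q' \<in> corners" "pt = F (quad q q')"
    using assms by (auto simp: vertices_def elim!: refineE)
  obtain d where d: "d \<in> frames" "d (0,0) = q" using corner_frame F(2) by metis
  obtain q0 where q0: "q0 \<in> corners" "q' = d q0" using frame_corner_local[OF d(1) F(3)] by metis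
  have pt: "pt = F (d (quad (0,0) q0))" using F(4) d q0 quad_frame[OF d(1), of "(0,0)" q0] by simp
  from q0(1) show ?thesis
  proof (cases rule: corner_cases)
    case 1
    then have "pt = F (d (0,0))" using pt by (simp add: quad_simp)
    then show ?thesis using that(1) frame_origin_vertex[OF F(1) d(1)] by simp
  next
    case 2
    then show ?thesis using that(2)[of F d] pt F(1) d by (simp add: quad_simp)
  next
    case 3
    then show ?thesis using that(2)[of F "d \<circ> swp"] pt F(1) d by (simp add: quad_simp)
  next
    case 4
    have "d (1/2,1/2) = (1/2,1/2)" using d(1) by (elim frameE) simp
    then show ?thesis using that(3)[of F] pt F(1) 4 by (simp add: quad_simp)
  qed
qed

section \<open>Edges of the refined mesh and the faces around its vertices\<close>

context qmesh
begin

abbreviation (input) T' :: "'p mesh" where "T' \<equiv> refine T"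

text \<open>The centre of a subface is an interior point of the coarse face, hence in no other face,
  and its position reveals the quarter.\<close>

lemma subface_eq_iff:
  assumes "F \<in> T" "G \<in> T" "q \<in> corners" "q' \<in> corners"
  shows "F \<circ> quad q = G \<circ> quad q' \<longleftrightarrow> F = G \<and> q = q'"
proof
  assume "F \<circ> quad q = G \<circ> quad q'"
  from fun_cong[OF this, of "(1/2,1/2)"] have eq: "F (quad q (1/2,1/2)) = G (quad q' (1/2,1/2))" by simp
  obtain a b where q: "q = (a,b)" by (cases q)
  have "F = G \<and> quad q' (1/2,1/2) = ((a+1/2)/2, (b+1/2)/2)"
    by (rule meet_interior[OF assms(1,2)])
       (use eq assms q in \<open>auto simp: quad_simp corners_iff sq_iff\<close>)
  then have "F = G" "quad q' (1/2,1/2) = quad q (1/2,1/2)" by (simp_all add: q quad_simp)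
  then show "F = G \<and> q = q'" by (auto simp: quad_def)
qed simp

lemma side_point_glued:
  assumes F: "F \<in> T" and G: "G \<in> T" and d: "d \<in> frames" and e: "e \<in> frames"
    and r: "0 < r" "r < 1" and t: "0 \<le> t" "t \<le> 1" and eq: "F (d (r,0)) = G (e (t,0))"
  shows "side F d = side G e" "F \<noteq> G \<Longrightarrow> glued F d G e \<and> t = r \<or> glued F d G (e \<circ> flip) \<and> t = 1 - r"
proof -
  have s: "e (t,0) \<in> sq" using e t by (simp add: sq_iff)
  have *: "glued F d G e \<and> t = r \<or> glued F d G (e \<circ> flip) \<and> t = 1 - r" if ne: "F \<noteq> G"
  proof -
    obtain e' where e': "e' \<in> frames" "glued F d G e'" "e (t,0) = e' (r,0)"
      using meet_side[OF F G d r s eq ne] by metis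
    then show ?thesis using frame_side_point[OF e'(1) e e'(3)[symmetric] r] by auto
  qed
  then show "F \<noteq> G \<Longrightarrow> glued F d G e \<and> t = r \<or> glued F d G (e \<circ> flip) \<and> t = 1 - r" .
  show "side F d = side G e"
  proof (cases "F = G")
    case True
    then have "d (r,0) = e (t,0)" using face_eq[OF F, of "d (r,0)" "e (t,0)"] eq s d r
      by (simp add: sq_iff)
    then show ?thesis using frame_side_point[OF d e _ r] True side_flip by metis
  next
    case False
    then show ?thesis using * glued_side side_flip by metis
  qed
qed

text \<open>The gluing is tested at parameter 1/4, an inner point of the half: this avoids the
  vertex and the midpoint, which belong to further subfaces.\<close>

lemma incident_half:
  assumes F: "F \<in> T" and d: "d \<in> frames"
  shows "incident T' (half F d) = {G \<circ> quad (e (0,0)) | G e. G \<in> T \<and> e \<in> frames \<and> glued F d G e}"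
    (is "?L = ?R")
proof
  show "?R \<subseteq> ?L"
  proof clarify
    fix G e assume G: "G \<in> T" "e \<in> frames" "glued F d G e"
    have "half F d = half G e" using glued_half G d by blast
    then show "sub G e \<in> ?L"
      using side_subset_carrier[OF G(2), of "sub G e"] refineI[OF G(1), of "e (0,0)"] G
      by (simp add: incident_def half_def)
  qed
  show "?L \<subseteq> ?R"
  proof
    fix K assume "K \<in> ?L"
    then obtain G q where G: "G \<in> T" "q \<in> corners" "K = G \<circ> quad q" "half F d \<subseteq> carrier_of (G \<circ> quad q)"
      by (auto simp: incident_def elim!: refineE)
    have "F (d (1/4,0)) \<in> half F d" unfolding half_eq[OF d] by (rule image_eqI[of _ _ "1/2"]) auto
    then obtain t where t: "t \<in> sq" "F (d (1/4,0)) = G (quad q t)"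
      using G by (force simp: carrier_of_def)
    obtain e where e: "e \<in> frames" "glued F d G e" "quad q t = e (1/4,0)"
    proof (cases "F = G")
      case True
      then have "quad q t = d (1/4,0)"
        using face_eq[OF F, of "d (1/4,0)" "quad q t"] t G d by (simp add: sq_iff)
      then show ?thesis using that[of d] d True by simp
    next
      case False
      show ?thesis
        using meet_side[OF F G(1) d _ _ quad_square[OF G(2) t(1)] t(2) False] that by auto
    qed
    obtain q0 where q0: "q0 \<in> corners" "q = e q0" using frame_corner_local[OF e(1) G(2)] by metis
    obtain t0 where t0: "t = e t0" "t0 \<in> sq" using t e(1) by (metis frame_square frames_inverse)
    have "quad q0 t0 = (1/4,0)" using e q0 t0 by (simp add: quad_frame frame_inj)
    then have "q0 = (0,0)" using q0(1) t0(2) by (cases q0; cases t0) (auto simp: quad_simp corners_iff sq_iff)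
    then show "K \<in> ?R" using G q0 e by blast
  qed
qed

lemma incident_inner:
  assumes F: "F \<in> T" and d: "d \<in> frames"
  shows "incident T' (inner_edge F d) = {F \<circ> quad (d (0,0)), F \<circ> quad (d (1,0))}" (is "?L = ?R")
proof
  have c: "d (0,0) \<in> corners" "d (1,0) \<in> corners" using d by (auto simp: corners_iff)
  have 1: "inner_edge F d \<subseteq> carrier_of (sub F d)"
    unfolding inner_edge_side[OF d] by (rule side_subset_carrier) (simp add: d)
  have "inner_edge F d \<subseteq> carrier_of (F \<circ> quad ((d \<circ> flip) (0,0)))"
    unfolding inner_edge_side[OF frame_flip_frames[OF d]] inner_edge_flip[of F d, symmetric]
    by (rule side_subset_carrier) (simp add: d)
  then show "?R \<subseteq> ?L" using 1 refineI[OF F c(1)] refineI[OF F c(2)] by (simp add: incident_def)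
  show "?L \<subseteq> ?R"
  proof
    fix K assume "K \<in> ?L"
    then obtain G q where G: "G \<in> T" "q \<in> corners" "K = G \<circ> quad q" "inner_edge F d \<subseteq> carrier_of (G \<circ> quad q)"
      by (auto simp: incident_def elim!: refineE)
    have "F (d (1/2,1/4)) \<in> inner_edge F d" unfolding inner_edge_def by (rule image_eqI[of _ _ "1/2"]) auto
    then obtain t where t: "t \<in> sq" "F (d (1/2,1/4)) = G (quad q t)"
      using G by (force simp: carrier_of_def)
    obtain u v where uv: "d (1/2,1/4) = (u,v)" by (cases "d (1/2,1/4)")
    have "0 < u" "u < 1" "0 < v" "v < 1" using uv d by (auto elim!: frameE split: if_splits)
    then have FG: "F = G" "quad q t = d (1/2,1/4)"
      using meet_interior[OF F G(1), of u v "quad q t"] t G uv by auto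
    obtain q0 where q0: "q0 \<in> corners" "q = d q0" using frame_corner_local[OF d G(2)] by metis
    obtain t0 where t0: "t = d t0" "t0 \<in> sq" using t d by (metis frame_square frames_inverse)
    have "quad q0 t0 = (1/2,1/4)" using FG q0 t0 d by (simp add: quad_frame frame_inj)
    then have "q0 = (0,0) \<or> q0 = (1,0)" using q0(1) t0(2) by (cases q0; cases t0) (auto simp: quad_simp corners_iff sq_iff)
    then show "K \<in> ?R" using G q0 FG by blast
  qed
qed

lemma inner_edge_faces_ne:
  assumes "F \<in> T" "d \<in> frames" shows "sub F d \<noteq> F \<circ> quad (d (1,0))"
  using subface_eq_iff[OF assms(1,1), of "d (0,0)" "d (1,0)"] assms
  by (simp add: frame_inj corners_iff)

lemma glued_self:
  assumes "F \<in> T" "d \<in> frames" "e \<in> frames" "glued F d F e" shows "e = d"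
  using glued_same_frame[OF assms(1,1,2,2,3)] assms(4) by simp

lemma incident_half_cases:
  assumes F: "F \<in> T" and d: "d \<in> frames"
  shows "side F d \<in> BE \<Longrightarrow> incident T' (half F d) = {F \<circ> quad (d (0,0))}"
    "G \<in> T \<Longrightarrow> e \<in> frames \<Longrightarrow> glued F d G e \<Longrightarrow> G \<noteq> F \<Longrightarrow>
      incident T' (half F d) = {F \<circ> quad (d (0,0)), sub G e}"
proof -
  assume "side F d \<in> BE"
  then have "incident T (side F d) = {F}" using boundary_side_iff F d by blast
  then have 1: "G = F \<and> e = d" if "G \<in> T" "e \<in> frames" "glued F d G e" for G e
  proof -
    have "G \<in> incident T (side F d)" unfolding incident_side[OF F d] using that by blast
    then have "G = F" using \<open>incident T (side F d) = {F}\<close> by blast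
    then show ?thesis using glued_self[OF F d that(2)] that(3) by blast
  qed
  show "incident T' (half F d) = {F \<circ> quad (d (0,0))}"
    unfolding incident_half[OF F d] using F d glued_refl[of F d] by (auto dest: 1 simp del: glued_refl)
next
  assume G: "G \<in> T" "e \<in> frames" "glued F d G e" "G \<noteq> F"
  then have inc: "incident T (side F d) = {F, G}" using glued_incident(1)[OF F G(1) d G(2,3)] by blast
  have 1: "H = F \<and> h = d \<or> H = G \<and> h = e" if "H \<in> T" "h \<in> frames" "glued F d H h" for H h
  proof -
    have "H \<in> incident T (side F d)" unfolding incident_side[OF F d] using that by blast
    then have "H = F \<or> H = G" using inc by blast
    then show ?thesis
      using glued_self[OF F d that(2)] glued_same_frame[OF F G(1) d G(2) that(2) G(3)] that(3) by blast
  qed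
  show "incident T' (half F d) = {F \<circ> quad (d (0,0)), sub G e}"
    unfolding incident_half[OF F d] using F d G glued_refl[of F d] by (auto dest: 1 simp del: glued_refl)
qed

lemma side_cases:
  assumes "F \<in> T" "d \<in> frames"
  obtains "side F d \<in> BE"
  | G e where "G \<in> T" "e \<in> frames" "glued F d G e" "G \<noteq> F" "side F d \<in> IE"
  using interior_side_glued[OF assms] side_edges[OF assms] by (metis DiffI interior_edges_def)

lemma half_boundary_iff:
  assumes F: "F \<in> T" and d: "d \<in> frames"
  shows "half F d \<in> boundary_edges T' \<longleftrightarrow> side F d \<in> BE"
  using F d
proof (cases rule: side_cases)
  case 1
  then show ?thesis
    using incident_half_cases(1)[OF F d] half_refine_edge[OF F d] by (simp add: boundary_edges_incident)
next
  case (2 G e)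
  have "sub F d \<noteq> G \<circ> quad (e (0,0))"
    using subface_eq_iff[OF F 2(1), of "d (0,0)" "e (0,0)"] 2 d by simp
  then show ?thesis
    using incident_half_cases(2)[OF F d 2(1-4)] 2(5) by (simp add: boundary_edges_incident interior_edges_def)
qed

lemma inner_interior:
  assumes "F \<in> T" "d \<in> frames" shows "inner_edge F d \<in> interior_edges T'"
  using incident_inner[OF assms] inner_edge_faces_ne[OF assms] inner_refine_edge[OF assms]
  by (simp add: interior_edges_def boundary_edges_incident)

lemma boundary_edges_refineE:
  assumes "\<rho> \<in> boundary_edges T'"
  obtains F d where "F \<in> T" "d \<in> frames" "\<rho> = half F d" "side F d \<in> BE"
proof -
  have "\<rho> \<in> edges T'" using assms by (simp add: boundary_edges_def)
  then show ?thesis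
  proof (cases rule: refine_edgesE)
    case (1 F d)
    then show ?thesis using that assms half_boundary_iff by blast
  next
    case (2 F d)
    then show ?thesis using inner_interior assms by (auto simp: interior_edges_def)
  qed
qed

lemma faces_at_refine_old:
  assumes pt: "pt \<in> vertices T"
  shows "faces_at T' pt = {G \<circ> quad (e (0,0)) | G e. G \<in> T \<and> e \<in> frames \<and> G (e (0,0)) = pt}"
    (is "?L = ?R")
proof
  show "?R \<subseteq> ?L"
  proof clarify
    fix G e assume G: "G \<in> T" "e \<in> frames" "pt = G (e (0,0))"
    have "pt = (sub G e) (e (0,0))" using G by simp
    then have "G (e (0,0)) \<in> carrier_of (sub G e)"
      using G unfolding carrier_of_def by (metis image_eqI frame_corners origin_corner corners_square)
    then show "sub G e \<in> faces_at T' (G (e (0,0)))"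
      using refineI[OF G(1), of "e (0,0)"] G by (simp add: faces_at_def)
  qed
  show "?L \<subseteq> ?R"
  proof
    fix K assume "K \<in> ?L"
    then obtain G q s where G: "G \<in> T" "q \<in> corners" "K = G \<circ> quad q" "s \<in> sq" "pt = G (quad q s)"
      by (auto simp: faces_at_def carrier_of_def elim!: refineE)
    then have "quad q s \<in> corners" using vertex_corner[OF pt G(1)] by simp
    then have "s = q" using quad_corner_iff G by blast
    moreover obtain e where "e \<in> frames" "e (0,0) = q" using corner_frame G(2) by metis
    ultimately show "K \<in> ?R" using G by auto
  qed
qed

lemma faces_at_refine_mid:
  assumes F: "F \<in> T" and d: "d \<in> frames"
  shows "faces_at T' (F (d (1/2,0))) =
    {G \<circ> quad (e (0,0)) | G e. G \<in> T \<and> e \<in> frames \<and> (glued F d G e \<or> glued F (d \<circ> flip) G e)}"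
    (is "?L = ?R")
proof
  show "?R \<subseteq> ?L"
  proof clarify
    fix G e assume G: "G \<in> T" "e \<in> frames" and g: "glued F d G e \<or> glued F (d \<circ> flip) G e"
    have h: "1/2 \<in> {0..1::real}" by simp
    have "F (d (1/2,0)) = G (e (1/2,0))"
      using g bspec[OF _ h, of "\<lambda>r. F (d (r, 0)) = G (e (r, 0))"]
        bspec[OF _ h, of "\<lambda>r. F ((d \<circ> flip) (r, 0)) = G (e (r, 0))"] by (auto simp: glued_def)
    also have "\<dots> = (sub G e) (e (1,0))" by (simp add: quad_frame G quad_simp)
    finally have "F (d (1/2,0)) \<in> carrier_of (sub G e)"
      using G unfolding carrier_of_def by (metis image_eqI frame_square sq_iff zero_le_one order_refl)
    then show "sub G e \<in> faces_at T' (F (d (1/2,0)))"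
      using refineI[OF G(1), of "e (0,0)"] G by (simp add: faces_at_def)
  qed
  show "?L \<subseteq> ?R"
  proof
    fix K assume "K \<in> ?L"
    then obtain G q s where G: "G \<in> T" "q \<in> corners" "K = G \<circ> quad q" "s \<in> sq"
      "F (d (1/2,0)) = G (quad q s)"
      by (auto simp: faces_at_def carrier_of_def elim!: refineE)
    obtain e where e: "e \<in> frames" "glued F d G e" "quad q s = e (1/2,0)"
    proof (cases "F = G")
      case True
      then have "quad q s = d (1/2,0)"
        using face_eq[OF F, of "d (1/2,0)" "quad q s"] G d by (simp add: sq_iff)
      then show ?thesis using that[of d] d True by simp
    next
      case False
      show ?thesis
        using meet_side[OF F G(1) d _ _ quad_square[OF G(2,4)] G(5) False] that by auto
    qed
    obtain q0 where q0: "q0 \<in> corners" "q = e q0" using frame_corner_local[OF e(1) G(2)] by metis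
    obtain s0 where s0: "s = e s0" "s0 \<in> sq" using G e(1) by (metis frame_square frames_inverse)
    have "quad q0 s0 = (1/2,0)" using e q0 s0 by (simp add: quad_frame frame_inj)
    then have "q0 = (0,0) \<or> q0 = (1,0)" using q0(1) s0(2) by (cases q0; cases s0) (auto simp: quad_simp corners_iff sq_iff)
    then show "K \<in> ?R"
    proof
      assume "q0 = (0,0)" then show ?thesis using G q0 e by blast
    next
      assume "q0 = (1,0)"
      then have "q = (e \<circ> flip) (0,0)" using q0 by simp
      then show ?thesis using G e(1) glued_flip[OF e(2)] frame_flip_frames[OF e(1)] by blast
    qed
  qed
qed

lemma faces_at_refine_center:
  assumes F: "F \<in> T"
  shows "faces_at T' (F (1/2,1/2)) = {F \<circ> quad q | q. q \<in> corners}" (is "?L = ?R")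
proof
  show "?R \<subseteq> ?L"
  proof clarify
    fix a b :: real assume q: "(a,b) \<in> corners"
    have "F (1/2,1/2) = (F \<circ> quad (a,b)) (1-a,1-b)" by (simp add: quad_simp)
    moreover have "(1-a,1-b) \<in> sq" using q by (auto simp: corners_iff sq_iff)
    ultimately have "F (1/2,1/2) \<in> carrier_of (F \<circ> quad (a,b))"
      unfolding carrier_of_def by (metis image_eqI)
    then show "F \<circ> quad (a,b) \<in> faces_at T' (F (1/2,1/2))"
      using refineI[OF F q] by (simp add: faces_at_def)
  qed
  show "?L \<subseteq> ?R"
  proof
    fix K assume "K \<in> ?L"
    then obtain G q s where G: "G \<in> T" "q \<in> corners" "K = G \<circ> quad q" "s \<in> sq"
      "F (1/2,1/2) = G (quad q s)"
      by (auto simp: faces_at_def carrier_of_def elim!: refineE)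
    then have "F = G" using meet_interior[OF F G(1), of "1/2" "1/2" "quad q s"] by simp
    then show "K \<in> ?R" using G by blast
  qed
qed

lemma incident_mesh_edge:
  assumes "\<tau> \<in> edges T'" shows "card (incident T' \<tau>) \<le> 2"
  using assms
proof (cases rule: refine_edgesE)
  case (1 F d)
  from 1(1,2) show ?thesis
  proof (cases rule: side_cases)
    case 1
    then show ?thesis using incident_half_cases(1)[of F d] \<open>\<tau> = half F d\<close> \<open>F \<in> T\<close> \<open>d \<in> frames\<close> by simp
  next
    case (2 G e)
    then show ?thesis using incident_half_cases(2)[of F d G e] \<open>\<tau> = half F d\<close> \<open>F \<in> T\<close> \<open>d \<in> frames\<close>
      by (simp add: card_insert_if)
  qed
next
  case (2 F d)
  then show ?thesis using incident_inner[of F d] by (simp add: card_insert_if)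
qed

section \<open>The refinement of a mesh is a mesh\<close>

abbreviation link :: "'p \<Rightarrow> ('p face \<times> 'p face) set" where
  "link pt \<equiv> {(F, G). F \<in> faces_at T' pt \<and> G \<in> faces_at T' pt \<and>
     (\<exists>\<tau>\<in>interior_edges T'. pt \<in> \<tau> \<and> \<tau> \<subseteq> carrier_of F \<and> \<tau> \<subseteq> carrier_of G)}"

lemma link_half:
  assumes F: "F \<in> T" and d: "d \<in> frames" and G: "G \<in> T" "e \<in> frames" "glued F d G e" and pt: "pt \<in> half F d"
  shows "(F \<circ> quad (d (0,0)), sub G e) \<in> (link pt)\<^sup>*"
proof (cases "G = F")
  case True
  then show ?thesis using glued_self[OF F d G(2)] G(3) by simp
next
  case False
  then have inc: "incident T' (half F d) = {F \<circ> quad (d (0,0)), sub G e}"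
    using incident_half_cases(2)[OF F d G] by simp
  have "side F d \<in> IE" using glued_incident(2)[OF F G(1) d G(2,3)] False by blast
  then have "half F d \<in> interior_edges T'"
    using half_boundary_iff[OF F d] half_refine_edge[OF F d] by (simp add: interior_edges_def)
  moreover have "half F d \<subseteq> carrier_of (sub F d)" "half F d \<subseteq> carrier_of (sub G e)"
    "sub F d \<in> T'" "sub G e \<in> T'"
    using inc unfolding incident_def by blast+
  ultimately have "(F \<circ> quad (d (0,0)), sub G e) \<in> link pt"
    using pt by (auto simp: faces_at_def)
  then show ?thesis by blast
qed

lemma link_inner:
  assumes F: "F \<in> T" and d: "d \<in> frames" and pt: "pt \<in> inner_edge F d"
  shows "(F \<circ> quad (d (0,0)), F \<circ> quad (d (1,0))) \<in> link pt"
proof -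
  have "inner_edge F d \<subseteq> carrier_of (sub F d)" "inner_edge F d \<subseteq> carrier_of (F \<circ> quad (d (1,0)))"
    "sub F d \<in> T'" "F \<circ> quad (d (1,0)) \<in> T'"
    using incident_inner[OF F d] unfolding incident_def by blast+
  then show ?thesis using inner_interior[OF F d] pt by (auto simp: faces_at_def)
qed

lemma link_sym: "(F, G) \<in> (link pt)\<^sup>* \<Longrightarrow> (G, F) \<in> (link pt)\<^sup>*"
proof -
  have "sym ((link pt)\<^sup>*)" by (rule sym_rtrancl) (auto simp: sym_def)
  then show "(F, G) \<in> (link pt)\<^sup>* \<Longrightarrow> (G, F) \<in> (link pt)\<^sup>*" by (auto dest: symD)
qed

lemma origin_half: "d \<in> frames \<Longrightarrow> F (d (0,0)) \<in> half F d"
  unfolding half_eq by (rule image_eqI[of _ _ 0]) auto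

lemma mid_half: "d \<in> frames \<Longrightarrow> F (d (1/2,0)) \<in> half F d"
  unfolding half_eq by (rule image_eqI[of _ _ 1]) auto

lemma mid_inner: "F (d (1/2,0)) \<in> inner_edge F d"
  unfolding inner_edge_def by (rule image_eqI[of _ _ 0]) auto

lemma center_frame: "d \<in> frames \<Longrightarrow> d (1/2,1/2) = (1/2,1/2)"
  by (elim frameE) simp

lemma center_inner: "d \<in> frames \<Longrightarrow> F (1/2,1/2) \<in> inner_edge F d"
  unfolding inner_edge_def by (rule image_eqI[of _ _ 1]) (auto simp: center_frame)

text \<open>A walk around \<open>pt\<close> in the coarse mesh is followed by the subfaces at
  \<open>pt\<close>: neighbours share the half edge at \<open>pt\<close>, which is again an interior
  edge.\<close>

lemma link_old:
  assumes pt: "pt \<in> vertices T" and K: "F \<in> T" "d \<in> frames" "F (d (0,0)) = pt"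
    and L: "G \<in> T" "e \<in> frames" "G (e (0,0)) = pt"
  shows "(F \<circ> quad (d (0,0)), sub G e) \<in> (link pt)\<^sup>*"
proof -
  define C where "C = {G \<in> faces_at T pt. \<forall>e\<in>frames. G (e (0,0)) = pt \<longrightarrow>
     (F \<circ> quad (d (0,0)), sub G e) \<in> (link pt)\<^sup>*}"
  have "F \<in> C"
  proof -
    have "(F \<circ> quad (d (0,0)), sub F e) \<in> (link pt)\<^sup>*" if "e \<in> frames" "F (e (0,0)) = pt" for e
    proof -
      have "e (0,0) = d (0,0)" using face_eq[OF K(1), of "e (0,0)" "d (0,0)"] that K by simp
      then show ?thesis by (simp only: rtrancl.rtrancl_refl)
    qed
    moreover have "F \<in> faces_at T pt" using faces_at_origin[OF K(1,2)] K(3) by simp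
    ultimately show ?thesis unfolding C_def by blast
  qed
  have "C = faces_at T pt"
  proof (rule star_closed[OF pt])
    show "C \<subseteq> faces_at T pt" "C \<noteq> {}" using \<open>F \<in> C\<close> by (auto simp: C_def)
    fix X x H h assume X: "X \<in> C" "x \<in> frames" "X (x (0,0)) = pt" "H \<in> T" "h \<in> frames" "glued X x H h"
    have XT: "X \<in> T" using X by (auto simp: C_def faces_at_def)
    have Hpt: "H (h (0,0)) = pt" using glued_origin[OF X(6)] X(3) by simp
    have 1: "(F \<circ> quad (d (0,0)), sub X x) \<in> (link pt)\<^sup>*" using X by (auto simp: C_def)
    have 2: "(X \<circ> quad (x (0,0)), sub H h) \<in> (link pt)\<^sup>*"
      using link_half[OF XT X(2,4,5,6), of pt] origin_half[OF X(2), of X] X(3) by simp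
    have "(F \<circ> quad (d (0,0)), sub H e') \<in> (link pt)\<^sup>*" if "e' \<in> frames" "H (e' (0,0)) = pt" for e'
    proof -
      have "e' (0,0) = h (0,0)" using face_eq[OF X(4), of "e' (0,0)" "h (0,0)"] that Hpt X by simp
      then show ?thesis using rtrancl_trans[OF 1 2] by simp
    qed
    moreover have "H \<in> faces_at T pt" using faces_at_origin[OF X(4,5)] Hpt by simp
    ultimately show "H \<in> C" unfolding C_def by blast
  qed
  moreover have "G \<in> faces_at T pt" using faces_at_origin[OF L(1,2)] L(3) by simp
  ultimately show ?thesis using L(2,3) unfolding C_def by blast
qed

lemma link_mid:
  assumes F: "F \<in> T" and d: "d \<in> frames" and K: "K \<in> faces_at T' (F (d (1/2,0)))"
  shows "(F \<circ> quad (d (0,0)), K) \<in> (link (F (d (1/2,0))))\<^sup>*"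
proof -
  let ?pt = "F (d (1/2,0))"
  obtain G e where G: "G \<in> T" "e \<in> frames" "K = sub G e" "glued F d G e \<or> glued F (d \<circ> flip) G e"
    using K unfolding faces_at_refine_mid[OF F d] by blast
  from G(4) show ?thesis
  proof
    assume "glued F d G e"
    then show ?thesis using link_half[OF F d G(1,2)] mid_half[OF d] G(3) by blast
  next
    assume g: "glued F (d \<circ> flip) G e"
    have "(F \<circ> quad (d (1,0)), K) \<in> (link ?pt)\<^sup>*"
      using link_half[OF F frame_flip_frames[OF d] G(1,2) g, of ?pt] mid_half[OF frame_flip_frames[OF d], of F] G(3)
      by simp
    moreover have "(F \<circ> quad (d (0,0)), F \<circ> quad (d (1,0))) \<in> link ?pt"
      using link_inner[OF F d mid_inner] .
    ultimately show ?thesis by (metis (no_types, lifting) converse_rtrancl_into_rtrancl)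
  qed
qed

lemma link_center:
  assumes F: "F \<in> T" and q: "q \<in> corners"
  shows "(F \<circ> quad (0,0), F \<circ> quad q) \<in> (link (F (1/2,1/2)))\<^sup>*"
proof -
  have 1: "(F \<circ> quad (d (0,0)), F \<circ> quad (d (1,0))) \<in> link (F (1/2,1/2))" if "d \<in> frames" for d
    using link_inner[OF F that center_inner[OF that]] .
  have a: "(F \<circ> quad (0,0), F \<circ> quad (1,0)) \<in> link (F (1/2,1/2))" using 1[of "fr False False False"] by simp
  have b: "(F \<circ> quad (0,0), F \<circ> quad (0,1)) \<in> link (F (1/2,1/2))" using 1[of "fr False False True"] by simp
  have c: "(F \<circ> quad (1,0), F \<circ> quad (1,1)) \<in> link (F (1/2,1/2))" using 1[of "fr True False True"] by simp
  show ?thesis using q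
  proof (cases rule: corner_cases)
    case 1 then show ?thesis by simp
  next
    case 2 then show ?thesis using a by blast
  next
    case 3 then show ?thesis using b by blast
  next
    case 4 then show ?thesis using r_into_rtrancl[OF a] c by (metis (no_types, lifting) rtrancl.rtrancl_into_rtrancl)
  qed
qed

lemma link_all:
  assumes pt: "pt \<in> vertices T'" and F: "F \<in> faces_at T' pt" and G: "G \<in> faces_at T' pt"
  shows "(F, G) \<in> (link pt)\<^sup>*"
  using pt
proof (cases rule: refine_verticesE)
  case 1
  show ?thesis using F G link_old[OF 1] unfolding faces_at_refine_old[OF 1] by auto
next
  case (2 H d)
  have "(H \<circ> quad (d (0,0)), F) \<in> (link pt)\<^sup>*" "(H \<circ> quad (d (0,0)), G) \<in> (link pt)\<^sup>*"
    using link_mid[OF 2(1,2)] F G 2(3) by simp_all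
  then show ?thesis using link_sym rtrancl_trans by fast
next
  case (3 H)
  have "(H \<circ> quad (0,0), F) \<in> (link pt)\<^sup>*" "(H \<circ> quad (0,0), G) \<in> (link pt)\<^sup>*"
    using link_center[OF 3(1)] F G unfolding 3(2) faces_at_refine_center[OF 3(1)] by auto
  then show ?thesis using link_sym rtrancl_trans by fast
qed

text \<open>Adjacent quarters of a square share an entire side of both, and diagonal quarters share
  only the centre, a corner of both. This supplies the meeting condition for subfaces of one
  face.\<close>

lemma frame_axis_cases:
  assumes q: "q \<in> corners" "q' \<in> corners" "q \<noteq> q'" and s: "s \<in> sq" "t \<in> sq"
    and eq: "quad q s = quad q' t" and nc: "\<not> (s \<in> corners \<and> t \<in> corners)"
  shows "\<exists>d\<in>frames. \<exists>e\<in>frames. (\<forall>r\<in>{0..1}. quad q (d (r,0)) = quad q' (e (r,0))) \<and>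
           (\<exists>r\<in>{0..1}. s = d (r, 0) \<and> t = e (r, 0))"
proof -
  obtain a b where ab: "q = (a,b)" by (cases q)
  obtain a' b' where ab': "q' = (a',b')" by (cases q')
  obtain u v where uv: "s = (u,v)" by (cases s)
  obtain u' v' where uv': "t = (u',v')" by (cases t)
  have e: "a + u = a' + u'" "b + v = b' + v'" using eq by (auto simp: ab ab' uv uv' quad_simp)
  have c: "(a = 0 \<or> a = 1)" "(b = 0 \<or> b = 1)" "(a' = 0 \<or> a' = 1)" "(b' = 0 \<or> b' = 1)"
    "0 \<le> u" "u \<le> 1" "0 \<le> v" "v \<le> 1" "0 \<le> u'" "u' \<le> 1" "0 \<le> v'" "v' \<le> 1"
    using q s by (auto simp: ab ab' uv uv' corners_iff sq_iff)
  consider "a \<noteq> a'" "b = b'" | "a = a'" "b \<noteq> b'" | "a \<noteq> a'" "b \<noteq> b'" using q(3) ab ab' by auto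
  then show ?thesis
  proof cases
    case 1
    have "u = a'" "u' = a" "v = v'" using 1 e c by auto
    then have "s = fr (a' = 1) False True (v,0)" "t = fr (a = 1) False True (v,0)"
      "\<forall>r\<in>{0..1}. quad q (fr (a' = 1) False True (r,0)) = quad q' (fr (a = 1) False True (r,0))"
      using 1 c by (auto simp: uv uv' ab ab' quad_simp)
    then show ?thesis
      using c(7,8) fr_frames[of "a' = 1" False True] fr_frames[of "a = 1" False True]
      by (metis atLeastAtMost_iff)
  next
    case 2
    have "v = b'" "v' = b" "u = u'" using 2 e c by auto
    then have "s = fr False (b' = 1) False (u,0)" "t = fr False (b = 1) False (u,0)"
      "\<forall>r\<in>{0..1}. quad q (fr False (b' = 1) False (r,0)) = quad q' (fr False (b = 1) False (r,0))"
      using 2 c by (auto simp: uv uv' ab ab' quad_simp)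
    then show ?thesis
      using c(5,6) fr_frames[of False "b' = 1" False] fr_frames[of False "b = 1" False]
      by (metis atLeastAtMost_iff)
  next
    case 3
    have "u = a'" "u' = a" "v = b'" "v' = b" using 3 e c by auto
    then have "s \<in> corners" "t \<in> corners" using c by (auto simp: uv uv' corners_iff)
    then show ?thesis using nc by blast
  qed
qed

lemma meet_refined:
  assumes F: "F \<in> T" and G: "G \<in> T" and q: "q \<in> corners" and q': "q' \<in> corners"
    and s: "s \<in> sq" and t: "t \<in> sq" and ne: "F \<circ> quad q \<noteq> G \<circ> quad q'"
    and eq: "F (quad q s) = G (quad q' t)" and nc: "\<not> (s \<in> corners \<and> t \<in> corners)"
  shows "\<exists>d\<in>frames. \<exists>e\<in>frames. (\<forall>r\<in>{0..1}. (F \<circ> quad q) (d (r,0)) = (G \<circ> quad q') (e (r,0))) \<and>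
           (\<exists>r\<in>{0..1}. s = d (r, 0) \<and> t = e (r, 0))"
proof (cases "F = G")
  case True
  then have "q \<noteq> q'" "quad q s = quad q' t"
    using ne face_eq[OF F quad_square[OF q s], of "quad q' t"] eq q' t by auto
  from frame_axis_cases[OF q q' this(1) s t this(2) nc] show ?thesis
    using True by (metis comp_apply)
next
  case False
  have "\<not> (quad q s \<in> corners \<and> quad q' t \<in> corners)"
    using nc quad_corner_iff[OF q s] quad_corner_iff[OF q' t] q q' by auto
  then obtain d e r where *: "d \<in> frames" "e \<in> frames" "glued F d G e" "0 \<le> r" "r \<le> 1"
    "quad q s = d (r,0)" "quad q' t = e (r,0)"
    using meet[OF F G quad_square[OF q s] quad_square[OF q' t] eq False] by metis
  obtain q0 where q0: "q0 \<in> corners" "q = d q0" using frame_corner_local[OF *(1) q] by metis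
  obtain q1 where q1: "q1 \<in> corners" "q' = e q1" using frame_corner_local[OF *(2) q'] by metis
  obtain s0 where s0: "s = d s0" "s0 \<in> sq" using s *(1) by (metis frame_square frames_inverse)
  obtain t0 where t0: "t = e t0" "t0 \<in> sq" using t *(2) by (metis frame_square frames_inverse)
  have 1: "quad q0 s0 = (r,0)" "quad q1 t0 = (r,0)"
    using * q0 q1 s0 t0 by (simp_all add: quad_frame frame_inj)
  obtain a b where a: "q0 = (a,b)" by (cases q0)
  obtain a' b' where a': "q1 = (a',b')" by (cases q1)
  have b: "b = 0" "b' = 0" "s0 = (2*r - a, 0)" "t0 = (2*r - a', 0)"
    using 1 q0(1) q1(1) s0(2) t0(2) by (cases s0; cases t0; auto simp: a a' quad_simp corners_iff sq_iff)+
  show ?thesis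
  proof (cases "a = a'")
    case True
    have "(F \<circ> quad q) (d (r',0)) = (G \<circ> quad q') (e (r',0))" if "r' \<in> {0..1}" for r'
    proof -
      have "(a + r')/2 \<in> {0..1}" using that q0(1) by (auto simp: a corners_iff)
      then have "F (d ((a+r')/2, 0)) = G (e ((a+r')/2, 0))" using *(3) by (simp add: glued_def)
      then show ?thesis using *(1,2) q0(2) q1(2) a a' b True by (simp add: quad_frame quad_simp)
    qed
    moreover have "2*r - a \<in> {0..1}" using s0 b by (auto simp: sq_iff)
    ultimately show ?thesis using * s0(1) t0(1) b True by metis
  next
    case False
    \<comment> \<open>The subfaces lie at different ends of the common side and so share only its
      midpoint there, which is a corner of both.\<close>
    have "(0 \<le> 2*r - a \<and> 2*r - a \<le> 1) \<and> (0 \<le> 2*r - a' \<and> 2*r - a' \<le> 1) \<and> (a = 0 \<or> a = 1) \<and> (a' = 0 \<or> a' = 1)"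
      using s0 t0 b q0 q1 by (auto simp: sq_iff a a' corners_iff)
    then have "s0 \<in> corners" "t0 \<in> corners" using False b by (auto simp: corners_iff)
    then show ?thesis using nc s0 t0 * by simp
  qed
qed

theorem refine_mesh: "quad_mesh T'"
proof -
  have 1: "finite T'"
  proof -
    have "T' = (\<lambda>(F,q). F \<circ> quad q) ` (T \<times> corners)" unfolding refine_def by auto
    then show ?thesis by (simp add: corners_def)
  qed
  have 2: "inj_on K sq" if "K \<in> T'" for K
    using that
  proof (cases rule: refineE)
    case (1 F q)
    then show ?thesis using face_eq[OF 1(1)] by (auto simp: inj_on_def)
  qed
  have 3: "(s \<in> corners \<and> t \<in> corners) \<or>
        (\<exists>d\<in>frames. \<exists>e\<in>frames. (\<forall>r\<in>{0..1}. K (d (r, 0)) = L (e (r, 0))) \<and>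
           (\<exists>r\<in>{0..1}. s = d (r, 0) \<and> t = e (r, 0)))"
    if KL: "K \<in> T'" "L \<in> T'" and st: "s \<in> sq" "t \<in> sq"
      and ne: "K \<noteq> L" and eq: "K s = L t" for K L s t
  proof (rule disjCI, goal_cases)
    case 1
    obtain F q where F: "F \<in> T" "q \<in> corners" "K = F \<circ> quad q" using KL(1) by (rule refineE)
    obtain G q' where G: "G \<in> T" "q' \<in> corners" "L = G \<circ> quad q'" using KL(2) by (rule refineE)
    show ?case
    proof (rule ccontr)
      assume nc: "\<not> (s \<in> corners \<and> t \<in> corners)"
      have "F (quad q s) = G (quad q' t)" using eq F G by simp
      from meet_refined[OF F(1) G(1) F(2) G(2) st ne[unfolded F(3) G(3)] this nc] show False
        using 1 unfolding F(3) G(3) by blast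
    qed
  qed
  have 4: "card {F \<in> T'. \<tau> \<subseteq> carrier_of F} \<le> 2" if "\<tau> \<in> edges T'" for \<tau>
    using incident_mesh_edge[OF that] by (simp add: incident_def)
  show ?thesis
    unfolding quad_mesh_def
    by (intro conjI ballI impI) (erule (1) 2 3[rule_format] 4 link_all | rule 1 2 3 4 link_all | assumption)+
qed

end

section \<open>Boundary, extraordinary and corner vertices of the refined mesh\<close>

context qmesh
begin

lemma refined: "qmesh T'"
  by unfold_locales (rule refine_mesh)

lemma vertices_refine: "vertices T \<subseteq> vertices T'"
proof
  fix pt assume "pt \<in> vertices T"
  then obtain F q where F: "F \<in> T" "q \<in> corners" "pt = F q" by (auto simp: vertices_def)
  then have "pt = (F \<circ> quad q) q" by simp
  then show "pt \<in> vertices T'" using F refineI unfolding vertices_def by blast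
qed

lemma refined_face_vertex:
  assumes "F \<in> T" "q \<in> corners" "s \<in> sq" "(F \<circ> quad q) s \<in> vertices T"
  shows "s = q"
  using vertex_corner[OF assms(4,1), of "quad q s"] assms quad_corner_iff[of q s] by simp

lemma mid_not_vertex: "F \<in> T \<Longrightarrow> d \<in> frames \<Longrightarrow> F (d (1/2,0)) \<notin> vertices T"
  using vertex_corner[of "F (d (1/2,0))" F "d (1/2,0)"] by (auto simp: sq_iff corners_iff)

lemma boundary_at_old:
  assumes pt: "pt \<in> vertices T"
  shows "{\<rho> \<in> boundary_edges T'. pt \<in> \<rho>} =
    {half F d | F d. F \<in> T \<and> d \<in> frames \<and> F (d (0,0)) = pt \<and> side F d \<in> BE}" (is "?L = ?R")
proof
  show "?R \<subseteq> ?L" using origin_half half_boundary_iff by auto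
  show "?L \<subseteq> ?R"
  proof clarify
    fix \<rho> assume \<rho>: "\<rho> \<in> boundary_edges T'" "pt \<in> \<rho>"
    obtain F d where F: "F \<in> T" "d \<in> frames" "\<rho> = half F d" "side F d \<in> BE"
      using boundary_edges_refineE[OF \<rho>(1)] by blast
    obtain t where t: "0 \<le> t" "t \<le> 1" "pt = F (d (t/2,0))" using \<rho> F by (auto simp: half_eq)
    have "d (t/2,0) \<in> corners" using vertex_corner[OF pt F(1), of "d (t/2,0)"] t F by (simp add: sq_iff)
    then have "t = 0" using t F by (auto simp: corners_iff)
    then show "\<exists>F d. \<rho> = half F d \<and> F \<in> T \<and> d \<in> frames \<and> F (d (0,0)) = pt \<and> side F d \<in> BE"
      using F t by auto
  qed
qed

lemma boundary_at:
  assumes pt: "pt \<in> vertices T"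
  shows "{\<rho> \<in> BE. pt \<in> \<rho>} =
    {side F d | F d. F \<in> T \<and> d \<in> frames \<and> F (d (0,0)) = pt \<and> side F d \<in> BE}"
proof (rule set_eqI)
  fix \<rho>
  have "\<exists>F d. \<rho> = side F d \<and> F \<in> T \<and> d \<in> frames \<and> F (d (0,0)) = pt \<and> side F d \<in> BE"
    if "\<rho> \<in> BE" "pt \<in> \<rho>"
    using boundary_edge_at_vertex[OF pt that] that by metis
  moreover have "pt \<in> side F d" if "F (d (0,0)) = pt" for F :: "'p face" and d
    using side_origin[of F d] that by simp
  ultimately show "\<rho> \<in> {\<rho> \<in> BE. pt \<in> \<rho>} \<longleftrightarrow>
    \<rho> \<in> {side F d | F d. F \<in> T \<and> d \<in> frames \<and> F (d (0,0)) = pt \<and> side F d \<in> BE}"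
    by auto
qed

lemma boundary_vertex_old:
  assumes pt: "pt \<in> vertices T"
  shows "pt \<in> boundary_vertices T' \<longleftrightarrow> pt \<in> BV"
proof -
  have "pt \<in> boundary_vertices T' \<longleftrightarrow> {\<rho> \<in> boundary_edges T'. pt \<in> \<rho>} \<noteq> {}"
    using vertices_refine pt by (auto simp: boundary_vertices_def)
  also have "\<dots> \<longleftrightarrow> {\<rho> \<in> BE. pt \<in> \<rho>} \<noteq> {}"
    unfolding boundary_at_old[OF pt] boundary_at[OF pt] by blast
  finally show ?thesis using pt by (auto simp: boundary_vertices_def)
qed

lemma interior_vertex_old:
  "pt \<in> vertices T \<Longrightarrow> pt \<in> interior_vertices T' \<longleftrightarrow> pt \<in> IV"
  using boundary_vertex_old vertices_refine by (auto simp: interior_vertices_def)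

text \<open>An old vertex is a single corner of each face at it, so each such face contributes
  exactly one subface. Serves to reindex sums over the star.\<close>

lemma sub_bij:
  assumes pt: "pt \<in> vertices T"
  obtains h where "bij_betw h (faces_at T pt) (faces_at T' pt)"
    "\<And>F d. F \<in> T \<Longrightarrow> d \<in> frames \<Longrightarrow> F (d (0,0)) = pt \<Longrightarrow> h F = sub F d"
proof -
  define h where "h F = F \<circ> quad (SOME q. q \<in> corners \<and> F q = pt)" for F :: "'p face"
  have h: "h F = sub F d" if F: "F \<in> T" "d \<in> frames" "F (d (0,0)) = pt" for F d
  proof -
    have "(SOME q. q \<in> corners \<and> F q = pt) = d (0,0)"
    proof (rule some_equality)
      show "q = d (0,0)" if "q \<in> corners \<and> F q = pt" for q
        using that F face_eq[OF F(1), of q "d (0,0)"] by simp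
    qed (use F in simp)
    then show ?thesis by (simp add: h_def)
  qed
  have "inj_on h (faces_at T pt)"
  proof (rule inj_onI)
    fix F G assume FG: "F \<in> faces_at T pt" "G \<in> faces_at T pt" "h F = h G"
    obtain d where d: "d \<in> frames" "F (d (0,0)) = pt" using vertex_frame[OF pt FG(1)] .
    obtain e where e: "e \<in> frames" "G (e (0,0)) = pt" using vertex_frame[OF pt FG(2)] .
    have "F \<in> T" "G \<in> T" using FG by (auto simp: faces_at_def)
    then show "F = G" using h[of F d] h[of G e] d e FG(3) subface_eq_iff[of F G "d (0,0)" "e (0,0)"] by simp
  qed
  moreover have "h ` faces_at T pt = faces_at T' pt"
  proof
    show "h ` faces_at T pt \<subseteq> faces_at T' pt"
    proof clarify
      fix F assume F: "F \<in> faces_at T pt"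
      obtain d where d: "d \<in> frames" "F (d (0,0)) = pt" using vertex_frame[OF pt F] .
      then show "h F \<in> faces_at T' pt"
        unfolding faces_at_refine_old[OF pt] using h F by (auto simp: faces_at_def)
    qed
    show "faces_at T' pt \<subseteq> h ` faces_at T pt"
      unfolding faces_at_refine_old[OF pt]
    proof clarify
      fix G e assume G: "G \<in> T" "e \<in> frames" "pt = G (e (0,0))"
      then show "sub G e \<in> h ` faces_at T (G (e (0,0)))"
        using h[of G e] faces_at_origin[of G e] by (metis image_eqI)
    qed
  qed
  ultimately show ?thesis using that h by (simp add: bij_betw_def)
qed

lemma valence_old: "pt \<in> vertices T \<Longrightarrow> card (faces_at T' pt) = card (faces_at T pt)"
  by (metis sub_bij bij_betw_same_card)

lemma mid_vertex: "F \<in> T \<Longrightarrow> d \<in> frames \<Longrightarrow> F (d (1/2,0)) \<in> vertices T'"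
proof -
  assume F: "F \<in> T" and d: "d \<in> frames"
  have "F (d (1/2,0)) = (sub F d) (d (1,0))" by (simp add: quad_frame d quad_simp)
  moreover have "sub F d \<in> T'" "d (1,0) \<in> corners"
    using refineI[OF F, of "d (0,0)"] d by (simp_all add: corners_iff)
  ultimately show ?thesis unfolding vertices_def by blast
qed

lemma faces_at_mid_incident:
  assumes F: "F \<in> T" and d: "d \<in> frames"
  shows "faces_at T' (F (d (1/2,0))) =
    incident T' (half F d) \<union> incident T' (half F (d \<circ> flip))"
  unfolding faces_at_refine_mid[OF F d] incident_half[OF F d] incident_half[OF F frame_flip_frames[OF d]]
  by (simp only: conj_disj_distribL ex_disj_distrib Collect_disj_eq)

lemma mid_boundary:
  assumes F: "F \<in> T" and d: "d \<in> frames" and b: "side F d \<in> BE"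
  shows "F (d (1/2,0)) \<in> boundary_vertices T'"
    "faces_at T' (F (d (1/2,0))) = {F \<circ> quad (d (0,0)), F \<circ> quad (d (1,0))}"
proof -
  have fb: "side F (d \<circ> flip) \<in> BE" using b by (simp add: side_flip)
  have "incident T' (half F d) = {F \<circ> quad (d (0,0))}"
    "incident T' (half F (d \<circ> flip)) = {F \<circ> quad (d (1,0))}"
    using incident_half_cases(1)[OF F d b] incident_half_cases(1)[OF F frame_flip_frames[OF d] fb] by simp_all
  then show at: "faces_at T' (F (d (1/2,0))) = {F \<circ> quad (d (0,0)), F \<circ> quad (d (1,0))}"
    unfolding faces_at_mid_incident[OF F d] by (simp add: insert_commute)
  show "F (d (1/2,0)) \<in> boundary_vertices T'"
    using half_boundary_iff[OF F d] b mid_half[OF d, of F] mid_vertex[OF F d]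
    unfolding boundary_vertices_def by blast
qed

lemma mid_interior:
  assumes F: "F \<in> T" and d: "d \<in> frames" and G: "G \<in> T" "e \<in> frames" "glued F d G e" "G \<noteq> F"
  shows "F (d (1/2,0)) \<in> interior_vertices T'"
    "card (faces_at T' (F (d (1/2,0)))) = 4"
proof -
  have "incident T' (half F d) = {F \<circ> quad (d (0,0)), sub G e}"
    "incident T' (half F (d \<circ> flip)) = {F \<circ> quad (d (1,0)), G \<circ> quad (e (1,0))}"
    using incident_half_cases(2)[OF F d G]
      incident_half_cases(2)[OF F frame_flip_frames[OF d] G(1) frame_flip_frames[OF G(2)] glued_flip[OF G(3)] G(4)]
    by simp_all
  then have "faces_at T' (F (d (1/2,0))) =
      {F \<circ> quad (d (0,0)), sub G e} \<union> {F \<circ> quad (d (1,0)), G \<circ> quad (e (1,0))}"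
    unfolding faces_at_mid_incident[OF F d] by simp
  moreover have "card ({F \<circ> quad (d (0,0)), sub G e} \<union> {F \<circ> quad (d (1,0)), G \<circ> quad (e (1,0))}) = 4"
    using F G d subface_eq_iff[of F F "d (0,0)" "d (1,0)"] subface_eq_iff[of G G "e (0,0)" "e (1,0)"]
      subface_eq_iff[of F G "d (0,0)" "e (0,0)"] subface_eq_iff[of F G "d (1,0)" "e (0,0)"]
      subface_eq_iff[of F G "d (0,0)" "e (1,0)"] subface_eq_iff[of F G "d (1,0)" "e (1,0)"]
    by (auto simp: corners_iff frame_inj card_insert_if)
  ultimately show "card (faces_at T' (F (d (1/2,0)))) = 4" by simp
  have int: "side F d \<in> IE" using glued_incident(2)[OF F G(1) d G(2,3)] G(4) by blast
  have "F (d (1/2,0)) \<notin> boundary_vertices T'"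
  proof
    assume "F (d (1/2,0)) \<in> boundary_vertices T'"
    then obtain \<rho> where \<rho>: "\<rho> \<in> boundary_edges T'" "F (d (1/2,0)) \<in> \<rho>" by (auto simp: boundary_vertices_def)
    then obtain H h where H: "H \<in> T" "h \<in> frames" "\<rho> = half H h" "side H h \<in> BE"
      using boundary_edges_refineE by blast
    then obtain t where t: "0 \<le> t" "t \<le> 1" "F (d (1/2,0)) = H (h (t/2,0))" using \<rho> by (auto simp: half_eq)
    have "side F d = side H h" using side_point_glued(1)[OF F H(1) d H(2), of "1/2" "t/2"] t by simp
    then show False using H(4) int by (simp add: interior_edges_def)
  qed
  then show "F (d (1/2,0)) \<in> interior_vertices T'"
    using mid_vertex[OF F d] by (simp add: interior_vertices_def)
qed

lemma center_interior:
  assumes F: "F \<in> T"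
  shows "F (1/2,1/2) \<in> interior_vertices T'" "card (faces_at T' (F (1/2,1/2))) = 4"
proof -
  have "faces_at T' (F (1/2,1/2)) = (\<lambda>q. F \<circ> quad q) ` corners"
    unfolding faces_at_refine_center[OF F] by blast
  moreover have "inj_on (\<lambda>q. F \<circ> quad q) corners" using subface_eq_iff[OF F F] by (auto simp: inj_on_def)
  moreover have "card corners = 4" by (simp add: corners_def)
  ultimately show "card (faces_at T' (F (1/2,1/2))) = 4" by (simp add: card_image)
  have "F (1/2,1/2) \<notin> boundary_vertices T'"
  proof
    assume "F (1/2,1/2) \<in> boundary_vertices T'"
    then obtain \<rho> where \<rho>: "\<rho> \<in> boundary_edges T'" "F (1/2,1/2) \<in> \<rho>" by (auto simp: boundary_vertices_def)
    then obtain H h where H: "H \<in> T" "h \<in> frames" "\<rho> = half H h"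
      using boundary_edges_refineE by blast
    then obtain t where t: "0 \<le> t" "t \<le> 1" "F (1/2,1/2) = H (h (t/2,0))" using \<rho> by (auto simp: half_eq)
    then have "h (t/2,0) = (1/2,1/2)"
      using meet_interior[OF F H(1), of "1/2" "1/2" "h (t/2,0)"] H by (simp add: sq_iff)
    then show False using H(2) by (elim frameE) (auto split: if_splits)
  qed
  moreover have "F (1/2,1/2) = (F \<circ> quad (0,0)) (1,1)" by (simp add: quad_simp)
  then have "F (1/2,1/2) \<in> vertices T'"
    using refineI[OF F origin_corner] corners_iff[of 1 1] unfolding vertices_def by blast
  ultimately show "F (1/2,1/2) \<in> interior_vertices T'" by (simp add: interior_vertices_def)
qed

lemma extraordinary_vertex: "pt \<in> EV \<Longrightarrow> pt \<in> vertices T"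
  by (auto simp: extraordinary_def interior_vertices_def boundary_vertices_def)

lemma refine_old_iff:
  assumes "pt \<in> vertices T"
  shows "pt \<in> extraordinary T' \<longleftrightarrow> pt \<in> EV"
    "pt \<in> corner_vertices T' \<longleftrightarrow> pt \<in> corner_vertices T"
  using assms boundary_vertex_old interior_vertex_old valence_old vertices_refine
  by (auto simp: extraordinary_def corner_vertices_def valence_def)

text \<open>New vertices are midpoints of sides or centres of faces; they have valence 4 in the
  interior and 2 on the boundary, the ordinary non-corner values. Hence the set of extraordinary
  vertices is constant along the process.\<close>

lemma refine_new:
  assumes "pt \<in> vertices T'" "pt \<notin> vertices T"
  shows "pt \<notin> extraordinary T'" "pt \<notin> corner_vertices T'"
proof -
  have "(pt \<in> interior_vertices T' \<and> card (faces_at T' pt) = 4) \<or>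
        (pt \<in> boundary_vertices T' \<and> card (faces_at T' pt) = 2)"
    using assms(1)
  proof (cases rule: refine_verticesE)
    case 1
    then show ?thesis using assms(2) by simp
  next
    case (2 F d)
    from 2(1,2) show ?thesis
    proof (cases rule: side_cases)
      case 1
      then show ?thesis using mid_boundary[of F d] inner_edge_faces_ne[of F d] 2 by simp
    next
      case (2 G e)
      then show ?thesis using mid_interior[of F d G e] \<open>pt = F (d (1/2,0))\<close> \<open>F \<in> T\<close> \<open>d \<in> frames\<close> by simp
    qed
  next
    case (3 F)
    then show ?thesis using center_interior by simp
  qed
  then show "pt \<notin> extraordinary T'" "pt \<notin> corner_vertices T'"
    by (auto simp: extraordinary_def corner_vertices_def valence_def interior_vertices_def)
qed

lemma extraordinary_refine: "extraordinary T' = EV"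
  using refine_new(1) refine_old_iff(1) extraordinary_vertex qmesh.extraordinary_vertex[OF refined] by blast

lemma corner_vertices_refine: "corner_vertices T' = corner_vertices T"
proof -
  have "pt \<in> corner_vertices T \<Longrightarrow> pt \<in> vertices T" "pt \<in> corner_vertices T' \<Longrightarrow> pt \<in> vertices T'" for pt
    by (auto simp: corner_vertices_def)
  then show ?thesis using refine_new(2) refine_old_iff(2) by blast
qed

lemma refined_face_extraordinary:
  assumes "F \<in> T" "q \<in> corners" "s \<in> sq" "(F \<circ> quad q) s \<in> EV"
  shows "s = q"
  using refined_face_vertex assms extraordinary_vertex by blast

text \<open>A subface contains just one old vertex, and extraordinary vertices are old, so no
  refined face can contain two of them.\<close>

lemma isolated_refine:
  assumes "pt \<in> EV" shows "isolated T' pt"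
  unfolding isolated_def extraordinary_refine
proof (intro ballI impI notI)
  fix \<delta> assume \<delta>: "\<delta> \<in> EV" "\<delta> \<noteq> pt" "pt \<in> one_ring T' \<delta>"
  then obtain K s t where K: "K \<in> T'" "s \<in> sq" "t \<in> sq" "K s = \<delta>" "K t = pt"
    by (auto simp: one_ring_def faces_at_def carrier_of_def)
  obtain F q where F: "F \<in> T" "q \<in> corners" "K = F \<circ> quad q" using K(1) by (rule refineE)
  have "s = q" "t = q" using refined_face_extraordinary[OF F(1,2)] K F(3) \<delta> assms by auto
  then show False using K \<delta> by simp
qed

text \<open>An interior edge at the vertex would bring in a second face.\<close>

lemma corner_vertex_boundary:
  assumes "pt \<in> corner_vertices T" shows "pt \<in> BV" "pt \<notin> EV"
proof -
  have pt: "pt \<in> vertices T" and c: "card (faces_at T pt) = 1"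
    using assms by (auto simp: corner_vertices_def valence_def)
  obtain F where F: "faces_at T pt = {F}" using c card_1_singletonE by blast
  then have FT: "F \<in> T" by (auto simp: faces_at_def)
  obtain d where d: "d \<in> frames" "F (d (0,0)) = pt" using vertex_frame[OF pt, of F] F by auto
  have "side F d \<in> BE"
    using FT d(1)
  proof (cases rule: side_cases)
    case (2 G e)
    then have "G \<in> faces_at T pt" using faces_at_glued[of G e F d] d by simp
    then show ?thesis using F 2 by auto
  qed
  then show b: "pt \<in> BV" using side_origin[of F d] d pt by (auto simp: boundary_vertices_def)
  then show "pt \<notin> EV" using c by (auto simp: extraordinary_def interior_vertices_def valence_def)
qed

end

lemma mesh_seq_Suc: "mesh_seq T (Suc k) = refine (mesh_seq T k)"
  by (simp add: mesh_seq_def)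

lemma mesh_seq_0 [simp]: "mesh_seq T 0 = T"
  by (simp add: mesh_seq_def)

lemma (in qmesh) mesh_seq_mesh: "qmesh (mesh_seq T k)"
  by (induction k) (auto simp: mesh_seq_Suc qmesh.refined qmesh_axioms)

lemma (in qmesh) mesh_seq_extraordinary: "extraordinary (mesh_seq T k) = extraordinary T"
  by (induction k) (auto simp: mesh_seq_Suc qmesh.extraordinary_refine[OF mesh_seq_mesh])

section \<open>B-splines and Bernstein polynomials on the square\<close>

definition bsp :: "(nat \<Rightarrow> nat \<Rightarrow> 'a::real_vector) \<Rightarrow> real \<times> real \<Rightarrow> 'a" where
  "bsp C s = (\<Sum>j\<le>3. \<Sum>k\<le>3. bspline2 j k s *\<^sub>R C j k)"

definition bern :: "(nat \<Rightarrow> nat \<Rightarrow> 'a::real_vector) \<Rightarrow> real \<times> real \<Rightarrow> 'a" where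
  "bern C s = (\<Sum>j\<le>2. \<Sum>k\<le>2. (Bernstein 2 j (fst s) * Bernstein 2 k (snd s)) *\<^sub>R C j k)"

text \<open>\<open>act m d C\<close> are the coefficients of \<open>C\<close> in the local coordinates \<open>d\<close>, for indices up to \<open>m\<close>.\<close>

definition idx :: "nat \<Rightarrow> frame \<Rightarrow> nat \<Rightarrow> nat \<Rightarrow> nat \<times> nat" where
  "idx m d j k = (let s = d (real j / real m, real k / real m) in
     (nat \<lfloor>real m * fst s\<rfloor>, nat \<lfloor>real m * snd s\<rfloor>))"

definition act :: "nat \<Rightarrow> frame \<Rightarrow> (nat \<Rightarrow> nat \<Rightarrow> 'a) \<Rightarrow> nat \<Rightarrow> nat \<Rightarrow> 'a" where
  "act m d C j k = (case idx m d j k of (j', k') \<Rightarrow> C j' k')"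

lemma idx_fr:
  assumes "j \<le> m" "k \<le> m" "m > 0"
  shows "idx m (fr a b w) j k =
    ((if a then m - (if w then k else j) else (if w then k else j)),
     (if b then m - (if w then j else k) else (if w then j else k)))"
proof -
  have "real m * (1 - real i / real m) = real m - real i" "nat \<lfloor>real m - real i\<rfloor> = m - i" if "i \<le> m" for i
    using assms that by (simp_all add: field_simps flip: of_nat_diff)
  then show ?thesis using assms by (simp add: idx_def Let_def)
qed

lemma sum_atMost_2: "(\<Sum>j\<le>(2::nat). f j) = f 0 + f 1 + f 2"
  by (simp add: numeral_2_eq_2)

lemma sum_atMost_3: "(\<Sum>j\<le>(3::nat). f j) = f 0 + f 1 + f 2 + f 3"
  by (simp add: numeral_3_eq_3 numeral_2_eq_2)

lemma Bernstein_2: "Bernstein 2 0 t = (1-t)^2" "Bernstein 2 1 t = 2*t*(1-t)" "Bernstein 2 (Suc 0) t = 2*t*(1-t)" "Bernstein 2 2 t = t^2"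
  by (simp_all add: Bernstein_def)

lemma bspline_flip: "j \<le> 3 \<Longrightarrow> bspline (3 - j) (1 - t) = bspline j t"
proof -
  assume "j \<le> 3"
  then consider "j = 0" | "j = 1" | "j = 2" | "j = 3" by linarith
  then show ?thesis
    by cases (cases "t = 1/2"; auto simp: bspline_def power2_eq_square field_simps)+
qed

lemma Bernstein_flip: "j \<le> 2 \<Longrightarrow> Bernstein 2 (2 - j) (1 - t) = Bernstein 2 j t"
proof -
  assume "j \<le> 2"
  then consider "j = 0" | "j = 1" | "j = 2" by linarith
  then show ?thesis by cases (simp_all add: Bernstein_2)
qed

lemma sum_flip: "(\<Sum>j\<le>m. f (m - j)) = (\<Sum>j\<le>(m::nat). f j :: 'a::comm_monoid_add)"
  by (rule sum.reindex_bij_witness[of _ "\<lambda>j. m - j" "\<lambda>j. m - j"]) auto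

text \<open>Stated for any family invariant under reversal of the interval, to serve the B-splines
  with m = 3 and the Bernstein polynomials with m = 2 at once. Reflections permute the indices of
  one sum, the swap exchanges the two sums.\<close>

lemma tensor_frame:
  fixes C :: "nat \<Rightarrow> nat \<Rightarrow> 'a::real_vector" and \<beta> :: "nat \<Rightarrow> real \<Rightarrow> real"
  assumes d: "d \<in> frames" and \<beta>: "\<And>j t. j \<le> m \<Longrightarrow> \<beta> (m - j) (1 - t) = \<beta> j t" and m: "m > 0"
  shows "(\<Sum>j\<le>m. \<Sum>k\<le>m. (\<beta> j (fst (d s)) * \<beta> k (snd (d s))) *\<^sub>R C j k) =
    (\<Sum>j\<le>m. \<Sum>k\<le>m. (\<beta> j (fst s) * \<beta> k (snd s)) *\<^sub>R act m d C j k)"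
proof -
  obtain a b w where fr: "d = fr a b w" by (rule frameE[OF d])
  obtain u v where s: "s = (u,v)" by (cases s)
  define \<sigma> where "\<sigma> a j = (if a then m - j else j)" for a j
  define \<tau> :: "bool \<Rightarrow> real \<Rightarrow> real" where "\<tau> a t = (if a then 1 - t else t)" for a t
  have \<sigma>: "(\<Sum>j\<le>m. f (\<sigma> a j)) = (\<Sum>j\<le>m. f j)" for a and f :: "nat \<Rightarrow> 'a"
    using sum_flip[of f m] by (cases a) (simp_all add: \<sigma>_def)
  have \<beta>': "\<beta> (\<sigma> a j) (\<tau> a t) = \<beta> j t" if "j \<le> m" for a j t
    using \<beta> that by (simp add: \<sigma>_def \<tau>_def)
  have *: "(\<Sum>j\<le>m. \<Sum>k\<le>m. (\<beta> j (\<tau> a u) * \<beta> k (\<tau> b v)) *\<^sub>R C j k) =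
     (\<Sum>j\<le>m. \<Sum>k\<le>m. (\<beta> j u * \<beta> k v) *\<^sub>R C (\<sigma> a j) (\<sigma> b k))" for u v
  proof -
    have "(\<Sum>j\<le>m. \<Sum>k\<le>m. (\<beta> j (\<tau> a u) * \<beta> k (\<tau> b v)) *\<^sub>R C j k) =
      (\<Sum>j\<le>m. \<Sum>k\<le>m. (\<beta> (\<sigma> a j) (\<tau> a u) * \<beta> (\<sigma> b k) (\<tau> b v)) *\<^sub>R C (\<sigma> a j) (\<sigma> b k))"
      using \<sigma>[of "\<lambda>j. \<Sum>k\<le>m. (\<beta> j (\<tau> a u) * \<beta> k (\<tau> b v)) *\<^sub>R C j k" a]
        \<sigma>[of "\<lambda>k. (\<beta> (\<sigma> a j) (\<tau> a u) * \<beta> k (\<tau> b v)) *\<^sub>R C (\<sigma> a j) k" b for j]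
      by simp
    also have "\<dots> = (\<Sum>j\<le>m. \<Sum>k\<le>m. (\<beta> j u * \<beta> k v) *\<^sub>R C (\<sigma> a j) (\<sigma> b k))"
      by (intro sum.cong refl) (simp add: \<beta>')
    finally show ?thesis .
  qed
  show ?thesis
  proof (cases w)
    case False
    have "act m d C j k = C (\<sigma> a j) (\<sigma> b k)" if "j \<le> m" "k \<le> m" for j k
      using that m False by (simp add: act_def fr idx_fr \<sigma>_def)
    moreover have "d s = (\<tau> a u, \<tau> b v)" using False by (simp add: fr s \<tau>_def)
    ultimately show ?thesis using *[of u v] by (simp add: s cong: sum.cong_simp)
  next
    case True
    have "act m d C j k = C (\<sigma> a k) (\<sigma> b j)" if "j \<le> m" "k \<le> m" for j k
      using that m True by (simp add: act_def fr idx_fr \<sigma>_def)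
    moreover have "d s = (\<tau> a v, \<tau> b u)" using True by (simp add: fr s \<tau>_def)
    moreover have "(\<Sum>j\<le>m. \<Sum>k\<le>m. (\<beta> j v * \<beta> k u) *\<^sub>R C (\<sigma> a j) (\<sigma> b k)) =
      (\<Sum>j\<le>m. \<Sum>k\<le>m. (\<beta> j u * \<beta> k v) *\<^sub>R C (\<sigma> a k) (\<sigma> b j))"
      by (subst sum.swap) (simp add: mult.commute)
    ultimately show ?thesis using *[of v u] by (simp add: s cong: sum.cong_simp)
  qed
qed

lemma bsp_frame: "d \<in> frames \<Longrightarrow> bsp C (d s) = bsp (act 3 d C) s"
  unfolding bsp_def bspline2_def by (rule tensor_frame) (simp_all add: bspline_flip)

lemma bern_frame: "d \<in> frames \<Longrightarrow> bern C (d s) = bern (act 2 d C) s"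
  unfolding bern_def by (rule tensor_frame) (simp_all add: Bernstein_flip)

lemma bsp_cong: "(\<And>j k. j \<le> 3 \<Longrightarrow> k \<le> 3 \<Longrightarrow> C j k = C' j k) \<Longrightarrow> bsp C s = bsp C' s"
  unfolding bsp_def by (intro sum.cong refl) auto

lemma bern_cong: "(\<And>j k. j \<le> 2 \<Longrightarrow> k \<le> 2 \<Longrightarrow> C j k = C' j k) \<Longrightarrow> bern C s = bern C' s"
  unfolding bern_def by (intro sum.cong refl) auto

section \<open>Uniqueness of coefficients, knot insertion and restriction to a quarter\<close>

lemma bsp_nested: "bsp C s = (\<Sum>j\<le>3. bspline j (fst s) *\<^sub>R (\<Sum>k\<le>3. bspline k (snd s) *\<^sub>R C j k))"
  by (simp add: bsp_def bspline2_def scaleR_sum_right)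

lemma bern_nested: "bern C s = (\<Sum>j\<le>2. Bernstein 2 j (fst s) *\<^sub>R (\<Sum>k\<le>2. Bernstein 2 k (snd s) *\<^sub>R C j k))"
  by (simp add: bern_def scaleR_sum_right)

text \<open>Elimination by evaluation: 0 and 1 isolate the end coefficients, then 1/2 and 1/4 give
  two independent equations for the middle pair.\<close>

lemma bspline_independent:
  fixes x :: "nat \<Rightarrow> 'a::real_vector"
  assumes "\<And>t. 0 \<le> t \<Longrightarrow> t \<le> 1 \<Longrightarrow> (\<Sum>j\<le>3. bspline j t *\<^sub>R x j) = 0" "j \<le> 3"
  shows "x j = 0"
proof -
  have 0: "x 0 = 0" using assms(1)[of 0] by (simp add: sum_atMost_3 bspline_def)
  have 3: "x 3 = 0" using assms(1)[of 1] by (simp add: sum_atMost_3 bspline_def)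
  have 12: "x 1 + x 2 = 0" using assms(1)[of "1/2"] 0 3
    by (simp add: sum_atMost_3 bspline_def power2_eq_square flip: scaleR_add_right)
  \<comment> \<open>At 1/4 the two middle B-splines have the values 5/8 and 1/8.\<close>
  have "(1/8) *\<^sub>R (5 *\<^sub>R x 1 + x 2) = 0" using assms(1)[of "1/4"] 0 3
    by (simp add: sum_atMost_3 bspline_def power2_eq_square scaleR_add_right)
  then have "5 *\<^sub>R x 1 + x 2 = 0" by simp
  moreover have "x 2 = - x 1" using 12 by (simp add: eq_neg_iff_add_eq_0 add.commute)
  moreover have "5 *\<^sub>R x 1 - x 1 = 4 *\<^sub>R x 1" using scaleR_left_diff_distrib[of 5 1 "x 1"] by simp
  ultimately have "x 1 = 0" by simp
  then have "x 2 = 0" using 12 by simp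
  consider "j = 0" | "j = 1" | "j = 2" | "j = 3" using assms(2) by linarith
  then show ?thesis by cases (use 0 3 \<open>x 1 = 0\<close> \<open>x 2 = 0\<close> in auto)
qed

lemma bsp_zero:
  fixes C :: "nat \<Rightarrow> nat \<Rightarrow> 'a::real_vector"
  assumes "\<And>s. s \<in> sq \<Longrightarrow> bsp C s = 0" "j \<le> 3" "k \<le> 3"
  shows "C j k = 0"
proof -
  have "(\<Sum>k\<le>3. bspline k v *\<^sub>R C j k) = 0" if "0 \<le> v" "v \<le> 1" for v
  proof (rule bspline_independent[OF _ assms(2)])
    fix u :: real assume "0 \<le> u" "u \<le> 1"
    then show "(\<Sum>j\<le>3. bspline j u *\<^sub>R (\<Sum>k\<le>3. bspline k v *\<^sub>R C j k)) = 0"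
      using assms(1)[of "(u,v)"] that by (simp add: bsp_nested sq_iff)
  qed
  then show ?thesis by (rule bspline_independent[OF _ assms(3)])
qed

lemma bsp_diff: "bsp (\<lambda>j k. C j k - C' j k) s = bsp C s - bsp C' s"
  by (simp add: bsp_def scaleR_diff_right sum_subtractf)

lemma bsp_inj:
  assumes "\<And>s. s \<in> sq \<Longrightarrow> bsp C s = bsp C' s" "j \<le> 3" "k \<le> 3"
  shows "C j k = C' j k"
  using bsp_zero[of "\<lambda>j k. C j k - C' j k", OF _ assms(2,3)] assms(1) by (simp add: bsp_diff)

text \<open>Linear independence makes the array in the definite description unique;
  \<open>subdiv_coeff\<close> is evaluated through this lemma and its version for local
  coordinates.\<close>

lemma subdiv_coeff_bsp:
  assumes "\<And>s. s \<in> sq \<Longrightarrow> g s = bsp C s"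
  shows "subdiv_coeff g j k = (if j \<le> 3 \<and> k \<le> 3 then C j k else 0)"
proof -
  have "subdiv_coeff g = (\<lambda>j k. if j \<le> 3 \<and> k \<le> 3 then C j k else 0)"
    unfolding subdiv_coeff_def bsp_def[symmetric]
  proof (rule the_equality)
    show "(\<forall>j k. j > 3 \<or> k > 3 \<longrightarrow> (if j \<le> 3 \<and> k \<le> 3 then C j k else 0) = 0) \<and>
      (\<forall>s\<in>sq. g s = bsp (\<lambda>j k. if j \<le> 3 \<and> k \<le> 3 then C j k else 0) s)"
      using assms by (auto intro!: bsp_cong)
  next
    fix c :: "nat \<Rightarrow> nat \<Rightarrow> 'a"
    assume c: "(\<forall>j k. j > 3 \<or> k > 3 \<longrightarrow> c j k = 0) \<and> (\<forall>s\<in>sq. g s = bsp c s)"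
    then have "j \<le> 3 \<Longrightarrow> k \<le> 3 \<Longrightarrow> c j k = C j k" for j k
      using bsp_inj[of c C j k] assms by auto
    then show "c = (\<lambda>j k. if j \<le> 3 \<and> k \<le> 3 then C j k else 0)" using c by (intro ext) auto
  qed
  then show ?thesis by simp
qed

lemma subdiv_coeff_frame:
  assumes "\<And>s. s \<in> sq \<Longrightarrow> g s = bsp C s" "d \<in> frames" "j \<le> 3" "k \<le> 3"
  shows "subdiv_coeff (g \<circ> d) j k = act 3 d C j k"
  using subdiv_coeff_bsp[of "g \<circ> d" "act 3 d C" j k] assms by (simp add: bsp_frame[symmetric])

text \<open>Insertion of the knot 1/2 in both directions, from Bernstein to B-spline coefficients:
  the outer coefficients stay, the inner ones are averages of neighbours. Truncated subtraction at 0
  and \<open>min\<close> at 3 let the formula average an end coefficient with itself.\<close>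

definition subdiv :: "(nat \<Rightarrow> nat \<Rightarrow> 'a::real_vector) \<Rightarrow> nat \<Rightarrow> nat \<Rightarrow> 'a" where
  "subdiv c j k = (1/2) *\<^sub>R ((1/2) *\<^sub>R (c (j-1) (k-1) + c (j-1) (min k 2)) +
                             (1/2) *\<^sub>R (c (min j 2) (k-1) + c (min j 2) (min k 2)))"

text \<open>The passage back: Bernstein coefficients on the quarter at the origin. In each direction
  they are the first two B-spline coefficients and the mean of the second and third, which is the
  value at the knot 1/2.\<close>

definition restr :: "(nat \<Rightarrow> nat \<Rightarrow> 'a::real_vector) \<Rightarrow> nat \<Rightarrow> nat \<Rightarrow> 'a" where
  "restr c j k = (1/2) *\<^sub>R ((1/2) *\<^sub>R (c (min j 1) (min k 1) + c (min j 1) k) +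
                            (1/2) *\<^sub>R (c j (min k 1) + c j k))"

lemma bern_bspline:
  fixes x :: "nat \<Rightarrow> 'a::real_vector"
  shows "(\<Sum>j\<le>2. Bernstein 2 j t *\<^sub>R x j) = (\<Sum>j\<le>3. bspline j t *\<^sub>R ((1/2) *\<^sub>R (x (j-1) + x (min j 2))))"
proof -
  have *: "Bernstein 2 0 t = bspline 0 t + bspline 1 t / 2" "Bernstein 2 1 t = bspline 1 t / 2 + bspline 2 t / 2"
    "Bernstein 2 2 t = bspline 2 t / 2 + bspline 3 t"
    by (simp_all add: Bernstein_2[unfolded One_nat_def] bspline_def power2_eq_square field_simps)
  have "(\<Sum>j\<le>3. bspline j t *\<^sub>R ((1/2) *\<^sub>R (x (j-1) + x (min j 2)))) =
    bspline 0 t *\<^sub>R x 0 + (bspline 1 t / 2) *\<^sub>R x 0 + (bspline 1 t / 2) *\<^sub>R x 1 +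
     (bspline 2 t / 2) *\<^sub>R x 1 + (bspline 2 t / 2) *\<^sub>R x 2 + bspline 3 t *\<^sub>R x 2"
    by (simp add: sum_atMost_3 scaleR_add_right flip: scaleR_add_left)
  also have "\<dots> = (\<Sum>j\<le>2. Bernstein 2 j t *\<^sub>R x j)"
    unfolding sum_atMost_2 * scaleR_add_left by (simp add: add_ac)
  finally show ?thesis ..
qed

lemma bern_subdiv: "bern c s = bsp (subdiv c) s"
proof -
  have "bern c s = (\<Sum>j\<le>2. Bernstein 2 j (fst s) *\<^sub>R (\<Sum>k\<le>3. bspline k (snd s) *\<^sub>R ((1/2) *\<^sub>R (c j (k-1) + c j (min k 2)))))"
    unfolding bern_nested bern_bspline[of "snd s"] ..
  also have "\<dots> = (\<Sum>j\<le>3. bspline j (fst s) *\<^sub>R ((1/2) *\<^sub>R (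
     (\<Sum>k\<le>3. bspline k (snd s) *\<^sub>R ((1/2) *\<^sub>R (c (j-1) (k-1) + c (j-1) (min k 2)))) +
     (\<Sum>k\<le>3. bspline k (snd s) *\<^sub>R ((1/2) *\<^sub>R (c (min j 2) (k-1) + c (min j 2) (min k 2)))))))"
    by (rule bern_bspline)
  also have "\<dots> = bsp (subdiv c) s"
    unfolding bsp_nested subdiv_def
    by (intro sum.cong refl arg_cong2[where f = scaleR])
       (simp add: scaleR_sum_right sum.distrib[symmetric] scaleR_add_right cong: sum.cong_simp)
  finally show ?thesis .
qed

lemma bspline_restrict:
  fixes x :: "nat \<Rightarrow> 'a::real_vector"
  assumes "t \<le> 1"
  shows "(\<Sum>j\<le>3. bspline j (t/2) *\<^sub>R x j) = (\<Sum>j\<le>2. Bernstein 2 j t *\<^sub>R ((1/2) *\<^sub>R (x (min j 1) + x j)))"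
proof -
  have *: "bspline 0 (t/2) = Bernstein 2 0 t" "bspline 1 (t/2) = Bernstein 2 1 t + Bernstein 2 2 t / 2"
    "bspline 2 (t/2) = Bernstein 2 2 t / 2" "bspline 3 (t/2) = 0"
    using assms by (simp_all add: Bernstein_2[unfolded One_nat_def] bspline_def power2_eq_square field_simps)
  have "(\<Sum>j\<le>2. Bernstein 2 j t *\<^sub>R ((1/2) *\<^sub>R (x (min j 1) + x j))) =
    Bernstein 2 0 t *\<^sub>R x 0 + Bernstein 2 1 t *\<^sub>R x 1 + (Bernstein 2 2 t / 2) *\<^sub>R x 1 + (Bernstein 2 2 t / 2) *\<^sub>R x 2"
    by (simp add: sum_atMost_2 scaleR_add_right flip: scaleR_add_left)
  also have "\<dots> = (\<Sum>j\<le>3. bspline j (t/2) *\<^sub>R x j)"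
    unfolding sum_atMost_3 * scaleR_add_left by (simp add: add_ac)
  finally show ?thesis ..
qed

lemma bsp_restr:
  assumes "s \<in> sq" shows "bsp C (quad (0,0) s) = bern (restr C) s"
proof -
  obtain u v where s: "s = (u,v)" by (cases s)
  have uv: "u \<le> 1" "v \<le> 1" using assms by (auto simp: s sq_iff)
  have "bsp C (quad (0,0) s) = (\<Sum>j\<le>3. bspline j (u/2) *\<^sub>R (\<Sum>k\<le>2. Bernstein 2 k v *\<^sub>R ((1/2) *\<^sub>R (C j (min k 1) + C j k))))"
    unfolding bsp_nested s quad_simp fst_conv snd_conv add_0 bspline_restrict[OF uv(2)] ..
  also have "\<dots> = (\<Sum>j\<le>2. Bernstein 2 j u *\<^sub>R ((1/2) *\<^sub>R (
     (\<Sum>k\<le>2. Bernstein 2 k v *\<^sub>R ((1/2) *\<^sub>R (C (min j 1) (min k 1) + C (min j 1) k))) +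
     (\<Sum>k\<le>2. Bernstein 2 k v *\<^sub>R ((1/2) *\<^sub>R (C j (min k 1) + C j k))))))"
    by (rule bspline_restrict[OF uv(1)])
  also have "\<dots> = bern (restr C) s"
    unfolding bern_nested restr_def s fst_conv snd_conv
    by (intro sum.cong refl arg_cong2[where f = scaleR])
       (simp add: scaleR_sum_right sum.distrib[symmetric] scaleR_add_right cong: sum.cong_simp)
  finally show ?thesis .
qed

section \<open>Derivatives\<close>

text \<open>Derivatives in truncated-power form: the kink of the derivative at the knot sits in
  \<open>max 0 (t - 1/2)\<close>, so both pieces are differentiated by one formula.\<close>

definition dbspline :: "nat \<Rightarrow> real \<Rightarrow> real" where
  "dbspline j t =
     (if j = 0 then -4*(1-2*t) - 8 * max 0 (t - 1/2)
      else if j = 1 then 4 - 12*t + 16 * max 0 (t - 1/2)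
      else if j = 2 then 4*t - 16 * max 0 (t - 1/2)
      else if j = 3 then 8 * max 0 (t - 1/2) else 0)"

text \<open>A truncated square is differentiable also at its kink, where the quotient is bounded by
  the increment. This one fact carries the smoothness of the B-splines at the knot and of
  \<open>bump\<close> at the end of its support.\<close>

lemma has_real_derivative_pos_square:
  "((\<lambda>t. (max 0 (t - c))^2) has_real_derivative 2 * max 0 (x - c)) (at x)" for c x :: real
proof -
  consider "x < c" | "x = c" | "x > c" by linarith
  then show ?thesis
  proof cases
    case 1
    have "((\<lambda>t. 0) has_real_derivative 0) (at x)" by simp
    then have "((\<lambda>t. (max 0 (t - c))^2) has_real_derivative 0) (at x)"
      by (rule has_field_derivative_transform_within_open[of _ _ _ "{..<c}"]) (use 1 in auto)
    then show ?thesis using 1 by simp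
  next
    case 3
    have "((\<lambda>t. (t - c)^2) has_real_derivative 2 * (x - c)) (at x)"
      by (auto intro!: derivative_eq_intros)
    then have "((\<lambda>t. (max 0 (t - c))^2) has_real_derivative 2 * (x - c)) (at x)"
      by (rule has_field_derivative_transform_within_open[of _ _ _ "{c<..}"]) (use 3 in auto)
    then show ?thesis using 3 by simp
  next
    case 2
    have "((\<lambda>h::real. (max 0 h)^2 / h) \<longlongrightarrow> 0) (at 0)"
    proof (rule Lim_null_comparison)
      show "\<forall>\<^sub>F h in at 0. norm ((max 0 h)^2 / h) \<le> \<bar>h\<bar>"
        by (auto simp: eventually_at_filter power2_eq_square max_def divide_simps)
      show "((\<lambda>h::real. \<bar>h\<bar>) \<longlongrightarrow> 0) (at 0)" using tendsto_rabs_zero[OF tendsto_ident_at] by simp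
    qed
    then show ?thesis using 2 by (simp add: DERIV_def)
  qed
qed

lemma bspline_truncated:
  "bspline 0 t = (1 - 2*t)^2 - 4 * (max 0 (t - 1/2))^2"
  "bspline (Suc 0) t = 2*t*(2 - 3*t) + 8 * (max 0 (t - 1/2))^2"
  "bspline 2 t = 2*t^2 - 8 * (max 0 (t - 1/2))^2"
  "bspline 3 t = 4 * (max 0 (t - 1/2))^2"
  by (auto simp: bspline_def max_def power2_eq_square field_simps)

lemma bspline_derivative: "j \<le> 3 \<Longrightarrow> (bspline j has_real_derivative dbspline j t) (at t within X)"
proof -
  assume "j \<le> 3"
  note p = has_real_derivative_pos_square[of "1/2" t, THEN has_field_derivative_at_within, of X]
  consider "j = 0" | "j = Suc 0" | "j = 2" | "j = 3" using \<open>j \<le> 3\<close> by linarith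
  then show ?thesis
    by cases (simp_all only: bspline_truncated[abs_def] dbspline_def,
      (rule derivative_eq_intros p refl | simp add: field_simps)+)
qed

lemma bspline2_derivative:
  assumes "j \<le> 3" "k \<le> 3"
  shows "(bspline2 j k has_derivative (\<lambda>h. fst h * (dbspline j (fst s) * bspline k (snd s)) +
     snd h * (bspline j (fst s) * dbspline k (snd s)))) (at s within X)"
proof -
  have 1: "((\<lambda>s. bspline j (fst s)) has_derivative (\<lambda>h. fst h * dbspline j (fst s))) (at s within X)" if "j \<le> 3" for j
  proof -
    have "((\<lambda>s. bspline j (fst s)) has_derivative ((\<lambda>h. dbspline j (fst s) * h) \<circ> fst)) (at s within X)"
      using diff_chain_within[OF has_derivative_fst[OF has_derivative_ident]
        bspline_derivative[OF that, of "fst s" "fst ` X", unfolded has_field_derivative_def]]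
      by (simp add: comp_def)
    then show ?thesis by (simp add: comp_def mult.commute)
  qed
  have 2: "((\<lambda>s. bspline k (snd s)) has_derivative (\<lambda>h. snd h * dbspline k (snd s))) (at s within X)" if "k \<le> 3" for k
  proof -
    have "((\<lambda>s. bspline k (snd s)) has_derivative ((\<lambda>h. dbspline k (snd s) * h) \<circ> snd)) (at s within X)"
      using diff_chain_within[OF has_derivative_snd[OF has_derivative_ident]
        bspline_derivative[OF that, of "snd s" "snd ` X", unfolded has_field_derivative_def]]
      by (simp add: comp_def)
    then show ?thesis by (simp add: comp_def mult.commute)
  qed
  show ?thesis unfolding bspline2_def[abs_def]
    by (rule has_derivative_eq_rhs, rule has_derivative_mult[OF 1[OF assms(1)] 2[OF assms(2)]])
       (auto simp: algebra_simps)
qed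

lemma bsp_derivative:
  fixes C :: "nat \<Rightarrow> nat \<Rightarrow> 'a::real_normed_vector"
  shows "(bsp C has_derivative (\<lambda>h. \<Sum>j\<le>3. \<Sum>k\<le>3.
     (fst h * (dbspline j (fst s) * bspline k (snd s)) + snd h * (bspline j (fst s) * dbspline k (snd s))) *\<^sub>R C j k))
     (at s within X)"
  unfolding bsp_def[abs_def]
  by (intro has_derivative_sum has_derivative_scaleR_left bspline2_derivative) auto

abbreviation hder :: "(real \<times> real \<Rightarrow> 'a::real_normed_vector) \<Rightarrow> real \<times> real \<Rightarrow> (real \<times> real \<Rightarrow> 'a) \<Rightarrow> bool" where
  "hder g s D \<equiv> (g has_derivative D) (at s within sq)"

lemma bsp_hder:
  fixes C :: "nat \<Rightarrow> nat \<Rightarrow> 'a::real_normed_vector"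
  obtains D where "hder (bsp C) s D"
  using bsp_derivative by blast

text \<open>At 0 only the first two B-splines have nonzero value or slope, with slopes -4 and 4;
  this is where the factor 4 comes from.\<close>

lemma bsp_hder_origin:
  fixes C :: "nat \<Rightarrow> nat \<Rightarrow> 'a::real_normed_vector"
  obtains D where "hder (bsp C) (0,0) D" "D (1,0) = 4 *\<^sub>R (C 1 0 - C 0 0)" "D (0,1) = 4 *\<^sub>R (C 0 1 - C 0 0)"
  by (rule that[OF bsp_derivative]) (simp_all add: sum_atMost_3 dbspline_def bspline_def scaleR_diff_right)

text \<open>Links the total derivative, for which calculus rules are at hand, with the one-sided
  partial derivatives in terms of which normals and tangent planes are defined.\<close>

lemma hder_partials:
  fixes g :: "real \<times> real \<Rightarrow> real^3"
  assumes g: "hder g s D" and s: "s \<in> sq"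
  shows "has_partials g s a b \<longleftrightarrow> a = D (1,0) \<and> b = D (0,1)"
proof -
  obtain u v where uv: "s = (u,v)" by (cases s)
  have u: "u \<in> {0..1}" "v \<in> {0..1}" using s by (auto simp: uv sq_iff)
  have lin: "linear D" using g by (rule has_derivative_linear)
  have sc: "D (h,0) = h *\<^sub>R D (1,0)" "D (0,h) = h *\<^sub>R D (0,1)" for h
    using linear_scale[OF lin, of h "(1,0)"] linear_scale[OF lin, of h "(0,1)"] by simp_all
  have 1: "((\<lambda>t. g (t, v)) has_vector_derivative D (1,0)) (at u within {0..1})"
  proof -
    have i: "((\<lambda>t. (t, v)) has_derivative (\<lambda>h. (h, 0))) (at u within {0..1})"
      by (auto intro!: derivative_eq_intros)
    have "(g has_derivative D) (at (u,v) within (\<lambda>t. (t,v)) ` {0..1})"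
      using g unfolding uv by (rule has_derivative_subset) (use u in \<open>auto simp: sq_iff\<close>)
    from diff_chain_within[OF i this] show ?thesis
      unfolding has_vector_derivative_def sc[symmetric] by (simp add: comp_def)
  qed
  have 2: "((\<lambda>t. g (u, t)) has_vector_derivative D (0,1)) (at v within {0..1})"
  proof -
    have i: "((\<lambda>t. (u, t)) has_derivative (\<lambda>h. (0, h))) (at v within {0..1})"
      by (auto intro!: derivative_eq_intros)
    have "(g has_derivative D) (at (u,v) within (\<lambda>t. (u,t)) ` {0..1})"
      using g unfolding uv by (rule has_derivative_subset) (use u in \<open>auto simp: sq_iff\<close>)
    from diff_chain_within[OF i this] show ?thesis
      unfolding has_vector_derivative_def sc[symmetric] by (simp add: comp_def)
  qed
  have "a = D (1,0)" if "((\<lambda>t. g (t, v)) has_vector_derivative a) (at u within {0..1})"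
    using vector_derivative_unique_within_closed_interval[of 0 1 u, OF _ _ that[folded cbox_interval] 1[folded cbox_interval]] u
    by simp
  moreover have "b = D (0,1)" if "((\<lambda>t. g (u, t)) has_vector_derivative b) (at v within {0..1})"
    using vector_derivative_unique_within_closed_interval[of 0 1 v, OF _ _ that[folded cbox_interval] 2[folded cbox_interval]] u
    by simp
  ultimately show ?thesis using 1 2 by (auto simp: has_partials_def uv)
qed

lemma has_partials_unique:
  fixes g :: "real \<times> real \<Rightarrow> real^3"
  assumes "has_partials g s a b" "has_partials g s a' b'" "s \<in> sq"
  shows "a' = a" "b' = b"
proof -
  have u: "fst s \<in> {0..1}" "snd s \<in> {0..1}" using assms(3) by (cases s; simp add: sq_iff)+
  show "a' = a" "b' = b"
    using assms(1,2) u
      vector_derivative_unique_within_closed_interval[of 0 1 "fst s" "\<lambda>t. g (t, snd s)" a' a]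
      vector_derivative_unique_within_closed_interval[of 0 1 "snd s" "\<lambda>t. g (fst s, t)" b' b]
    by (simp_all add: has_partials_def)
qed

definition lin :: "frame \<Rightarrow> real \<times> real \<Rightarrow> real \<times> real" where
  "lin d h = d h - d (0,0)"

lemma lin_fr: "lin (fr a b w) (h, k) = ((if a then -1 else 1) * (if w then k else h), (if b then -1 else 1) * (if w then h else k))"
  by (simp add: lin_def)

lemma frame_derivative: "d \<in> frames \<Longrightarrow> (d has_derivative lin d) (at s within X)"
proof -
  assume "d \<in> frames"
  then obtain a b w where d: "d = fr a b w" by (rule frameE)
  have 1: "lin d = (\<lambda>h. ((if a then -1 else 1) * (if w then snd h else fst h), (if b then -1 else 1) * (if w then fst h else snd h)))"
    unfolding d by (rule ext) (auto simp: lin_fr simp del: fr_simps split: prod.splits)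
  have 2: "d = (\<lambda>s. (if a then 1 - (if w then snd s else fst s) else (if w then snd s else fst s),
                        if b then 1 - (if w then fst s else snd s) else (if w then fst s else snd s)))"
    unfolding d by (rule ext) (auto split: prod.splits)
  show ?thesis unfolding 1 unfolding 2
    by (cases a; cases b; cases w) (auto intro!: derivative_eq_intros)
qed

lemma hder_frame:
  assumes "hder g (d s) D" "d \<in> frames" shows "hder (g \<circ> d) s (D \<circ> lin d)"
proof (rule diff_chain_within[OF frame_derivative[OF assms(2)]])
  show "(g has_derivative D) (at (d s) within d ` sq)"
    using assms by (simp add: frame_image_square)
qed

text \<open>The linear part of a frame is a signed permutation, so a cross product changes at most
  its sign. Normals may therefore be computed in any local coordinates.\<close>

lemma frame_cross:
  assumes "linear D" "d \<in> frames"
  shows "cross3 (D (lin d (1,0))) (D (lin d (0,1))) = cross3 (D (1,0)) (D (0,1)) \<or>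
    cross3 (D (lin d (1,0))) (D (lin d (0,1))) = - cross3 (D (1,0)) (D (0,1))"
proof -
  obtain a b w where d: "d = fr a b w" by (rule frameE[OF assms(2)])
  have m: "D (-1,0) = - D (1,0)" "D (0,-1) = - D (0,1)"
    using linear_neg[OF assms(1), of "(1,0)"] linear_neg[OF assms(1), of "(0,1)"] by simp_all
  show ?thesis unfolding d lin_fr
    by (cases a; cases b; cases w) (simp_all add: m cross_skew[of "D (0,1)" "D (1,0)"])
qed

lemma span_cross:
  fixes a b :: "real^3"
  assumes "cross3 a b \<noteq> 0"
  shows "span {a, b} = {v. v \<bullet> cross3 a b = 0}" "dim {v. v \<bullet> cross3 a b = 0} = 2"
    "subspace {v. v \<bullet> cross3 a b = 0}"
proof -
  let ?W = "{v. v \<bullet> cross3 a b = 0}"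
  have W: "?W = {v. cross3 a b \<bullet> v = 0}" by (simp add: inner_commute)
  show dW: "dim ?W = 2" unfolding W using dim_hyperplane[OF assms] by simp
  show sW: "subspace ?W" unfolding W by (rule subspace_hyperplane)
  have sub: "{a,b} \<subseteq> ?W" by (simp add: dot_cross_self)
  have indep: "independent {a,b}" "a \<noteq> b"
  proof -
    show "a \<noteq> b" using assms by auto
    have "b \<noteq> 0" using assms by auto
    moreover have "a \<notin> span {b}"
    proof
      assume "a \<in> span {b}"
      then obtain k where "a = k *\<^sub>R b" by (auto simp: span_singleton)
      then show False using assms by (simp add: cross_mult_left)
    qed
    ultimately show "independent {a,b}" using \<open>a \<noteq> b\<close> by (simp add: independent_insert)
  qed
  show "span {a,b} = ?W"
  proof (rule subspace_dim_equal[OF subspace_span sW])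
    show "span {a,b} \<subseteq> ?W" by (rule span_minimal[OF sub sW])
    show "dim ?W \<le> dim (span {a,b})"
      using dW indep by (simp add: dim_eq_card_independent)
  qed
qed

section \<open>Bernstein coefficients of the splines \<open>B\<^sup>*\<close>\<close>

abbreviation star :: "'p mesh \<Rightarrow> ('p dof \<Rightarrow> 'a::real_vector) \<Rightarrow> ('p, 'a) mesh_fun" where
  "star T z \<equiv> spline (dof_star T) (basis_star T) z"

text \<open>The vertex and edge coefficients of \<open>star T z\<close>, and the Bernstein coefficient with a given index.\<close>

definition vc :: "'p mesh \<Rightarrow> ('p dof \<Rightarrow> 'a::real_vector) \<Rightarrow> 'p \<Rightarrow> 'a" where
  "vc T z pt =
     (if pt \<in> interior_vertices T then (1 / real (valence T pt)) *\<^sub>R (\<Sum>F\<in>faces_at T pt. z (Face F))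
      else if pt \<in> corner_vertices T then z (Corner pt)
      else (1/2) *\<^sub>R (\<Sum>\<rho>\<in>{\<rho> \<in> boundary_edges T. pt \<in> \<rho>}. z (BEdge \<rho>)))"

definition ec :: "'p mesh \<Rightarrow> ('p dof \<Rightarrow> 'a::real_vector) \<Rightarrow> 'p set \<Rightarrow> 'a" where
  "ec T z \<tau> = (if \<tau> \<in> interior_edges T then (1/2) *\<^sub>R (\<Sum>F\<in>incident T \<tau>. z (Face F)) else z (BEdge \<tau>))"

text \<open>\<open>y\<close> is the face coefficient; it is separate because \<open>H\<close> may be a face in local coordinates.\<close>

definition bc :: "'p mesh \<Rightarrow> ('p dof \<Rightarrow> 'a::real_vector) \<Rightarrow> 'p face \<Rightarrow> 'a \<Rightarrow> nat \<Rightarrow> nat \<Rightarrow> 'a" where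
  "bc T z H y j k = (if j = 1 \<and> k = 1 then y else if j = 1 \<or> k = 1 then ec T z (cell H j k)
     else vc T z (H (real j / 2, real k / 2)))"

lemma cell_frame:
  assumes d: "d \<in> frames" and jk: "j \<le> 2" "k \<le> 2"
  shows "cell (F \<circ> d) j k = (case idx 2 d j k of (j', k') \<Rightarrow> cell F j' k')"
proof -
  obtain a b w where fr: "d = fr a b w" by (rule frameE[OF d])
  obtain j' k' where jk': "idx 2 d j k = (j', k')" by (cases "idx 2 d j k")
  define S where "S j k = {(u,v) \<in> sq. (j \<noteq> 1 \<longrightarrow> u = real j / 2) \<and> (k \<noteq> 1 \<longrightarrow> v = real k / 2)}" for j k :: nat
  have j: "j = 0 \<or> j = 1 \<or> j = 2" "k = 0 \<or> k = 1 \<or> k = 2" using jk by auto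
  define p where "p j u \<longleftrightarrow> (j \<noteq> 1 \<longrightarrow> u = real j / 2)" for j :: nat and u
  have p: "p (2 - i) (1 - u) \<longleftrightarrow> p i u" if "i = 0 \<or> i = 1 \<or> i = 2" for i u
    using that by (auto simp: p_def)
  have S: "(u,v) \<in> S j k \<longleftrightarrow> (u,v) \<in> sq \<and> p j u \<and> p k v" for j k u v
    by (simp add: S_def p_def)
  have eq: "d s \<in> S j' k' \<longleftrightarrow> s \<in> S j k" for s
  proof -
    obtain u v where s: "s = (u,v)" by (cases s)
    have sq: "fr a b w (u,v) \<in> sq \<longleftrightarrow> (u,v) \<in> sq" by (rule frame_square) simp
    show ?thesis
      using jk' jk sq p[OF j(1)] p[OF j(2)] unfolding fr s
      by (cases a; cases b; cases w; simp add: idx_fr S; blast)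
  qed
  have "S j' k' = d ` S j k"
  proof
    show "d ` S j k \<subseteq> S j' k'" using eq by blast
    show "S j' k' \<subseteq> d ` S j k"
    proof
      fix s assume s: "s \<in> S j' k'"
      obtain t where "s = d t" using d by (metis frames_inverse)
      then show "s \<in> d ` S j k" using eq s by blast
    qed
  qed
  then have "cell F j' k' = F ` d ` S j k" "cell (F \<circ> d) j k = (F \<circ> d) ` S j k"
    unfolding cell_def S_def by simp_all
  then show ?thesis using jk' by (simp add: image_comp)
qed

lemma bc_frame:
  assumes d: "d \<in> frames" and jk: "j \<le> 2" "k \<le> 2"
  shows "act 2 d (bc T z F y) j k = bc T z (F \<circ> d) y j k"
proof -
  obtain a b w where fr: "d = fr a b w" by (rule frameE[OF d])
  obtain j' k' where jk': "idx 2 d j k = (j', k')" by (cases "idx 2 d j k")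
  have j: "j = 0 \<or> j = 1 \<or> j = 2" "k = 0 \<or> k = 1 \<or> k = 2" using jk by auto
  have "(j' = 1 \<and> k' = 1) = (j = 1 \<and> k = 1)" "(j' = 1 \<or> k' = 1) = (j = 1 \<or> k = 1)"
    "(real j' / 2, real k' / 2) = d (real j / 2, real k / 2)"
    using jk' j unfolding fr by (cases a; cases b; cases w; auto simp: idx_fr)+
  then show ?thesis using cell_frame[OF d jk, of F] jk' by (simp add: act_def bc_def)
qed

lemma cell_side: "cell (F \<circ> d) 1 0 = side F d" "cell (F \<circ> d) 0 1 = side F (d \<circ> swp)"
proof -
  have "{(u,v) \<in> sq. v = 0} = (\<lambda>t. (t,0)) ` {0..1}" "{(u,v) \<in> sq. u = 0} = (\<lambda>t. (0,t)) ` {0..1}"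
    by (auto simp: sq_iff)
  then show "cell (F \<circ> d) 1 0 = side F d" "cell (F \<circ> d) 0 1 = side F (d \<circ> swp)"
    by (simp_all add: cell_def side_def image_image)
qed

lemma bc_local:
  "bc T z (F \<circ> d) y 0 0 = vc T z (F (d (0,0)))" "bc T z (F \<circ> d) y (Suc 0) 0 = ec T z (side F d)"
  "bc T z (F \<circ> d) y 0 (Suc 0) = ec T z (side F (d \<circ> swp))" "bc T z (F \<circ> d) y (Suc 0) (Suc 0) = y"
  using cell_side[of F d] by (simp_all add: bc_def)

text \<open>The device for passing from local to global: a statement about the four coefficients
  next to the local origin, proved for every frame, covers all sixteen.\<close>

lemma idx_corner:
  assumes "j \<le> 3" "k \<le> 3"
  obtains d j0 k0 where "d \<in> frames" "j0 \<le> 1" "k0 \<le> 1" "idx 3 d j0 k0 = (j, k)" "d (0,0) = block_corner j k"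
proof -
  let ?d = "fr (2 \<le> j) (2 \<le> k) False"
  have jk: "j = 0 \<or> j = 1 \<or> j = 2 \<or> j = 3" "k = 0 \<or> k = 1 \<or> k = 2 \<or> k = 3" using assms by auto
  show ?thesis
    by (rule that[of ?d "if 2 \<le> j then 3 - j else j" "if 2 \<le> k then 3 - k else k"])
       (use jk in \<open>auto simp: idx_fr block_corner_def\<close>)
qed

lemma block_corner_idx:
  assumes "d \<in> frames" "j \<le> 1" "k \<le> 1"
  shows "block_corner (fst (idx 3 d j k)) (snd (idx 3 d j k)) = d (0,0)"
    "fst (idx 3 d j k) \<le> 3" "snd (idx 3 d j k) \<le> 3"
proof -
  obtain a b w where fr: "d = fr a b w" by (rule frameE[OF assms(1)])
  have jk: "j = 0 \<or> j = 1" "k = 0 \<or> k = 1" using assms by auto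
  show "block_corner (fst (idx 3 d j k)) (snd (idx 3 d j k)) = d (0,0)"
    "fst (idx 3 d j k) \<le> 3" "snd (idx 3 d j k) \<le> 3"
    using jk unfolding fr by (cases a; cases b; cases w; auto simp: idx_fr block_corner_def)+
qed

lemma bsp_sum_eq: "bsp (\<lambda>j k. \<Sum>i\<in>I. w i j k *\<^sub>R z i) s = (\<Sum>i\<in>I. bsp (w i) s *\<^sub>R z i)"
  for w :: "'i \<Rightarrow> nat \<Rightarrow> nat \<Rightarrow> real"
proof -
  have "bsp (\<lambda>j k. \<Sum>i\<in>I. w i j k *\<^sub>R z i) s = (\<Sum>j\<le>3. \<Sum>k\<le>3. \<Sum>i\<in>I. (bspline2 j k s * w i j k) *\<^sub>R z i)"
    by (simp add: bsp_def scaleR_sum_right)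
  also have "\<dots> = (\<Sum>i\<in>I. \<Sum>j\<le>3. \<Sum>k\<le>3. (bspline2 j k s * w i j k) *\<^sub>R z i)"
    by (subst sum.swap, subst (2) sum.swap) (simp add: sum.swap[of _ "{..3}" I])
  finally show ?thesis by (simp add: bsp_def scaleR_sum_left)
qed

lemma bern_sum_eq: "bern (\<lambda>j k. \<Sum>i\<in>I. w i j k *\<^sub>R z i) s = (\<Sum>i\<in>I. bern (w i) s *\<^sub>R z i)"
  for w :: "'i \<Rightarrow> nat \<Rightarrow> nat \<Rightarrow> real"
proof -
  have "bern (\<lambda>j k. \<Sum>i\<in>I. w i j k *\<^sub>R z i) s =
    (\<Sum>j\<le>2. \<Sum>k\<le>2. \<Sum>i\<in>I. ((Bernstein 2 j (fst s) * Bernstein 2 k (snd s)) * w i j k) *\<^sub>R z i)"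
    by (simp add: bern_def scaleR_sum_right)
  also have "\<dots> = (\<Sum>i\<in>I. \<Sum>j\<le>2. \<Sum>k\<le>2. ((Bernstein 2 j (fst s) * Bernstein 2 k (snd s)) * w i j k) *\<^sub>R z i)"
    by (subst sum.swap, subst (2) sum.swap) (simp add: sum.swap[of _ "{..2}" I])
  finally show ?thesis by (simp add: bern_def scaleR_sum_left)
qed

lemma basis_star_bern: "basis_star T \<phi> F s = bern (coeff_star T \<phi> F) s"
  by (simp add: basis_star_def bern_def mult_ac)

context qmesh
begin

lemma finite_frames [simp]: "finite frames"
proof -
  have "frames \<subseteq> (\<lambda>(a,b,w). fr a b w) ` UNIV" unfolding frames_fr by (force simp: image_iff)
  then show ?thesis by (rule finite_subset) simp
qed

lemma finite_edges [simp]: "finite (edges T)"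
proof -
  have "edges T = (\<lambda>(F,d). side F d) ` (T \<times> frames)" unfolding edges_def by auto
  then show ?thesis by simp
qed

lemma finite_vertices [simp]: "finite (vertices T)"
proof -
  have "vertices T = (\<lambda>(F,q). F q) ` (T \<times> corners)" unfolding vertices_def by auto
  then show ?thesis by (simp add: corners_def)
qed

lemma finite_boundary_edges [simp]: "finite (BE)"
  by (rule finite_subset[OF _ finite_edges]) (auto simp: boundary_edges_def)

lemma finite_corner_vertices [simp]: "finite (corner_vertices T)"
  by (rule finite_subset[OF _ finite_vertices]) (auto simp: corner_vertices_def)

lemma finite_extraordinary [simp]: "finite (EV)"
  by (rule finite_subset[OF _ finite_vertices]) (use extraordinary_vertex in auto)

lemma finite_dof_star [simp]: "finite (dof_star T)"
  by (simp add: dof_star_def)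

lemma sum_dof_star:
  "sum g (dof_star T) = (\<Sum>F\<in>T. g (Face F)) + (\<Sum>\<rho>\<in>BE. g (BEdge \<rho>)) +
     (\<Sum>pt\<in>corner_vertices T. g (Corner pt))"
proof -
  have "sum g (dof_star T) = sum g (Face ` T) + sum g (BEdge ` BE) + sum g (Corner ` corner_vertices T)"
    unfolding dof_star_def by (subst sum.union_disjoint, auto)+
  then show ?thesis by (simp add: sum.reindex inj_on_def)
qed

text \<open>The definition of the splines lists coefficients per degree of freedom; here they are
  regrouped per face, edge and vertex, which yields the averages \<open>ec\<close> and
  \<open>vc\<close>.\<close>

lemma coeff_star_sum:
  fixes z :: "'p dof \<Rightarrow> 'b::real_vector"
  assumes F: "F \<in> T" and jk: "j \<le> 2" "k \<le> 2"
  shows "(\<Sum>\<phi>\<in>dof_star T. coeff_star T \<phi> F j k *\<^sub>R z \<phi>) = bc T z F (z (Face F)) j k"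
proof -
  let ?pt = "F (real j / 2, real k / 2)" and ?\<tau> = "cell F j k"
  have if_scale: "(if P then a else 0) *\<^sub>R x = (if P then a *\<^sub>R x else 0)" for P a and x :: 'b by simp
  have sum_filter: "(\<Sum>x\<in>A. if P x then g x else 0) = (\<Sum>x\<in>{x\<in>A. P x}. g x)" if "finite A" for A :: "'c set" and P and g :: "'c \<Rightarrow> 'b"
    using that by (simp add: sum.inter_filter)
  consider (face) "j = 1 \<and> k = 1" | (edge) "\<not> (j = 1 \<and> k = 1)" "j = 1 \<or> k = 1" | (vertex) "\<not> (j = 1 \<or> k = 1)" by blast
  then show ?thesis
  proof cases
    case face
    then show ?thesis using F
      by (simp add: sum_dof_star coeff_star_def bc_def if_scale sum.delta' cong: if_cong)
  next
    case edge
    have "j = 1 \<and> (k = 0 \<or> k = 2) \<or> k = 1 \<and> (j = 0 \<or> j = 2)" using edge jk by auto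
    then have \<tau>: "?\<tau> \<in> edges T"
    proof -
      have "?\<tau> = side F d" if "idx 2 d 1 0 = (j,k)" "d \<in> frames" for d
        using cell_frame[OF that(2), of 1 0 F] cell_side(1)[of F d] that(1) by simp
      moreover have "\<exists>d\<in>frames. idx 2 d 1 0 = (j,k)"
        using \<open>j = 1 \<and> (k = 0 \<or> k = 2) \<or> k = 1 \<and> (j = 0 \<or> j = 2)\<close>
        by (elim disjE conjE)
          (rule bexI[of _ "fr False False False"] bexI[of _ "fr False True False"]
             bexI[of _ "fr False False True"] bexI[of _ "fr True False True"], simp add: idx_fr, simp)+
      ultimately show ?thesis using side_edges F by metis
    qed
    have cf: "coeff_star T (Face G) F j k = (if ?\<tau> \<in> IE \<and> ?\<tau> \<subseteq> carrier_of G then 1/2 else 0)"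
      "coeff_star T (BEdge \<rho>) F j k = (if ?\<tau> = \<rho> then 1 else 0)" "coeff_star T (Corner \<delta>) F j k = 0"
      "bc T z F y j k = ec T z ?\<tau>" for G \<rho> \<delta> y
      using edge by (simp_all only: coeff_star_def bc_def Let_def dof.case if_False if_True)
    show ?thesis
    proof (cases "?\<tau> \<in> IE")
      case True
      have "{G \<in> T. ?\<tau> \<subseteq> carrier_of G} = incident T ?\<tau>" by (simp add: incident_def)
      moreover have "?\<tau> \<notin> BE" using True by (simp add: interior_edges_def)
      ultimately show ?thesis using True
        by (simp add: sum_dof_star cf ec_def if_scale sum_filter scaleR_sum_right cong: if_cong)
    next
      case False
      then have "?\<tau> \<in> BE" using \<tau> by (simp add: interior_edges_def)
      then show ?thesis using False
        by (simp add: sum_dof_star cf ec_def if_scale cong: if_cong)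
    qed
  next
    case vertex
    then have "(j = 0 \<or> j = 2) \<and> (k = 0 \<or> k = 2)" using jk by auto
    then have "(real j / 2, real k / 2) \<in> corners" by (auto simp: corners_iff)
    then have pt: "?pt \<in> vertices T" using F unfolding vertices_def by blast
    have fa: "{G \<in> T. ?pt \<in> carrier_of G} = faces_at T ?pt" by (simp add: faces_at_def)
    show ?thesis
    proof (cases "?pt \<in> IV")
      case True
      then have nb: "?pt \<notin> BV" by (simp add: interior_vertices_def)
      then have "?pt \<notin> corner_vertices T" using corner_vertex_boundary(1) by blast
      moreover have "\<rho> \<in> BE \<Longrightarrow> ?pt \<notin> \<rho>" for \<rho> using nb pt by (auto simp: boundary_vertices_def)
      ultimately show ?thesis using vertex True fa
        by (simp add: sum_dof_star coeff_star_def Let_def bc_def vc_def if_scale sum_filter scaleR_sum_right cong: if_cong)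
    next
      case False
      then show ?thesis using vertex
        by (cases "?pt \<in> corner_vertices T")
           (simp_all add: sum_dof_star coeff_star_def Let_def bc_def vc_def if_scale sum_filter scaleR_sum_right cong: if_cong)
    qed
  qed
qed

lemma star_bern: "F \<in> T \<Longrightarrow> star T z F s = bern (bc T z F (z (Face F))) s"
proof -
  assume F: "F \<in> T"
  have "star T z F s = bern (\<lambda>j k. \<Sum>\<phi>\<in>dof_star T. coeff_star T \<phi> F j k *\<^sub>R z \<phi>) s"
    unfolding spline_def basis_star_bern bern_sum_eq ..
  also have "\<dots> = bern (bc T z F (z (Face F))) s"
    by (rule bern_cong) (rule coeff_star_sum[OF F])
  finally show ?thesis .
qed

lemma star_frame: "F \<in> T \<Longrightarrow> d \<in> frames \<Longrightarrow> star T z F (d s) = bern (bc T z (F \<circ> d) (z (Face F))) s"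
  by (simp add: star_bern bern_frame bc_frame cong: bern_cong)

lemma star_subdiv:
  assumes "F \<in> T" "d \<in> frames" "j \<le> 3" "k \<le> 3"
  shows "subdiv_coeff (star T z F \<circ> d) j k = subdiv (bc T z (F \<circ> d) (z (Face F))) j k"
  using subdiv_coeff_bsp[of "star T z F \<circ> d" "subdiv (bc T z (F \<circ> d) (z (Face F)))" j k] assms
  by (simp add: star_frame bern_subdiv)

lemma star_corner: "F \<in> T \<Longrightarrow> d \<in> frames \<Longrightarrow> star T z F (d (0,0)) = vc T z (F (d (0,0)))"
  by (simp add: star_frame bern_def sum_atMost_2 Bernstein_2 bc_local)

lemma value_at_star: "pt \<in> vertices T \<Longrightarrow> value_at T (star T z) pt = vc T z pt"
proof -
  assume pt: "pt \<in> vertices T"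
  then obtain F q where F: "F \<in> T" "q \<in> corners" "pt = F q" by (auto simp: vertices_def)
  have *: "star T z G s = vc T z pt" if G: "G \<in> T" "s \<in> sq" "G s = pt" for G s
  proof -
    have "s \<in> corners" using vertex_corner[OF pt G] .
    then obtain d where "d \<in> frames" "d (0,0) = s" using corner_frame by blast
    then show ?thesis using star_corner[OF G(1), of d z] G by simp
  qed
  show ?thesis unfolding value_at_def
  proof (rule the_equality)
    show "\<forall>F\<in>T. \<forall>s\<in>sq. F s = pt \<longrightarrow> star T z F s = vc T z pt" using * by blast
    show "y = vc T z pt" if "\<forall>F\<in>T. \<forall>s\<in>sq. F s = pt \<longrightarrow> star T z F s = y" for y
      using that F * by (metis corners_square)
  qed
qed

lemma ec_glued:
  assumes "F \<in> T" "G \<in> T" "d \<in> frames" "e \<in> frames" "glued F d G e" "F \<noteq> G"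
  shows "ec T z (side F d) = (1/2) *\<^sub>R (z (Face F) + z (Face G))"
  using glued_incident[OF assms] assms(6) by (simp add: ec_def)

lemma ec_boundary: "\<tau> \<in> BE \<Longrightarrow> ec T z \<tau> = z (BEdge \<tau>)"
  by (simp add: ec_def interior_edges_def)

text \<open>The source of smoothness at ordinary vertices. In the interior both sides equal half the
  sum of the four face values around the vertex; on the boundary the vertex coefficient is by
  definition the mean of the two boundary edges.\<close>

lemma opposite_coeff:
  assumes F: "F \<in> T" and G: "G \<in> T" and d: "d \<in> frames" and e: "e \<in> frames"
    and g: "glued F d G e" and ne: "F \<noteq> G" and ord: "F (d (0,0)) \<notin> EV"
  shows "ec T z (side F (d \<circ> swp)) + ec T z (side G (e \<circ> swp)) = 2 *\<^sub>R vc T z (F (d (0,0)))"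
proof -
  let ?pt = "F (d (0,0))"
  have pt: "?pt \<in> vertices T" using F d frame_origin_vertex by blast
  from pt ord show ?thesis
  proof (cases rule: ordinary_cases)
    case 1
    obtain H h H' h' where H: "H \<in> T" "H' \<in> T" "h \<in> frames" "h' \<in> frames"
      "glued F (d \<circ> swp) H h" "glued G (e \<circ> swp) H' h'" "distinct [F, G, H, H']"
      "faces_at T ?pt = {F, G, H, H'}"
      using opposite_interior[OF F G d e g ne 1(2,1)] by metis
    have "ec T z (side F (d \<circ> swp)) = (1/2) *\<^sub>R (z (Face F) + z (Face H))"
      "ec T z (side G (e \<circ> swp)) = (1/2) *\<^sub>R (z (Face G) + z (Face H'))"
      using ec_glued[of F H "d \<circ> swp" h z] ec_glued[of G H' "e \<circ> swp" h' z] F G d e H by auto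
    moreover have "vc T z ?pt = (1/4) *\<^sub>R (z (Face F) + z (Face G) + z (Face H) + z (Face H'))"
      using 1 H(7,8) by (simp add: vc_def valence_def add_ac)
    ultimately show ?thesis by (simp add: scaleR_add_right add_ac)
  next
    case 2
    note ob = opposite_boundary[OF F G d e g ne 2(2,1)]
    have "side F (d \<circ> swp) \<in> BE" "side G (e \<circ> swp) \<in> BE" using ob(2) by blast+
    moreover have "?pt \<notin> IV" using 2 by (simp add: interior_vertices_def)
    moreover have "?pt \<notin> corner_vertices T" using ob(1) ne by (simp add: corner_vertices_def valence_def)
    ultimately show ?thesis using ob by (simp add: ec_boundary vc_def)
  qed
qed

text \<open>On a common side only the coefficients of that side enter, and these are attached to
  vertices and edges as point sets, not to faces.\<close>

lemma star_continuous:
  assumes F: "F \<in> T" and G: "G \<in> T" and s: "s \<in> sq" and t: "t \<in> sq" and eq: "F s = G t"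
  shows "star T z F s = star T z G t"
proof (cases "F = G")
  case True
  then show ?thesis using face_eq[OF F s t] eq by simp
next
  case False
  show ?thesis
  proof (cases "s \<in> corners \<and> t \<in> corners")
    case True
    then obtain d e where "d \<in> frames" "d (0,0) = s" "e \<in> frames" "e (0,0) = t" using corner_frame by metis
    then show ?thesis using star_corner[OF F, of d z] star_corner[OF G, of e z] eq by simp
  next
    case False
    then obtain d e r where *: "d \<in> frames" "e \<in> frames" "glued F d G e" "0 \<le> r" "r \<le> 1"
      "s = d (r,0)" "t = e (r,0)" using meet[OF F G s t eq \<open>F \<noteq> G\<close>] by metis
    have "bc T z (F \<circ> d) y j 0 = bc T z (G \<circ> e) y' j 0" if "j \<le> 2" for j y y'
    proof -
      have "F (d (1,0)) = G (e (1,0))" "F (d (0,0)) = G (e (0,0))" using *(3) by (auto simp: glued_def)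
      moreover have "j = 0 \<or> j = 1 \<or> j = 2" using that by auto
      ultimately show ?thesis using glued_side[OF *(3)] cell_side[of F d] cell_side[of G e] by (auto simp: bc_def)
    qed
    from this[of 0 "z (Face F)" "z (Face G)"] this[of "Suc 0" "z (Face F)" "z (Face G)"]
      this[of 2 "z (Face F)" "z (Face G)"]
    show ?thesis using * F G by (simp add: star_frame bern_def sum_atMost_2 Bernstein_2)
  qed
qed

end

section \<open>Coefficients of almost-\<open>C\<^sup>1\<close> splines\<close>

lemma collinear_cross:
  fixes a b c :: "real^3"
  shows "collinear {a, b, c} \<longleftrightarrow> cross3 (b - a) (c - a) = 0"
proof -
  have "collinear {a, b, c} \<longleftrightarrow> collinear {b, a, c}" by (simp add: insert_commute)
  also have "\<dots> \<longleftrightarrow> collinear {0, b - a, c - a}" by (rule collinear_3) (simp add: NO_MATCH_def)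
  finally show ?thesis by (simp add: cross_eq_0)
qed

text \<open>Existence: the edge vectors of the triangle span a space of dimension 2 inside the plane
  orthogonal to \<open>n\<close>, hence all of it. Uniqueness: cross products with the edge vectors
  read off the two coefficients.\<close>

lemma barycentric_plane:
  fixes t :: "nat \<Rightarrow> real^3"
  assumes nc: "\<not> collinear {t 1, t 2, t 3}" and n: "n \<noteq> 0"
    and t: "\<And>\<nu>. \<nu> \<in> {1,2,3} \<Longrightarrow> (t \<nu> - c) \<bullet> n = 0" and p: "(p - c) \<bullet> n = 0"
  shows "(\<Sum>\<nu>\<in>{1,2,3}. barycentric t p \<nu>) = 1" "(\<Sum>\<nu>\<in>{1,2,3}. barycentric t p \<nu> *\<^sub>R t \<nu>) = p"
proof -
  let ?u = "t 2 - t 1" and ?v = "t 3 - t 1"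
  have cr: "cross3 ?u ?v \<noteq> 0" using nc by (simp add: collinear_cross)
  have un: "?u \<bullet> n = 0" "?v \<bullet> n = 0" "(p - t 1) \<bullet> n = 0"
    using t[of 1] t[of 2] t[of 3] p by (simp_all add: inner_diff_left)
  have "span {?u, ?v} = {w. n \<bullet> w = 0}"
  proof (rule subspace_dim_equal[OF subspace_span subspace_hyperplane])
    show "span {?u, ?v} \<subseteq> {w. n \<bullet> w = 0}"
      by (rule span_minimal[OF _ subspace_hyperplane]) (use un in \<open>auto simp: inner_commute\<close>)
    show "dim {w. n \<bullet> w = 0} \<le> dim (span {?u, ?v})"
      using dim_hyperplane[OF n] span_cross[OF cr] by simp
  qed
  then have "p - t 1 \<in> span {?u, ?v}" using un by (simp add: inner_commute)
  then obtain a b where ab: "p - t 1 = a *\<^sub>R ?u + b *\<^sub>R ?v"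
    by (auto simp: span_breakdown_eq span_singleton algebra_simps)
  define l where "l \<nu> = (if \<nu> = 1 then 1 - a - b else if \<nu> = 2 then a else if \<nu> = 3 then b else 0)" for \<nu> :: nat
  let ?P = "\<lambda>l. (\<forall>\<nu>. \<nu> \<notin> {1,2,3} \<longrightarrow> l \<nu> = 0) \<and>
             (\<Sum>\<nu>\<in>{1,2,3}. l \<nu>) = 1 \<and> (\<Sum>\<nu>\<in>{1,2,3}. l \<nu> *\<^sub>R t \<nu>) = p"
  have sum3: "(\<Sum>\<nu>\<in>{1,2,3::nat}. h \<nu>) = h 1 + h 2 + h 3" for h :: "nat \<Rightarrow> 'b::comm_monoid_add"
    by (simp add: add.assoc)
  have P: "?P l"
    unfolding sum3 using ab by (auto simp: l_def algebra_simps)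
  have "barycentric t p = l"
    unfolding barycentric_def
  proof (rule the_equality)
    show "?P l" by (rule P)
    fix m assume m: "?P m"
    let ?d = "\<lambda>\<nu>. m \<nu> - l \<nu>"
    have 1: "?d 1 = - ?d 2 - ?d 3" using m P unfolding sum3 by linarith
    have "?d 1 *\<^sub>R t 1 + ?d 2 *\<^sub>R t 2 + ?d 3 *\<^sub>R t 3 = 0"
      using m P unfolding sum3 by (simp add: scaleR_left_diff_distrib algebra_simps)
    then have z: "?d 2 *\<^sub>R ?u + ?d 3 *\<^sub>R ?v = 0" unfolding 1 by (simp add: algebra_simps)
    have "cross3 (?d 2 *\<^sub>R ?u + ?d 3 *\<^sub>R ?v) ?v = ?d 2 *\<^sub>R cross3 ?u ?v"
      "cross3 ?u (?d 2 *\<^sub>R ?u + ?d 3 *\<^sub>R ?v) = ?d 3 *\<^sub>R cross3 ?u ?v"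
      by (simp_all only: cross_add_left cross_add_right cross_mult_left cross_mult_right cross_refl scaleR_zero_right add_0_right add_0_left)
    then have "?d 2 = 0" "?d 3 = 0" unfolding z using cr by simp_all
    then have "m 1 = l 1" "m 2 = l 2" "m 3 = l 3" using 1 by simp_all
    moreover have "m \<nu> = 0" "l \<nu> = 0" if "\<nu> \<notin> {1,2,3}" for \<nu> using m P that by blast+
    ultimately have "m \<nu> = l \<nu>" for \<nu> by (cases "\<nu> \<in> {1,2,3}") auto
    then show "m = l" by blast
  qed
  then show "(\<Sum>\<nu>\<in>{1,2,3}. barycentric t p \<nu>) = 1" "(\<Sum>\<nu>\<in>{1,2,3}. barycentric t p \<nu> *\<^sub>R t \<nu>) = p"
    using P by blast+
qed

lemma plane_proj_plane: "n \<noteq> 0 \<Longrightarrow> (plane_proj c n y - c) \<bullet> n = 0"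
  by (simp add: plane_proj_def inner_diff_left)

lemma plane_proj_fixed: "(y - c) \<bullet> n = 0 \<Longrightarrow> plane_proj c n y = y"
  by (simp add: plane_proj_def)

text \<open>The B-spline coefficients of every basis function on every face in one formula. On faces
  without extraordinary vertices no block is cleared, so the case distinction in
  \<open>basis\<close> disappears.\<close>

definition bcoef ::
  "'p mesh \<Rightarrow> ('p dof \<Rightarrow> real^3) \<Rightarrow> ('p \<Rightarrow> real^3) \<Rightarrow> ('p \<Rightarrow> nat \<Rightarrow> real^3) \<Rightarrow>
   'p dof \<Rightarrow> 'p face \<Rightarrow> nat \<Rightarrow> nat \<Rightarrow> real"
where
  "bcoef T xs n tri \<phi> F j k =
     (case \<phi> of
        Tri pt \<nu> \<Rightarrow> if F (block_corner j k) = pt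
                  then barycentric (tri pt) (proj_coeff T xs n pt F j k) \<nu> else 0
      | _ \<Rightarrow> if F (block_corner j k) \<in> extraordinary T then 0
             else subdiv_coeff (basis_star T \<phi> F) j k)"

lemma block_corner_corners: "j \<le> 3 \<Longrightarrow> k \<le> 3 \<Longrightarrow> block_corner j k \<in> corners"
proof -
  assume "j \<le> 3" "k \<le> 3"
  then have "j = 0 \<or> j = 1 \<or> j = 2 \<or> j = 3" "k = 0 \<or> k = 1 \<or> k = 2 \<or> k = 3" by auto
  then show ?thesis by (auto simp: block_corner_def corners_iff)
qed

lemma subdiv_coeff_basis_star: "j \<le> 3 \<Longrightarrow> k \<le> 3 \<Longrightarrow> subdiv_coeff (basis_star T \<phi> F) j k = subdiv (coeff_star T \<phi> F) j k"
  by (subst subdiv_coeff_bsp[of _ "subdiv (coeff_star T \<phi> F)"]) (simp_all add: basis_star_bern bern_subdiv)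

lemma basis_bsp: "basis T xs n tri \<phi> F s = bsp (bcoef T xs n tri \<phi> F) s"
proof (cases "\<exists>pt \<nu>. \<phi> = Tri pt \<nu>")
  case True
  then show ?thesis by (auto simp: basis_def bsp_def bcoef_def mult.commute)
next
  case False
  show ?thesis
  proof (cases "carrier_of F \<inter> extraordinary T = {}")
    case True
    have "F (block_corner j k) \<notin> extraordinary T" if "j \<le> 3" "k \<le> 3" for j k
      using True corners_square[OF block_corner_corners[OF that]] unfolding carrier_of_def by blast
    then have "bcoef T xs n tri \<phi> F j k = subdiv (coeff_star T \<phi> F) j k" if "j \<le> 3" "k \<le> 3" for j k
      using False that by (auto simp: bcoef_def subdiv_coeff_basis_star split: dof.split)
    then have "bsp (bcoef T xs n tri \<phi> F) s = basis_star T \<phi> F s"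
      unfolding basis_star_bern bern_subdiv by (intro bsp_cong)
    then show ?thesis using False True by (auto simp: basis_def split: dof.split)
  next
    case False
    then show ?thesis using \<open>\<not> (\<exists>pt \<nu>. \<phi> = Tri pt \<nu>)\<close>
      by (auto simp: basis_def bsp_def bcoef_def mult.commute split: dof.split)
  qed
qed

lemma spline_basis_bsp:
  "spline (dof T) (basis T xs n tri) z F s = bsp (\<lambda>j k. \<Sum>\<phi>\<in>dof T. bcoef T xs n tri \<phi> F j k *\<^sub>R z \<phi>) s"
  by (simp add: spline_def basis_bsp bsp_sum_eq)

lemma subdiv_simps:
  "subdiv c 0 0 = c 0 0" "subdiv c (Suc 0) 0 = (1/2) *\<^sub>R (c 0 0 + c (Suc 0) 0)" "subdiv c 0 (Suc 0) = (1/2) *\<^sub>R (c 0 0 + c 0 (Suc 0))"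
  "subdiv c (Suc 0) (Suc 0) = (1/4) *\<^sub>R (c 0 0 + c (Suc 0) 0 + c 0 (Suc 0) + c (Suc 0) (Suc 0))"
proof -
  have h: "x + x = 2 *\<^sub>R x" for x :: 'a by (simp add: scaleR_2)
  show "subdiv c 0 0 = c 0 0" "subdiv c (Suc 0) 0 = (1/2) *\<^sub>R (c 0 0 + c (Suc 0) 0)" "subdiv c 0 (Suc 0) = (1/2) *\<^sub>R (c 0 0 + c 0 (Suc 0))"
    by (simp_all add: subdiv_def h flip: scaleR_add_right)
  show "subdiv c (Suc 0) (Suc 0) = (1/4) *\<^sub>R (c 0 0 + c (Suc 0) 0 + c 0 (Suc 0) + c (Suc 0) (Suc 0))"
    by (simp add: subdiv_def scaleR_add_right add_ac)
qed

lemma subdiv_local_cong: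
  assumes "j \<le> 1" "k \<le> 1" "c 0 0 = c' 0 0" "c (Suc 0) 0 = c' (Suc 0) 0" "c 0 (Suc 0) = c' 0 (Suc 0)"
    "c (Suc 0) (Suc 0) = c' (Suc 0) (Suc 0)"
  shows "subdiv c j k = subdiv c' j k"
proof -
  have "j = 0 \<or> j = Suc 0" "k = 0 \<or> k = Suc 0" using assms by auto
  then show ?thesis using assms by (auto simp: subdiv_simps)
qed

context qmesh
begin

lemma finite_dof [simp]: "finite (dof T)"
proof -
  have "{Tri pt \<nu> | pt \<nu>. pt \<in> EV \<and> \<nu> \<in> {1,2,3::nat}} = (\<lambda>(pt,\<nu>). Tri pt \<nu>) ` (EV \<times> {1,2,3})"
    by auto
  then show ?thesis by (simp add: dof_def)
qed

lemma vc_cong: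
  assumes pt: "pt \<in> vertices T"
    and "\<And>F. F \<in> faces_at T pt \<Longrightarrow> z (Face F) = z' (Face F)"
    "\<And>\<rho>. \<rho> \<in> BE \<Longrightarrow> pt \<in> \<rho> \<Longrightarrow> z (BEdge \<rho>) = z' (BEdge \<rho>)"
    "pt \<in> corner_vertices T \<Longrightarrow> z (Corner pt) = z' (Corner pt)"
  shows "vc T z pt = vc T z' pt"
  using assms by (auto simp: vc_def intro!: sum.cong)

lemma ec_cong:
  assumes F: "F \<in> T" "d \<in> frames"
    and "\<And>G. G \<in> T \<Longrightarrow> side F d \<subseteq> carrier_of G \<Longrightarrow> z (Face G) = z' (Face G)"
    "side F d \<in> BE \<Longrightarrow> z (BEdge (side F d)) = z' (BEdge (side F d))"
  shows "ec T z (side F d) = ec T z' (side F d)"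
  using assms(3,4) side_edges[OF F] by (auto simp: ec_def incident_def interior_edges_def intro!: sum.cong)

lemma spline_local_frame:
  assumes "F \<in> T" "d \<in> frames" "j \<le> 1" "k \<le> 1"
  shows "subdiv_coeff (spline (dof T) (basis T xs n tri) z F \<circ> d) j k =
    (\<Sum>\<phi>\<in>dof T. bcoef T xs n tri \<phi> F (fst (idx 3 d j k)) (snd (idx 3 d j k)) *\<^sub>R z \<phi>)"
proof -
  have "subdiv_coeff (spline (dof T) (basis T xs n tri) z F \<circ> d) j k =
     act 3 d (\<lambda>j k. \<Sum>\<phi>\<in>dof T. bcoef T xs n tri \<phi> F j k *\<^sub>R z \<phi>) j k"
    by (rule subdiv_coeff_frame) (use assms in \<open>auto simp: spline_basis_bsp\<close>)
  then show ?thesis by (simp add: act_def case_prod_unfold)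
qed

text \<open>In the block of an extraordinary vertex the functions of faces, edges and corners are
  cleared and the triangle functions of other vertices have no share, so three terms of the sum
  remain.\<close>

lemma spline_local_extraordinary:
  assumes F: "F \<in> T" and d: "d \<in> frames" and jk: "j \<le> 1" "k \<le> 1" and pt: "F (d (0,0)) \<in> EV"
  shows "subdiv_coeff (spline (dof T) (basis T xs n tri) z F \<circ> d) j k =
    (\<Sum>\<nu>\<in>{1,2,3}. barycentric (tri (F (d (0,0))))
       (plane_proj (vc T xs (F (d (0,0)))) (n (F (d (0,0)))) (subdiv (bc T xs (F \<circ> d) (xs (Face F))) j k)) \<nu>
         *\<^sub>R z (Tri (F (d (0,0))) \<nu>))"
proof -
  let ?pt = "F (d (0,0))"
  obtain j' k' where jk': "idx 3 d j k = (j', k')" by (cases "idx 3 d j k")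
  have b: "block_corner j' k' = d (0,0)" "j' \<le> 3" "k' \<le> 3" using block_corner_idx[OF d jk] jk' by auto
  have s: "subdiv_coeff (star T xs F) j' k' = subdiv (bc T xs (F \<circ> d) (xs (Face F))) j k"
  proof -
    have 1: "subdiv_coeff (star T xs F \<circ> d) j k = act 3 d (subdiv (bc T xs F (xs (Face F)))) j k"
      by (rule subdiv_coeff_frame) (use F d jk in \<open>auto simp: star_bern bern_subdiv\<close>)
    have 2: "subdiv_coeff (star T xs F) j' k' = subdiv (bc T xs F (xs (Face F))) j' k'"
      by (subst subdiv_coeff_bsp[of _ "subdiv (bc T xs F (xs (Face F)))"]) (use b F in \<open>auto simp: star_bern bern_subdiv\<close>)
    have "subdiv_coeff (star T xs F \<circ> d) j k = subdiv (bc T xs (F \<circ> d) (xs (Face F))) j k"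
      by (rule star_subdiv) (use F d jk in auto)
    then show ?thesis using 1 2 jk' by (simp add: act_def)
  qed
  have p: "proj_coeff T xs n ?pt F j' k' =
     plane_proj (vc T xs ?pt) (n ?pt) (subdiv (bc T xs (F \<circ> d) (xs (Face F))) j k)"
    using value_at_star[OF extraordinary_vertex[OF pt], of xs] s
    by (simp add: proj_coeff_def vertex_proj_def geometry_star_def)
  have "(\<Sum>\<phi>\<in>dof T. bcoef T xs n tri \<phi> F j' k' *\<^sub>R z \<phi>) =
    (\<Sum>\<phi>\<in>Tri ?pt ` {1,2,3}. bcoef T xs n tri \<phi> F j' k' *\<^sub>R z \<phi>)"
  proof (rule sum.mono_neutral_right[OF finite_dof])
    show "Tri ?pt ` {1, 2, 3} \<subseteq> dof T" using pt by (auto simp: dof_def)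
    show "\<forall>\<phi>\<in>dof T - Tri ?pt ` {1, 2, 3}. bcoef T xs n tri \<phi> F j' k' *\<^sub>R z \<phi> = 0"
      using pt b by (auto simp: dof_def bcoef_def split: if_splits)
  qed
  also have "\<dots> = (\<Sum>\<nu>\<in>{1,2,3}. bcoef T xs n tri (Tri ?pt \<nu>) F j' k' *\<^sub>R z (Tri ?pt \<nu>))"
    by (rule sum.reindex_cong[of "Tri ?pt"]) (auto simp: inj_on_def)
  finally show ?thesis
    unfolding spline_local_frame[OF F d jk] jk' fst_conv snd_conv by (simp add: bcoef_def b p)
qed

lemma spline_local_ordinary:
  fixes z :: "'p dof \<Rightarrow> 'a::real_vector"
  assumes F: "F \<in> T" and d: "d \<in> frames" and jk: "j \<le> 1" "k \<le> 1" and pt: "F (d (0,0)) \<notin> EV"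
  shows "subdiv_coeff (spline (dof T) (basis T xs n tri) z F \<circ> d) j k = subdiv (bc T z (F \<circ> d) (z (Face F))) j k"
proof -
  let ?pt = "F (d (0,0))"
  obtain j' k' where jk': "idx 3 d j k = (j', k')" by (cases "idx 3 d j k")
  have b: "block_corner j' k' = d (0,0)" "j' \<le> 3" "k' \<le> 3" using block_corner_idx[OF d jk] jk' by auto
  have ptv: "?pt \<in> vertices T" using frame_origin_vertex F d by blast
  \<comment> \<open>\<open>dof_star T\<close> exceeds \<open>dof T\<close> by faces and edges all of
    whose vertices are extraordinary. Giving these the value 0 allows summation over the union of
    both sets.\<close>
  define z' where "z' \<phi> = (if \<phi> \<in> dof T then z \<phi> else 0)" for \<phi>
  have "(\<Sum>\<phi>\<in>dof T. bcoef T xs n tri \<phi> F j' k' *\<^sub>R z \<phi>) =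
    (\<Sum>\<phi>\<in>dof T \<union> dof_star T. bcoef T xs n tri \<phi> F j' k' *\<^sub>R z' \<phi>)"
    by (rule sum.mono_neutral_cong_left) (auto simp: z'_def)
  also have "\<dots> = (\<Sum>\<phi>\<in>dof_star T. subdiv (coeff_star T \<phi> F) j' k' *\<^sub>R z' \<phi>)"
  proof (rule sum.mono_neutral_cong_right)
    show "\<forall>\<phi>\<in>dof T \<union> dof_star T - dof_star T. bcoef T xs n tri \<phi> F j' k' *\<^sub>R z' \<phi> = 0"
      using pt b by (auto simp: dof_def dof_star_def bcoef_def)
    show "\<And>\<phi>. \<phi> \<in> dof_star T \<Longrightarrow> bcoef T xs n tri \<phi> F j' k' *\<^sub>R z' \<phi> = subdiv (coeff_star T \<phi> F) j' k' *\<^sub>R z' \<phi>"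
      using pt b by (auto simp: dof_star_def bcoef_def subdiv_coeff_basis_star)
  qed auto
  also have "\<dots> = subdiv_coeff (star T z' F) j' k'"
    by (subst subdiv_coeff_bsp[of _ "\<lambda>j k. \<Sum>\<phi>\<in>dof_star T. subdiv (coeff_star T \<phi> F) j k *\<^sub>R z' \<phi>"])
       (use b in \<open>auto simp: bsp_sum_eq spline_def basis_star_bern bern_subdiv\<close>)
  also have "\<dots> = subdiv (bc T z' (F \<circ> d) (z' (Face F))) j k"
  proof -
    have 1: "subdiv_coeff (star T z' F \<circ> d) j k = act 3 d (subdiv (bc T z' F (z' (Face F)))) j k"
      by (rule subdiv_coeff_frame) (use F d jk in \<open>auto simp: star_bern bern_subdiv\<close>)
    have 2: "subdiv_coeff (star T z' F) j' k' = subdiv (bc T z' F (z' (Face F))) j' k'"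
      by (subst subdiv_coeff_bsp[of _ "subdiv (bc T z' F (z' (Face F)))"]) (use b F in \<open>auto simp: star_bern bern_subdiv\<close>)
    have "subdiv_coeff (star T z' F \<circ> d) j k = subdiv (bc T z' (F \<circ> d) (z' (Face F))) j k"
      by (rule star_subdiv) (use F d jk in auto)
    then show ?thesis using 1 2 jk' by (simp add: act_def)
  qed
  also have "\<dots> = subdiv (bc T z (F \<circ> d) (z (Face F))) j k"
  proof -
    \<comment> \<open>Whatever touches an ordinary vertex is in \<open>dof T\<close>, so the zeros
      introduced above are invisible in its block.\<close>
    have Fd: "z' (Face G) = z (Face G)" if "G \<in> T" "?pt \<in> carrier_of G" for G
      using that pt ptv by (auto simp: z'_def dof_def)
    have Bd: "z' (BEdge \<rho>) = z (BEdge \<rho>)" if "\<rho> \<in> BE" "?pt \<in> \<rho>" for \<rho>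
      using that pt ptv by (auto simp: z'_def dof_def)
    have v: "vc T z' ?pt = vc T z ?pt"
      by (rule vc_cong[OF ptv]) (auto simp: Fd Bd faces_at_def, simp add: z'_def dof_def)
    have e: "ec T z' (side F e) = ec T z (side F e)" if "e \<in> frames" "F (e (0,0)) = ?pt" for e
      by (rule ec_cong[OF F that(1)]) (use Fd Bd side_origin[of F e] that(2) in auto)
    have f: "z' (Face F) = z (Face F)"
      by (rule Fd[OF F]) (use faces_at_origin[OF F d] in \<open>simp add: faces_at_def\<close>)
    show ?thesis
      by (rule subdiv_local_cong[OF jk]) (simp_all add: bc_local v e d f)
  qed
  finally show ?thesis unfolding spline_local_frame[OF F d jk] jk' by simp
qed

end

section \<open>Coefficient blocks of an almost-C1 geometry\<close>

locale geometry = qmesh T for T :: "'p mesh" +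
  fixes xs :: "'p dof \<Rightarrow> real^3" and n :: "'p \<Rightarrow> real^3" and tri :: "'p \<Rightarrow> nat \<Rightarrow> real^3"
  assumes input: "almost_C1_input T xs n tri"
begin

definition x :: "('p, real^3) mesh_fun" where
  "x = almost_C1_geometry T xs n tri"

text \<open>Extended by the identity to ordinary vertices, so that \<open>lc_eq\<close> describes
  the blocks of a geometry at all vertices uniformly.\<close>

definition P :: "'p \<Rightarrow> real^3 \<Rightarrow> real^3" where
  "P pt y = (if pt \<in> EV then plane_proj (vc T xs pt) (n pt) y else y)"

definition lc :: "'p face \<Rightarrow> frame \<Rightarrow> nat \<Rightarrow> nat \<Rightarrow> real^3" where
  "lc F d = subdiv_coeff (x F \<circ> d)"

lemma input_vertex:
  assumes "pt \<in> EV"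
  shows "n pt \<noteq> 0" "\<And>\<nu>. \<nu> \<in> {1,2,3} \<Longrightarrow> (tri pt \<nu> - vc T xs pt) \<bullet> n pt = 0"
    "\<not> collinear {tri pt 1, tri pt 2, tri pt 3}"
  using input assms value_at_star[OF extraordinary_vertex[OF assms], of xs]
  unfolding almost_C1_input_def geometry_star_def by auto

lemma P_fix [simp]: "P pt (vc T xs pt) = vc T xs pt"
  by (simp add: P_def plane_proj_fixed)

lemma P_plane: "pt \<in> EV \<Longrightarrow> (P pt y - vc T xs pt) \<bullet> n pt = 0"
  using plane_proj_plane[OF input_vertex(1)] by (simp add: P_def)

lemma barycentric_sums:
  assumes "pt \<in> EV" "(y - vc T xs pt) \<bullet> n pt = 0"
  shows "(\<Sum>\<nu>\<in>{1,2,3}. barycentric (tri pt) y \<nu>) = 1"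
    "(\<Sum>\<nu>\<in>{1,2,3}. barycentric (tri pt) y \<nu> *\<^sub>R tri pt \<nu>) = y"
  using barycentric_plane[OF input_vertex(3)[OF assms(1)] input_vertex(1)[OF assms(1)] input_vertex(2)[OF assms(1)] assms(2)]
  by blast+

lemma vc_control: "vc T (control_point xs tri) = vc T xs" "ec T (control_point xs tri) = ec T xs"
  by (rule ext, simp add: vc_def ec_def control_point_def)+

text \<open>At an extraordinary vertex the barycentric coordinates recombine with the triangle
  vertices to the projected point itself: the choice of the control triangle influences the basis
  but not the geometry.\<close>

lemma lc_eq:
  assumes F: "F \<in> T" and d: "d \<in> frames" and jk: "j \<le> 1" "k \<le> 1"
  shows "lc F d j k = P (F (d (0,0))) (subdiv (bc T xs (F \<circ> d) (xs (Face F))) j k)"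
proof (cases "F (d (0,0)) \<in> EV")
  case True
  then show ?thesis
    unfolding lc_def x_def almost_C1_geometry_def spline_local_extraordinary[OF F d jk True]
    using barycentric_sums(2)[OF True P_plane[OF True]] by (simp add: P_def control_point_def)
next
  case False
  have cp: "control_point xs tri (Face F) = xs (Face F)" by (simp add: control_point_def)
  have "subdiv (bc T (control_point xs tri) (F \<circ> d) (control_point xs tri (Face F))) j k =
      subdiv (bc T xs (F \<circ> d) (xs (Face F))) j k"
    by (simp add: bc_def[abs_def] vc_control cp cong: if_cong)
  then show ?thesis
    unfolding lc_def x_def almost_C1_geometry_def spline_local_ordinary[OF F d jk False]
    using False by (simp add: P_def)
qed

lemma lc_simps:
  assumes "F \<in> T" "d \<in> frames"
  shows "lc F d 0 0 = vc T xs (F (d (0,0)))"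
    "lc F d (Suc 0) 0 = P (F (d (0,0))) ((1/2) *\<^sub>R (vc T xs (F (d (0,0))) + ec T xs (side F d)))"
    "lc F d 0 (Suc 0) = P (F (d (0,0))) ((1/2) *\<^sub>R (vc T xs (F (d (0,0))) + ec T xs (side F (d \<circ> swp))))"
    "lc F d (Suc 0) (Suc 0) = P (F (d (0,0))) ((1/4) *\<^sub>R (vc T xs (F (d (0,0))) + ec T xs (side F d) +
       ec T xs (side F (d \<circ> swp)) + xs (Face F)))"
  using assms by (simp_all add: lc_eq subdiv_simps bc_local)

lemma lc_plane:
  assumes "F \<in> T" "d \<in> frames" "j \<le> 1" "k \<le> 1" "F (d (0,0)) \<in> EV"
  shows "(lc F d j k - vc T xs (F (d (0,0)))) \<bullet> n (F (d (0,0))) = 0"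
  using lc_eq[OF assms(1-4)] P_plane[OF assms(5)] by simp

lemma x_bsp: "x F s = bsp (\<lambda>j k. \<Sum>\<phi>\<in>dof T. bcoef T xs n tri \<phi> F j k *\<^sub>R control_point xs tri \<phi>) s"
  by (simp add: x_def almost_C1_geometry_def spline_basis_bsp)

lemma x_lc: "d \<in> frames \<Longrightarrow> x F (d s) = bsp (lc F d) s"
proof -
  assume d: "d \<in> frames"
  have "x F (d s) = bsp (act 3 d (\<lambda>j k. \<Sum>\<phi>\<in>dof T. bcoef T xs n tri \<phi> F j k *\<^sub>R control_point xs tri \<phi>)) s"
    by (simp add: x_bsp bsp_frame d)
  also have "\<dots> = bsp (lc F d) s"
    by (rule bsp_cong) (simp add: lc_def subdiv_coeff_frame[OF x_bsp d])
  finally show ?thesis .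
qed

lemma lc_act: "F \<in> T \<Longrightarrow> d \<in> frames \<Longrightarrow> j \<le> 3 \<Longrightarrow> k \<le> 3 \<Longrightarrow> lc F d j k = act 3 d (lc F id) j k"
proof -
  assume "F \<in> T" "d \<in> frames" "j \<le> 3" "k \<le> 3"
  then show ?thesis
    unfolding lc_def using subdiv_coeff_frame[of "x F" "lc F id" d j k] x_lc[of id F] by (simp add: lc_def)
qed

end

section \<open>The matrices of the refinement rule\<close>

definition inner_point :: "bool \<Rightarrow> nat \<Rightarrow> (nat \<Rightarrow> 'a::real_vector) \<Rightarrow> (nat \<Rightarrow> 'a) \<Rightarrow> nat \<Rightarrow> 'a" where
  "inner_point cyc mu e f r = (\<Sum>k = 1..(if cyc then mu else mu - 1). S_mat cyc mu r k *\<^sub>R e k) +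
     (\<Sum>k = 1..mu. Q_mat cyc mu r k *\<^sub>R f k)"

text \<open>In a circulant matrix the next row is read one position earlier, cyclically;
  \<open>i\<close> is the distance from \<open>r\<close> to \<open>k\<close> around the vertex. For
  even valence the cyclic wrap preserves its parity.\<close>

lemma circulant_shift:
  assumes r: "r \<in> {1..mu}" and k: "k \<in> {1..mu}"
  obtains i where "i < mu" "(k + mu - r) mod mu = i" "i = 0 \<longleftrightarrow> k = r" "even mu \<Longrightarrow> (-1::real)^i = (-1)^(k + r)"
    "(k + mu - (if r = mu then 1 else r + 1)) mod mu = (if i = 0 then mu - 1 else i - 1)"
proof -
  define i where "i = (if k \<ge> r then k - r else k + mu - r)"
  have i: "i < mu" "(k + mu - r) mod mu = i"
    using r k by (auto simp: i_def mod_if)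
  have z: "i = 0 \<longleftrightarrow> k = r" using r k by (auto simp: i_def)
  have sh: "(k + mu - (if r = mu then 1 else r + 1)) mod mu = (if i = 0 then mu - 1 else i - 1)"
    using r k by (auto simp: i_def mod_if)
  have par: "(-1::real)^i = (-1)^(k + r)" if "even mu"
  proof -
    have "even i \<longleftrightarrow> even (k + r)" using that r k by (auto simp: i_def)
    then show ?thesis by (simp add: minus_one_power_iff)
  qed
  show ?thesis by (rule that[OF i z par sh])
qed

text \<open>Consecutive rows are added. For odd valence the alternating entries cancel except at k =
  r, where the first and the last entry add to 2. For even valence a multiple of the alternating
  vector is left over, since no matrix can solve y_r + y_(r+1) = 2 e_r for all right-hand sides;
  \<open>alt\<close> is the solvability condition.\<close>

lemma inner_point_interior:
  fixes e f :: "nat \<Rightarrow> 'a::real_vector"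
  assumes r: "r \<in> {1..mu}" and alt: "even mu \<Longrightarrow> (\<Sum>k = 1..mu. (-1)^k *\<^sub>R e k) = 0"
  shows "inner_point True mu e f r + inner_point True mu e f (if r = mu then 1 else r + 1) = 2 *\<^sub>R e r"
proof -
  let ?r' = "if r = mu then 1 else r + 1"
  have sum: "inner_point True mu e f r + inner_point True mu e f ?r' =
     (\<Sum>k = 1..mu. (S_mat True mu r k + S_mat True mu ?r' k) *\<^sub>R e k) +
     (\<Sum>k = 1..mu. (Q_mat True mu r k + Q_mat True mu ?r' k) *\<^sub>R f k)"
    by (simp add: inner_point_def scaleR_add_left sum.distrib)
  have delta: "(\<Sum>k = 1..mu. (if k = r then 2 else 0) *\<^sub>R e k) = 2 *\<^sub>R e r"
    using r by (simp add: if_distrib[of "\<lambda>x. x *\<^sub>R _"] cong: if_cong)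
  show ?thesis
  proof (cases "even mu")
    case True
    have "S_mat True mu r k + S_mat True mu ?r' k = (if k = r then 2 else 0) - (2 / real mu * (-1)^r) * (-1)^k"
      "Q_mat True mu r k + Q_mat True mu ?r' k = 0" if k: "k \<in> {1..mu}" for k
    proof -
      obtain i where i: "i < mu" "(k + mu - r) mod mu = i" "i = 0 \<longleftrightarrow> k = r" "even mu \<Longrightarrow> (-1::real)^i = (-1)^(k + r)"
        "(k + mu - ?r') mod mu = (if i = 0 then mu - 1 else i - 1)"
        using circulant_shift[OF r k] by metis
      have sg: "(-1::real)^r * (-1)^k = (-1)^i" using i(4)[OF True] by (simp add: power_add mult.commute)
      show "S_mat True mu r k + S_mat True mu ?r' k = (if k = r then 2 else 0) - (2 / real mu * (-1)^r) * (-1)^k"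
      proof (cases "k = r")
        case True
        then show ?thesis using i \<open>even mu\<close> sg
          unfolding S_mat_def circulant_def by (auto simp: field_simps)
      next
        case False
        then obtain j where "i = Suc j" using i(3) not0_implies_Suc by blast
        then show ?thesis using i \<open>even mu\<close> sg False
          unfolding S_mat_def circulant_def by (auto simp: field_simps)
      qed
      show "Q_mat True mu r k + Q_mat True mu ?r' k = 0"
      proof (cases "k = r")
        case True
        then have "i = 0" using i by simp
        moreover have "(-1::real)^mu = 1" using \<open>even mu\<close> by simp
        ultimately show ?thesis using i \<open>even mu\<close> unfolding Q_mat_def circulant_def by (auto simp: field_simps)
      next
        case False
        then obtain j where "i = Suc j" using i(3) not0_implies_Suc by blast
        then show ?thesis using i \<open>even mu\<close> False unfolding Q_mat_def circulant_def by (auto simp: field_simps)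
      qed
    qed
    then have "inner_point True mu e f r + inner_point True mu e f ?r' =
      (\<Sum>k = 1..mu. ((if k = r then 2 else 0) - (2 / real mu * (-1)^r) * (-1)^k) *\<^sub>R e k)"
      unfolding sum by simp
    also have "\<dots> = 2 *\<^sub>R e r - (2 / real mu * (-1)^r) *\<^sub>R (\<Sum>k = 1..mu. (-1)^k *\<^sub>R e k)"
      by (simp only: scaleR_left_diff_distrib sum_subtractf delta scaleR_sum_right scaleR_scaleR)
    finally show ?thesis using alt[OF True] by simp
  next
    case False
    have "S_mat True mu r k + S_mat True mu ?r' k = (if k = r then 2 else 0)" if k: "k \<in> {1..mu}" for k
    proof -
      obtain i where i: "i < mu" "(k + mu - r) mod mu = i" "i = 0 \<longleftrightarrow> k = r"
        "(k + mu - ?r') mod mu = (if i = 0 then mu - 1 else i - 1)"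
        using circulant_shift[OF r k] by metis
      show ?thesis
      proof (cases "k = r")
        case True
        then show ?thesis using i False by (simp add: S_mat_def circulant_def)
      next
        case False
        then obtain j where "i = Suc j" using i(3) not0_implies_Suc by blast
        then show ?thesis using i \<open>odd mu\<close> False by (simp add: S_mat_def circulant_def)
      qed
    qed
    moreover have "Q_mat True mu r k = 0" for r k using False by (simp add: Q_mat_def)
    ultimately show ?thesis unfolding sum using delta by simp
  qed
qed

text \<open>\<open>R_mat\<close> solves the equations from one end of the fan and its reversal from
  the other. In consecutive rows they leave 4 - 4r/mu and 4r/mu at k = r and nothing elsewhere, so
  their mean gives 2.\<close>

lemma inner_point_boundary:
  fixes e f :: "nat \<Rightarrow> 'a::real_vector"
  assumes r: "r \<in> {1..mu - 1}"
  shows "inner_point False mu e f r + inner_point False mu e f (Suc r) = 2 *\<^sub>R e r"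
proof -
  have S: "S_mat False mu r k + S_mat False mu (Suc r) k = (if k = r then 2 else 0)" if k: "k \<in> {1..mu - 1}" for k
  proof -
    consider "k = r" | "r < k" | "k < r" by linarith
    then show ?thesis
    proof cases
      case 1
      then show ?thesis using r by (auto simp: S_mat_def R_mat_def of_nat_diff field_simps)
    next
      case 2
      then obtain j where "k = r + Suc j" using less_iff_Suc_add by auto
      then show ?thesis using r k by (auto simp: S_mat_def R_mat_def)
    next
      case 3
      have "mu - k - (mu - r) = Suc (mu - k - (mu + 1 - r))" using 3 r k by auto
      then show ?thesis using r k 3 by (auto simp: S_mat_def R_mat_def)
    qed
  qed
  have Q: "Q_mat False mu r k + Q_mat False mu (Suc r) k = 0" for k
    by (simp add: Q_mat_def)
  have "inner_point False mu e f r + inner_point False mu e f (Suc r) =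
     (\<Sum>k = 1..mu-1. (S_mat False mu r k + S_mat False mu (Suc r) k) *\<^sub>R e k) +
     (\<Sum>k = 1..mu. (Q_mat False mu r k + Q_mat False mu (Suc r) k) *\<^sub>R f k)"
    by (simp add: inner_point_def scaleR_add_left sum.distrib)
  also have "\<dots> = (\<Sum>k = 1..mu-1. (if k = r then 2 else 0) *\<^sub>R e k)"
    using S Q by simp
  also have "\<dots> = 2 *\<^sub>R e r" using r by (simp add: if_distrib[of "\<lambda>x. x *\<^sub>R _"] cong: if_cong)
  finally show ?thesis .
qed

lemma sum_circulant:
  assumes r: "r \<in> {1..mu}" shows "(\<Sum>k = 1..mu. circulant mu a r k) = (\<Sum>i = 1..mu. a i)"
  unfolding circulant_def
proof (rule sum.reindex_bij_witness[of _ "\<lambda>i. if i + r \<le> mu + 1 then i + r - 1 else i + r - 1 - mu"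
      "\<lambda>k. (k + mu - r) mod mu + 1"])
qed (use r in \<open>auto simp: mod_if\<close>)

lemma alternating_sums:
  "(\<Sum>i = 1..m. (-1::real)^(i+1)) = (if odd m then 1 else 0)"
  "(\<Sum>i = 1..m. (-1::real)^(i+1) * real i) = (if odd m then (real m + 1) / 2 else - real m / 2)"
  by (induction m) (auto simp: field_simps)

text \<open>From the diagonal on, the entries are 4/mu times mu - k, mu - k - 1, ..., 1 with
  alternating signs, which sum to half of mu - k rounded up.\<close>

lemma R_mat_row: "k \<le> mu \<Longrightarrow> mu > 0 \<Longrightarrow> k \<ge> 1 \<Longrightarrow> (\<Sum>j = 1..mu-1. R_mat mu k j) = 4 / real mu * real ((mu - k + 1) div 2)"
proof -
  assume k: "k \<le> mu" "mu > 0" "k \<ge> 1"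
  have A: "(\<Sum>i<m. (-1::real)^i * real (m - i)) = real ((m + 1) div 2)" for m
  proof (induction m rule: nat_less_induct)
    case (1 m)
    consider "m = 0" | "m = 1" | l where "m = Suc (Suc l)" by (metis One_nat_def nat.exhaust)
    then show ?case
    proof cases
      case 3
      have "(\<Sum>i<m. (-1::real)^i * real (m - i)) = real m - real (m - 1) + (\<Sum>i<l. (-1::real)^i * real (l - i))"
        unfolding 3 sum.lessThan_Suc_shift by simp
      also have "\<dots> = 1 + real ((l + 1) div 2)" using 1 3 by simp
      finally show ?thesis using 3 by simp
    qed simp_all
  qed
  have "(\<Sum>j = 1..mu-1. R_mat mu k j) = (\<Sum>j = k..mu-1. (-1)^(j - k) * (4 - 4 * real j / real mu))"
    by (rule sum.mono_neutral_cong_right) (use k in \<open>auto simp: R_mat_def\<close>)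
  also have "\<dots> = (\<Sum>i<mu-k. 4 / real mu * ((-1)^i * real (mu - k - i)))"
    by (rule sum.reindex_bij_witness[of _ "\<lambda>i. i + k" "\<lambda>j. j - k"])
       (use k in \<open>auto simp: of_nat_diff field_simps\<close>)
  also have "\<dots> = 4 / real mu * real ((mu - k + 1) div 2)"
    unfolding sum_distrib_left[symmetric] A ..
  finally show ?thesis .
qed

text \<open>The rows of S and Q together sum to 1, so inner control points are affine combinations
  of coefficients. In the interior S alone has row sum 1; at a boundary vertex of odd valence Q
  compensates the rounding in the row sums of S.\<close>

lemma inner_point_const:
  assumes r: "r \<in> {1..mu}"
  shows "inner_point cyc mu (\<lambda>_. c) (\<lambda>_. c) r = (c :: 'a::real_vector)"
proof -
  have "(\<Sum>k = 1..(if cyc then mu else mu - 1). S_mat cyc mu r k) + (\<Sum>k = 1..mu. Q_mat cyc mu r k) = 1"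
  proof (cases cyc)
    case True
    show ?thesis
    proof (cases "odd mu")
      case odd: True
      then have "(\<Sum>k = 1..mu. S_mat cyc mu r k) = (\<Sum>k = 1..mu. circulant mu (\<lambda>i. (-1)^(i+1)) r k)"
        "(\<Sum>k = 1..mu. Q_mat cyc mu r k) = 0"
        using True by (simp_all add: S_mat_def Q_mat_def)
      then show ?thesis using odd True by (simp only: sum_circulant[OF r] alternating_sums) simp
    next
      case even: False
      have "(\<Sum>k = 1..mu. S_mat cyc mu r k) = (\<Sum>k = 1..mu. circulant mu (\<lambda>i. (-1)^(i+1) * (2 - 2 * real i / real mu)) r k)"
        using even True by (simp add: S_mat_def)
      also have "\<dots> = (\<Sum>i = 1..mu. 2 * (-1)^(i+1) - 2 / real mu * ((-1)^(i+1) * real i))"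
        unfolding sum_circulant[OF r] by (intro sum.cong refl) (simp add: algebra_simps)
      also have "\<dots> = 2 * (\<Sum>i = 1..mu. (-1)^(i+1)) - 2 / real mu * (\<Sum>i = 1..mu. (-1)^(i+1) * real i)"
        by (simp only: sum_subtractf sum_distrib_left)
      also have "\<dots> = 1" using even r unfolding alternating_sums by simp
      finally have S: "(\<Sum>k = 1..mu. S_mat cyc mu r k) = 1" .
      have "(\<Sum>k = 1..mu. Q_mat cyc mu r k) = (\<Sum>k = 1..mu. circulant mu (\<lambda>i. (-1)^(i+1)) r k) / real mu"
        using even True by (simp add: Q_mat_def sum_divide_distrib)
      then have "(\<Sum>k = 1..mu. Q_mat cyc mu r k) = 0"
        using even by (simp only: sum_circulant[OF r] alternating_sums) simp
      then show ?thesis using S True by simp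
    qed
  next
    case False
    have rev: "(\<Sum>k = 1..mu-1. R_mat mu (mu + 1 - r) (mu - k)) = (\<Sum>j = 1..mu-1. R_mat mu (mu + 1 - r) j)"
      by (rule sum.reindex_bij_witness[of _ "\<lambda>j. mu - j" "\<lambda>j. mu - j"]) auto
    have "(\<Sum>k = 1..mu-1. S_mat cyc mu r k) = ((\<Sum>k = 1..mu-1. R_mat mu r k) + (\<Sum>k = 1..mu-1. R_mat mu (mu + 1 - r) (mu - k))) / 2"
      using False by (simp add: S_mat_def sum.distrib flip: sum_divide_distrib)
    also have "\<dots> = 2 / real mu * (real ((mu - r + 1) div 2) + real (r div 2))"
    proof -
      have h: "mu - (mu + 1 - r) + 1 = r" using r by simp
      have "r \<le> mu" "mu > 0" "r \<ge> 1" "mu + 1 - r \<le> mu" "mu + 1 - r \<ge> 1" using r by auto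
      then have "(\<Sum>j = 1..mu-1. R_mat mu r j) = 4 / real mu * real ((mu - r + 1) div 2)"
        "(\<Sum>j = 1..mu-1. R_mat mu (mu + 1 - r) j) = 4 / real mu * real (r div 2)"
        using R_mat_row[of r mu] R_mat_row[of "mu + 1 - r" mu, unfolded h] by blast+
      then show ?thesis unfolding rev by (simp add: algebra_simps)
    qed
    finally have S: "(\<Sum>k = 1..mu-1. S_mat cyc mu r k) = 2 / real mu * (real ((mu - r + 1) div 2) + real (r div 2))" .
    have "(\<Sum>k = 1..mu. Q_mat cyc mu r k) = (\<Sum>k = 1..mu. (-1)^(r+1) / real mu * (-1)^(k+1))"
    proof (rule sum.cong[OF refl])
      fix k
      have pw: "(-1::real)^(r + k) = (-1)^(r+1) * (-1)^(k+1)" by (simp add: power_add)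
      show "Q_mat cyc mu r k = (-1)^(r+1) / real mu * (-1)^(k+1)"
        using False unfolding Q_mat_def pw by simp
    qed
    also have "\<dots> = (-1)^(r+1) / real mu * (if odd mu then 1 else 0)"
      unfolding sum_distrib_left[symmetric] alternating_sums ..
    finally have Q: "(\<Sum>k = 1..mu. Q_mat cyc mu r k) = (-1)^(r+1) / real mu * (if odd mu then 1 else 0)" .
    have "2 * (real ((mu - r + 1) div 2) + real (r div 2)) + (-1)^(r+1) * (if odd mu then 1 else 0) = real mu"
    proof -
      obtain m where mu: "mu = r + m" using r le_Suc_ex by auto
      show ?thesis
      proof (cases "even r"; cases "even m")
        assume "even r" "even m" then show ?thesis unfolding mu by (elim evenE) simp
      next
        assume "even r" "odd m" then show ?thesis unfolding mu by (elim evenE oddE) simp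
      next
        assume "odd r" "even m" then show ?thesis unfolding mu by (elim evenE oddE) simp
      next
        assume "odd r" "odd m" then show ?thesis unfolding mu by (elim oddE) simp
      qed
    qed
    then have "2 / real mu * (real ((mu - r + 1) div 2) + real (r div 2)) +
        (-1)^(r+1) / real mu * (if odd mu then 1 else 0) = 1"
      using r by (simp add: field_simps)
    moreover have "(if cyc then mu else mu - 1) = mu - 1" using False by simp
    ultimately show ?thesis by (simp only: S Q)
  qed
  then show ?thesis
    unfolding inner_point_def by (metis scaleR_sum_left scaleR_left_distrib scaleR_one)
qed

text \<open>A crude bound uniform in the valence; 4 bounds the numbers 4 - 4j/mu of the boundary
  case.\<close>

lemma S_mat_bound:
  assumes "r \<in> {1..mu}" "k \<in> {1..mu}" shows "\<bar>S_mat cyc mu r k\<bar> \<le> 4"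
proof -
  have R: "\<bar>R_mat mu i j\<bar> \<le> 4" if "j \<le> mu" for i j
  proof -
    have "0 \<le> real j / real mu" "real j / real mu \<le> 1" using that assms by auto
    then have "\<bar>4 - 4 * real j / real mu\<bar> \<le> 4" by auto
    then show ?thesis by (simp add: R_mat_def abs_mult power_abs)
  qed
  have i: "(k + mu - r) mod mu + 1 \<le> mu" using assms by (metis Suc_eq_plus1 Suc_leI atLeastAtMost_iff less_le_trans mod_less_divisor zero_less_one)
  have C: "\<bar>circulant mu (\<lambda>i. (-1)^(i+1) * (2 - 2 * real i / real mu)) r k\<bar> \<le> 4"
  proof -
    define i where "i = (k + mu - r) mod mu + 1"
    have "i \<le> mu" using i by (simp add: i_def)
    then have "0 \<le> real i / real mu" "real i / real mu \<le> 1" using assms by auto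
    then have "\<bar>2 - 2 * (real i / real mu)\<bar> \<le> 4" by linarith
    then show ?thesis unfolding circulant_def i_def[symmetric] by (simp add: abs_mult power_abs)
  qed
  show ?thesis
  proof (cases cyc)
    case True
    then show ?thesis using C by (auto simp: S_mat_def) (simp add: circulant_def power_abs)
  next
    case False
    then show ?thesis using R[of k r] R[of "mu - k" "mu + 1 - r"] assms by (auto simp: S_mat_def)
  qed
qed

lemma Q_mat_bound: "\<bar>Q_mat cyc mu r k\<bar> \<le> 1 / real mu"
  by (auto simp: Q_mat_def circulant_def abs_mult power_abs divide_simps)

lemma inner_point_linear:
  assumes "linear g" shows "g (inner_point cyc mu e f r) = inner_point cyc mu (\<lambda>k. g (e k)) (\<lambda>k. g (f k)) r"
  by (simp add: inner_point_def linear_add[OF assms] linear_sum[OF assms] linear_scale[OF assms])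

text \<open>At most mu entries of size 4 act on the spokes, while the entries of Q have size at most
  1/mu, so a row of Q has total weight at most 1. That \<open>G\<close> enters with factor 1 is what
  later allows the factor 1/4 of \<open>subdiv\<close> to contract.\<close>

lemma inner_point_norm:
  fixes e f :: "nat \<Rightarrow> 'a::real_normed_vector"
  assumes r: "r \<in> {1..mu}" and e: "\<And>k. k \<in> {1..(if cyc then mu else mu - 1)} \<Longrightarrow> norm (e k) \<le> E"
    and f: "\<And>k. k \<in> {1..mu} \<Longrightarrow> norm (f k) \<le> G" and "0 \<le> E"
  shows "norm (inner_point cyc mu e f r) \<le> 4 * real mu * E + G"
proof -
  let ?m = "if cyc then mu else mu - 1"
  have "norm (\<Sum>k = 1..?m. S_mat cyc mu r k *\<^sub>R e k) \<le> (\<Sum>k = 1..?m. 4 * E)"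
  proof (rule sum_norm_le)
    fix k assume k: "k \<in> {1..?m}"
    then have "k \<in> {1..mu}" by (auto split: if_splits)
    then show "norm (S_mat cyc mu r k *\<^sub>R e k) \<le> 4 * E"
      using S_mat_bound[OF r, of k cyc] e[OF k] by (auto intro: mult_mono)
  qed
  also have "\<dots> \<le> 4 * real mu * E" using \<open>0 \<le> E\<close> by (auto simp: mult_right_mono)
  finally have 1: "norm (\<Sum>k = 1..?m. S_mat cyc mu r k *\<^sub>R e k) \<le> 4 * real mu * E" .
  have "norm (\<Sum>k = 1..mu. Q_mat cyc mu r k *\<^sub>R f k) \<le> (\<Sum>k = 1..mu. 1 / real mu * G)"
  proof (rule sum_norm_le)
    fix k assume k: "k \<in> {1..mu}"
    show "norm (Q_mat cyc mu r k *\<^sub>R f k) \<le> 1 / real mu * G"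
      unfolding norm_scaleR by (rule mult_mono[OF Q_mat_bound f[OF k]]) auto
  qed
  also have "\<dots> = G" using r by simp
  finally have 2: "norm (\<Sum>k = 1..mu. Q_mat cyc mu r k *\<^sub>R f k) \<le> G" .
  show ?thesis unfolding inner_point_def by (rule order_trans[OF norm_triangle_ineq]) (use 1 2 in simp)
qed

section \<open>Evaluation of the refinement rule\<close>

text \<open>The rule reads a function through its sixteen coefficients on each face; this is the
  class of functions on which it can be evaluated.\<close>

definition (in qmesh) spl :: "('p, 'a::real_vector) mesh_fun \<Rightarrow> bool" where
  "spl f \<longleftrightarrow> (\<forall>F\<in>T. \<exists>C. \<forall>s\<in>sq. f F s = bsp C s)"

abbreviation loc :: "('p, 'a::real_vector) mesh_fun \<Rightarrow> 'p face \<Rightarrow> frame \<Rightarrow> nat \<Rightarrow> nat \<Rightarrow> 'a" where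
  "loc f F d \<equiv> subdiv_coeff (f F \<circ> d)"

lemma bsp_const: "bsp (\<lambda>_ _. c) s = c"
proof -
  have "bern (\<lambda>_ _. c) s = bsp (\<lambda>_ _. c) s"
    unfolding bern_subdiv by (rule bsp_cong) (simp add: subdiv_def flip: scaleR_add_left)
  moreover have "bern (\<lambda>_ _. c) s = c"
  proof -
    have h: "(\<Sum>j\<le>2. Bernstein 2 j t *\<^sub>R y) = y" for t :: real and y :: 'a
    proof -
      have "(1-t)^2 + 2*t*(1-t) + t^2 = 1" by (simp add: power2_eq_square algebra_simps)
      then show ?thesis by (simp add: sum_atMost_2 Bernstein_2 flip: scaleR_add_left)
    qed
    show ?thesis unfolding bern_nested h ..
  qed
  ultimately show ?thesis by simp
qed

lemma linear_bsp: "linear g \<Longrightarrow> g (bsp C s) = bsp (\<lambda>j k. g (C j k)) s"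
  by (simp add: bsp_def linear_sum linear_scale)

context qmesh
begin

lemma spl_bsp:
  assumes "spl f" "F \<in> T" "d \<in> frames" "s \<in> sq"
  shows "f F (d s) = bsp (loc f F d) s"
proof -
  obtain C where C: "\<And>s. s \<in> sq \<Longrightarrow> f F s = bsp C s" using assms by (auto simp: spl_def)
  have "f F (d s) = bsp (act 3 d C) s" using C[of "d s"] assms by (simp add: bsp_frame)
  also have "\<dots> = bsp (loc f F d) s"
    by (rule bsp_cong) (use subdiv_coeff_frame[OF C assms(3)] in simp)
  finally show ?thesis .
qed

lemma loc_frame:
  assumes "spl f" "F \<in> T" "d \<in> frames" "e \<in> frames" "j \<le> 3" "k \<le> 3"
  shows "loc f F (d \<circ> e) j k = act 3 e (loc f F d) j k"
proof -
  have "subdiv_coeff ((f F \<circ> d) \<circ> e) j k = act 3 e (loc f F d) j k"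
    by (rule subdiv_coeff_frame) (use spl_bsp[OF assms(1-3)] assms in auto)
  then show ?thesis by (simp add: comp_assoc)
qed

lemma loc_swp: "spl f \<Longrightarrow> F \<in> T \<Longrightarrow> d \<in> frames \<Longrightarrow> j \<le> 3 \<Longrightarrow> k \<le> 3 \<Longrightarrow> loc f F (d \<circ> swp) j k = loc f F d k j"
  by (subst loc_frame) (auto simp: act_def idx_fr)

lemma loc_flip: "spl f \<Longrightarrow> F \<in> T \<Longrightarrow> d \<in> frames \<Longrightarrow> j \<le> 3 \<Longrightarrow> k \<le> 3 \<Longrightarrow> loc f F (d \<circ> flip) j k = loc f F d (3 - j) k"
  by (subst loc_frame) (auto simp: act_def idx_fr)

lemma loc_origin_11:
  assumes "spl f" "F \<in> T" "d \<in> frames" "e \<in> frames" "d (0,0) = e (0,0)"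
  shows "loc f F d 1 1 = loc f F e 1 1"
  using frame_same_origin[OF assms(3,4,5)] loc_swp[OF assms(1-3), of 1 1] by auto

text \<open>The rule names one coefficient in several ways: by an index in the coordinates of the
  face or of the fan, or as the diagonal one in coordinates centred at the corner. The
  identification makes it possible to see that the rule is single-valued.\<close>

lemma loc_corner_11:
  assumes "spl f" "F \<in> T" "d \<in> frames" "e \<in> frames" "a \<le> 1" "b \<le> 1" "e (0,0) = d (real a, real b)"
  shows "loc f F d (1 + a) (1 + b) = loc f F e 1 1"
proof -
  let ?g = "fr (a = 1) (b = 1) False"
  have ab: "a = 0 \<or> a = 1" "b = 0 \<or> b = 1" using assms by auto
  have "loc f F (d \<circ> ?g) 1 1 = loc f F d (1 + a) (1 + b)"
    by (subst loc_frame) (use ab assms in \<open>auto simp: act_def idx_fr numeral_2_eq_2\<close>)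
  moreover have "(d \<circ> ?g) (0,0) = e (0,0)" using ab assms(7) by auto
  ultimately show ?thesis using loc_origin_11[OF assms(1,2) frames_comp[OF assms(3), of ?g] assms(4)] by simp
qed

text \<open>The point at parameter 1/4 of a boundary half recovers the face and the frame. Hence the
  two edge clauses of the rule, which address the same half in reversed coordinates, cannot
  disagree.\<close>

lemma half_inj:
  assumes F: "F \<in> T" "d \<in> frames" and b: "side F d \<in> BE" and G: "G \<in> T" "e \<in> frames"
    and eq: "half G e = half F d"
  shows "G = F \<and> e = d"
proof -
  have "F (d (1/4,0)) \<in> half F d" unfolding half_eq[OF F(2)] by (rule image_eqI[of _ _ "1/2"]) auto
  then have "F (d (1/4,0)) \<in> half G e" using eq by simp
  then obtain t where t: "0 \<le> t" "t \<le> 1" "F (d (1/4,0)) = G (e (t/2,0))" unfolding half_eq[OF G(2)] by auto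
  have FG: "F = G"
  proof (rule ccontr)
    assume "F \<noteq> G"
    then have "glued F d G e \<or> glued F d G (e \<circ> flip)"
      using side_point_glued(2)[OF F(1) G(1) F(2) G(2), of "1/4" "t/2"] t by auto
    then have "side F d \<in> IE"
      using glued_incident(2)[OF F(1) G(1) F(2)] G \<open>F \<noteq> G\<close> by (metis frame_flip_frames)
    then show False using b by (simp add: interior_edges_def)
  qed
  then have "d (1/4,0) = e (t/2,0)" using face_eq[OF F(1), of "d (1/4,0)" "e (t/2,0)"] t F G by (simp add: sq_iff)
  then show ?thesis using frame_side_point[OF F(2) G(2), of "1/4" "t/2"] t FG by auto
qed

lemma isolated_other:
  assumes "isolated T pt" "\<delta> \<in> EV" "F \<in> T" "pt \<in> carrier_of F" "\<delta> \<in> carrier_of F"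
  shows "\<delta> = pt"
  using assms by (auto simp: isolated_def one_ring_def faces_at_def)

end

locale fanned = qmesh T for T :: "'p mesh" +
  fixes fan :: "'p \<Rightarrow> ('p face \<times> frame) list"
  assumes fan: "\<forall>pt\<in>extraordinary T. is_fan T pt (fan pt)"
begin

definition fF :: "'p \<Rightarrow> nat \<Rightarrow> 'p face" where "fF pt r = fst (fan pt ! (r - 1))"
definition fd :: "'p \<Rightarrow> nat \<Rightarrow> frame" where "fd pt r = snd (fan pt ! (r - 1))"

definition inner_value :: "('p, 'a::real_vector) mesh_fun \<Rightarrow> 'p \<Rightarrow> nat \<Rightarrow> 'a" where
  "inner_value f pt r = inner_point (pt \<in> IV) (valence T pt)
     (\<lambda>k. loc f (fF pt k) (fd pt k) 0 1) (\<lambda>k. loc f (fF pt k) (fd pt k) 1 1) r"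

context
  fixes pt assumes pt: "pt \<in> EV"
begin

lemma fan_length: "length (fan pt) = valence T pt"
proof -
  have d: "distinct (map fst (fan pt))" and s: "fst ` set (fan pt) = faces_at T pt"
    using fan pt by (simp_all add: is_fan_def)
  have "length (fan pt) = card (set (map fst (fan pt)))" using distinct_card[OF d] by simp
  then show ?thesis using s by (simp add: valence_def)
qed

lemma fan_nth: "r \<in> {1..valence T pt} \<Longrightarrow> (fF pt r, fd pt r) \<in> set (fan pt)"
  using fan_length by (auto simp: fF_def fd_def intro!: nth_mem)

lemma fan_set:
  assumes "(F, d) \<in> set (fan pt)" shows "F \<in> T" "d \<in> frames" "F (d (0,0)) = pt"
proof -
  have f: "fst ` set (fan pt) = faces_at T pt" "\<forall>(F, d)\<in>set (fan pt). d \<in> frames \<and> F (d (0, 0)) = pt"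
    using fan pt by (simp_all add: is_fan_def)
  show "d \<in> frames" "F (d (0,0)) = pt" using f(2) assms by auto
  have "F \<in> fst ` set (fan pt)" using assms by force
  then show "F \<in> T" unfolding f(1) by (simp add: faces_at_def)
qed

lemma fan_face:
  assumes "r \<in> {1..valence T pt}" shows "fF pt r \<in> T" "fd pt r \<in> frames" "fF pt r (fd pt r (0,0)) = pt"
  using fan_set[OF fan_nth[OF assms]] .

lemma fan_inj: "r \<in> {1..valence T pt} \<Longrightarrow> r' \<in> {1..valence T pt} \<Longrightarrow> fF pt r = fF pt r' \<Longrightarrow> r = r'"
proof -
  assume r: "r \<in> {1..valence T pt}" "r' \<in> {1..valence T pt}" "fF pt r = fF pt r'"
  have d: "distinct (map fst (fan pt))" using fan pt by (simp add: is_fan_def)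
  have "map fst (fan pt) ! (r - 1) = map fst (fan pt) ! (r' - 1)"
  proof -
    have "r - 1 < length (fan pt)" "r' - 1 < length (fan pt)" using r fan_length by auto
    then show ?thesis using r(3) by (simp only: nth_map fF_def)
  qed
  then have "r - 1 = r' - 1" using d r fan_length by (subst (asm) nth_eq_iff_index_eq) auto
  then show "r = r'" using r by simp linarith
qed

lemma fan_index:
  assumes "F \<in> faces_at T pt" obtains r where "r \<in> {1..valence T pt}" "fF pt r = F"
proof -
  have "fst ` set (fan pt) = faces_at T pt" using fan pt by (simp add: is_fan_def)
  then obtain i where "i < length (fan pt)" "fst (fan pt ! i) = F"
    using assms by (metis (no_types, lifting) imageE in_set_conv_nth)
  then show ?thesis using that[of "Suc i"] fan_length by (simp add: fF_def)
qed

lemma fan_faces: "faces_at T pt = fF pt ` {1..valence T pt}" "inj_on (fF pt) {1..valence T pt}"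
proof -
  show "inj_on (fF pt) {1..valence T pt}" by (rule inj_onI) (rule fan_inj)
  have "fF pt r \<in> faces_at T pt" if "r \<in> {1..valence T pt}" for r
    using faces_at_origin[OF fan_face(1,2)[OF that]] fan_face(3)[OF that] by simp
  then show "faces_at T pt = fF pt ` {1..valence T pt}" using fan_index by blast
qed

lemma fan_glued:
  assumes "r \<in> {1..valence T pt}" "pt \<in> IV \<or> r < valence T pt"
  defines "r' \<equiv> (if r = valence T pt then 1 else r + 1)"
  shows "glued (fF pt r) (fd pt r \<circ> swp) (fF pt r') (fd pt r')" "r' \<in> {1..valence T pt}"
proof -
  show r': "r' \<in> {1..valence T pt}" using assms(1) by (auto simp: r'_def)
  have g: "\<forall>r < length (fan pt). pt \<in> IV \<or> r + 1 < length (fan pt) \<longrightarrow>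
        (\<forall>t\<in>{0..1}. fst (fan pt ! r) (snd (fan pt ! r) (0, t)) =
           fst (fan pt ! ((r + 1) mod length (fan pt))) (snd (fan pt ! ((r + 1) mod length (fan pt))) (t, 0)))"
    using fan pt by (simp add: is_fan_def)
  have "r' - 1 = (r - 1 + 1) mod length (fan pt)"
    using assms(1) fan_length by (auto simp: r'_def)
  then show "glued (fF pt r) (fd pt r \<circ> swp) (fF pt r') (fd pt r')"
    using g[rule_format, of "r - 1"] assms(1,2) fan_length by (auto simp: glued_def fF_def fd_def)
qed

end

text \<open>Evaluates the definite description in \<open>refined_points\<close>: the rule applies,
  and any other instance of it, with another frame at the corner, yields the same coefficient. The
  next lemmas treat the other degrees of freedom alike.\<close>

lemma refined_corner:
  assumes f: "spl f" and pt: "pt \<in> corner_vertices T" and F: "F \<in> T" "d \<in> frames" "F (d (0,0)) = pt"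
  shows "refined_points T fan f (Corner pt) = loc f F d 0 0"
  unfolding refined_points_def
proof (rule the_equality)
  show "refine_rule T fan f (Corner pt) (loc f F d 0 0)" by (rule refine_rule.corner) fact+
  fix y assume "refine_rule T fan f (Corner pt) y"
  then show "y = loc f F d 0 0"
  proof (cases rule: refine_rule.cases)
    case (corner F' d')
    have "card (faces_at T pt) = 1" using pt by (simp add: corner_vertices_def valence_def)
    moreover have "F \<in> faces_at T pt" "F' \<in> faces_at T pt"
      using faces_at_origin[OF F(1,2)] faces_at_origin[of F' d'] F corner by auto
    ultimately have "F' = F" by (metis card_1_singletonE singletonD)
    then have "d' = d \<or> d' = d \<circ> swp" using origin_eq[of F d d'] F corner by simp
    then show ?thesis using corner \<open>F' = F\<close> loc_swp[OF f F(1,2), of 0 0] by auto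
  qed
qed

lemma refined_edge:
  assumes f: "spl f" and F: "F \<in> T" "d \<in> frames" and b: "side F d \<in> BE"
  shows "refined_points T fan f (BEdge (half F d)) = loc f F d 1 0"
  unfolding refined_points_def
proof (rule the_equality)
  show "refine_rule T fan f (BEdge (half F d)) (loc f F d 1 0)"
    unfolding half_def by (rule refine_rule.edge_left) fact+
  fix y assume "refine_rule T fan f (BEdge (half F d)) y"
  then show "y = loc f F d 1 0"
  proof (cases rule: refine_rule.cases)
    case (edge_left F' d')
    then have "F' = F \<and> d' = d" using half_inj[OF F b, of F' d'] by (simp add: half_def)
    then show ?thesis using edge_left by simp
  next
    case (edge_right F' d')
    have "half F' (d' \<circ> flip) = half F d"
      using edge_right(1) side_flip[of "F' \<circ> quad (d' (1,0))" d'] by (simp add: half_def)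
    then have "F' = F \<and> d' \<circ> flip = d"
      using half_inj[OF F b edge_right(3), of "d' \<circ> flip"] edge_right(4) by simp
    then show ?thesis using edge_right loc_flip[OF f edge_right(3,4), of 1 0] by auto
  qed
qed

text \<open>Unites two clauses of the rule: away from isolated extraordinary vertices a subface
  receives the diagonal coefficient at its corner, whether through \<open>face\<close> or through
  \<open>extraordinary_outer\<close>.\<close>

lemma refined_face_rule:
  assumes f: "spl f" and F: "F \<in> T" "d \<in> frames"
    and no: "\<not> (F (d (0,0)) \<in> EV \<and> isolated T (F (d (0,0))))"
  shows "refined_points T fan f (Face (sub F d)) = loc f F d 1 1"
  unfolding refined_points_def
proof (rule the_equality)
  have dc: "d (0,0) \<in> corners" using F by simp
  then obtain a b :: nat where ab: "a \<le> 1" "b \<le> 1" "d (0,0) = (real a, real b)"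
    using that[of 0 0] that[of 1 0] that[of 0 1] that[of 1 1] by (auto simp: corners_def)
  show "refine_rule T fan f (Face (sub F d)) (loc f F d 1 1)"
  proof (cases "carrier_of F \<inter> EV = {} \<or> card (carrier_of F \<inter> EV) > 1 \<or>
        (\<exists>pt\<in>carrier_of F \<inter> EV. \<not> isolated T pt)")
    case True
    have "refine_rule T fan f (Face (F \<circ> quad (real a, real b))) (subdiv_coeff (f F) (1 + a) (1 + b))"
      by (rule refine_rule.face) (use F ab True in auto)
    moreover have "subdiv_coeff (f F) (1 + a) (1 + b) = loc f F d 1 1"
      using loc_corner_11[OF f F(1), of id d a b] F ab by simp
    ultimately show ?thesis using ab by simp
  next
    case False
    then obtain \<delta> where \<delta>: "\<delta> \<in> carrier_of F" "\<delta> \<in> EV" "isolated T \<delta>" by blast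
    have Fa: "F \<in> faces_at T \<delta>" using \<delta> F by (simp add: faces_at_def)
    obtain e where e: "(F, e) \<in> set (fan \<delta>)"
      using fan \<delta>(2) Fa unfolding is_fan_def by (metis (no_types, lifting) imageE prod.collapse)
    note fs = fan_set[OF \<delta>(2) e]
    obtain q0 where q0: "q0 \<in> corners" "d (0,0) = e q0" using frame_corner_local[OF fs(2) dc] by metis
    \<comment> \<open>The corner in question is not \<open>\<delta>\<close>, so the subface is one
      of the three outer ones of the fan at \<open>\<delta>\<close>.\<close>
    have "q0 \<noteq> (0,0)" using no \<delta> fs q0 by auto
    then obtain a' b' :: nat where ab': "q0 = (real a', real b')" "(a',b') \<in> {(1,0),(1,1),(0,1)}"
      using q0(1) that[of 1 0] that[of 1 1] that[of 0 1] by (auto simp: corners_def)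
    have "refine_rule T fan f (Face (F \<circ> quad (e (real a', real b')))) (loc f F e (1 + a') (1 + b'))"
      using refine_rule.extraordinary_outer[where fan = fan, OF \<delta>(2,3) e ab'(2), of f] .
    moreover have "loc f F e (1 + a') (1 + b') = loc f F d 1 1"
      by (rule loc_corner_11[OF f F(1) fs(2) F(2)]) (use ab' q0 in auto)
    ultimately show ?thesis using q0(2) ab' by simp
  qed
  fix y assume "refine_rule T fan f (Face (sub F d)) y"
  then show "y = loc f F d 1 1"
  proof (cases rule: refine_rule.cases)
    case (face F' a' b')
    have "(real a', real b') \<in> corners" using face by (auto simp: corners_iff)
    then have "F' = F" "(real a', real b') = d (0,0)"
      using face subface_eq_iff[OF F(1) face(3) dc] by auto
    then show ?thesis using loc_corner_11[OF f F(1), of id d a' b'] F face by simp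
  next
    case (extraordinary_outer \<delta> F' e a' b')
    note fs = fan_set[OF extraordinary_outer(3,5)]
    have c: "(real a', real b') \<in> corners" using extraordinary_outer by (auto simp: corners_iff)
    then have "e (real a', real b') \<in> corners" using fs by simp
    then have "F' = F" "e (real a', real b') = d (0,0)"
      using extraordinary_outer(1) subface_eq_iff[OF F(1) fs(1) dc] by auto
    then show ?thesis using loc_corner_11[OF f F(1) fs(2) F(2), of a' b'] extraordinary_outer by auto
  next
    case (extraordinary_inner \<delta> cyc mu m r F' e)
    have "(F', e) = (fF \<delta> r, fd \<delta> r)" using extraordinary_inner by (simp add: fF_def fd_def)
    then have fs: "F' \<in> T" "e \<in> frames" "F' (e (0,0)) = \<delta>"
      using fan_face[OF extraordinary_inner(3)] extraordinary_inner by auto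
    have "F' = F" "e (0,0) = d (0,0)"
      using extraordinary_inner(1) subface_eq_iff[OF F(1) fs(1) dc] fs by auto
    then show ?thesis using no extraordinary_inner fs by simp
  qed
qed

text \<open>Isolation separates the clauses: the face has no extraordinary vertex besides
  \<open>pt\<close>, so neither \<open>face\<close> nor the outer clause of another vertex can
  address the subface at \<open>pt\<close>.\<close>

lemma refined_face_inner:
  assumes f: "spl f" and pt: "pt \<in> EV" "isolated T pt" and r: "r \<in> {1..valence T pt}"
  shows "refined_points T fan f (Face (sub (fF pt r) (fd pt r))) = inner_value f pt r"
  unfolding refined_points_def
proof (rule the_equality)
  have iv: "inner_value f pt r = (\<Sum>k = 1..(if pt \<in> IV then valence T pt else valence T pt - 1).
       S_mat (pt \<in> IV) (valence T pt) r k *\<^sub>R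
            subdiv_coeff (f (fst (fan pt ! (k - 1))) \<circ> snd (fan pt ! (k - 1))) 0 1) +
        (\<Sum>k = 1..valence T pt. Q_mat (pt \<in> IV) (valence T pt) r k *\<^sub>R
            subdiv_coeff (f (fst (fan pt ! (k - 1))) \<circ> snd (fan pt ! (k - 1))) 1 1)"
    by (simp add: inner_value_def inner_point_def fF_def fd_def)
  show "refine_rule T fan f (Face (sub (fF pt r) (fd pt r))) (inner_value f pt r)"
    unfolding iv by (rule refine_rule.extraordinary_inner) (use pt r in \<open>auto simp: fF_def fd_def\<close>)
  note F = fan_face[OF pt(1) r]
  have dc: "fd pt r (0,0) \<in> corners" using F by simp
  have ptF: "pt \<in> carrier_of (fF pt r)"
    using faces_at_origin[OF F(1,2)] F(3) by (simp add: faces_at_def)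
  fix y assume "refine_rule T fan f (Face (sub (fF pt r) (fd pt r))) y"
  then show "y = inner_value f pt r"
  proof (cases rule: refine_rule.cases)
    case (face F' a' b')
    have "(real a', real b') \<in> corners" using face by (auto simp: corners_iff)
    then have FF: "F' = fF pt r" using face subface_eq_iff[OF F(1) face(3) dc] by auto
    have "\<delta> = pt" if "\<delta> \<in> carrier_of F' \<inter> EV" for \<delta>
      using isolated_other[OF pt(2), of \<delta> F'] that ptF FF F(1) by auto
    then have "carrier_of F' \<inter> EV = {pt}" using ptF FF pt by auto
    then show ?thesis using face(6) pt by auto
  next
    case (extraordinary_outer \<delta> F' e a' b')
    note fs = fan_set[OF extraordinary_outer(3,5)]
    have c: "(real a', real b') \<in> corners" using extraordinary_outer by (auto simp: corners_iff)
    then have "e (real a', real b') \<in> corners" using fs by simp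
    then have FF: "F' = fF pt r" "e (real a', real b') = fd pt r (0,0)"
      using extraordinary_outer(1) subface_eq_iff[OF F(1) fs(1) dc] by auto
    have "\<delta> \<in> carrier_of F'" using faces_at_origin[OF fs(1,2)] fs(3) by (simp add: faces_at_def)
    then have "\<delta> = pt" using isolated_other[OF pt(2) extraordinary_outer(3) F(1) ptF] FF by simp
    then have "fF pt r (e (0,0)) = fF pt r (fd pt r (0,0))" using F(3) fs(3) FF by simp
    then have "e (0,0) = fd pt r (0,0)" using face_eq[OF F(1), of "e (0,0)" "fd pt r (0,0)"] fs F by simp
    then have "e (0,0) = e (real a', real b')" using FF by simp
    then have "(0,0) = (real a', real b')" using frame_inj[OF fs(2)] by blast
    then show ?thesis using extraordinary_outer(6) by auto
  next
    case (extraordinary_inner \<delta> cyc mu m r' F' e)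
    have FF: "F' = fF \<delta> r'" "e = fd \<delta> r'" using extraordinary_inner(9) unfolding fF_def fd_def by (metis fst_conv, metis snd_conv)
    have r': "r' \<in> {1..valence T \<delta>}" using extraordinary_inner by simp
    note fs = fan_face[OF extraordinary_inner(3) r', folded FF]
    have eq: "F' = fF pt r" "e (0,0) = fd pt r (0,0)"
      using extraordinary_inner(1) subface_eq_iff[OF F(1) fs(1) dc] fs by auto
    then have "\<delta> = pt" using fs(3) F(3) by simp
    then have "r' = r" using fan_inj[OF pt(1), of r' r] r r' eq FF by simp
    then show ?thesis using extraordinary_inner(2,5-7) \<open>\<delta> = pt\<close> by (simp add: iv)
  qed
qed

section \<open>The rule commutes with linear maps and preserves constants\<close>

lemma refined_dof_cases:
  assumes "\<phi> \<in> dof_star T'"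
  obtains pt F d where "\<phi> = Corner pt" "pt \<in> corner_vertices T" "F \<in> T" "d \<in> frames" "F (d (0,0)) = pt"
  | F d where "\<phi> = BEdge (half F d)" "F \<in> T" "d \<in> frames" "side F d \<in> BE"
  | F d where "\<phi> = Face (sub F d)" "F \<in> T" "d \<in> frames"
      "\<not> (F (d (0,0)) \<in> EV \<and> isolated T (F (d (0,0))))"
  | pt r where "\<phi> = Face (sub (fF pt r) (fd pt r))" "pt \<in> EV" "isolated T pt" "r \<in> {1..valence T pt}"
proof -
  consider (f) K where "\<phi> = Face K" "K \<in> T'" | (b) \<rho> where "\<phi> = BEdge \<rho>" "\<rho> \<in> boundary_edges T'"
    | (c) pt where "\<phi> = Corner pt" "pt \<in> corner_vertices T"
    using assms by (auto simp: dof_star_def corner_vertices_refine)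
  then show ?thesis
  proof cases
    case f
    obtain F q where F: "F \<in> T" "q \<in> corners" "K = F \<circ> quad q" using f(2) by (rule refineE)
    obtain d where d: "d \<in> frames" "d (0,0) = q" using corner_frame F(2) by metis
    show ?thesis
    proof (cases "F (d (0,0)) \<in> EV \<and> isolated T (F (d (0,0)))")
      case False
      then show ?thesis using that(3)[of F d] f F d by simp
    next
      case True
      let ?pt = "F (d (0,0))"
      obtain r where r: "r \<in> {1..valence T ?pt}" "fF ?pt r = F"
        using fan_index[of ?pt F] True faces_at_origin[OF F(1) d(1)] by blast
      have "fd ?pt r (0,0) = d (0,0)"
        using face_eq[OF F(1), of "fd ?pt r (0,0)" "d (0,0)"] fan_face[of ?pt r] True r d F(2) by simp
      then show ?thesis using that(4)[of ?pt r] f F d True r by simp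
    qed
  next
    case b
    then show ?thesis using that(2) boundary_edges_refineE by metis
  next
    case c
    then have "pt \<in> vertices T" by (simp add: corner_vertices_def)
    then obtain F q where F: "F \<in> T" "q \<in> corners" "F q = pt" by (auto simp: vertices_def)
    obtain d where "d \<in> frames" "d (0,0) = q" using corner_frame F(2) by metis
    then show ?thesis using that(1) c F by metis
  qed
qed

lemma spl_linear: "spl f \<Longrightarrow> linear g \<Longrightarrow> spl (\<lambda>F s. g (f F s))"
  unfolding spl_def by (metis linear_bsp)

lemma loc_linear:
  assumes "spl f" "linear g" "F \<in> T" "d \<in> frames" "j \<le> 3" "k \<le> 3"
  shows "loc (\<lambda>F s. g (f F s)) F d j k = g (loc f F d j k)"
proof -
  have "subdiv_coeff ((\<lambda>s. g (f F s)) \<circ> d) j k = (if j \<le> 3 \<and> k \<le> 3 then g (loc f F d j k) else 0)"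
    by (rule subdiv_coeff_bsp[of _ "\<lambda>j k. g (loc f F d j k)"])
       (use spl_bsp[OF assms(1,3,4)] linear_bsp[OF assms(2)] in auto)
  then show ?thesis using assms by simp
qed

text \<open>In each of the four cases the value is a fixed real linear combination of coefficients
  of \<open>f\<close>.\<close>

lemma refined_linear:
  assumes f: "spl f" and g: "linear g" and \<phi>: "\<phi> \<in> dof_star T'"
  shows "refined_points T fan (\<lambda>F s. g (f F s)) \<phi> = g (refined_points T fan f \<phi>)"
proof -
  note fg = spl_linear[OF f g]
  from \<phi> show ?thesis
  proof (cases rule: refined_dof_cases)
    case (1 pt F d)
    then show ?thesis using refined_corner[OF f 1(2-5)] refined_corner[OF fg 1(2-5)] loc_linear[OF f g 1(3,4)] by simp
  next
    case (2 F d)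
    then show ?thesis using refined_edge[OF f 2(2-4)] refined_edge[OF fg 2(2-4)] loc_linear[OF f g 2(2,3)] by simp
  next
    case (3 F d)
    then show ?thesis using refined_face_rule[OF f 3(2-4)] refined_face_rule[OF fg 3(2-4)] loc_linear[OF f g 3(2,3)] by simp
  next
    case (4 pt r)
    have "inner_value (\<lambda>F s. g (f F s)) pt r = g (inner_value f pt r)"
      unfolding inner_value_def inner_point_linear[OF g]
      unfolding inner_point_def using loc_linear[OF f g fan_face(1,2)[OF 4(2)]]
      by (intro arg_cong2[where f = "(+)"] sum.cong refl) (auto split: if_splits)
    then show ?thesis using refined_face_inner[OF f 4(2-4)] refined_face_inner[OF fg 4(2-4)] 4(1) by simp
  qed
qed

text \<open>Additivity is derived from compatibility with linear maps: the rule is applied to the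
  pair of functions, with values in the product space, and both projections and the sum are linear
  maps of the pair.\<close>

lemma refined_add:
  fixes f g :: "('p, 'b::real_vector) mesh_fun"
  assumes f: "spl f" and g: "spl g" and \<phi>: "\<phi> \<in> dof_star T'"
  shows "refined_points T fan (\<lambda>F s. f F s + g F s) \<phi> = refined_points T fan f \<phi> + refined_points T fan g \<phi>"
proof -
  let ?h = "\<lambda>F s. (f F s, g F s)"
  have pair: "bsp (\<lambda>j k. (C j k, C' j k)) s = (bsp C s, bsp C' s)" for C C' s
    using linear_bsp[OF linear_fst, of "\<lambda>j k. (C j k, C' j k)" s]
      linear_bsp[OF linear_snd, of "\<lambda>j k. (C j k, C' j k)" s] by (simp add: prod_eq_iff)
  have h: "spl ?h" unfolding spl_def
  proof
    fix F assume "F \<in> T"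
    then obtain C C' where "\<forall>s\<in>sq. f F s = bsp C s" "\<forall>s\<in>sq. g F s = bsp C' s"
      using f g unfolding spl_def by meson
    then show "\<exists>C. \<forall>s\<in>sq. (f F s, g F s) = bsp C s" using pair by metis
  qed
  have a: "linear (\<lambda>p. fst p + snd p :: 'b)" by (intro linear_compose_add linear_fst linear_snd)
  show ?thesis
    using refined_linear[OF h linear_fst \<phi>] refined_linear[OF h linear_snd \<phi>] refined_linear[OF h a \<phi>] by simp
qed

lemma refined_const:
  assumes \<phi>: "\<phi> \<in> dof_star T'"
  shows "refined_points T fan (\<lambda>F s. c) \<phi> = c"
proof -
  let ?f = "\<lambda>(F::'p face) s. c"
  have f: "spl ?f" unfolding spl_def using bsp_const by metis
  have l: "loc ?f F d j k = c" if "j \<le> 3" "k \<le> 3" for F d j k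
    by (subst subdiv_coeff_bsp[of _ "\<lambda>_ _. c"]) (use that in \<open>auto simp: bsp_const\<close>)
  from \<phi> show ?thesis
  proof (cases rule: refined_dof_cases)
    case (1 pt F d)
    then show ?thesis using refined_corner[OF f 1(2-5)] l by simp
  next
    case (2 F d)
    then show ?thesis using refined_edge[OF f 2(2-4)] l by simp
  next
    case (3 F d)
    then show ?thesis using refined_face_rule[OF f 3(2-4)] l by simp
  next
    case (4 pt r)
    then show ?thesis using refined_face_inner[OF f 4(2-4)] l inner_point_const[OF 4(4)] by (simp add: inner_value_def)
  qed
qed

end

section \<open>Refinement at the vertices\<close>

lemma sum_next:
  assumes "mu \<ge> 1"
  shows "(\<Sum>k = 1..mu. g (if k = mu then 1 else k + 1)) = (\<Sum>k = 1..(mu::nat). g k :: 'a::comm_monoid_add)"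
  by (rule sum.reindex_bij_witness[of _ "\<lambda>k. if k = 1 then mu else k - 1" "\<lambda>k. if k = mu then 1 else k + 1"])
     (use assms in auto)

context fanned
begin

context
  fixes pt assumes pt: "pt \<in> EV"
begin

lemma valence_ge_2: "valence T pt \<ge> 2"
proof -
  have v: "pt \<in> vertices T" using pt extraordinary_vertex by blast
  then obtain F q where F: "F \<in> T" "q \<in> corners" "F q = pt" by (auto simp: vertices_def)
  have "F \<in> faces_at T pt" using F by (auto simp: faces_at_def carrier_of_def)
  then have "valence T pt \<noteq> 0" by (auto simp: valence_def)
  moreover have "valence T pt \<noteq> 1"
    using corner_vertex_boundary(2)[of pt] v pt by (auto simp: corner_vertices_def)
  ultimately show ?thesis by linarith
qed

lemma spoke_cases:
  assumes "F \<in> T" "d \<in> frames" "F (d (0,0)) = pt"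
  obtains r where "r \<in> {1..valence T pt}" "fF pt r = F" "d = fd pt r \<or> d = fd pt r \<circ> swp"
proof -
  obtain r where r: "r \<in> {1..valence T pt}" "fF pt r = F"
    using fan_index[OF pt, of F] faces_at_origin[OF assms(1,2)] assms(3) by blast
  have "d = fd pt r \<or> d = fd pt r \<circ> swp"
    using origin_eq[OF assms(1), of "fd pt r" d] fan_face[OF pt r(1)] r assms by simp
  then show ?thesis using that r by blast
qed

lemma fan_next:
  assumes "r \<in> {1..valence T pt}" "pt \<in> IV \<or> r < valence T pt"
  defines "r' \<equiv> (if r = valence T pt then 1 else r + 1)"
  shows "glued (fF pt r) (fd pt r \<circ> swp) (fF pt r') (fd pt r')" "fF pt r' \<noteq> fF pt r"
    "side (fF pt r) (fd pt r \<circ> swp) = side (fF pt r') (fd pt r')"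
    "side (fF pt r) (fd pt r \<circ> swp) \<in> IE" "r' \<in> {1..valence T pt}"
proof -
  note g = fan_glued[OF pt assms(1,2), folded r'_def]
  show g1: "glued (fF pt r) (fd pt r \<circ> swp) (fF pt r') (fd pt r')" and r': "r' \<in> {1..valence T pt}" by (fact g)+
  have "r' \<noteq> r" using valence_ge_2 by (auto simp: r'_def)
  then show ne: "fF pt r' \<noteq> fF pt r" using fan_inj[OF pt r' assms(1)] by blast
  show "side (fF pt r) (fd pt r \<circ> swp) = side (fF pt r') (fd pt r')" by (rule glued_side[OF g1])
  show "side (fF pt r) (fd pt r \<circ> swp) \<in> IE"
    using glued_incident(2)[OF fan_face(1)[OF pt assms(1)] fan_face(1)[OF pt r'] _ fan_face(2)[OF pt r'] g1] ne
      fan_face(2)[OF pt assms(1)] by simp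
qed

lemma fan_prev:
  assumes "r \<in> {2..valence T pt}"
  shows "glued (fF pt r) (fd pt r) (fF pt (r - 1)) (fd pt (r - 1) \<circ> swp)"
    "side (fF pt r) (fd pt r) = side (fF pt (r - 1)) (fd pt (r - 1) \<circ> swp)"
proof -
  obtain k where k: "r = Suc k" "k \<in> {1..valence T pt}" "k < valence T pt" "k \<noteq> valence T pt"
    using assms by (cases r) auto
  show "glued (fF pt r) (fd pt r) (fF pt (r - 1)) (fd pt (r - 1) \<circ> swp)"
    "side (fF pt r) (fd pt r) = side (fF pt (r - 1)) (fd pt (r - 1) \<circ> swp)"
    using fan_next(1,3)[of k] k glued_sym by simp_all
qed

lemma boundary_spoke:
  assumes \<rho>: "\<rho> \<in> BE" "pt \<in> \<rho>"
  shows "\<rho> = side (fF pt 1) (fd pt 1) \<or> \<rho> = side (fF pt (valence T pt)) (fd pt (valence T pt) \<circ> swp)"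
proof (rule ccontr)
  let ?m = "valence T pt"
  assume no: "\<not> ?thesis"
  obtain F d where F: "F \<in> T" "d \<in> frames" "F (d (0,0)) = pt" "\<rho> = side F d"
    using boundary_edge_at_vertex[OF extraordinary_vertex[OF pt] \<rho>] by metis
  obtain r where r: "r \<in> {1..?m}" "fF pt r = F" "d = fd pt r \<or> d = fd pt r \<circ> swp"
    using spoke_cases[OF F(1-3)] by blast
  from r(3) have "side F d \<in> IE"
  proof
    assume d: "d = fd pt r"
    then have "r \<noteq> 1" using no F r by auto
    then have "r \<in> {2..?m}" "r - 1 \<in> {1..?m}" "r - 1 < ?m" using r by auto
    then show ?thesis using fan_prev(2)[of r] fan_next(4)[of "r - 1"] r d by simp
  next
    assume d: "d = fd pt r \<circ> swp"
    then have "r \<noteq> ?m" using no F r by auto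
    then show ?thesis using fan_next(4)[of r] r d by auto
  qed
  then show False using \<rho> F by (simp add: interior_edges_def)
qed

text \<open>A fan only lists the faces in order, so this has to be derived. Let S 0, ..., S mu be
  the sides along the fan. An interior end side would coincide with another S j. If S 0 = S mu, that
  edge must be the boundary edge at the vertex, yet lies in two faces. An inner S j already has its
  two faces, so it must be next to the end, and one face would have two equal sides at the
  vertex.\<close>

lemma end_sides_boundary:
  assumes b: "pt \<in> BV"
  shows "side (fF pt 1) (fd pt 1) \<in> BE"
    "side (fF pt (valence T pt)) (fd pt (valence T pt) \<circ> swp) \<in> BE"
proof -
  let ?m = "valence T pt"
  define S where "S i = (if i = 0 then side (fF pt 1) (fd pt 1) else side (fF pt i) (fd pt i \<circ> swp))" for i
  have m: "?m \<ge> 2" by (rule valence_ge_2)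
  note ff = fan_face[OF pt]
  have S: "side (fF pt r) (fd pt r) = S (r - 1)" "side (fF pt r) (fd pt r \<circ> swp) = S r" if "r \<in> {1..?m}" for r
    using fan_prev(2)[of r] that by (cases "r = 1"; simp add: S_def)+
  have mid: "incident T (S i) = {fF pt i, fF pt (i + 1)}" if "i \<in> {1..<?m}" for i
  proof -
    have i: "i \<in> {1..?m}" "i < ?m" "i + 1 \<in> {1..?m}" using that by auto
    show ?thesis
      using glued_incident(1)[of "fF pt i" "fF pt (i + 1)" "fd pt i \<circ> swp" "fd pt (i + 1)"]
        fan_next(1,2)[OF i(1) disjI2[OF i(2)]] ff[OF i(1)] ff[OF i(3)] S(2)[OF i(1)] i(2) by simp
  qed
  have step: "S (r - 1) \<noteq> S r" if "r \<in> {1..?m}" for r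
    using side_swp_ne[OF ff(1,2)[OF that]] S[OF that] by metis
  have face: "fF pt r \<in> incident T (S (r - 1))" "fF pt r \<in> incident T (S r)" if "r \<in> {1..?m}" for r
    using self_incident[of "fF pt r" "fd pt r"] self_incident[of "fF pt r" "fd pt r \<circ> swp"] ff[OF that] S[OF that] by simp_all
  have ends: "S 0 \<noteq> S ?m"
  proof
    assume eq: "S 0 = S ?m"
    obtain \<rho> where "\<rho> \<in> BE" "pt \<in> \<rho>" using b by (auto simp: boundary_vertices_def)
    with boundary_spoke have "S 0 \<in> BE" using S(1)[of 1] S(2)[of ?m] m eq by force
    then have "incident T (S 0) = {fF pt 1}" using boundary_side_iff ff[of 1] m by (simp add: S_def)
    then have "fF pt ?m = fF pt 1" using face(2)[of ?m] eq m by auto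
    then show False using fan_inj[OF pt, of ?m 1] m by simp
  qed
  have "S i \<in> BE" if i: "i = 0 \<and> r = 1 \<or> i = ?m \<and> r = ?m" for i r
  proof (rule ccontr)
    assume nb: "S i \<notin> BE"
    define d where "d = (if i = 0 then fd pt 1 else fd pt ?m \<circ> swp)"
    have r: "r \<in> {1..?m}" using i m by auto
    have d: "d \<in> frames" "fF pt r (d (0,0)) = pt" "side (fF pt r) d = S i"
      using i m ff[of 1] ff[of ?m] S[of 1] S[of ?m] by (auto simp: d_def)
    then have "side (fF pt r) d \<in> IE" using nb side_edges[OF ff(1)[OF r] d(1)] by (simp add: interior_edges_def)
    then obtain G e where G: "G \<in> T" "G \<noteq> fF pt r" "e \<in> frames" "glued (fF pt r) d G e"
      using interior_side_glued[OF ff(1)[OF r] d(1)] by metis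
    have "G (e (0,0)) = pt" using glued_origin[OF G(4)] d by simp
    then obtain s where s: "s \<in> {1..?m}" "fF pt s = G" "e = fd pt s \<or> e = fd pt s \<circ> swp"
      using spoke_cases[OF G(1,3)] by blast
    have sr: "s \<noteq> r" using s G(2) by auto
    obtain j where j: "S j = S i" "j = s - 1 \<or> j = s"
      using s(3) S[OF s(1)] glued_side[OF G(4)] d(3) s(2) by metis
    have "j \<noteq> i" using j(2) i s(1) sr by auto
    moreover have "\<not> (i = 0 \<and> j = ?m)" "\<not> (i = ?m \<and> j = 0)" using ends j(1) by metis+
    ultimately have jm: "j \<in> {1..<?m}" using j(2) s(1) i by auto
    have "fF pt r \<in> incident T (S j)" using self_incident[OF ff(1)[OF r] d(1)] d(3) j(1) by simp
    then have "fF pt r = fF pt j \<or> fF pt r = fF pt (j + 1)" using mid[OF jm] by simp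
    then have rj: "r = j \<or> r = j + 1" using fan_inj[OF pt r, of j] fan_inj[OF pt r, of "j + 1"] jm by auto
    show False
      using i
    proof (elim disjE conjE)
      assume "i = 0" "r = 1"
      then have "j = 1" using rj jm by auto
      then show False using step[OF r] j(1) \<open>i = 0\<close> \<open>r = 1\<close> by simp
    next
      assume "i = ?m" "r = ?m"
      then have "j = r - 1" using rj jm by auto
      then show False using step[OF r] j(1) \<open>i = ?m\<close> \<open>r = ?m\<close> by simp
    qed
  qed
  from this[of 0 1] this[of ?m ?m] show "side (fF pt 1) (fd pt 1) \<in> BE"
    "side (fF pt ?m) (fd pt ?m \<circ> swp) \<in> BE"
    using S(1)[of 1] S(2)[of ?m] m by simp_all
qed

text \<open>A normal form for interior spokes: the side shared by a face of the fan and its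
  successor. The first side of the fan is shared with the last face at an interior vertex and is a
  boundary edge otherwise.\<close>

lemma spoke_interior:
  assumes F: "F \<in> T" "d \<in> frames" "F (d (0,0)) = pt" and i: "side F d \<in> IE"
  obtains r where "r \<in> {1..valence T pt}" "pt \<in> IV \<or> r < valence T pt"
    "side F d = side (fF pt r) (fd pt r \<circ> swp)"
proof -
  let ?mu = "valence T pt"
  have mu: "?mu \<ge> 2" by (rule valence_ge_2)
  have v: "pt \<in> vertices T" using pt extraordinary_vertex by blast
  have bd: "pt \<in> BV" if "pt \<notin> IV" using that v by (simp add: interior_vertices_def)
  obtain r where r: "r \<in> {1..?mu}" "fF pt r = F" "d = fd pt r \<or> d = fd pt r \<circ> swp"
    using spoke_cases[OF F] by blast
  from r(3) show ?thesis
  proof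
    assume d: "d = fd pt r \<circ> swp"
    have "pt \<in> IV \<or> r < ?mu"
    proof (rule ccontr)
      assume "\<not> ?thesis"
      then have "r = ?mu" "pt \<in> BV" using r bd by auto
      then show False using end_sides_boundary(2) i r d by (simp add: interior_edges_def)
    qed
    then show ?thesis using that[of r] r d by simp
  next
    assume d: "d = fd pt r"
    show ?thesis
    proof (cases "r = 1")
      case False
      then have "r \<in> {2..?mu}" "r - 1 \<in> {1..?mu}" "r - 1 < ?mu" using r by auto
      then show ?thesis using that[of "r - 1"] fan_prev(2)[of r] r d by simp
    next
      case True
      have int: "pt \<in> IV"
      proof (rule ccontr)
        assume "\<not> ?thesis"
        then show False using end_sides_boundary(1)[OF bd] i r d True by (simp add: interior_edges_def)
      qed
      have "?mu \<in> {1..?mu}" using mu by simp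
      then show ?thesis using that[of ?mu] fan_next(3)[of ?mu] int r d True by simp
    qed
  qed
qed

end

lemma half_cong:
  assumes "F \<in> T" "G \<in> T" "d \<in> frames" "e \<in> frames" "F (d (0,0)) = G (e (0,0))" "side F d = side G e"
  shows "glued F d G e" "half F d = half G e"
proof -
  obtain e' where e': "e' \<in> frames" "glued F d G e'"
    using side_subset_glued[OF assms(1-3)] assms(4,6) side_subset_carrier by metis
  have "side G e' = side G e" using glued_side[OF e'(2)] assms(6) by simp
  then have "e' = e \<or> e' = e \<circ> flip" using side_eq_iff[OF assms(2,4) e'(1)] by simp
  moreover have "e' \<noteq> e \<circ> flip"
  proof
    assume "e' = e \<circ> flip"
    then have "G (e (1,0)) = G (e (0,0))" using glued_origin[OF e'(2)] assms(5) by simp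
    then have "e (1,0) = e (0,0)" using face_eq[OF assms(2), of "e (1,0)" "e (0,0)"] assms(4) by (simp add: sq_iff)
    then show False using frame_inj[OF assms(4)] by simp
  qed
  ultimately show g: "glued F d G e" using e' by blast
  show "half F d = half G e" by (rule glued_half[OF g assms(3,4)])
qed

text \<open>At an extraordinary vertex the two edges are the ends of the fan. At an ordinary one
  there is a second face, since a single face would make it a corner vertex, and
  \<open>opposite_boundary\<close> applies to the pair.\<close>

lemma boundary_pair:
  assumes pt: "pt \<in> BV" "pt \<notin> corner_vertices T"
  obtains F d G e where "F \<in> T" "d \<in> frames" "F (d (0,0)) = pt" "G \<in> T" "e \<in> frames" "G (e (0,0)) = pt"
    "side F d \<in> BE" "side G e \<in> BE" "side F d \<noteq> side G e"
    "{\<rho> \<in> BE. pt \<in> \<rho>} = {side F d, side G e}"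
proof -
  have v: "pt \<in> vertices T" using pt by (simp add: boundary_vertices_def)
  show ?thesis
  proof (cases "pt \<in> EV")
    case True
    let ?mu = "valence T pt"
    have mu: "?mu \<ge> 2" by (rule valence_ge_2[OF True])
    have one: "1 \<in> {1..?mu}" and last: "?mu \<in> {1..?mu}" using mu by auto
    note f1 = fan_face[OF True one] and fl = fan_face[OF True last]
    note eb = end_sides_boundary[OF True pt(1)]
    have "{\<rho> \<in> BE. pt \<in> \<rho>} \<subseteq> {side (fF pt 1) (fd pt 1), side (fF pt ?mu) (fd pt ?mu \<circ> swp)}"
      using boundary_spoke[OF True] by blast
    moreover have "pt \<in> side (fF pt 1) (fd pt 1)" "pt \<in> side (fF pt ?mu) (fd pt ?mu \<circ> swp)"
      using side_origin[of "fF pt 1" "fd pt 1"] side_origin[of "fF pt ?mu" "fd pt ?mu \<circ> swp"] f1 fl by simp_all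
    ultimately have eq: "{\<rho> \<in> BE. pt \<in> \<rho>} = {side (fF pt 1) (fd pt 1), side (fF pt ?mu) (fd pt ?mu \<circ> swp)}"
      using eb by blast
    have "side (fF pt 1) (fd pt 1) \<noteq> side (fF pt ?mu) (fd pt ?mu \<circ> swp)"
    proof
      assume "side (fF pt 1) (fd pt 1) = side (fF pt ?mu) (fd pt ?mu \<circ> swp)"
      then have "{fF pt 1} = {fF pt ?mu}"
        using eb boundary_side_iff[OF f1(1,2)] boundary_side_iff[OF fl(1), of "fd pt ?mu \<circ> swp"] fl by simp
      then show False using fan_inj[OF True one last] mu by simp
    qed
    then show ?thesis using that[of "fF pt 1" "fd pt 1" "fF pt ?mu" "fd pt ?mu \<circ> swp"] f1 fl eb eq by simp
  next
    case False
    then have le: "card (faces_at T pt) \<le> 2" using pt by (auto simp: extraordinary_def valence_def)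
    obtain F q where F: "F \<in> T" "q \<in> corners" "F q = pt" using v by (auto simp: vertices_def)
    have Fa: "F \<in> faces_at T pt" using F by (auto simp: faces_at_def carrier_of_def)
    have "\<exists>d\<in>frames. \<exists>G\<in>T. \<exists>e\<in>frames. F (d (0,0)) = pt \<and> glued F d G e \<and> G \<noteq> F"
    proof (rule ccontr)
      assume no: "\<not> ?thesis"
      have "{F} = faces_at T pt"
      proof (rule star_closed[OF v])
        show "{F} \<subseteq> faces_at T pt" using Fa by simp
        fix X x G e assume X: "X \<in> {F}" "x \<in> frames" "X (x (0,0)) = pt" "G \<in> T" "e \<in> frames" "glued X x G e"
        show "G \<in> {F}"
        proof (rule ccontr)
          assume "G \<notin> {F}"
          then show False using X no by blast
        qed
      qed simp
      then have "card (faces_at T pt) = card {F}" by simp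
      then show False using pt(2) v by (simp add: corner_vertices_def valence_def)
    qed
    then obtain d G e where d: "d \<in> frames" "F (d (0,0)) = pt" and G: "G \<in> T" "e \<in> frames" "glued F d G e" "F \<noteq> G" by metis
    have "card (faces_at T (F (d (0,0)))) \<le> 2" "F (d (0,0)) \<in> BV" using le d pt by simp_all
    note ob = opposite_boundary[OF F(1) G(1) d(1) G(2,3,4) this, unfolded d(2)]
    have "G (e (0,0)) = pt" using glued_origin[OF G(3)] d by simp
    moreover have "side F (d \<circ> swp) \<in> BE" "side G (e \<circ> swp) \<in> BE" using ob(2) by blast+
    ultimately show ?thesis using that[of F "d \<circ> swp" G "e \<circ> swp"] F d G ob by simp
  qed
qed

lemma boundary_pair_refined:
  assumes pt: "pt \<in> BV" "pt \<notin> corner_vertices T"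
  obtains F d G e where "F \<in> T" "d \<in> frames" "F (d (0,0)) = pt" "G \<in> T" "e \<in> frames" "G (e (0,0)) = pt"
    "side F d \<in> BE" "side G e \<in> BE" "side F d \<noteq> side G e"
    "{\<rho> \<in> BE. pt \<in> \<rho>} = {side F d, side G e}"
    "{\<rho> \<in> boundary_edges T'. pt \<in> \<rho>} = {half F d, half G e}" "half F d \<noteq> half G e"
proof -
  have v: "pt \<in> vertices T" using pt by (simp add: boundary_vertices_def)
  obtain F d G e where F: "F \<in> T" "d \<in> frames" "F (d (0,0)) = pt" and G: "G \<in> T" "e \<in> frames" "G (e (0,0)) = pt"
    and b: "side F d \<in> BE" "side G e \<in> BE" "side F d \<noteq> side G e"
    "{\<rho> \<in> BE. pt \<in> \<rho>} = {side F d, side G e}"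
    using boundary_pair[OF pt] .
  have ne: "half F d \<noteq> half G e"
  proof
    assume "half F d = half G e"
    then have "G = F \<and> e = d" using half_inj[OF F(1,2) b(1) G(1,2)] by simp
    then show False using b(3) by simp
  qed
  have "{half F d | F d. F \<in> T \<and> d \<in> frames \<and> F (d (0,0)) = pt \<and> side F d \<in> BE} = {half F d, half G e}"
    (is "?L = ?R")
  proof
    show "?R \<subseteq> ?L" using F G b by blast
    show "?L \<subseteq> ?R"
    proof (rule subsetI)
      fix \<rho> assume "\<rho> \<in> ?L"
      then obtain H h where H: "H \<in> T" "h \<in> frames" "H (h (0,0)) = pt" "side H h \<in> BE" "\<rho> = half H h"
        by blast
      have "side H h \<in> {side F d, side G e}" using b(4) H side_origin[of H h] by blast
      then show "\<rho> \<in> ?R"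
        using half_cong(2)[OF H(1) F(1) H(2) F(2)] half_cong(2)[OF H(1) G(1) H(2) G(2)] H F G by auto
    qed
  qed
  then show ?thesis using that[OF F G b _ ne] boundary_at_old[OF v] by simp
qed

end

lemma idx_flip: "j \<le> m \<Longrightarrow> m > 0 \<Longrightarrow> idx m (d \<circ> flip) j k = idx m d (m - j) k"
proof -
  assume "j \<le> m" "m > 0"
  then have "1 - real j / real m = real (m - j) / real m" by (simp add: field_simps of_nat_diff)
  then show ?thesis by (simp add: idx_def)
qed

lemma act_flip: "j \<le> m \<Longrightarrow> m > 0 \<Longrightarrow> act m (d \<circ> flip) C j k = act m d C (m - j) k"
  by (simp add: act_def idx_flip)

lemma act_swp: "act m (d \<circ> swp) C j k = act m d C k j"
  by (simp add: act_def idx_def)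

section \<open>Splines of the refined mesh as C1 splines on the old faces\<close>

context qmesh
begin

text \<open>
  The coefficients of a spline of the refined mesh on a coarse face \<open>F\<close>, as a \<open>C\<^sup>1\<close> spline on the four
  subfaces together.
\<close>

definition joint :: "('p dof \<Rightarrow> 'a::real_vector) \<Rightarrow> 'p face \<Rightarrow> nat \<Rightarrow> nat \<Rightarrow> 'a" where
  "joint z F j k = bc T' z (F \<circ> quad (block_corner j k)) (z (Face (F \<circ> quad (block_corner j k))))
     (j - j div 2) (k - k div 2)"

lemma joint_frame:
  assumes "F \<in> T" "d \<in> frames" "j \<le> 1" "k \<le> 1"
  shows "act 3 d (joint z F) j k =
    bc T' z (F \<circ> quad (d (0,0)) \<circ> d) (z (Face (sub F d))) j k"
proof -
  obtain j' k' where jk': "idx 3 d j k = (j', k')" by (cases "idx 3 d j k")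
  have b: "block_corner j' k' = d (0,0)" using block_corner_idx[OF assms(2-4)] jk' by auto
  have "(j' - j' div 2, k' - k' div 2) = idx 2 d j k"
  proof -
    obtain a b w where fr: "d = fr a b w" by (rule frameE[OF assms(2)])
    have "j = 0 \<or> j = 1" "k = 0 \<or> k = 1" using assms by auto
    then show ?thesis using jk' unfolding fr by (cases a; cases b; cases w; auto simp: idx_fr)
  qed
  then have "act 3 d (joint z F) j k = act 2 d (bc T' z (sub F d) (z (Face (sub F d)))) j k"
    using jk' b by (auto simp: act_def joint_def split: prod.splits)
  also have "\<dots> = bc T' z (F \<circ> quad (d (0,0)) \<circ> d) (z (Face (sub F d))) j k"
    by (rule bc_frame) (use assms in auto)
  finally show ?thesis .
qed

lemma joint_local:
  assumes "F \<in> T" "d \<in> frames"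
  shows "act 3 d (joint z F) 0 0 = vc T' z (F (d (0,0)))"
    "act 3 d (joint z F) (Suc 0) 0 = ec T' z (half F d)"
    "act 3 d (joint z F) 0 (Suc 0) = ec T' z (half F (d \<circ> swp))"
    "act 3 d (joint z F) (Suc 0) (Suc 0) = z (Face (sub F d))"
  using joint_frame[OF assms, of 0 0 z] joint_frame[OF assms, of 1 0 z] joint_frame[OF assms, of 0 1 z]
    joint_frame[OF assms, of 1 1 z] assms(2)
  by (simp_all add: bc_local half_def quad_frame)

lemma ec_inner:
  assumes "F \<in> T" "d \<in> frames"
  shows "ec T' z (inner_edge F d) = (1/2) *\<^sub>R (z (Face (sub F d)) + z (Face (F \<circ> quad (d (1,0)))))"
  using inner_interior[OF assms] incident_inner[OF assms] inner_edge_faces_ne[OF assms] by (simp add: ec_def)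

text \<open>The midpoint is an ordinary vertex of the refined mesh, and the two halves of the side
  are opposite edges there.\<close>

lemma vc_mid:
  assumes F: "F \<in> T" and d: "d \<in> frames"
  shows "vc T' z (F (d (1/2,0))) = (1/2) *\<^sub>R (ec T' z (half F d) + ec T' z (half F (d \<circ> flip)))"
proof -
  interpret R: qmesh "T'" by (rule refined)
  let ?K = "sub F d" and ?L = "F \<circ> quad (d (1,0))"
  let ?f = "d \<circ> flip \<circ> swp" and ?g = "d \<circ> swp"
  have c: "d (0,0) \<in> corners" "d (1,0) \<in> corners" using d by (auto simp: corners_iff)
  have 1: "?K (?f (t,0)) = F (d (1/2,t/2))" for t
    using quad_frame[OF d, of "(0,0)" "(1,t)"] by (simp add: quad_simp)
  have 2: "?L (?g (t,0)) = F (d (1/2,t/2))" for t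
    using quad_frame[OF d, of "(1,0)" "(0,t)"] by (simp add: quad_simp)
  have g: "glued ?K ?f ?L ?g" unfolding glued_def 1 2 by simp
  have o: "?K (?f (0,0)) = F (d (1/2,0))" using 1[of 0] by simp
  have ne: "?K (?f (0,0)) \<notin> extraordinary T'"
    unfolding o using mid_not_vertex[OF F d] extraordinary_vertex by (auto simp: extraordinary_refine)
  have "ec T' z (side ?K (?f \<circ> swp)) + ec T' z (side ?L (?g \<circ> swp)) = 2 *\<^sub>R vc T' z (?K (?f (0,0)))"
    by (rule R.opposite_coeff[OF refineI[OF F c(1)] refineI[OF F c(2)] frame_swp_frames[OF frame_flip_frames[OF d]]
          frame_swp_frames[OF d] g inner_edge_faces_ne[OF F d] ne])
  moreover have "side ?K (?f \<circ> swp) = half F d" by (simp add: side_flip half_def)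
  moreover have "side ?L (?g \<circ> swp) = half F (d \<circ> flip)"
    using side_flip[of ?L d] by (simp add: half_def)
  ultimately show ?thesis unfolding o by simp
qed

lemma vc_center:
  assumes F: "F \<in> T" and d: "d \<in> frames"
  shows "vc T' z (F (1/2,1/2)) = (1/4) *\<^sub>R (z (Face (sub F d)) + z (Face (F \<circ> quad (d (1,0)))) +
     z (Face (F \<circ> quad (d (0,1)))) + z (Face (F \<circ> quad (d (1,1)))))"
proof -
  have "faces_at T' (F (1/2,1/2)) = (\<lambda>q. F \<circ> quad q) ` corners"
    unfolding faces_at_refine_center[OF F] by blast
  moreover have "inj_on (\<lambda>q. F \<circ> quad q) corners" using subface_eq_iff[OF F F] by (auto simp: inj_on_def)
  ultimately have "(\<Sum>K\<in>faces_at T' (F (1/2,1/2)). z (Face K)) = (\<Sum>q\<in>corners. z (Face (F \<circ> quad q)))"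
    by (simp add: sum.reindex)
  also have "\<dots> = (\<Sum>q\<in>d ` corners. z (Face (F \<circ> quad q)))"
  proof -
    have "d ` corners = corners"
    proof
      show "d ` corners \<subseteq> corners" using d by auto
      show "corners \<subseteq> d ` corners" using frame_corner_local[OF d] by blast
    qed
    then show ?thesis by simp
  qed
  also have "\<dots> = (\<Sum>q\<in>corners. z (Face (F \<circ> quad (d q))))"
    using d by (subst sum.reindex) (auto simp: inj_on_def frame_inj)
  also have "\<dots> = z (Face (sub F d)) + z (Face (F \<circ> quad (d (1,0)))) +
     z (Face (F \<circ> quad (d (0,1)))) + z (Face (F \<circ> quad (d (1,1))))"
    by (simp add: corners_def add_ac)
  finally show ?thesis using center_interior[OF F] by (simp add: vc_def valence_def)
qed

text \<open>At the midpoints and at the centre the refined spline is built by averaging, so the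
  Bernstein coefficients of a subface outside its block at the old vertex are means of entries of
  \<open>joint\<close>, exactly those that \<open>restr\<close> prescribes.\<close>

lemma joint_star_frame:
  fixes z :: "'p dof \<Rightarrow> 'a::real_vector"
  assumes F: "F \<in> T" and d: "d \<in> frames" and s: "s \<in> sq"
  shows "star T' z (sub F d) (d s) = bsp (joint z F) (d (quad (0,0) s))"
proof -
  interpret R: qmesh "T'" by (rule refined)
  let ?K = "sub F d" and ?A = "act 3 d (joint z F)"
  let ?y = "z (Face ?K)"
  have K: "?K \<in> T'" using refineI[OF F, of "d (0,0)"] d by simp
  note J = joint_local[OF F]
  have pt: "?K (d s) = F (d (quad (0,0) s))" for s by (simp add: quad_frame d)
  have A: "?A 2 0 = ec T' z (half F (d \<circ> flip))" "?A 2 (Suc 0) = z (Face (F \<circ> quad (d (1,0))))"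
    "?A 0 2 = ec T' z (half F (d \<circ> swp \<circ> flip))" "?A (Suc 0) 2 = z (Face (F \<circ> quad (d (0,1))))"
    "?A 2 2 = z (Face (F \<circ> quad (d (1,1))))"
    using J(2,4)[of "d \<circ> flip" z] J(2,4)[of "d \<circ> swp \<circ> flip" z] J(4)[of "d \<circ> flip \<circ> swp \<circ> flip" z] d
    by (simp_all add: act_flip act_swp)
  have mid: "vc T' z (F (d (1/2,0))) = (1/2) *\<^sub>R (ec T' z (half F d) + ec T' z (half F (d \<circ> flip)))"
    "vc T' z (F (d (0,1/2))) = (1/2) *\<^sub>R (ec T' z (half F (d \<circ> swp)) + ec T' z (half F (d \<circ> swp \<circ> flip)))"
    using vc_mid[OF F d, of z] vc_mid[OF F frame_swp_frames[OF d], of z] by simp_all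
  have cell1: "cell (?K \<circ> d) 2 (Suc 0) = inner_edge F d"
  proof -
    have "{(u,v) \<in> sq. u = 1} = (\<lambda>t. (1,t)) ` {0..1}" by (auto simp: sq_iff)
    then have "cell (?K \<circ> d) 2 (Suc 0) = (\<lambda>t. ?K (d (1,t))) ` {0..1}" by (simp add: cell_def image_image)
    then show ?thesis unfolding pt inner_edge_def by (simp add: quad_simp)
  qed
  have cell2: "cell (?K \<circ> d) (Suc 0) 2 = inner_edge F (d \<circ> swp)"
  proof -
    have "{(u,v) \<in> sq. v = 1} = (\<lambda>t. (t,1)) ` {0..1}" by (auto simp: sq_iff)
    then have "cell (?K \<circ> d) (Suc 0) 2 = (\<lambda>t. ?K (d (t,1))) ` {0..1}" by (simp add: cell_def image_image)
    then show ?thesis unfolding pt inner_edge_def by (simp add: quad_simp)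
  qed
  have inner: "ec T' z (inner_edge F d) = (1/2) *\<^sub>R (?y + z (Face (F \<circ> quad (d (1,0)))))"
    "ec T' z (inner_edge F (d \<circ> swp)) = (1/2) *\<^sub>R (?y + z (Face (F \<circ> quad (d (0,1)))))"
    using ec_inner[OF F d, of z] ec_inner[OF F frame_swp_frames[OF d], of z] by simp_all
  have half2: "(1/2) *\<^sub>R (x + x) = x" for x :: 'a by (simp flip: scaleR_2)
  have eq: "bc T' z (?K \<circ> d) ?y j k = restr ?A j k" if jk: "j \<le> 2" "k \<le> 2" for j k
  proof -
    have pts: "?K (d (1,0)) = F (d (1/2,0))" "?K (d (0,1)) = F (d (0,1/2))" "?K (d (1,1)) = F (1/2,1/2)"
      unfolding pt using center_frame[OF d] by (simp_all add: quad_simp)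
    have v: "bc T' z (?K \<circ> d) ?y 2 0 = vc T' z (F (d (1/2,0)))"
      "bc T' z (?K \<circ> d) ?y 0 2 = vc T' z (F (d (0,1/2)))"
      "bc T' z (?K \<circ> d) ?y 2 2 = vc T' z (F (1/2,1/2))"
      "bc T' z (?K \<circ> d) ?y 2 (Suc 0) = ec T' z (inner_edge F d)"
      "bc T' z (?K \<circ> d) ?y (Suc 0) 2 = ec T' z (inner_edge F (d \<circ> swp))"
      using pts cell1 cell2 by (simp_all add: bc_def)
    consider "j \<le> 1 \<and> k \<le> 1" | "j = 2 \<and> k = 0" | "j = 2 \<and> k = 1" | "j = 0 \<and> k = 2" | "j = 1 \<and> k = 2" | "j = 2 \<and> k = 2"
      using jk by linarith
    then show ?thesis
    proof cases
      case 1
      then show ?thesis using joint_frame[OF F d, of j k z] by (simp add: restr_def half2 min_def)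
    next
      case 2
      then show ?thesis using v(1) mid(1) A(1) J(2)[OF d, of z] by (simp add: restr_def half2)
    next
      case 3
      then show ?thesis using v(4) inner(1) A(2) J(4)[OF d, of z] by (simp add: restr_def half2)
    next
      case 4
      then show ?thesis using v(2) mid(2) A(3) J(3)[OF d, of z] by (simp add: restr_def half2)
    next
      case 5
      then show ?thesis using v(5) inner(2) A(4) J(4)[OF d, of z] by (simp add: restr_def half2)
    next
      case 6
      then show ?thesis using v(3) vc_center[OF F d, of z] A(2,4,5) J(4)[OF d, of z]
        by (simp add: restr_def scaleR_add_right add_ac)
    qed
  qed
  have "star T' z ?K (d s) = bern (bc T' z (?K \<circ> d) ?y) s" by (rule R.star_frame[OF K d])
  also have "\<dots> = bern (restr ?A) s" by (rule bern_cong) (rule eq)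
  also have "\<dots> = bsp ?A (quad (0,0) s)" by (rule bsp_restr[OF s, symmetric])
  also have "\<dots> = bsp (joint z F) (d (quad (0,0) s))" by (rule bsp_frame[OF d, symmetric])
  finally show ?thesis .
qed

lemma joint_star:
  assumes F: "F \<in> T" and q: "q \<in> corners" and s: "s \<in> sq"
  shows "star T' z (F \<circ> quad q) s = bsp (joint z F) (quad q s)"
proof -
  obtain d where d: "d \<in> frames" "d (0,0) = q" using corner_frame[OF q] .
  obtain t where t: "s = d t" using d by (metis frames_inverse)
  have "t \<in> sq" using s d t by simp
  then show ?thesis using joint_star_frame[OF F d(1), of t z] quad_frame[OF d(1), of "(0,0)" t] d t by simp
qed

end

section \<open>Control points around an extraordinary vertex\<close>

locale refinement = geometry T xs n tri + fanned T fan
  for T :: "'p mesh" and xs n tri fan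
begin

abbreviation (input) xs' :: "'p dof \<Rightarrow> real^3" where
  "xs' \<equiv> refined_points T fan x"

text \<open>The linear part of the projection, extended by the identity like \<open>P\<close>; it
  lets weighted sums of differences to the vertex be projected as a whole.\<close>

definition Lam :: "'p \<Rightarrow> real^3 \<Rightarrow> real^3" where
  "Lam pt w = (if pt \<in> EV then w - ((w \<bullet> n pt) / (n pt \<bullet> n pt)) *\<^sub>R n pt else w)"

lemma linear_Lam: "linear (Lam pt)"
  by (rule linearI) (auto simp: Lam_def algebra_simps add_divide_distrib)

lemma P_Lam: "P pt y = vc T xs pt + Lam pt (y - vc T xs pt)"
  by (simp add: P_def Lam_def plane_proj_def)

lemma P_sum:
  "(\<Sum>i\<in>A. w i *\<^sub>R (P pt (y i) - vc T xs pt)) = Lam pt (\<Sum>i\<in>A. w i *\<^sub>R (y i - vc T xs pt))"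
  by (simp add: P_Lam linear_sum[OF linear_Lam] linear_scale[OF linear_Lam])

lemma x_spl: "spl x"
  unfolding spl_def using x_bsp by blast

text \<open>An affine map that fixes a point preserves symmetry about it.\<close>

lemma half_average: "P pt y + P pt y' = 2 *\<^sub>R vc T xs pt" if "y + y' = 2 *\<^sub>R vc T xs pt"
proof -
  have "y' = (vc T xs pt + vc T xs pt) - y" using that unfolding scaleR_2 by (metis add_diff_cancel_left')
  then have "y' - vc T xs pt = - (y - vc T xs pt)" by simp
  then show ?thesis unfolding P_Lam by (simp only: linear_neg[OF linear_Lam] scaleR_2) simp
qed

lemma sum_const: "(\<Sum>k = 1..m. v) = real m *\<^sub>R (v :: real^3)"
  by (simp only: sum_constant_scaleR card_atLeastAtMost) simp

lemma lc_spoke_cong: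
  assumes "F \<in> T" "d \<in> frames" "G \<in> T" "e \<in> frames" "F (d (0,0)) = G (e (0,0))" "side F d = side G e"
  shows "lc F d (Suc 0) 0 = lc G e (Suc 0) 0"
  using assms by (simp add: lc_simps)

lemma ec_half_interior:
  assumes "F \<in> T" "d \<in> frames" "G \<in> T" "e \<in> frames" "glued F d G e" "G \<noteq> F"
  shows "ec T' z (half F d) = (1/2) *\<^sub>R (z (Face (sub F d)) + z (Face (sub G e)))"
proof -
  interpret R: qmesh "T'" by (rule refined)
  have "half F d \<in> interior_edges T'"
    using half_boundary_iff[OF assms(1,2)] half_refine_edge[OF assms(1,2)]
      glued_incident(2)[OF assms(1,3,2,4,5)] assms(6) by (auto simp: interior_edges_def)
  moreover have "sub F d \<noteq> G \<circ> quad (e (0,0))"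
    using subface_eq_iff[OF assms(1,3)] assms by simp
  ultimately show ?thesis using incident_half_cases(2)[OF assms] by (simp add: ec_def)
qed

lemma refined_boundary_edge:
  assumes "F \<in> T" "d \<in> frames" "side F d \<in> BE"
  shows "ec T' xs' (half F d) = lc F d (Suc 0) 0"
proof -
  interpret R: qmesh "T'" by (rule refined)
  show ?thesis
    using refined_edge[OF x_spl assms] half_boundary_iff[OF assms(1,2)] assms(3) by (simp add: R.ec_boundary lc_def)
qed

lemma refined_face:
  assumes "F \<in> T" "d \<in> frames" "\<not> (F (d (0,0)) \<in> EV \<and> isolated T (F (d (0,0))))"
  shows "xs' (Face (sub F d)) = lc F d (Suc 0) (Suc 0)"
  using refined_face_rule[OF x_spl assms] by (simp add: lc_def)

context
  fixes pt assumes pt: "pt \<in> EV"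
begin

abbreviation (input) "mu \<equiv> valence T pt"
abbreviation (input) "cyc \<equiv> pt \<in> IV"
abbreviation (input) "c \<equiv> vc T xs pt"
abbreviation (input) "spoke k \<equiv> lc (fF pt k) (fd pt k) 0 (Suc 0)"
abbreviation (input) "twist k \<equiv> lc (fF pt k) (fd pt k) (Suc 0) (Suc 0)"
abbreviation (input) "nx k \<equiv> if k = mu then 1 else k + 1"

lemma sum_fan: "(\<Sum>F\<in>faces_at T pt. g F) = (\<Sum>k = 1..mu. g (fF pt k))"
  using fan_faces[OF pt] by (simp add: sum.reindex)

lemma spoke_P: "k \<in> {1..mu} \<Longrightarrow> spoke k = P pt ((1/2) *\<^sub>R (c + ec T xs (side (fF pt k) (fd pt k \<circ> swp))))"
  using fan_face[OF pt] by (simp add: lc_simps)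

lemma ec_fan:
  assumes "k \<in> {1..mu}" "cyc \<or> k < mu"
  shows "ec T xs (side (fF pt k) (fd pt k \<circ> swp)) = (1/2) *\<^sub>R (xs (Face (fF pt k)) + xs (Face (fF pt (nx k))))"
    "ec T xs (side (fF pt (nx k)) (fd pt (nx k))) = ec T xs (side (fF pt k) (fd pt k \<circ> swp))"
proof -
  note nx = fan_next[OF pt assms]
  note f = fan_face[OF pt assms(1)] and f' = fan_face[OF pt nx(5)]
  show "ec T xs (side (fF pt k) (fd pt k \<circ> swp)) = (1/2) *\<^sub>R (xs (Face (fF pt k)) + xs (Face (fF pt (nx k))))"
    by (rule ec_glued[OF f(1) f'(1) frame_swp_frames[OF f(2)] f'(2) nx(1) nx(2)[symmetric]])
  show "ec T xs (side (fF pt (nx k)) (fd pt (nx k))) = ec T xs (side (fF pt k) (fd pt k \<circ> swp))"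
    using nx(3) by simp
qed

lemma sum_control: assumes cyc shows "(\<Sum>k = 1..mu. xs (Face (fF pt k))) = real mu *\<^sub>R c"
proof -
  have "mu \<noteq> 0" using valence_ge_2[OF pt] by simp
  then show ?thesis using assms sum_fan[of "\<lambda>F. xs (Face F)"] by (simp add: vc_def)
qed

lemma sum_edges:
  assumes cyc
  shows "(\<Sum>k = 1..mu. ec T xs (side (fF pt k) (fd pt k \<circ> swp))) = real mu *\<^sub>R c"
    "(\<Sum>k = 1..mu. ec T xs (side (fF pt k) (fd pt k))) = real mu *\<^sub>R c"
proof -
  have mu: "mu \<ge> 1" using valence_ge_2[OF pt] by simp
  have half: "(1/2) *\<^sub>R (real mu *\<^sub>R c + real mu *\<^sub>R c) = real mu *\<^sub>R c" by (simp flip: scaleR_add_left)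
  have "(\<Sum>k = 1..mu. ec T xs (side (fF pt k) (fd pt k \<circ> swp))) =
    (\<Sum>k = 1..mu. (1/2) *\<^sub>R (xs (Face (fF pt k)) + xs (Face (fF pt (nx k)))))"
    by (rule sum.cong[OF refl]) (use ec_fan(1) assms in auto)
  also have "\<dots> = (1/2) *\<^sub>R ((\<Sum>k = 1..mu. xs (Face (fF pt k))) + (\<Sum>k = 1..mu. xs (Face (fF pt (nx k)))))"
    by (simp only: sum.distrib[symmetric] scaleR_sum_right)
  also have "(\<Sum>k = 1..mu. xs (Face (fF pt (nx k)))) = (\<Sum>k = 1..mu. xs (Face (fF pt k)))"
    by (rule sum_next[OF mu])
  finally show 1: "(\<Sum>k = 1..mu. ec T xs (side (fF pt k) (fd pt k \<circ> swp))) = real mu *\<^sub>R c"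
    unfolding sum_control[OF assms] half .
  have "(\<Sum>k = 1..mu. ec T xs (side (fF pt k) (fd pt k))) = (\<Sum>k = 1..mu. ec T xs (side (fF pt (nx k)) (fd pt (nx k))))"
    by (rule sum_next[OF mu, symmetric])
  also have "\<dots> = (\<Sum>k = 1..mu. ec T xs (side (fF pt k) (fd pt k \<circ> swp)))"
    by (rule sum.cong[OF refl]) (use ec_fan(2) assms in auto)
  finally show "(\<Sum>k = 1..mu. ec T xs (side (fF pt k) (fd pt k))) = real mu *\<^sub>R c" using 1 by simp
qed

text \<open>The solvability condition of \<open>inner_point_interior\<close>. Edge coefficients are
  means of consecutive face points, so their alternating sum telescopes around the vertex; averaging
  with the vertex and projecting preserve this because the weights sum to 0.\<close>

lemma spoke_alternating:
  assumes cyc "even mu" shows "(\<Sum>k = 1..mu. (-1)^k *\<^sub>R spoke k) = 0"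
proof -
  let ?b = "\<lambda>k. ec T xs (side (fF pt k) (fd pt k \<circ> swp))" and ?X = "\<lambda>k. xs (Face (fF pt k))"
  have mu: "mu \<ge> 1" using valence_ge_2[OF pt] by simp
  have alt0: "(\<Sum>k = 1..mu. (-1::real)^k) = 0"
    using alternating_sums(1)[of mu] assms(2) by (simp add: sum_negf)
  have altc: "(\<Sum>k = 1..mu. (-1)^k *\<^sub>R v) = 0" for v :: "real^3"
    by (simp only: scaleR_sum_left[symmetric] alt0 scaleR_zero_left)
  \<comment> \<open>Even valence enters here: at the wrap from mu to 1 the sign still
    changes.\<close>
  have "(\<Sum>k = 1..mu. (-1)^k *\<^sub>R ?X (nx k)) = (\<Sum>k = 1..mu. - ((-1)^(nx k) *\<^sub>R ?X (nx k)))"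
    by (rule sum.cong[OF refl]) (use assms(2) in auto)
  also have "\<dots> = - (\<Sum>k = 1..mu. (-1)^k *\<^sub>R ?X k)"
    unfolding sum_negf by (rule arg_cong[of _ _ uminus], rule sum_next[OF mu])
  finally have nx: "(\<Sum>k = 1..mu. (-1)^k *\<^sub>R ?X (nx k)) = - (\<Sum>k = 1..mu. (-1)^k *\<^sub>R ?X k)" .
  have "(\<Sum>k = 1..mu. (-1)^k *\<^sub>R ?b k) = (\<Sum>k = 1..mu. (1/2) *\<^sub>R ((-1)^k *\<^sub>R ?X k + (-1)^k *\<^sub>R ?X (nx k)))"
    by (rule sum.cong[OF refl]) (use ec_fan(1) assms in \<open>auto simp: scaleR_add_right\<close>)
  also have "\<dots> = 0"
    unfolding scaleR_sum_right[symmetric] sum.distrib nx by simp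
  finally have b0: "(\<Sum>k = 1..mu. (-1)^k *\<^sub>R ?b k) = 0" .
  have "(\<Sum>k = 1..mu. (-1)^k *\<^sub>R spoke k) = (\<Sum>k = 1..mu. (-1)^k *\<^sub>R (spoke k - c))"
    by (simp only: scaleR_diff_right sum_subtractf altc diff_zero)
  also have "\<dots> = (\<Sum>k = 1..mu. (-1)^k *\<^sub>R (P pt ((1/2) *\<^sub>R (c + ?b k)) - c))"
    by (rule sum.cong[OF refl]) (simp add: spoke_P)
  also have "\<dots> = Lam pt (\<Sum>k = 1..mu. (-1)^k *\<^sub>R ((1/2) *\<^sub>R (c + ?b k) - c))" by (rule P_sum)
  also have "(\<Sum>k = 1..mu. (-1)^k *\<^sub>R ((1/2) *\<^sub>R (c + ?b k) - c)) =
    (1/2) *\<^sub>R (\<Sum>k = 1..mu. (-1)^k *\<^sub>R ?b k) + (\<Sum>k = 1..mu. (-1)^k *\<^sub>R ((1/2) *\<^sub>R c - c))"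
    unfolding scaleR_sum_right sum.distrib[symmetric] by (intro sum.cong refl) (simp add: algebra_simps)
  also have "\<dots> = 0" using b0 altc by simp
  finally show ?thesis by (simp add: linear_0[OF linear_Lam])
qed

lemma sum_spoke: assumes cyc shows "(\<Sum>k = 1..mu. spoke k) = real mu *\<^sub>R c"
proof -
  let ?b = "\<lambda>k. ec T xs (side (fF pt k) (fd pt k \<circ> swp))"
  have "(\<Sum>k = 1..mu. spoke k) - real mu *\<^sub>R c = (\<Sum>k = 1..mu. 1 *\<^sub>R (P pt ((1/2) *\<^sub>R (c + ?b k)) - c))"
    unfolding sum_const[symmetric] sum_subtractf[symmetric] by (rule sum.cong[OF refl]) (simp add: spoke_P)
  also have "\<dots> = Lam pt (\<Sum>k = 1..mu. 1 *\<^sub>R ((1/2) *\<^sub>R (c + ?b k) - c))" by (rule P_sum)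
  also have "(\<Sum>k = 1..mu. 1 *\<^sub>R ((1/2) *\<^sub>R (c + ?b k) - c)) = (1/2) *\<^sub>R (\<Sum>k = 1..mu. ?b k) - (\<Sum>k = 1..mu. (1/2) *\<^sub>R c)"
    unfolding scaleR_sum_right sum_subtractf[symmetric] by (intro sum.cong refl) (simp add: algebra_simps flip: scaleR_add_left)
  also have "\<dots> = 0" unfolding sum_edges[OF assms] sum_const by simp
  finally show ?thesis by (simp add: linear_0[OF linear_Lam])
qed

text \<open>For vertices that are not isolated: there the subfaces at the vertex receive the
  projected diagonal coefficients, whose mean is thereby still the vertex. The analogous sum of
  spokes serves the isolated case.\<close>

lemma sum_twist: assumes cyc shows "(\<Sum>k = 1..mu. twist k) = real mu *\<^sub>R c"
proof -
  let ?b = "\<lambda>k. ec T xs (side (fF pt k) (fd pt k \<circ> swp))" and ?a = "\<lambda>k. ec T xs (side (fF pt k) (fd pt k))"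
    and ?X = "\<lambda>k. xs (Face (fF pt k))"
  have tw: "twist k = P pt ((1/4) *\<^sub>R (c + ?a k + ?b k + ?X k))" if "k \<in> {1..mu}" for k
    using fan_face[OF pt that] by (simp add: lc_simps)
  have "(\<Sum>k = 1..mu. twist k) - real mu *\<^sub>R c = (\<Sum>k = 1..mu. 1 *\<^sub>R (P pt ((1/4) *\<^sub>R (c + ?a k + ?b k + ?X k)) - c))"
    unfolding sum_const[symmetric] sum_subtractf[symmetric] by (rule sum.cong[OF refl]) (simp add: tw)
  also have "\<dots> = Lam pt (\<Sum>k = 1..mu. 1 *\<^sub>R ((1/4) *\<^sub>R (c + ?a k + ?b k + ?X k) - c))" by (rule P_sum)
  also have "(\<Sum>k = 1..mu. 1 *\<^sub>R ((1/4) *\<^sub>R (c + ?a k + ?b k + ?X k) - c)) =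
    (1/4) *\<^sub>R ((\<Sum>k = 1..mu. ?a k) + (\<Sum>k = 1..mu. ?b k) + (\<Sum>k = 1..mu. ?X k)) - (\<Sum>k = 1..mu. (3/4) *\<^sub>R c)"
    unfolding scaleR_sum_right sum.distrib[symmetric] sum_subtractf[symmetric]
    by (intro sum.cong refl) (simp add: algebra_simps flip: scaleR_add_left)
  also have "\<dots> = 0"
    unfolding sum_edges[OF assms] sum_control[OF assms] sum_const by (simp flip: scaleR_add_left)
  finally show ?thesis by (simp add: linear_0[OF linear_Lam])
qed

lemma inner_value_x: "inner_value x pt k = inner_point cyc mu spoke twist k"
  by (simp add: inner_value_def lc_def)

lemma inner_value_pair:
  assumes "k \<in> {1..mu}" "cyc \<or> k < mu"
  shows "inner_value x pt k + inner_value x pt (nx k) = 2 *\<^sub>R spoke k"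
proof (cases cyc)
  case True
  then show ?thesis unfolding inner_value_x
    using inner_point_interior[OF assms(1), of spoke twist] spoke_alternating by simp
next
  case False
  then have "k \<in> {1..mu - 1}" "k \<noteq> mu" using assms by auto
  then show ?thesis unfolding inner_value_x
    using inner_point_boundary[of k mu spoke twist] False by simp
qed

lemma refined_inner:
  assumes "isolated T pt" "k \<in> {1..mu}"
  shows "xs' (Face (sub (fF pt k) (fd pt k))) = inner_value x pt k"
  by (rule refined_face_inner[OF x_spl pt assms])

text \<open>The functional w \<bullet> n takes the same value on all spokes and diagonals, and the
  inner points are affine combinations of these.\<close>

lemma inner_value_plane: "k \<in> {1..mu} \<Longrightarrow> (inner_value x pt k - c) \<bullet> n pt = 0"
proof -
  assume k: "k \<in> {1..mu}"
  have l: "linear (\<lambda>w. w \<bullet> n pt)" by (rule linearI) (auto simp: inner_add_left)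
  have e: "spoke i \<bullet> n pt = c \<bullet> n pt" "twist i \<bullet> n pt = c \<bullet> n pt" if "i \<in> {1..mu}" for i
    using lc_plane[OF fan_face(1,2)[OF pt that], of 0 "Suc 0"] lc_plane[OF fan_face(1,2)[OF pt that], of "Suc 0" "Suc 0"]
      fan_face(3)[OF pt that] pt by (simp_all add: inner_diff_left)
  have "inner_value x pt k \<bullet> n pt = inner_point cyc mu (\<lambda>i. spoke i \<bullet> n pt) (\<lambda>i. twist i \<bullet> n pt) k"
    unfolding inner_value_x by (rule inner_point_linear[OF l])
  also have "\<dots> = inner_point cyc mu (\<lambda>_. c \<bullet> n pt) (\<lambda>_. c \<bullet> n pt) k"
    unfolding inner_point_def using e by (intro arg_cong2[where f = "(+)"] sum.cong refl) (auto split: if_splits)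
  finally show ?thesis using inner_point_const[OF k] by (simp add: inner_diff_left)
qed

end

end

section \<open>Preservation of vertices, edges and planes by the rule\<close>

context refinement
begin

lemma lc_swp: "F \<in> T \<Longrightarrow> d \<in> frames \<Longrightarrow> j \<le> 3 \<Longrightarrow> k \<le> 3 \<Longrightarrow> lc F (d \<circ> swp) j k = lc F d k j"
  unfolding lc_def by (rule loc_swp[OF x_spl])

lemma lc_flip: "F \<in> T \<Longrightarrow> d \<in> frames \<Longrightarrow> j \<le> 3 \<Longrightarrow> k \<le> 3 \<Longrightarrow> lc F (d \<circ> flip) j k = lc F d (3 - j) k"
  unfolding lc_def by (rule loc_flip[OF x_spl])

text \<open>Each new face value is a quarter of vertex, two edges and face. In the sum every edge
  occurs twice and opposite edges add to twice the vertex coefficient; with the four face values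
  this makes 16 quarters of it.\<close>

lemma refined_vertex_ordinary_interior:
  assumes pt: "pt \<in> IV" "pt \<notin> EV"
  shows "vc T' xs' pt = vc T xs pt"
proof -
  have v: "pt \<in> vertices T" using pt by (simp add: interior_vertices_def)
  have val: "card (faces_at T pt) = 4" using pt by (auto simp: extraordinary_def valence_def)
  obtain F q where F: "F \<in> T" "q \<in> corners" "F q = pt" using v by (auto simp: vertices_def)
  obtain d where d: "d \<in> frames" "d (0,0) = q" using corner_frame F(2) by metis
  have Fd: "F (d (0,0)) = pt" using F d by simp
  obtain G e where G: "G \<in> T" "G \<noteq> F" "e \<in> frames" "glued F d G e"
    using interior_side_glued[OF F(1) d(1)] interior_vertex_side[OF F(1) d(1)] Fd pt by metis
  obtain H h H' h' where H: "H \<in> T" "H' \<in> T" "h \<in> frames" "h' \<in> frames"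
    "glued F (d \<circ> swp) H h" "glued G (e \<circ> swp) H' h'" "distinct [F, G, H, H']" "faces_at T pt = {F, G, H, H'}"
    using opposite_interior[OF F(1) G(1) d(1) G(3,4) G(2)[symmetric]] val pt Fd by metis
  have o: "G (e (0,0)) = pt" "H (h (0,0)) = pt" "H' (h' (0,0)) = pt"
    using glued_origin[OF G(4)] glued_origin[OF H(5)] glued_origin[OF H(6)] Fd by simp_all
  let ?c = "vc T xs pt" and ?e = "ec T xs" and ?X = "\<lambda>F. xs (Face F)"
  have e1: "?e (side G e) = ?e (side F d)" "?e (side H h) = ?e (side F (d \<circ> swp))" "?e (side H' h') = ?e (side G (e \<circ> swp))"
    using glued_side[OF G(4)] glued_side[OF H(5)] glued_side[OF H(6)] by simp_all
  have e2: "?e (side F (d \<circ> swp)) + ?e (side G (e \<circ> swp)) = 2 *\<^sub>R ?c"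
    "?e (side F d) + ?e (side H (h \<circ> swp)) = 2 *\<^sub>R ?c" "?e (side F d) + ?e (side H' (h' \<circ> swp)) = 2 *\<^sub>R ?c"
    using opposite_coeff[OF F(1) G(1) d(1) G(3,4) G(2)[symmetric], of xs]
      opposite_coeff[OF F(1) H(1) frame_swp_frames[OF d(1)] H(3,5), of xs]
      opposite_coeff[OF G(1) H(2) frame_swp_frames[OF G(3)] H(4,6), of xs] H(7) pt Fd o e1(1) by simp_all
  have X: "?X F + ?X G + ?X H + ?X H' = 4 *\<^sub>R ?c"
    using pt H(7,8) by (simp add: vc_def valence_def add_ac)
  have xf: "xs' (Face (sub K k)) = (1/4) *\<^sub>R (?c + ?e (side K k) + ?e (side K (k \<circ> swp)) + ?X K)"
    if "K \<in> T" "k \<in> frames" "K (k (0,0)) = pt" for K k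
    using refined_face[OF that(1,2)] lc_simps(4)[OF that(1,2)] that(3) pt by (simp add: P_def)
  obtain hh where hh: "bij_betw hh (faces_at T pt) (faces_at T' pt)"
    "\<And>F d. F \<in> T \<Longrightarrow> d \<in> frames \<Longrightarrow> F (d (0,0)) = pt \<Longrightarrow> hh F = sub F d"
    using sub_bij[OF v] by blast
  have "(\<Sum>K\<in>faces_at T' pt. xs' (Face K)) = (\<Sum>K\<in>faces_at T pt. xs' (Face (hh K)))"
    by (rule sum.reindex_bij_betw[OF hh(1), symmetric])
  also have "\<dots> = xs' (Face (hh F)) + xs' (Face (hh G)) + xs' (Face (hh H)) + xs' (Face (hh H'))"
    using H(7,8) by (simp add: add_ac)
  also have "\<dots> = (1/4) *\<^sub>R (?c + ?e (side F d) + ?e (side F (d \<circ> swp)) + ?X F) + (1/4) *\<^sub>R (?c + ?e (side F d) + ?e (side G (e \<circ> swp)) + ?X G)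
    + (1/4) *\<^sub>R (?c + ?e (side F (d \<circ> swp)) + ?e (side H (h \<circ> swp)) + ?X H)
    + (1/4) *\<^sub>R (?c + ?e (side G (e \<circ> swp)) + ?e (side H' (h' \<circ> swp)) + ?X H')"
    using xf[OF F(1) d(1) Fd] xf[OF G(1,3) o(1)] xf[OF H(1,3) o(2)] xf[OF H(2,4) o(3)] e1
      hh(2)[OF F(1) d(1) Fd] hh(2)[OF G(1,3) o(1)] hh(2)[OF H(1,3) o(2)] hh(2)[OF H(2,4) o(3)] by simp
  also have "\<dots> = (1/4) *\<^sub>R (4 *\<^sub>R ?c + 2 *\<^sub>R (?e (side F (d \<circ> swp)) + ?e (side G (e \<circ> swp))) +
      (?e (side F d) + ?e (side H (h \<circ> swp))) + (?e (side F d) + ?e (side H' (h' \<circ> swp))) + (?X F + ?X G + ?X H + ?X H'))"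
  proof -
    have q: "4 *\<^sub>R v = v + v + v + v" for v :: "real^3"
      using scaleR_add_left[of 2 2 v] by (simp add: scaleR_2 add_ac)
    show ?thesis by (simp only: scaleR_add_right[symmetric] q scaleR_2) (simp add: add_ac)
  qed
  also have "\<dots> = 4 *\<^sub>R ?c" unfolding e2 X by (simp flip: scaleR_add_left)
  finally have "(\<Sum>K\<in>faces_at T' pt. xs' (Face K)) = 4 *\<^sub>R ?c" .
  then show ?thesis using interior_vertex_old[OF v] valence_old[OF v] pt val by (simp add: vc_def valence_def)
qed

text \<open>In the isolated case the pair relation, summed once around the vertex, equates twice the
  sum of the inner points with twice the sum of the spokes, and the spokes average to the
  vertex.\<close>

lemma refined_vertex_extraordinary_interior:
  assumes pt: "pt \<in> IV" "pt \<in> EV"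
  shows "vc T' xs' pt = vc T xs pt"
proof -
  let ?mu = "valence T pt" and ?c = "vc T xs pt"
  have v: "pt \<in> vertices T" using pt by (simp add: interior_vertices_def)
  have mu: "?mu \<ge> 1" using valence_ge_2[OF pt(2)] by simp
  obtain hh where hh: "bij_betw hh (faces_at T pt) (faces_at T' pt)"
    "\<And>F d. F \<in> T \<Longrightarrow> d \<in> frames \<Longrightarrow> F (d (0,0)) = pt \<Longrightarrow> hh F = sub F d"
    using sub_bij[OF v] by blast
  have "(\<Sum>K\<in>faces_at T' pt. xs' (Face K)) = (\<Sum>K\<in>faces_at T pt. xs' (Face (hh K)))"
    by (rule sum.reindex_bij_betw[OF hh(1), symmetric])
  also have "\<dots> = (\<Sum>k = 1..?mu. xs' (Face (hh (fF pt k))))" by (rule sum_fan[OF pt(2)])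
  also have "\<dots> = (\<Sum>k = 1..?mu. xs' (Face (sub (fF pt k) (fd pt k))))"
  proof (rule sum.cong[OF refl])
    fix k assume "k \<in> {1..?mu}"
    from hh(2)[OF fan_face[OF pt(2) this]]
    show "xs' (Face (hh (fF pt k))) = xs' (Face (sub (fF pt k) (fd pt k)))" by simp
  qed
  also have "\<dots> = real ?mu *\<^sub>R ?c"
  proof (cases "isolated T pt")
    case False
    have "(\<Sum>k = 1..?mu. xs' (Face (sub (fF pt k) (fd pt k)))) = (\<Sum>k = 1..?mu. lc (fF pt k) (fd pt k) (Suc 0) (Suc 0))"
      by (rule sum.cong[OF refl]) (use refined_face fan_face[OF pt(2)] False in simp)
    then show ?thesis using sum_twist[OF pt(2,1)] by simp
  next
    case True
    have "(\<Sum>k = 1..?mu. xs' (Face (sub (fF pt k) (fd pt k)))) = (\<Sum>k = 1..?mu. inner_value x pt k)"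
      by (rule sum.cong[OF refl]) (use refined_inner[OF pt(2) True] in simp)
    moreover have "(\<Sum>k = 1..?mu. inner_value x pt k) + (\<Sum>k = 1..?mu. inner_value x pt k) = 2 *\<^sub>R (\<Sum>k = 1..?mu. lc (fF pt k) (fd pt k) 0 (Suc 0))"
    proof -
      have "(\<Sum>k = 1..?mu. inner_value x pt k) + (\<Sum>k = 1..?mu. inner_value x pt k) =
        (\<Sum>k = 1..?mu. inner_value x pt k) + (\<Sum>k = 1..?mu. inner_value x pt (if k = ?mu then 1 else k + 1))"
        unfolding sum_next[OF mu] ..
      also have "\<dots> = (\<Sum>k = 1..?mu. 2 *\<^sub>R lc (fF pt k) (fd pt k) 0 (Suc 0))"
        unfolding sum.distrib[symmetric] by (rule sum.cong[OF refl]) (rule inner_value_pair[OF pt(2) _ disjI1[OF pt(1)]])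
      finally show ?thesis by (simp only: scaleR_sum_right)
    qed
    ultimately have "2 *\<^sub>R (\<Sum>k = 1..?mu. xs' (Face (sub (fF pt k) (fd pt k)))) = 2 *\<^sub>R (real ?mu *\<^sub>R ?c)"
      by (simp only: scaleR_2[symmetric] sum_spoke[OF pt(2,1)])
    then show ?thesis unfolding scaleR_cancel_left by (metis zero_neq_numeral)
  qed
  finally have "(\<Sum>K\<in>faces_at T' pt. xs' (Face K)) = real ?mu *\<^sub>R ?c" .
  then show ?thesis using interior_vertex_old[OF v] valence_old[OF v] pt mu by (simp add: vc_def valence_def)
qed

lemma refined_vertex_boundary:
  assumes pt: "pt \<in> BV"
  shows "vc T' xs' pt = vc T xs pt"
proof -
  have v: "pt \<in> vertices T" using pt by (simp add: boundary_vertices_def)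
  have ni: "pt \<notin> IV" "pt \<notin> interior_vertices T'"
    using pt interior_vertex_old[OF v] by (auto simp: interior_vertices_def)
  show ?thesis
  proof (cases "pt \<in> corner_vertices T")
    case True
    obtain F q where F: "F \<in> T" "q \<in> corners" "F q = pt" using v by (auto simp: vertices_def)
    obtain d where d: "d \<in> frames" "d (0,0) = q" using corner_frame F(2) by metis
    have "xs' (Corner pt) = lc F d 0 0" using refined_corner[OF x_spl True F(1) d(1)] F d by (simp add: lc_def)
    then show ?thesis using True lc_simps(1)[OF F(1) d(1)] F d ni by (simp add: vc_def corner_vertices_refine)
  next
    case False
    obtain F d G e where F: "F \<in> T" "d \<in> frames" "F (d (0,0)) = pt" and G: "G \<in> T" "e \<in> frames" "G (e (0,0)) = pt"
      and b: "side F d \<in> BE" "side G e \<in> BE" "side F d \<noteq> side G e"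
      "{\<rho> \<in> BE. pt \<in> \<rho>} = {side F d, side G e}"
      "{\<rho> \<in> boundary_edges T'. pt \<in> \<rho>} = {half F d, half G e}" "half F d \<noteq> half G e"
      using boundary_pair_refined[OF pt False] .
    have c: "vc T xs pt = (1/2) *\<^sub>R (xs (BEdge (side F d)) + xs (BEdge (side G e)))"
      using ni False b by (simp add: vc_def)
    let ?y = "\<lambda>\<rho>. (1/2) *\<^sub>R (vc T xs pt + xs (BEdge \<rho>))"
    have "?y (side F d) + ?y (side G e) = (1/2) *\<^sub>R (vc T xs pt + vc T xs pt) + (1/2) *\<^sub>R (xs (BEdge (side F d)) + xs (BEdge (side G e)))"
      by (simp only: scaleR_add_right add_ac)
    also have "\<dots> = 2 *\<^sub>R vc T xs pt" unfolding c[symmetric] by (simp add: scaleR_2 flip: scaleR_add_left)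
    finally have "P pt (?y (side F d)) + P pt (?y (side G e)) = 2 *\<^sub>R vc T xs pt" by (rule half_average)
    then have "lc F d (Suc 0) 0 + lc G e (Suc 0) 0 = 2 *\<^sub>R vc T xs pt"
      using F G b by (simp add: lc_simps ec_boundary)
    moreover have "xs' (BEdge (half F d)) = lc F d (Suc 0) 0" "xs' (BEdge (half G e)) = lc G e (Suc 0) 0"
      using refined_edge[OF x_spl F(1,2) b(1)] refined_edge[OF x_spl G(1,2) b(2)] by (simp_all add: lc_def)
    moreover have "vc T' xs' pt = (1/2) *\<^sub>R (xs' (BEdge (half F d)) + xs' (BEdge (half G e)))"
      using ni False b(5,6) by (simp add: vc_def corner_vertices_refine)
    ultimately show ?thesis by simp
  qed
qed

lemma refined_vertex: "pt \<in> vertices T \<Longrightarrow> vc T' xs' pt = vc T xs pt"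
  using refined_vertex_boundary refined_vertex_ordinary_interior refined_vertex_extraordinary_interior
  by (metis DiffI interior_vertices_def)

text \<open>The hypothesis \<open>c\<close> leaves out exactly the interior spokes at extraordinary
  vertices that are not isolated: there the half edge becomes a mean of diagonals that may differ
  from the spoke. At an ordinary vertex the mean of two diagonals is the edge coefficient by
  \<open>opposite_coeff\<close>.\<close>

lemma refined_half:
  assumes F: "F \<in> T" and d: "d \<in> frames"
    and c: "side F d \<in> BE \<or> F (d (0,0)) \<notin> EV \<or> isolated T (F (d (0,0)))"
  shows "ec T' xs' (half F d) = lc F d (Suc 0) 0"
  using F d
proof (cases rule: side_cases)
  case 1
  then show ?thesis using refined_boundary_edge F d by blast
next
  case (2 G e)
  let ?pt = "F (d (0,0))"
  have nb: "side F d \<notin> BE" using 2 by (simp add: interior_edges_def)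
  have ptG: "G (e (0,0)) = ?pt" using glued_origin[OF 2(3)] by simp
  show ?thesis
  proof (cases "?pt \<in> EV")
    case False
    let ?c = "vc T xs ?pt" and ?X = "\<lambda>F. xs (Face F)" and ?e = "ec T xs"
    have o: "?e (side F (d \<circ> swp)) + ?e (side G (e \<circ> swp)) = 2 *\<^sub>R ?c"
      by (rule opposite_coeff[OF F 2(1) d 2(2,3) 2(4)[symmetric] False])
    have E: "?X F + ?X G = 2 *\<^sub>R ?e (side F d)" using ec_glued[OF F 2(1) d 2(2,3) 2(4)[symmetric], of xs] by simp
    have "ec T' xs' (half F d) = (1/2) *\<^sub>R (lc F d (Suc 0) (Suc 0) + lc G e (Suc 0) (Suc 0))"
      using ec_half_interior[OF F d 2(1-4), of xs'] refined_face[OF F d] refined_face[OF 2(1,2)] False ptG by simp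
    also have "\<dots> = (1/2) *\<^sub>R ((1/4) *\<^sub>R (?c + ?e (side F d) + ?e (side F (d \<circ> swp)) + ?X F) +
        (1/4) *\<^sub>R (?c + ?e (side F d) + ?e (side G (e \<circ> swp)) + ?X G))"
      using lc_simps(4)[OF F d] lc_simps(4)[OF 2(1,2)] False ptG glued_side[OF 2(3)] by (simp add: P_def)
    also have "\<dots> = (1/8) *\<^sub>R ((?c + ?c) + (?e (side F d) + ?e (side F d)) + (?e (side F (d \<circ> swp)) + ?e (side G (e \<circ> swp))) + (?X F + ?X G))"
      by (simp add: scaleR_add_right add_ac)
    also have "\<dots> = (1/2) *\<^sub>R (?c + ?e (side F d))"
      unfolding o E by (simp add: scaleR_add_right scaleR_2[symmetric] flip: scaleR_add_left)
    also have "\<dots> = lc F d (Suc 0) 0" using lc_simps(2)[OF F d] False by (simp add: P_def)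
    finally show ?thesis .
  next
    case True
    then have iso: "isolated T ?pt" using c nb by blast
    obtain r where r: "r \<in> {1..valence T ?pt}" "?pt \<in> IV \<or> r < valence T ?pt"
      "side F d = side (fF ?pt r) (fd ?pt r \<circ> swp)"
      using spoke_interior[OF True F d refl 2(5)] by blast
    let ?r' = "if r = valence T ?pt then 1 else r + 1"
    note f = fan_face[OF True r(1)]
    have f2: "fd ?pt r \<circ> swp \<in> frames" "F (d (0,0)) = fF ?pt r ((fd ?pt r \<circ> swp) (0,0))" using f by simp_all
    note nx = fan_next[OF True r(1,2)]
    note f' = fan_face[OF True nx(5)]
    have "ec T' xs' (half F d) = ec T' xs' (half (fF ?pt r) (fd ?pt r \<circ> swp))"
      using half_cong(2)[OF F f(1) d f2 r(3)] by simp
    also have "\<dots> = (1/2) *\<^sub>R (inner_value x ?pt r + inner_value x ?pt ?r')"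
      using ec_half_interior[OF f(1) f2(1) f'(1,2) nx(1,2), of xs'] refined_inner[OF True iso r(1)]
        refined_inner[OF True iso nx(5)] by simp
    also have "\<dots> = lc (fF ?pt r) (fd ?pt r) 0 (Suc 0)" using inner_value_pair[OF True r(1,2)] by simp
    also have "\<dots> = lc (fF ?pt r) (fd ?pt r \<circ> swp) (Suc 0) 0" using lc_swp[OF f(1,2), of "Suc 0" 0] by simp
    also have "\<dots> = lc F d (Suc 0) 0" by (rule lc_spoke_cong[OF f(1) f2(1) F d f2(2)[symmetric] r(3)[symmetric]])
    finally show ?thesis .
  qed
qed

lemma refined_face_plane:
  assumes F: "F \<in> T" and d: "d \<in> frames" and pt: "F (d (0,0)) \<in> EV"
  shows "(xs' (Face (sub F d)) - vc T xs (F (d (0,0)))) \<bullet> n (F (d (0,0))) = 0"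
proof (cases "isolated T (F (d (0,0)))")
  case False
  then show ?thesis using refined_face[OF F d] lc_plane[OF F d _ _ pt, of "Suc 0" "Suc 0"] by simp
next
  case True
  let ?pt = "F (d (0,0))"
  obtain r where r: "r \<in> {1..valence T ?pt}" "fF ?pt r = F" "d = fd ?pt r \<or> d = fd ?pt r \<circ> swp"
    using spoke_cases[OF pt F d refl] by blast
  from r(3) have "d (0,0) = fd ?pt r (0,0)"
  proof
    assume "d = fd ?pt r \<circ> swp"
    from fun_cong[OF this, of "(0,0)"] show ?thesis by simp
  next
    assume "d = fd ?pt r"
    from fun_cong[OF this, of "(0,0)"] show ?thesis .
  qed
  then have "xs' (Face (sub F d)) = inner_value x ?pt r"
    using refined_inner[OF pt True r(1)] r(2) by simp
  then show ?thesis using inner_value_plane[OF pt r(1)] by simp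
qed

lemma refined_half_plane:
  assumes F: "F \<in> T" and d: "d \<in> frames" and pt: "F (d (0,0)) \<in> EV"
  shows "(ec T' xs' (half F d) - vc T xs (F (d (0,0)))) \<bullet> n (F (d (0,0))) = 0"
  using F d
proof (cases rule: side_cases)
  case 1
  then show ?thesis using refined_half[OF F d] lc_plane[OF F d _ _ pt, of "Suc 0" 0] by simp
next
  case (2 G e)
  have "G (e (0,0)) = F (d (0,0))" using glued_origin[OF 2(3)] by simp
  then show ?thesis
    using ec_half_interior[OF F d 2(1-4), of xs'] refined_face_plane[OF F d pt] refined_face_plane[OF 2(1,2)] pt
    by (simp add: inner_diff_left inner_add_left)
qed

text \<open>In contrast to \<open>joint_lc\<close> this holds without isolation and for the diagonal
  too, and it is what makes the next projection trivial.\<close>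

lemma joint_plane:
  assumes F: "F \<in> T" and d: "d \<in> frames" and pt: "F (d (0,0)) \<in> EV" and jk: "j \<le> 1" "k \<le> 1"
  shows "(act 3 d (joint xs' F) j k - vc T xs (F (d (0,0)))) \<bullet> n (F (d (0,0))) = 0"
proof -
  have "j = 0 \<or> j = Suc 0" "k = 0 \<or> k = Suc 0" using jk by auto
  then show ?thesis
    using joint_local[OF F d, of xs'] refined_vertex[OF frame_origin_vertex[OF F d]] refined_half_plane[OF F d pt]
      refined_half_plane[OF F frame_swp_frames[OF d]] refined_face_plane[OF F d pt] pt by auto
qed

lemma joint_lc:
  assumes F: "F \<in> T" and d: "d \<in> frames" and jk: "j \<le> 1" "k \<le> 1"
    and c: "F (d (0,0)) \<notin> EV \<or> (isolated T (F (d (0,0))) \<and> \<not> (j = 1 \<and> k = 1))"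
  shows "act 3 d (joint xs' F) j k = lc F d j k"
proof -
  have "j = 0 \<or> j = Suc 0" "k = 0 \<or> k = Suc 0" using jk by auto
  then show ?thesis
    using joint_local[OF F d, of xs'] refined_vertex[OF frame_origin_vertex[OF F d]] refined_half[OF F d]
      refined_half[OF F frame_swp_frames[OF d]] refined_face[OF F d] c lc_swp[OF F d, of "Suc 0" 0] lc_simps(1)[OF F d] by auto
qed

text \<open>Boundary control points are taken directly from the coefficients on the edge, at
  extraordinary vertices as elsewhere, so the whole row survives. Its far half is the near half in
  flipped coordinates.\<close>

lemma joint_boundary:
  assumes F: "F \<in> T" and d: "d \<in> frames" and b: "side F d \<in> BE" and j: "j \<le> 3"
  shows "act 3 d (joint xs' F) j 0 = lc F d j 0"
proof -
  have *: "act 3 e (joint xs' F) j 0 = lc F e j 0" if "e \<in> frames" "side F e \<in> BE" "j \<le> 1" for e j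
  proof -
    have "j = 0 \<or> j = Suc 0" using that by auto
    then show ?thesis using joint_local[OF F that(1), of xs'] refined_vertex[OF frame_origin_vertex[OF F that(1)]]
        refined_half[OF F that(1)] that lc_simps(1)[OF F that(1)] by auto
  qed
  show ?thesis
  proof (cases "j \<le> 1")
    case True
    then show ?thesis using * d b by blast
  next
    case False
    then have "3 - j \<le> 1" "3 - (3 - j) = j" using j by auto
    then show ?thesis using *[of "d \<circ> flip" "3 - j"] d b act_flip[of "3 - j" 3 d "joint xs' F" 0]
        lc_flip[OF F d, of "3 - j" 0] by (simp add: side_flip)
  qed
qed

end

section \<open>Boundary edges, structured faces and spoke midpoints\<close>

locale refinement_step = refinement T xs n tri fan
  for T :: "'p mesh" and xs n tri fan +
  fixes tri' :: "'p \<Rightarrow> nat \<Rightarrow> real^3"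
  assumes input': "almost_C1_input (refine T) (refined_points T fan x) n tri'"
begin

sublocale R: geometry "refine T" "refined_points T fan x" n tri'
  by (intro geometry.intro refined geometry_axioms.intro input')

text \<open>At an extraordinary vertex all four Bernstein coefficients of the block lie in the
  projection plane by \<open>joint_plane\<close>, and the base point of the plane is kept by
  \<open>refined_vertex\<close>; so the projection acts as the identity.\<close>

lemma refined_lc:
  assumes K: "K \<in> T'" and d: "d \<in> frames" and jk: "j \<le> 1" "k \<le> 1"
  shows "R.lc K d j k = subdiv (bc T' xs' (K \<circ> d) (xs' (Face K))) j k"
proof (cases "K (d (0,0)) \<in> extraordinary T'")
  case False
  then show ?thesis using R.lc_eq[OF K d jk] by (simp add: R.P_def)
next
  case True
  let ?pt = "K (d (0,0))"
  obtain F q where F: "F \<in> T" "q \<in> corners" "K = F \<circ> quad q" using K by (rule refineE)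
  have pt: "?pt \<in> EV" using True extraordinary_refine by simp
  have dq: "d (0,0) = q" using refined_face_extraordinary[OF F(1,2), of "d (0,0)"] pt F d by simp
  then have ptF: "?pt = F (d (0,0))" using F by simp
  have KF: "K = sub F d" using F dq by simp
  let ?b = "bc T' xs' (K \<circ> d) (xs' (Face K))"
  let ?c = "vc T xs ?pt"
  have b: "?b i l \<bullet> n ?pt = ?c \<bullet> n ?pt" if "i \<le> 1" "l \<le> 1" for i l
    using joint_frame[OF F(1) d that, of xs'] joint_plane[OF F(1) d _ that] pt unfolding ptF
    by (simp add: KF inner_diff_left)
  have "subdiv ?b j k \<bullet> n ?pt = ?c \<bullet> n ?pt"
  proof -
    have "j = 0 \<or> j = Suc 0" "k = 0 \<or> k = Suc 0" using jk by auto
    then show ?thesis using b[of 0 0] b[of "Suc 0" 0] b[of 0 "Suc 0"] b[of "Suc 0" "Suc 0"]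
      by (auto simp: subdiv_simps inner_add_left)
  qed
  moreover have "vc T' xs' ?pt = ?c" using refined_vertex[OF extraordinary_vertex[OF pt]] .
  ultimately show ?thesis using R.lc_eq[OF K d jk] True by (simp add: R.P_def plane_proj_fixed inner_diff_left)
qed

lemma refined_x:
  assumes K: "K \<in> T'"
  shows "R.x K s = star T' xs' K s"
proof -
  have "R.lc K id j k = subdiv (bc T' xs' K (xs' (Face K))) j k" if jk: "j \<le> 3" "k \<le> 3" for j k
  proof -
    obtain d j0 k0 where d: "d \<in> frames" "j0 \<le> 1" "k0 \<le> 1" "idx 3 d j0 k0 = (j, k)" by (rule idx_corner[OF jk])
    have "R.lc K id j k = R.lc K d j0 k0" using R.lc_act[OF K d(1), of j0 k0] d by (simp add: act_def)
    also have "\<dots> = subdiv_coeff (star T' xs' K \<circ> d) j0 k0"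
      using refined_lc[OF K d(1-3)] R.star_subdiv[OF K d(1), of j0 k0 xs'] d by simp
    also have "\<dots> = act 3 d (subdiv (bc T' xs' K (xs' (Face K)))) j0 k0"
      by (rule subdiv_coeff_frame) (use K d in \<open>auto simp: R.star_bern bern_subdiv\<close>)
    finally show ?thesis using d by (simp add: act_def)
  qed
  then have "bsp (R.lc K id) s = bsp (subdiv (bc T' xs' K (xs' (Face K)))) s" by (rule bsp_cong)
  then show ?thesis using R.x_lc[of id K s] by (simp add: R.star_bern[OF K] bern_subdiv)
qed

lemma refined_joint:
  assumes "F \<in> T" "q \<in> corners" "s \<in> sq"
  shows "R.x (F \<circ> quad q) s = bsp (joint xs' F) (quad q s)"
  using refined_x[OF refineI[OF assms(1,2)]] joint_star[OF assms] by simp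

lemma refined_joint_frame:
  assumes "F \<in> T" "d \<in> frames" "s \<in> sq"
  shows "R.x (sub F d) (d s) = bsp (act 3 d (joint xs' F)) (quad (0,0) s)"
  using refined_x[OF refineI[OF assms(1), of "d (0,0)"]] joint_star_frame[OF assms] assms(2) by (simp add: bsp_frame)

lemma joint_eq_lc:
  assumes F: "F \<in> T" and c: "carrier_of F \<inter> EV = {}" and jk: "j \<le> 3" "k \<le> 3"
  shows "joint xs' F j k = lc F id j k"
proof -
  obtain d j0 k0 where d: "d \<in> frames" "j0 \<le> 1" "k0 \<le> 1" "idx 3 d j0 k0 = (j, k)" by (rule idx_corner[OF jk])
  have "F (d (0,0)) \<in> carrier_of F" using d(1) by (simp add: carrier_of_def sq_iff)
  then have "F (d (0,0)) \<notin> EV" using c by blast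
  then have "act 3 d (joint xs' F) j0 k0 = lc F d j0 k0" using joint_lc[OF F d(1-3)] by blast
  then show ?thesis using lc_act[OF F d(1), of j0 k0] d by (simp add: act_def)
qed

theorem structured_preserved:
  assumes "F \<in> T" "carrier_of F \<inter> EV = {}" "q \<in> corners" "s \<in> sq"
  shows "R.x (F \<circ> quad q) s = x F (quad q s)"
proof -
  have "bsp (joint xs' F) (quad q s) = bsp (lc F id) (quad q s)"
    by (rule bsp_cong) (rule joint_eq_lc[OF assms(1,2)])
  then show ?thesis using refined_joint[OF assms(1,3,4)] x_lc[of id F "quad q s"] by simp
qed

lemma bsp_axis: "bsp C (t, 0) = (\<Sum>j\<le>3. bspline j t *\<^sub>R C j 0)"
  by (simp add: bsp_nested sum_atMost_3 bspline_def)

lemma boundary_preserved_left: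
  assumes F: "F \<in> T" and d: "d \<in> frames" and b: "side F d \<in> BE" and t: "t \<in> {0..1}"
  shows "R.x (sub F d) (d (t,0)) = x F (d (t/2,0))"
proof -
  have s: "(t,0) \<in> sq" using t by (simp add: sq_iff)
  have "R.x (sub F d) (d (t,0)) = bsp (act 3 d (joint xs' F)) (t/2,0)"
    using refined_joint_frame[OF F d s] by (simp add: quad_simp)
  also have "\<dots> = bsp (lc F d) (t/2,0)"
    unfolding bsp_axis by (intro sum.cong refl) (use joint_boundary[OF F d b] in simp)
  finally show ?thesis by (simp add: x_lc[OF d])
qed

theorem boundary_preserved:
  assumes F: "F \<in> T" and d: "d \<in> frames" and b: "side F d \<in> BE" and t: "t \<in> {0..1}"
  shows "R.x (sub F d) (d (t,0)) = x F (d (t/2,0)) \<and>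
    R.x (F \<circ> quad (d (1,0))) (d (t,0)) = x F (d ((1+t)/2,0))"
proof -
  have "1 - t \<in> {0..1}" using t by simp
  from boundary_preserved_left[OF F frame_flip_frames[OF d] _ this] b
  have "R.x (F \<circ> quad (d (1,0))) (d (t,0)) = x F (d (1 - (1 - t)/2,0))" by (simp add: side_flip)
  moreover have "1 - (1 - t)/2 = (1+t)/2" by (simp add: field_simps)
  ultimately show ?thesis using boundary_preserved_left[OF assms] by simp
qed

text \<open>At 1/2 only the two middle B-splines are nonzero. The first middle coefficient belongs
  to the isolated vertex and lies off the diagonal, the second belongs to the block of the far end,
  which is ordinary by assumption.\<close>

theorem spoke_midpoint:
  assumes F: "F \<in> T" and d: "d \<in> frames" and pt: "F (d (0,0)) \<in> EV"
    and only: "\<forall>G\<in>faces_at T (F (d (0,0))). carrier_of G \<inter> EV = {F (d (0,0))}"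
  shows "R.x (sub F d) (d (1,0)) = x F (d (1/2,0))"
proof -
  have iso: "isolated T (F (d (0,0)))"
    unfolding isolated_def one_ring_def using only by (auto simp: faces_at_def)
  have "F (d (1,0)) \<notin> EV"
  proof
    assume e: "F (d (1,0)) \<in> EV"
    have "F (d (1,0)) \<in> carrier_of F" using d by (simp add: carrier_of_def sq_iff)
    then have "F (d (1,0)) = F (d (0,0))" using only faces_at_origin[OF F d] e by blast
    then have "d (1,0) = d (0,0)" using face_eq[OF F, of "d (1,0)" "d (0,0)"] d by (simp add: sq_iff)
    then show False using d by (simp add: frame_inj)
  qed
  then have 2: "act 3 d (joint xs' F) 2 0 = lc F d 2 0"
    using joint_lc[OF F frame_flip_frames[OF d], of "Suc 0" 0] act_flip[of "Suc 0" 3 d "joint xs' F" 0]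
      lc_flip[OF F d, of "Suc 0" 0] by simp
  have 1: "act 3 d (joint xs' F) (Suc 0) 0 = lc F d (Suc 0) 0"
    using joint_lc[OF F d, of "Suc 0" 0] iso by simp
  have "(1,0) \<in> sq" by (simp add: sq_iff)
  from refined_joint_frame[OF F d this]
  have "R.x (sub F d) (d (1,0)) = bsp (act 3 d (joint xs' F)) (1/2,0)" by (simp add: quad_simp)
  also have "\<dots> = bsp (lc F d) (1/2,0)"
    unfolding bsp_axis using 1 2 by (simp add: sum_atMost_3 bspline_def)
  finally show ?thesis by (simp add: x_lc[OF d])
qed

end

section \<open>Normal vectors\<close>

context geometry
begin

text \<open>The normal direction at the corner \<open>d (0,0)\<close>, not normalized: the cross
  product of the actual partial derivatives differs by the factor 16 and possibly by the sign of
  \<open>d\<close>.\<close>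

definition N :: "'p face \<Rightarrow> frame \<Rightarrow> real^3" where
  "N F d = cross3 (lc F d (Suc 0) 0 - lc F d 0 0) (lc F d 0 (Suc 0) - lc F d 0 0)"

lemma x_hder:
  obtains D where "hder (x F) s D"
proof -
  have eq: "x F = bsp (\<lambda>j k. \<Sum>\<phi>\<in>dof T. bcoef T xs n tri \<phi> F j k *\<^sub>R control_point xs tri \<phi>)"
    by (rule ext) (rule x_bsp)
  show ?thesis by (rule bsp_hder) (rule that[unfolded eq])
qed

lemma corner_partials:
  assumes d: "d \<in> frames"
  shows "\<exists>a b. (\<forall>a' b'. has_partials (x F) (d (0,0)) a' b' \<longleftrightarrow> a' = a \<and> b' = b) \<and>
    (cross3 a b = 16 *\<^sub>R N F d \<or> cross3 a b = - (16 *\<^sub>R N F d))"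
proof -
  obtain D where D: "hder (x F) (d (0,0)) D" by (rule x_hder)
  have D': "hder (x F \<circ> d) (0,0) (D \<circ> lin d)" by (rule hder_frame[OF D d])
  have eq: "x F \<circ> d = bsp (lc F d)" by (rule ext) (simp add: x_lc[OF d])
  obtain D0 where D0: "hder (bsp (lc F d)) (0,0) D0" "D0 (1,0) = 4 *\<^sub>R (lc F d (Suc 0) 0 - lc F d 0 0)"
    "D0 (0,1) = 4 *\<^sub>R (lc F d 0 (Suc 0) - lc F d 0 0)"
    by (rule bsp_hder_origin[of "lc F d", unfolded One_nat_def])
  have z: "(0,0) \<in> sq" by (simp add: sq_iff)
  have "has_partials (bsp (lc F d)) (0,0) (D0 (1,0)) (D0 (0,1))" using hder_partials[OF D0(1) z] by simp
  then have DD: "D (lin d (1,0)) = 4 *\<^sub>R (lc F d (Suc 0) 0 - lc F d 0 0)" "D (lin d (0,1)) = 4 *\<^sub>R (lc F d 0 (Suc 0) - lc F d 0 0)"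
    using hder_partials[OF D'[unfolded eq] z] D0(2,3) by simp_all
  have "cross3 (D (lin d (1,0))) (D (lin d (0,1))) = 16 *\<^sub>R N F d"
    unfolding DD N_def by (simp add: cross_mult_left cross_mult_right)
  then have c: "cross3 (D (1,0)) (D (0,1)) = 16 *\<^sub>R N F d \<or> cross3 (D (1,0)) (D (0,1)) = - (16 *\<^sub>R N F d)"
    using frame_cross[OF has_derivative_linear[OF D] d] by auto
  have sq: "d (0,0) \<in> sq" using d by (simp add: sq_iff)
  show ?thesis using hder_partials[OF D sq] c by blast
qed

lemma vertex_points:
  assumes pt: "pt \<in> vertices T"
  shows "(\<forall>F\<in>T. \<forall>s\<in>sq. F s = pt \<longrightarrow> Q F s) \<longleftrightarrow>
    (\<forall>F\<in>T. \<forall>d\<in>frames. F (d (0,0)) = pt \<longrightarrow> Q F (d (0,0)))"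
proof
  assume *: "\<forall>F\<in>T. \<forall>s\<in>sq. F s = pt \<longrightarrow> Q F s"
  show "\<forall>F\<in>T. \<forall>d\<in>frames. F (d (0,0)) = pt \<longrightarrow> Q F (d (0,0))"
    using * by (simp add: sq_iff)
next
  assume *: "\<forall>F\<in>T. \<forall>d\<in>frames. F (d (0,0)) = pt \<longrightarrow> Q F (d (0,0))"
  show "\<forall>F\<in>T. \<forall>s\<in>sq. F s = pt \<longrightarrow> Q F s"
  proof (intro ballI impI)
    fix F s assume F: "F \<in> T" "s \<in> sq" "F s = pt"
    then have "s \<in> corners" using vertex_corner[OF pt] by blast
    then obtain d where "d \<in> frames" "d (0,0) = s" using corner_frame by blast
    then show "Q F s" using * F by metis
  qed
qed

lemma normal_vector_iff:
  assumes pt: "pt \<in> vertices T"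
  shows "normal_vector T x pt \<nu> \<longleftrightarrow> norm \<nu> = 1 \<and>
    (\<forall>F\<in>T. \<forall>d\<in>frames. F (d (0,0)) = pt \<longrightarrow> N F d \<noteq> 0 \<and> (sgn (N F d) = \<nu> \<or> sgn (N F d) = - \<nu>))"
proof -
  have *: "(\<exists>a b. has_partials (x F) (d (0,0)) a b \<and> cross3 a b \<noteq> 0 \<and> (sgn (cross3 a b) = \<nu> \<or> sgn (cross3 a b) = - \<nu>)) \<longleftrightarrow>
     N F d \<noteq> 0 \<and> (sgn (N F d) = \<nu> \<or> sgn (N F d) = - \<nu>)" if d: "d \<in> frames" for F d
  proof -
    obtain a b where ab: "\<forall>a' b'. has_partials (x F) (d (0,0)) a' b' \<longleftrightarrow> a' = a \<and> b' = b"
      "cross3 a b = 16 *\<^sub>R N F d \<or> cross3 a b = - (16 *\<^sub>R N F d)" using corner_partials[OF d, of F] by blast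
    have "(\<exists>a b. has_partials (x F) (d (0,0)) a b \<and> cross3 a b \<noteq> 0 \<and> (sgn (cross3 a b) = \<nu> \<or> sgn (cross3 a b) = - \<nu>)) \<longleftrightarrow>
      cross3 a b \<noteq> 0 \<and> (sgn (cross3 a b) = \<nu> \<or> sgn (cross3 a b) = - \<nu>)" unfolding ab(1)[rule_format] by blast
    moreover have "sgn (16 *\<^sub>R N F d) = sgn (N F d)" by (simp add: sgn_scaleR)
    ultimately show ?thesis using ab(2) by (auto simp: sgn_minus)
  qed
  show ?thesis
    unfolding normal_vector_def vertex_points[OF pt, of "\<lambda>F s. \<exists>a b. has_partials (x F) s a b \<and> cross3 a b \<noteq> 0 \<and>
        (sgn (cross3 a b) = \<nu> \<or> sgn (cross3 a b) = - \<nu>)"]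
    using * by blast
qed

lemma regular_at_iff:
  assumes pt: "pt \<in> vertices T"
  shows "regular_at T x pt \<longleftrightarrow> (\<forall>F\<in>T. \<forall>d\<in>frames. F (d (0,0)) = pt \<longrightarrow> N F d \<noteq> 0)"
proof -
  have *: "regular (x F) (d (0,0)) \<longleftrightarrow> N F d \<noteq> 0" if d: "d \<in> frames" for F d
  proof -
    obtain a b where "\<forall>a' b'. has_partials (x F) (d (0,0)) a' b' \<longleftrightarrow> a' = a \<and> b' = b"
      "cross3 a b = 16 *\<^sub>R N F d \<or> cross3 a b = - (16 *\<^sub>R N F d)" using corner_partials[OF d, of F] by blast
    then show ?thesis by (auto simp: regular_def)
  qed
  show ?thesis unfolding regular_at_def vertex_points[OF pt, of "\<lambda>F s. regular (x F) s"] using * by blast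
qed

lemma cross_plane_parallel:
  fixes a b v :: "real^3"
  assumes "a \<bullet> v = 0" "b \<bullet> v = 0" "v \<noteq> 0" "cross3 a b \<noteq> 0"
  shows "sgn (cross3 a b) = sgn v \<or> sgn (cross3 a b) = - sgn v"
proof -
  have "cross3 v (cross3 a b) = 0" using assms by (simp add: Lagrange inner_commute)
  then have "collinear {0, v, cross3 a b}" by (simp add: cross_eq_0)
  then obtain k where k: "cross3 a b = k *\<^sub>R v" using assms by (auto simp: collinear_lemma)
  then have "k \<noteq> 0" using assms by auto
  then show ?thesis unfolding k by (cases "k > 0") (auto simp: sgn_scaleR)
qed

lemma N_extraordinary:
  assumes F: "F \<in> T" and d: "d \<in> frames" and pt: "F (d (0,0)) \<in> EV" and nz: "N F d \<noteq> 0"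
  shows "sgn (N F d) = sgn (n (F (d (0,0)))) \<or> sgn (N F d) = - sgn (n (F (d (0,0))))"
  unfolding N_def
proof (rule cross_plane_parallel)
  show "n (F (d (0,0))) \<noteq> 0" using input_vertex(1)[OF pt] .
  show "(lc F d (Suc 0) 0 - lc F d 0 0) \<bullet> n (F (d (0,0))) = 0" "(lc F d 0 (Suc 0) - lc F d 0 0) \<bullet> n (F (d (0,0))) = 0"
    using lc_plane[OF F d _ _ pt, of "Suc 0" 0] lc_plane[OF F d _ _ pt, of 0 "Suc 0"] lc_plane[OF F d _ _ pt, of 0 0]
    by (simp_all add: inner_diff_left)
  show "cross3 (lc F d (Suc 0) 0 - lc F d 0 0) (lc F d 0 (Suc 0) - lc F d 0 0) \<noteq> 0" using nz by (simp add: N_def)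
qed

lemma lc_diff_ordinary:
  assumes F: "F \<in> T" and d: "d \<in> frames" and pt: "F (d (0,0)) \<notin> EV"
  shows "lc F d (Suc 0) 0 - lc F d 0 0 = (1/2) *\<^sub>R (ec T xs (side F d) - vc T xs (F (d (0,0))))"
    "lc F d 0 (Suc 0) - lc F d 0 0 = (1/2) *\<^sub>R (ec T xs (side F (d \<circ> swp)) - vc T xs (F (d (0,0))))"
  using lc_simps[OF F d] pt by (simp_all add: P_def algebra_simps flip: scaleR_add_left)

lemma N_swp:
  assumes "F \<in> T" "d \<in> frames" shows "N F (d \<circ> swp) = - N F d"
proof -
  have "lc F (d \<circ> swp) j k = lc F d k j" if "j \<le> 3" "k \<le> 3" for j k
    unfolding lc_def by (rule loc_swp) (use x_bsp assms that in \<open>auto simp: spl_def\<close>)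
  then show ?thesis unfolding N_def by (simp add: cross_skew[of "lc F d 0 (Suc 0) - lc F d 0 0"])
qed

text \<open>Across an edge at an ordinary vertex the tangent along the edge is common and the
  transverse one changes sign, by \<open>opposite_coeff\<close>.\<close>

lemma N_glued:
  assumes F: "F \<in> T" and G: "G \<in> T" and d: "d \<in> frames" and e: "e \<in> frames" and g: "glued F d G e"
    and ne: "F \<noteq> G" and pt: "F (d (0,0)) \<notin> EV"
  shows "N G e = - N F d"
proof -
  have ptG: "G (e (0,0)) = F (d (0,0))" using glued_origin[OF g] by simp
  have "ec T xs (side F (d \<circ> swp)) + ec T xs (side G (e \<circ> swp)) = vc T xs (F (d (0,0))) + vc T xs (F (d (0,0)))"
    using opposite_coeff[OF F G d e g ne pt, of xs] by (simp only: scaleR_2)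
  then have "ec T xs (side G (e \<circ> swp)) = vc T xs (F (d (0,0))) + vc T xs (F (d (0,0))) - ec T xs (side F (d \<circ> swp))"
    by (metis add_diff_cancel_left')
  then have o: "ec T xs (side G (e \<circ> swp)) - vc T xs (F (d (0,0))) = - (ec T xs (side F (d \<circ> swp)) - vc T xs (F (d (0,0))))"
    by simp
  show ?thesis
    unfolding N_def lc_diff_ordinary[OF F d pt] lc_diff_ordinary[OF G e pt[folded ptG]] ptG o glued_side[OF g, symmetric]
    by (simp only: cross_mult_left cross_mult_right cross_minus_right scaleR_minus_right)
qed

text \<open>At an extraordinary vertex the blocks lie in the plane orthogonal to
  \<open>n pt\<close>. At an ordinary one, having the normal of a fixed face up to sign is passed on
  through each edge by \<open>N_glued\<close>, hence to the whole star by
  \<open>star_closed\<close>.\<close>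

theorem normal_exists:
  assumes pt: "pt \<in> vertices T" and reg: "regular_at T x pt"
  shows "\<exists>\<nu>. normal_vector T x pt \<nu>"
proof (cases "pt \<in> EV")
  case True
  have "norm (sgn (n pt)) = 1" using input_vertex(1)[OF True] by (simp add: norm_sgn)
  then have "normal_vector T x pt (sgn (n pt))"
    unfolding normal_vector_iff[OF pt] using reg[unfolded regular_at_iff[OF pt]] N_extraordinary True by blast
  then show ?thesis ..
next
  case False
  obtain F q where F: "F \<in> T" "q \<in> corners" "F q = pt" using pt by (auto simp: vertices_def)
  obtain d where d: "d \<in> frames" "d (0,0) = q" using corner_frame F(2) by metis
  have Fd: "F (d (0,0)) = pt" using F d by simp
  define C where "C = {K \<in> faces_at T pt. \<forall>k\<in>frames. K (k (0,0)) = pt \<longrightarrow> N K k = N F d \<or> N K k = - N F d}"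
  have all: "N K k' = N F d \<or> N K k' = - N F d"
    if K: "K \<in> T" "k \<in> frames" "K (k (0,0)) = pt" "N K k = N F d \<or> N K k = - N F d" "k' \<in> frames" "K (k' (0,0)) = pt" for K k k'
    using origin_eq[OF K(1,2,5)] K N_swp[OF K(1,2)] by auto
  have inC: "K \<in> C" if K: "K \<in> T" "k \<in> frames" "K (k (0,0)) = pt" "N K k = N F d \<or> N K k = - N F d" for K k
    unfolding C_def using all[OF K] faces_at_origin[OF K(1,2)] K(3) by simp
  have "C = faces_at T pt"
  proof (rule star_closed[OF pt])
    show "C \<subseteq> faces_at T pt" by (auto simp: C_def)
    show "C \<noteq> {}" using inC[OF F(1) d(1) Fd] by auto
    fix X y G e assume X: "X \<in> C" "y \<in> frames" "X (y (0,0)) = pt" "G \<in> T" "e \<in> frames" "glued X y G e"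
    have XT: "X \<in> T" using X(1) by (simp add: C_def faces_at_def)
    show "G \<in> C"
    proof (cases "G = X")
      case True then show ?thesis using X by simp
    next
      case ne: False
      have "N G e = - N X y" using N_glued[OF XT X(4,2,5,6)] ne X(3) False by metis
      moreover have "N X y = N F d \<or> N X y = - N F d" using X by (simp add: C_def)
      moreover have "G (e (0,0)) = pt" using glued_origin[OF X(6)] X(3) by simp
      ultimately show ?thesis using inC[OF X(4,5)] by auto
    qed
  qed
  then have *: "N K k = N F d \<or> N K k = - N F d" if "K \<in> T" "k \<in> frames" "K (k (0,0)) = pt" for K k
    using faces_at_origin[OF that(1,2)] that unfolding C_def by auto
  have nz: "N F d \<noteq> 0" using reg[unfolded regular_at_iff[OF pt]] F d Fd by blast
  have "normal_vector T x pt (sgn (N F d))"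
    unfolding normal_vector_iff[OF pt]
  proof (intro conjI ballI impI)
    show "norm (sgn (N F d)) = 1" using nz by (simp add: norm_sgn)
    fix K k assume "K \<in> T" "k \<in> frames" "K (k (0,0)) = pt"
    from *[OF this] show "N K k \<noteq> 0" "sgn (N K k) = sgn (N F d) \<or> sgn (N K k) = - sgn (N F d)"
      using nz by (auto simp: sgn_minus)
  qed
  then show ?thesis ..
qed

text \<open>The block of the almost-C1 geometry is the projection of the block of
  \<open>star T xs\<close>, so it inherits the regularity that the input assumes of the projected
  geometry. Linear independence of the basis rests on this.\<close>

lemma vertex_N:
  assumes pt: "pt \<in> EV" and F: "F \<in> T" and d: "d \<in> frames" and Fd: "F (d (0,0)) = pt"
  shows "N F d \<noteq> 0"
proof -
  let ?g = "star T xs F"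
  have sq: "d (0,0) \<in> sq" "(0,0) \<in> sq" using d by (simp_all add: sq_iff)
  obtain \<epsilon> where "\<epsilon> > 0" and \<epsilon>: "\<And>F q s. F \<in> T \<Longrightarrow> q \<in> corners \<Longrightarrow> F q = pt \<Longrightarrow> s \<in> sq \<Longrightarrow> dist s q < \<epsilon> \<Longrightarrow>
              regular (vertex_proj T xs n pt \<circ> geometry_star T xs F) s"
    using input pt unfolding almost_C1_input_def by metis
  have "regular (vertex_proj T xs n pt \<circ> geometry_star T xs F) (d (0,0))"
    by (rule \<epsilon>[OF F _ Fd sq(1)]) (use d \<open>\<epsilon> > 0\<close> in auto)
  then have reg: "regular (plane_proj (vc T xs pt) (n pt) \<circ> ?g) (d (0,0))"
    using value_at_star[OF extraordinary_vertex[OF pt], of xs] by (simp add: vertex_proj_def geometry_star_def)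
  let ?L = "\<lambda>w. w - ((w \<bullet> n pt) / (n pt \<bullet> n pt)) *\<^sub>R n pt"
  have L: "bounded_linear ?L"
    by (intro bounded_linear_sub bounded_linear_ident)
       (simp add: bounded_linear_scaleR_const bounded_linear_divide bounded_linear_inner_left bounded_linear_compose[OF bounded_linear_divide])
  have pp: "plane_proj (vc T xs pt) (n pt) = (\<lambda>y. vc T xs pt + ?L (y - vc T xs pt))"
    by (rule ext) (simp add: plane_proj_def)
  have gb: "?g = bsp (subdiv (bc T xs F (xs (Face F))))" by (rule ext) (simp add: star_bern[OF F] bern_subdiv)
  obtain D where D: "hder ?g (d (0,0)) D" unfolding gb by (rule bsp_hder)
  have pD: "hder (plane_proj (vc T xs pt) (n pt) \<circ> ?g) (d (0,0)) (\<lambda>h. ?L (D h))"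
    unfolding pp comp_def
    by (rule has_derivative_eq_rhs, rule has_derivative_add[OF has_derivative_const
          bounded_linear.has_derivative[OF L has_derivative_diff[OF D has_derivative_const]]]) simp
  have nz: "cross3 (?L (D (1,0))) (?L (D (0,1))) \<noteq> 0"
    using reg hder_partials[OF pD sq(1)] by (auto simp: regular_def)
  have eq: "?g \<circ> d = bsp (subdiv (bc T xs (F \<circ> d) (xs (Face F))))"
    by (rule ext) (simp add: star_frame[OF F d] bern_subdiv)
  let ?s = "subdiv (bc T xs (F \<circ> d) (xs (Face F)))"
  have D': "hder (?g \<circ> d) (0,0) (D \<circ> lin d)" by (rule hder_frame[OF D d])
  obtain D0 where D0: "hder (bsp ?s) (0,0) D0" "D0 (1,0) = 4 *\<^sub>R (?s (Suc 0) 0 - ?s 0 0)" "D0 (0,1) = 4 *\<^sub>R (?s 0 (Suc 0) - ?s 0 0)"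
    by (rule bsp_hder_origin[of ?s, unfolded One_nat_def])
  have "has_partials (bsp ?s) (0,0) (D0 (1,0)) (D0 (0,1))" using hder_partials[OF D0(1) sq(2)] by simp
  then have DD: "D (lin d (1,0)) = 4 *\<^sub>R (?s (Suc 0) 0 - ?s 0 0)" "D (lin d (0,1)) = 4 *\<^sub>R (?s 0 (Suc 0) - ?s 0 0)"
    using hder_partials[OF D'[unfolded eq] sq(2)] D0(2,3) by simp_all
  have lcL: "lc F d (Suc 0) 0 - lc F d 0 0 = ?L (?s (Suc 0) 0 - ?s 0 0)" "lc F d 0 (Suc 0) - lc F d 0 0 = ?L (?s 0 (Suc 0) - ?s 0 0)"
    using lc_eq[OF F d] Fd pt by (simp_all add: P_def pp algebra_simps diff_divide_distrib add_divide_distrib)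
  have l4: "?L (4 *\<^sub>R w) = 4 *\<^sub>R ?L w" for w by (simp add: algebra_simps)
  have "linear (\<lambda>h. ?L (D h))" using has_derivative_linear[OF pD] .
  from frame_cross[OF this d] nz have "cross3 (?L (D (lin d (1,0)))) (?L (D (lin d (0,1)))) \<noteq> 0" by auto
  then have "cross3 (4 *\<^sub>R (lc F d (Suc 0) 0 - lc F d 0 0)) (4 *\<^sub>R (lc F d 0 (Suc 0) - lc F d 0 0)) \<noteq> 0"
    unfolding DD l4 lcL[symmetric] .
  then show ?thesis by (simp add: N_def cross_mult_left cross_mult_right)
qed

end

section \<open>Normals before and after a step\<close>

context refinement_step
begin

text \<open>The block of the coarse face is kept and then subdivided, which halves both difference
  vectors.\<close>

lemma refined_N:
  assumes F: "F \<in> T" and d: "d \<in> frames" and pt: "F (d (0,0)) \<notin> EV"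
  shows "R.N (sub F d) d = (1/4) *\<^sub>R N F d"
proof -
  let ?K = "sub F d"
  have K: "?K \<in> T'" using refineI[OF F, of "d (0,0)"] d by simp
  have b: "bc T' xs' (?K \<circ> d) (xs' (Face ?K)) j k = lc F d j k" if "j \<le> 1" "k \<le> 1" for j k
    using joint_frame[OF F d that, of xs'] joint_lc[OF F d that] pt by simp
  have "R.lc ?K d (Suc 0) 0 - R.lc ?K d 0 0 = (1/2) *\<^sub>R (lc F d (Suc 0) 0 - lc F d 0 0)"
    "R.lc ?K d 0 (Suc 0) - R.lc ?K d 0 0 = (1/2) *\<^sub>R (lc F d 0 (Suc 0) - lc F d 0 0)"
    using refined_lc[OF K d] b by (simp_all add: subdiv_simps algebra_simps flip: scaleR_add_left)
  then show ?thesis by (simp add: R.N_def N_def cross_mult_left cross_mult_right)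
qed

theorem normal_preserved:
  assumes pt: "pt \<in> vertices T" and reg: "regular_at T x pt" "regular_at T' R.x pt"
  shows "normal_vector T' R.x pt \<nu> \<longleftrightarrow> normal_vector T x pt \<nu>"
proof -
  have pt': "pt \<in> vertices T'" using pt vertices_refine by blast
  obtain F q where F: "F \<in> T" "q \<in> corners" "F q = pt" using pt by (auto simp: vertices_def)
  obtain d where d: "d \<in> frames" "d (0,0) = q" using corner_frame F(2) by metis
  have FK: "sub F e \<in> T'" "(sub F e) (e (0,0)) = F (e (0,0))" if "F \<in> T" "e \<in> frames" for F e
    using refineI[OF that(1), of "e (0,0)"] that(2) by simp_all
  show ?thesis
  proof (cases "pt \<in> EV")
    case True
    then have T': "pt \<in> extraordinary T'" by (simp add: extraordinary_refine)
    have s: "(s = \<nu> \<or> s = - \<nu>) \<longleftrightarrow> (n0 = \<nu> \<or> n0 = - \<nu>)" if "s = n0 \<or> s = - n0" for s n0 :: "real^3"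
      using that by (auto simp: equation_minus_iff)
    have 1: "normal_vector T x pt \<nu> \<longleftrightarrow> norm \<nu> = 1 \<and> (sgn (n pt) = \<nu> \<or> sgn (n pt) = - \<nu>)"
    proof -
      have "N F d \<noteq> 0 \<and> (sgn (N F d) = \<nu> \<or> sgn (N F d) = - \<nu>) \<longleftrightarrow> (sgn (n pt) = \<nu> \<or> sgn (n pt) = - \<nu>)"
        if "F \<in> T" "d \<in> frames" "F (d (0,0)) = pt" for F d
        using reg(1)[unfolded regular_at_iff[OF pt]] N_extraordinary[OF that(1,2)] True s that by metis
      then show ?thesis unfolding normal_vector_iff[OF pt] using F d by metis
    qed
    have 2: "normal_vector T' R.x pt \<nu> \<longleftrightarrow> norm \<nu> = 1 \<and> (sgn (n pt) = \<nu> \<or> sgn (n pt) = - \<nu>)"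
    proof -
      have "R.N F d \<noteq> 0 \<and> (sgn (R.N F d) = \<nu> \<or> sgn (R.N F d) = - \<nu>) \<longleftrightarrow> (sgn (n pt) = \<nu> \<or> sgn (n pt) = - \<nu>)"
        if "F \<in> T'" "d \<in> frames" "F (d (0,0)) = pt" for F d
        using reg(2)[unfolded R.regular_at_iff[OF pt']] R.N_extraordinary[OF that(1,2)] T' s that by metis
      then show ?thesis unfolding R.normal_vector_iff[OF pt'] using FK[OF F(1) d(1)] F d by metis
    qed
    show ?thesis using 1 2 by simp
  next
    case False
    have sg: "sgn ((1/4) *\<^sub>R v) = sgn v" for v :: "real^3" by (simp add: sgn_scaleR)
    have "(\<forall>K\<in>T'. \<forall>d\<in>frames. K (d (0,0)) = pt \<longrightarrow> R.N K d \<noteq> 0 \<and> (sgn (R.N K d) = \<nu> \<or> sgn (R.N K d) = - \<nu>)) \<longleftrightarrow>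
      (\<forall>F\<in>T. \<forall>d\<in>frames. F (d (0,0)) = pt \<longrightarrow> N F d \<noteq> 0 \<and> (sgn (N F d) = \<nu> \<or> sgn (N F d) = - \<nu>))" (is "?L \<longleftrightarrow> ?R")
    proof
      assume L: ?L
      show ?R
      proof (intro ballI impI)
        fix F d assume F: "F \<in> T" "d \<in> frames" "F (d (0,0)) = pt"
        have "R.N (sub F d) d = (1/4) *\<^sub>R N F d" using refined_N[OF F(1,2)] F(3) False by simp
        then show "N F d \<noteq> 0 \<and> (sgn (N F d) = \<nu> \<or> sgn (N F d) = - \<nu>)"
          using L FK[OF F(1,2)] F by (metis sg scaleR_zero_right)
      qed
    next
      assume R: ?R
      show ?L
      proof (intro ballI impI)
        fix K d assume K: "K \<in> T'" "d \<in> frames" "K (d (0,0)) = pt"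
        obtain F q where F: "F \<in> T" "q \<in> corners" "K = F \<circ> quad q" using K(1) by (rule refineE)
        have "d (0,0) = q" using refined_face_vertex[OF F(1,2), of "d (0,0)"] K F pt by (simp add: sq_iff)
        then have K': "K = sub F d" "F (d (0,0)) = pt" using F K by simp_all
        have "R.N K d = (1/4) *\<^sub>R N F d" using refined_N[OF F(1) K(2)] K' False by simp
        then show "R.N K d \<noteq> 0 \<and> (sgn (R.N K d) = \<nu> \<or> sgn (R.N K d) = - \<nu>)"
          using R F(1) K(2) K'(2) sg by simp
      qed
    qed
    then show ?thesis unfolding normal_vector_iff[OF pt] R.normal_vector_iff[OF pt'] by blast
  qed
qed

end

section \<open>The refined degrees of freedom\<close>

context qmesh
begin

text \<open>Each subface and each refined boundary edge contains the midpoint of an old side, a new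
  and hence ordinary vertex; so no degree of freedom of \<open>dof_star\<close> is dropped.\<close>

lemma dof_refine:
  "dof T' = dof_star T' \<union> {Tri pt \<nu> | pt \<nu>. pt \<in> extraordinary T' \<and> \<nu> \<in> {1,2,3}}"
proof -
  have new: "F (d (1/2,0)) \<in> vertices T' - extraordinary T'" if "F \<in> T" "d \<in> frames" for F d
    using mid_vertex[OF that] mid_not_vertex[OF that] extraordinary_vertex by (auto simp: extraordinary_refine)
  have 1: "\<exists>pt\<in>vertices T' - extraordinary T'. pt \<in> carrier_of K" if K: "K \<in> T'" for K
  proof -
    obtain F q where F: "F \<in> T" "q \<in> corners" "K = F \<circ> quad q" using K by (rule refineE)
    obtain d where d: "d \<in> frames" "d (0,0) = q" using corner_frame F(2) by metis
    have "F (d (1/2,0)) = K (d (1,0))" using F d quad_frame[OF d(1), of "(0,0)" "(1,0)"] by (simp add: quad_simp)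
    moreover have "d (1,0) \<in> sq" using d by (simp add: sq_iff)
    ultimately have "F (d (1/2,0)) \<in> carrier_of K" by (simp add: carrier_of_def)
    then show ?thesis using new[OF F(1) d(1)] by blast
  qed
  have 2: "\<exists>pt\<in>vertices T' - extraordinary T'. pt \<in> \<rho>" if \<rho>: "\<rho> \<in> boundary_edges T'" for \<rho>
  proof -
    obtain F d where F: "F \<in> T" "d \<in> frames" "\<rho> = half F d" using boundary_edges_refineE[OF \<rho>] by metis
    then show ?thesis using new[OF F(1,2)] mid_half[OF F(2), of F] by blast
  qed
  have "{F \<in> T'. \<exists>pt\<in>vertices T' - extraordinary T'. pt \<in> carrier_of F} = T'"
    "{\<tau> \<in> boundary_edges T'. \<exists>pt\<in>vertices T' - extraordinary T'. pt \<in> \<tau>} = boundary_edges T'"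
    using 1 2 by blast+
  then show ?thesis by (simp only: dof_def dof_star_def)
qed

lemma card_dof_refine:
  "card (dof T') = card T' + card (boundary_edges T') + card (corner_vertices T')
     + 3 * card (extraordinary T')"
proof -
  interpret R: qmesh "T'" by (rule refined)
  let ?T = "refine T"
  have tri: "{Tri pt \<nu> | pt \<nu>. pt \<in> extraordinary ?T \<and> \<nu> \<in> {1,2,3::nat}} = (\<lambda>(pt,\<nu>). Tri pt \<nu>) ` (extraordinary ?T \<times> {1,2,3})"
    by auto
  have c: "card ((\<lambda>(pt,\<nu>). Tri pt \<nu>) ` (extraordinary ?T \<times> {1,2,3::nat})) = 3 * card (extraordinary ?T)"
    by (subst card_image) (auto simp: inj_on_def card_cartesian_product)
  have f: "card (Face ` ?T) = card ?T" "card (BEdge ` boundary_edges ?T) = card (boundary_edges ?T)"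
    "card (Corner ` corner_vertices ?T) = card (corner_vertices ?T)"
    by (simp_all add: card_image inj_on_def)
  have "card (dof_star ?T) = card ?T + card (boundary_edges ?T) + card (corner_vertices ?T)"
    unfolding dof_star_def f[symmetric] by (subst card_Un_disjoint, auto)+
  moreover have "card (dof ?T) = card (dof_star ?T) + card ((\<lambda>(pt,\<nu>). Tri pt \<nu>) ` (extraordinary ?T \<times> {1,2,3::nat}))"
    unfolding dof_refine tri by (rule card_Un_disjoint) (auto simp: dof_star_def)
  ultimately show ?thesis using c by simp
qed

end

section \<open>The refinement matrix\<close>

text \<open>Cramer's rule: the coefficients of a vector along the edges of the triangle are
  quotients of triple products with the normal \<open>?m\<close>. Written this way, L is linear on
  all of space.\<close>

lemma affine_interpolation:
  fixes t :: "nat \<Rightarrow> real^3" and z :: "nat \<Rightarrow> real"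
  assumes "\<not> collinear {t 1, t 2, t 3}"
  obtains L h where "linear L" "\<And>\<nu>. \<nu> \<in> {1,2,3} \<Longrightarrow> L (t \<nu>) + h = z \<nu>"
proof -
  let ?u = "t 2 - t 1" and ?v = "t 3 - t 1"
  let ?m = "cross3 ?u ?v"
  have m: "?m \<bullet> ?m \<noteq> 0" using assms by (simp add: collinear_cross)
  define L where "L w = (cross3 w ?v \<bullet> ?m) / (?m \<bullet> ?m) * (z 2 - z 1) + (cross3 ?u w \<bullet> ?m) / (?m \<bullet> ?m) * (z 3 - z 1)" for w
  have lin: "linear L"
    by (rule linearI)
       (simp_all add: L_def cross_add_left cross_add_right cross_mult_left cross_mult_right inner_add_left add_divide_distrib algebra_simps)
  have "L ?u = z 2 - z 1" "L ?v = z 3 - z 1" using m by (simp_all add: L_def)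
  then have "L (t 2) - L (t 1) = z 2 - z 1" "L (t 3) - L (t 1) = z 3 - z 1" by (simp_all add: linear_diff[OF lin])
  then show ?thesis by (intro that[OF lin, of "z 1 - L (t 1)"]) auto
qed

lemma affine_sum:
  fixes L :: "'a::real_vector \<Rightarrow> real"
  assumes "linear L" "sum b I = 1"
  shows "(\<Sum>i\<in>I. b i * (L (p i) + h)) = L (\<Sum>i\<in>I. b i *\<^sub>R p i) + h"
proof -
  have "(\<Sum>i\<in>I. b i * (L (p i) + h)) = (\<Sum>i\<in>I. b i * L (p i)) + (\<Sum>i\<in>I. b i) * h"
    by (simp add: distrib_left sum.distrib sum_distrib_right)
  then show ?thesis using assms(2) by (simp add: linear_sum[OF assms(1)] linear_scale[OF assms(1)])
qed

context qmesh
begin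

lemma vc_ec_dof_star_cong:
  assumes "\<And>\<phi>. \<phi> \<in> dof_star T \<Longrightarrow> z \<phi> = z' \<phi>"
  shows "pt \<in> vertices T \<Longrightarrow> vc T z pt = vc T z' pt" "F \<in> T \<Longrightarrow> d \<in> frames \<Longrightarrow> ec T z (side F d) = ec T z' (side F d)"
  by (rule vc_cong; auto intro!: assms simp: dof_star_def faces_at_def)
     (rule ec_cong; auto intro!: assms simp: dof_star_def)

lemma spl_basis: "spl (basis T xs n tri \<phi>)"
  unfolding spl_def using basis_bsp by blast

lemma spl_spline: "spl (spline (dof T) (basis T xs n tri) z)"
  unfolding spl_def using spline_basis_bsp by blast

end

context fanned
begin

text \<open>Serves the row sums of the refinement matrix, where the spline with all coefficients 1
  is known through its blocks.\<close>

lemma refined_local_const: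
  assumes f: "spl f" and \<phi>: "\<phi> \<in> dof_star T'"
    and l: "\<And>F d j k. F \<in> T \<Longrightarrow> d \<in> frames \<Longrightarrow> j \<le> 1 \<Longrightarrow> k \<le> 1 \<Longrightarrow> loc f F d j k = c"
  shows "refined_points T fan f \<phi> = c"
  using \<phi>
proof (cases rule: refined_dof_cases)
  case (1 pt F d)
  then show ?thesis using refined_corner[OF f 1(2-5)] l by simp
next
  case (2 F d)
  then show ?thesis using refined_edge[OF f 2(2-4)] l by simp
next
  case (3 F d)
  then show ?thesis using refined_face_rule[OF f 3(2-4)] l by simp
next
  case (4 pt r)
  have "inner_value f pt r = inner_point (pt \<in> IV) (valence T pt) (\<lambda>_. c) (\<lambda>_. c) r"
    unfolding inner_value_def inner_point_def using l fan_face[OF 4(2)]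
    by (intro arg_cong2[where f = "(+)"] sum.cong refl) (auto split: if_splits)
  then show ?thesis using refined_face_inner[OF f 4(2-4)] inner_point_const[OF 4(4)] 4(1) by simp
qed

text \<open>Locality of the rule: the control point of the subface at \<open>pt\<close> reads only
  blocks at \<open>pt\<close>. A spline may therefore be replaced, near one extraordinary vertex, by
  an affine function of the geometry.\<close>

lemma refined_face_cong:
  assumes f: "spl f" "spl g" and F: "F \<in> T" "d \<in> frames" and pt: "F (d (0,0)) = pt"
    and l: "\<And>G e j k. G \<in> T \<Longrightarrow> e \<in> frames \<Longrightarrow> G (e (0,0)) = pt \<Longrightarrow> j \<le> 1 \<Longrightarrow> k \<le> 1 \<Longrightarrow> loc f G e j k = loc g G e j k"
  shows "refined_points T fan f (Face (sub F d)) = refined_points T fan g (Face (sub F d))"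
proof (cases "pt \<in> EV \<and> isolated T pt")
  case False
  then show ?thesis
    using refined_face_rule[OF f(1) F] refined_face_rule[OF f(2) F] l[OF F pt] pt by simp
next
  case True
  then have e: "pt \<in> EV" by blast
  obtain r where r: "r \<in> {1..valence T pt}" "fF pt r = F" "d = fd pt r \<or> d = fd pt r \<circ> swp"
    using spoke_cases[OF e F pt] by blast
  from r(3) have d0: "d (0,0) = fd pt r (0,0)"
  proof
    assume "d = fd pt r \<circ> swp"
    from fun_cong[OF this, of "(0,0)"] show ?thesis by simp
  next
    assume "d = fd pt r"
    from fun_cong[OF this, of "(0,0)"] show ?thesis .
  qed
  have "inner_value f pt r = inner_value g pt r"
    unfolding inner_value_def inner_point_def using l fan_face[OF e]
    by (intro arg_cong2[where f = "(+)"] sum.cong refl) (auto split: if_splits)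
  then show ?thesis
    using refined_face_inner[OF f(1) e _ r(1)] refined_face_inner[OF f(2) e _ r(1)] True r(2) d0 by simp
qed

lemma refined_sum:
  fixes z :: "'i \<Rightarrow> 'b::real_vector"
  assumes B: "\<And>i. i \<in> I \<Longrightarrow> spl (B i)" and fin: "finite I" and \<phi>: "\<phi> \<in> dof_star T'"
  shows "refined_points T fan (\<lambda>F s. \<Sum>i\<in>I. B i F s *\<^sub>R z i) \<phi> = (\<Sum>i\<in>I. refined_points T fan (B i) \<phi> *\<^sub>R z i)"
proof -
  have "spl (\<lambda>F s. \<Sum>i\<in>I. B i F s *\<^sub>R z i) \<and>
    refined_points T fan (\<lambda>F s. \<Sum>i\<in>I. B i F s *\<^sub>R z i) \<phi> = (\<Sum>i\<in>I. refined_points T fan (B i) \<phi> *\<^sub>R z i)"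
    using fin B
  proof (induction I rule: finite_induct)
    case empty
    have "spl (\<lambda>F s. 0 :: 'b)" unfolding spl_def using bsp_const by metis
    then show ?case using refined_const[OF \<phi>, of "0::'b"] by simp
  next
    case (insert i I)
    have l: "linear (\<lambda>r. r *\<^sub>R z i)" by (rule linearI) (auto simp: scaleR_add_left)
    have 1: "spl (\<lambda>F s. B i F s *\<^sub>R z i)" by (rule spl_linear[OF _ l]) (use insert in auto)
    have 2: "spl (\<lambda>F s. \<Sum>i\<in>I. B i F s *\<^sub>R z i)" using insert by auto
    have "spl (\<lambda>F s. B i F s *\<^sub>R z i + (\<Sum>i\<in>I. B i F s *\<^sub>R z i))"
      unfolding spl_def
    proof
      fix F assume "F \<in> T"
      then obtain C C' where C: "\<forall>s\<in>sq. B i F s *\<^sub>R z i = bsp C s" "\<forall>s\<in>sq. (\<Sum>i\<in>I. B i F s *\<^sub>R z i) = bsp C' s"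
        using 1 2 unfolding spl_def by meson
      have "bsp (\<lambda>j k. C j k + C' j k) s = bsp C s + bsp C' s" for s
        by (simp add: bsp_def scaleR_add_right sum.distrib)
      then show "\<exists>C. \<forall>s\<in>sq. B i F s *\<^sub>R z i + (\<Sum>i\<in>I. B i F s *\<^sub>R z i) = bsp C s" using C by metis
    qed
    moreover have "refined_points T fan (\<lambda>F s. B i F s *\<^sub>R z i + (\<Sum>i\<in>I. B i F s *\<^sub>R z i)) \<phi> =
      refined_points T fan (B i) \<phi> *\<^sub>R z i + (\<Sum>i\<in>I. refined_points T fan (B i) \<phi> *\<^sub>R z i)"
      using refined_add[OF 1 2 \<phi>] refined_linear[OF _ l \<phi>, of "B i"] insert by simp
    ultimately show ?case using insert(1,2) by simp
  qed
  then show ?thesis ..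
qed

lemma refined_spline:
  fixes z :: "'p dof \<Rightarrow> 'b::real_vector"
  assumes "\<phi> \<in> dof_star T'"
  shows "refined_points T fan (spline (dof T) (basis T xs n tri) z) \<phi> =
    (\<Sum>\<psi>\<in>dof T. refined_points T fan (basis T xs n tri \<psi>) \<phi> *\<^sub>R z \<psi>)"
proof -
  have "spline (dof T) (basis T xs n tri) z = (\<lambda>F s. \<Sum>\<psi>\<in>dof T. basis T xs n tri \<psi> F s *\<^sub>R z \<psi>)"
    by (intro ext) (simp add: spline_def)
  then show ?thesis using refined_sum[OF spl_basis finite_dof assms] by simp
qed

lemma vc_one: "pt \<in> vertices T \<Longrightarrow> vc T (\<lambda>_. c) pt = c"
proof -
  assume v: "pt \<in> vertices T"
  then obtain F q where F: "F \<in> T" "q \<in> corners" "F q = pt" by (auto simp: vertices_def)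
  have "F \<in> faces_at T pt" using F by (auto simp: faces_at_def carrier_of_def)
  then have c: "card (faces_at T pt) \<noteq> 0" by auto
  consider "pt \<in> IV" | "pt \<in> corner_vertices T" "pt \<notin> IV"
    | "pt \<in> BV" "pt \<notin> corner_vertices T" "pt \<notin> IV"
    using v by (auto simp: interior_vertices_def)
  then show ?thesis
  proof cases
    case 1
    then show ?thesis using c by (simp add: vc_def valence_def sum_constant_scaleR)
  next
    case 2
    then show ?thesis by (simp add: vc_def)
  next
    case 3
    obtain F d G e where "{\<rho> \<in> BE. pt \<in> \<rho>} = {side F d, side G e}" "side F d \<noteq> side G e"
      using boundary_pair[OF 3(1,2)] by metis
    then show ?thesis using 3 by (simp add: vc_def flip: scaleR_2)
  qed
qed

lemma ec_one: "F \<in> T \<Longrightarrow> d \<in> frames \<Longrightarrow> ec T (\<lambda>_. c) (side F d) = c"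
proof -
  assume F: "F \<in> T" "d \<in> frames"
  then show ?thesis
  proof (cases rule: side_cases)
    case 1
    then show ?thesis by (simp add: ec_boundary)
  next
    case (2 G e)
    then show ?thesis using ec_glued[OF F(1) 2(1) F(2) 2(2,3) 2(4)[symmetric], of "\<lambda>_. c"] by (simp flip: scaleR_2)
  qed
qed

end

section \<open>Splines at extraordinary vertices as affine functions, and independence of the
  basis\<close>

context geometry
begin

text \<open>Three values at the vertices of a nondegenerate triangle are interpolated by an affine
  function, and barycentric combinations reproduce it throughout the plane. Scalar coefficients at
  an extraordinary vertex are thus read as a function of position.\<close>

lemma input_affine:
  assumes pt: "pt \<in> EV"
  obtains L h where "linear L" "\<And>\<nu>. \<nu> \<in> {1,2,3} \<Longrightarrow> L (tri pt \<nu>) + h = (z \<nu> :: real)"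
    "\<And>y. (y - vc T xs pt) \<bullet> n pt = 0 \<Longrightarrow> (\<Sum>\<nu>\<in>{1,2,3}. barycentric (tri pt) y \<nu> * z \<nu>) = L y + h"
proof -
  obtain L h where L: "linear L" "\<And>\<nu>. \<nu> \<in> {1,2,3} \<Longrightarrow> L (tri pt \<nu>) + h = z \<nu>"
    using affine_interpolation[OF input_vertex(3)[OF pt]] by blast
  have "(\<Sum>\<nu>\<in>{1,2,3}. barycentric (tri pt) y \<nu> * z \<nu>) = L y + h" if y: "(y - vc T xs pt) \<bullet> n pt = 0" for y
  proof -
    have "(\<Sum>\<nu>\<in>{1,2,3}. barycentric (tri pt) y \<nu> * z \<nu>) = (\<Sum>\<nu>\<in>{1,2,3}. barycentric (tri pt) y \<nu> * (L (tri pt \<nu>) + h))"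
      by (rule sum.cong[OF refl]) (use L(2) in simp)
    also have "\<dots> = L y + h"
      unfolding affine_sum[OF L(1) barycentric_sums(1)[OF pt y]] barycentric_sums(2)[OF pt y] ..
    finally show ?thesis .
  qed
  then show ?thesis using that L by blast
qed

lemma loc_extraordinary:
  assumes "F \<in> T" "d \<in> frames" "j \<le> 1" "k \<le> 1" "F (d (0,0)) \<in> EV"
  shows "loc (spline (dof T) (basis T xs n tri) z) F d j k =
    (\<Sum>\<nu>\<in>{1,2,3}. barycentric (tri (F (d (0,0)))) (lc F d j k) \<nu> *\<^sub>R z (Tri (F (d (0,0))) \<nu>))"
  using spline_local_extraordinary[OF assms, of xs n tri z] lc_eq[OF assms(1-4)] assms(5) by (simp add: P_def)

text \<open>Yields uniqueness of the refinement matrix. At an extraordinary vertex a vanishing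
  spline means that an affine function vanishes at three coefficients of one block; these are not
  collinear by \<open>vertex_N\<close>, so it vanishes on the whole plane and in particular on the
  control triangle.\<close>

lemma basis_independent:
  fixes z :: "'p dof \<Rightarrow> real"
  assumes zero: "\<And>F s. F \<in> T \<Longrightarrow> s \<in> sq \<Longrightarrow> spline (dof T) (basis T xs n tri) z F s = 0"
    and \<phi>: "\<phi> \<in> dof T"
  shows "z \<phi> = 0"
proof -
  let ?f = "spline (dof T) (basis T xs n tri) z"
  have l0: "loc ?f F d j k = 0" if "F \<in> T" "d \<in> frames" for F d j k
    by (subst subdiv_coeff_bsp[of _ "\<lambda>_ _. 0"]) (use that zero in \<open>auto simp: bsp_const\<close>)
  have ord: "vc T z (F (d (0,0))) = 0 \<and> ec T z (side F d) = 0 \<and> z (Face F) = 0"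
    if F: "F \<in> T" "d \<in> frames" and pt: "F (d (0,0)) \<notin> EV" for F d
  proof -
    have s: "subdiv (bc T z (F \<circ> d) (z (Face F))) j k = 0" if "j \<le> 1" "k \<le> 1" for j k
      using spline_local_ordinary[OF F that pt, of xs n tri z] l0[OF F] by simp
    have "vc T z (F (d (0,0))) = 0" "ec T z (side F d) = 0" "ec T z (side F (d \<circ> swp)) = 0"
      using s[of 0 0] s[of "Suc 0" 0] s[of 0 "Suc 0"] by (simp_all add: subdiv_simps bc_local)
    then show ?thesis using s[of "Suc 0" "Suc 0"] by (simp add: subdiv_simps bc_local)
  qed
  consider (f) F pt where "\<phi> = Face F" "F \<in> T" "pt \<in> vertices T - EV" "pt \<in> carrier_of F"
    | (b) \<tau> pt where "\<phi> = BEdge \<tau>" "\<tau> \<in> BE" "pt \<in> vertices T - EV" "pt \<in> \<tau>"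
    | (c) pt where "\<phi> = Corner pt" "pt \<in> corner_vertices T"
    | (t) pt \<nu> where "\<phi> = Tri pt \<nu>" "pt \<in> EV" "\<nu> \<in> {1,2,3}"
    using \<phi> unfolding dof_def by blast
  then show ?thesis
  proof cases
    case f
    obtain d where "d \<in> frames" "F (d (0,0)) = pt" using vertex_frame[of pt F] f by (auto simp: faces_at_def)
    then show ?thesis using ord[of F d] f by auto
  next
    case b
    obtain F d where "F \<in> faces_at T pt" "F \<in> T" "d \<in> frames" "F (d (0,0)) = pt" "\<tau> = side F d"
      by (rule boundary_edge_at_vertex[of pt \<tau>]) (use b in auto)
    then show ?thesis using ord[of F d] b by (auto simp: ec_boundary)
  next
    case c
    then have v: "pt \<in> vertices T" by (simp add: corner_vertices_def)
    then obtain F q where F: "F \<in> T" "q \<in> corners" "F q = pt" by (auto simp: vertices_def)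
    obtain d where d: "d \<in> frames" "d (0,0) = q" using corner_frame F(2) by metis
    have "pt \<notin> IV" using corner_vertex_boundary(1)[OF c(2)] by (simp add: interior_vertices_def)
    then show ?thesis using ord[OF F(1) d(1)] F d c corner_vertex_boundary(2)[OF c(2)] by (simp add: vc_def)
  next
    case t
    obtain F q where F: "F \<in> T" "q \<in> corners" "F q = pt" using extraordinary_vertex[OF t(2)] by (auto simp: vertices_def)
    obtain d where d: "d \<in> frames" "d (0,0) = q" using corner_frame F(2) by metis
    have Fd: "F (d (0,0)) = pt" using F d by simp
    obtain L h where L: "linear L" "\<And>\<nu>. \<nu> \<in> {1,2,3} \<Longrightarrow> L (tri pt \<nu>) + h = z (Tri pt \<nu>)"
      "\<And>y. (y - vc T xs pt) \<bullet> n pt = 0 \<Longrightarrow> (\<Sum>\<nu>\<in>{1,2,3}. barycentric (tri pt) y \<nu> * z (Tri pt \<nu>)) = L y + h"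
      using input_affine[OF t(2), where z = "\<lambda>\<nu>. z (Tri pt \<nu>)"] by blast
    have L0: "L (lc F d j k) + h = 0" if "j \<le> 1" "k \<le> 1" for j k
      using loc_extraordinary[OF F(1) d(1) that, of z] L(3)[of "lc F d j k"] lc_plane[OF F(1) d(1) that] l0[OF F(1) d(1)] Fd t(2)
      by simp
    \<comment> \<open>A second triangle in the same plane, made of coefficients of the block; the
      vertices of the control triangle are expressed in its barycentric coordinates.\<close>
    define p where "p i = (if i = 1 then lc F d 0 0 else if i = 2 then lc F d (Suc 0) 0 else lc F d 0 (Suc 0))" for i :: nat
    have "\<not> collinear {p 1, p 2, p 3}"
      using vertex_N[OF t(2) F(1) d(1) Fd] by (simp add: collinear_cross p_def N_def)
    moreover have "(p i - vc T xs pt) \<bullet> n pt = 0" for i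
      using lc_plane[OF F(1) d(1), of 0 0] lc_plane[OF F(1) d(1), of "Suc 0" 0] lc_plane[OF F(1) d(1), of 0 "Suc 0"] Fd t(2)
      by (simp add: p_def)
    ultimately have b: "(\<Sum>i\<in>{1,2,3}. barycentric p (tri pt \<nu>) i) = 1" "(\<Sum>i\<in>{1,2,3}. barycentric p (tri pt \<nu>) i *\<^sub>R p i) = tri pt \<nu>"
      using barycentric_plane[OF _ input_vertex(1)[OF t(2)], of p "vc T xs pt" "tri pt \<nu>"] input_vertex(2)[OF t(2,3)] by blast+
    have p0: "L (p i) + h = 0" for i using L0[of 0 0] L0[of "Suc 0" 0] L0[of 0 "Suc 0"] by (simp add: p_def)
    have "z (Tri pt \<nu>) = L (tri pt \<nu>) + h" using L(2)[OF t(3)] by simp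
    also have "\<dots> = (\<Sum>i\<in>{1,2,3}. barycentric p (tri pt \<nu>) i * (L (p i) + h))"
      using affine_sum[OF L(1) b(1), of p h] b(2) by simp
    also have "\<dots> = 0" by (simp only: p0 mult_zero_right sum.neutral_const)
    finally show ?thesis using t by simp
  qed
qed

end

section \<open>The matrix of the refinement rule\<close>

context refinement_step
begin

text \<open>Rows of faces, edges and corners are the rule applied to the basis functions. Control
  triangles are chosen rather than computed; their rows express the new triangle vertices in
  barycentric coordinates of the old triangle, so that affine functions on the plane are carried
  over.\<close>

definition M :: "'p dof \<Rightarrow> 'p dof \<Rightarrow> real" where
  "M \<phi> \<psi> = (if \<phi> \<in> dof T' \<and> \<psi> \<in> dof T then
     (case \<phi> of Tri pt \<nu> \<Rightarrow> (case \<psi> of Tri \<delta> \<kappa> \<Rightarrow> if \<delta> = pt then barycentric (tri pt) (tri' pt \<nu>) \<kappa> else 0 | _ \<Rightarrow> 0)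
      | _ \<Rightarrow> refined_points T fan (basis T xs n tri \<psi>) \<phi>) else 0)"

lemma M_star:
  fixes z :: "'p dof \<Rightarrow> 'a::real_vector"
  assumes "\<phi> \<in> dof_star T'"
  shows "apply_matrix T M z \<phi> = refined_points T fan (spline (dof T) (basis T xs n tri) z) \<phi>"
proof -
  have "\<phi> \<in> dof T'" using assms by (simp add: dof_refine)
  then have "M \<phi> \<psi> = refined_points T fan (basis T xs n tri \<psi>) \<phi>" if "\<psi> \<in> dof T" for \<psi>
    using that assms by (auto simp: M_def dof_star_def)
  then show ?thesis by (simp add: apply_matrix_def refined_spline[OF assms])
qed

lemma M_tri:
  fixes z :: "'p dof \<Rightarrow> 'a::real_vector"
  assumes "pt \<in> EV" "\<nu> \<in> {1,2,3}"
  shows "apply_matrix T M z (Tri pt \<nu>) = (\<Sum>\<kappa>\<in>{1,2,3}. barycentric (tri pt) (tri' pt \<nu>) \<kappa> *\<^sub>R z (Tri pt \<kappa>))"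
proof -
  have 1: "Tri pt \<nu> \<in> dof T'" using assms by (auto simp: dof_def extraordinary_refine)
  have "apply_matrix T M z (Tri pt \<nu>) = (\<Sum>\<psi>\<in>Tri pt ` {1,2,3}. M (Tri pt \<nu>) \<psi> *\<^sub>R z \<psi>)"
    unfolding apply_matrix_def
  proof (rule sum.mono_neutral_right[OF finite_dof])
    show "Tri pt ` {1,2,3} \<subseteq> dof T" using assms by (auto simp: dof_def)
    show "\<forall>\<psi>\<in>dof T - Tri pt ` {1,2,3}. M (Tri pt \<nu>) \<psi> *\<^sub>R z \<psi> = 0"
      by (auto simp: dof_def M_def)
  qed
  also have "\<dots> = (\<Sum>\<kappa>\<in>{1,2,3}. M (Tri pt \<nu>) (Tri pt \<kappa>) *\<^sub>R z (Tri pt \<kappa>))"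
    by (rule sum.reindex_cong[of "Tri pt"]) (auto simp: inj_on_def)
  also have "\<dots> = (\<Sum>\<kappa>\<in>{1,2,3}. barycentric (tri pt) (tri' pt \<nu>) \<kappa> *\<^sub>R z (Tri pt \<kappa>))"
  proof (rule sum.cong[OF refl])
    fix \<kappa> :: nat assume "\<kappa> \<in> {1,2,3}"
    then have "Tri pt \<kappa> \<in> dof T" using assms by (auto simp: dof_def)
    then show "M (Tri pt \<nu>) (Tri pt \<kappa>) *\<^sub>R z (Tri pt \<kappa>) = barycentric (tri pt) (tri' pt \<nu>) \<kappa> *\<^sub>R z (Tri pt \<kappa>)"
      using 1 by (simp add: M_def)
  qed
  finally show ?thesis .
qed

lemma tri'_plane: "pt \<in> EV \<Longrightarrow> \<nu> \<in> {1,2,3} \<Longrightarrow> (tri' pt \<nu> - vc T xs pt) \<bullet> n pt = 0"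
  using R.input_vertex(2)[of pt \<nu>] refined_vertex[OF extraordinary_vertex] by (simp add: extraordinary_refine)

text \<open>Edge and vertex coefficients and the entries of \<open>subdiv\<close> are averages with
  weights of sum 1, so an affine relation between the control points around \<open>pt\<close> is
  inherited by the block.\<close>

lemma refined_affine:
  assumes pt: "pt \<in> EV" and L: "linear L"
    and wf: "\<And>F d. F \<in> T \<Longrightarrow> d \<in> frames \<Longrightarrow> F (d (0,0)) = pt \<Longrightarrow>
      w (Face (sub F d)) = L (xs' (Face (sub F d))) + (h::real)"
    and wb: "\<And>F d. F \<in> T \<Longrightarrow> d \<in> frames \<Longrightarrow> F (d (0,0)) = pt \<Longrightarrow> side F d \<in> BE \<Longrightarrow>
      w (BEdge (half F d)) = L (xs' (BEdge (half F d))) + h"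
    and F: "F \<in> T" "d \<in> frames" "F (d (0,0)) = pt" and jk: "j \<le> 1" "k \<le> 1"
  shows "subdiv (bc T' w (F \<circ> quad (d (0,0)) \<circ> d) (w (Face (sub F d)))) j k =
    L (subdiv (bc T' xs' (F \<circ> quad (d (0,0)) \<circ> d) (xs' (Face (sub F d)))) j k) + h"
proof -
  let ?T = "refine T"
  have v: "pt \<in> vertices T" using pt extraordinary_vertex by blast
  have vcw: "vc ?T w pt = L (vc ?T xs' pt) + h"
  proof (cases "pt \<in> IV")
    case True
    have n0: "card (faces_at T pt) \<noteq> 0" using faces_at_origin[OF F(1,2)] F(3) by auto
    have "(\<Sum>K\<in>faces_at ?T pt. w (Face K)) = (\<Sum>K\<in>faces_at ?T pt. L (xs' (Face K)) + h)"
    proof (rule sum.cong[OF refl])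
      fix K assume "K \<in> faces_at ?T pt"
      then obtain G e where "K = sub G e" "G \<in> T" "e \<in> frames" "G (e (0,0)) = pt"
        unfolding faces_at_refine_old[OF v] by blast
      then show "w (Face K) = L (xs' (Face K)) + h" using wf by simp
    qed
    then show ?thesis using True interior_vertex_old[OF v] valence_old[OF v] n0
      by (simp add: vc_def valence_def linear_scale[OF L] linear_sum[OF L] sum.distrib field_simps)
  next
    case False
    then have bv: "pt \<in> BV" using v by (simp add: interior_vertices_def)
    have nc: "pt \<notin> corner_vertices T" using corner_vertex_boundary(2) pt by blast
    from boundary_pair_refined[OF bv nc] obtain F d G e where F: "F \<in> T" "d \<in> frames" "F (d (0,0)) = pt" and G: "G \<in> T" "e \<in> frames" "G (e (0,0)) = pt"
      and b: "side F d \<in> BE" "side G e \<in> BE" "side F d \<noteq> side G e"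
      "{\<rho> \<in> BE. pt \<in> \<rho>} = {side F d, side G e}"
      "{\<rho> \<in> boundary_edges T'. pt \<in> \<rho>} = {half F d, half G e}" "half F d \<noteq> half G e" .
    have "vc ?T z pt = (1/2) *\<^sub>R (z (BEdge (half F d)) + z (BEdge (half G e)))" for z :: "'p dof \<Rightarrow> 'b::real_vector"
      using False nc b(5,6) interior_vertex_old[OF v] by (simp add: vc_def corner_vertices_refine)
    from this[of w] this[of xs'] show ?thesis
      using wb[OF F b(1)] wb[OF G b(2)] by (simp add: linear_scale[OF L] linear_add[OF L] field_simps)
  qed
  have ecw: "ec ?T w (half F d) = L (ec ?T xs' (half F d)) + h" if F: "F \<in> T" "d \<in> frames" "F (d (0,0)) = pt" for F d
    using F(1,2)
  proof (cases rule: side_cases)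
    case 1
    then show ?thesis using wb[OF F 1] half_boundary_iff[OF F(1,2)] by (simp add: R.ec_boundary)
  next
    case (2 G e)
    have "G (e (0,0)) = pt" using glued_origin[OF 2(3)] F by simp
    then show ?thesis using wf[OF F] wf[OF 2(1,2)]
        ec_half_interior[OF F(1,2) 2(1-4), of w] ec_half_interior[OF F(1,2) 2(1-4), of xs']
      by (simp add: linear_scale[OF L] linear_add[OF L] field_simps)
  qed
  have o: "(sub F d) (d (0,0)) = pt" using F by simp
  have b: "bc ?T z (F \<circ> quad (d (0,0)) \<circ> d) y 0 0 = vc ?T z pt" "bc ?T z (F \<circ> quad (d (0,0)) \<circ> d) y (Suc 0) 0 = ec ?T z (half F d)"
     "bc ?T z (F \<circ> quad (d (0,0)) \<circ> d) y 0 (Suc 0) = ec ?T z (half F (d \<circ> swp))" "bc ?T z (F \<circ> quad (d (0,0)) \<circ> d) y (Suc 0) (Suc 0) = y"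
    for z :: "'p dof \<Rightarrow> 'b::real_vector" and y
    using o by (simp_all add: bc_local half_def)
  have "j = 0 \<or> j = Suc 0" "k = 0 \<or> k = Suc 0" using jk by auto
  then show ?thesis
    using vcw ecw[OF F] ecw[of F "d \<circ> swp"] wf[OF F] F
    by (auto simp: subdiv_simps b linear_scale[OF L] linear_add[OF L] field_simps)
qed

text \<open>Both sides are compared block by block. At ordinary vertices the splines of
  \<open>basis\<close> and \<open>basis_star\<close> have the same blocks. At an extraordinary
  vertex the coarse spline is the affine function L + h of the geometry, the rule commutes with it,
  and the new barycentric coordinates reproduce it from its values at the new triangle.\<close>

lemma M_refines:
  fixes z :: "'p dof \<Rightarrow> real"
  assumes G: "G \<in> T'"
  shows "refine_fun T fan (spline (dof T) (basis T xs n tri) z) G s =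
    spline (dof T') (basis T' xs' n tri') (apply_matrix T M z) G s"
proof -
  let ?T = "refine T"
  let ?f = "spline (dof T) (basis T xs n tri) z"
  let ?w = "refined_points T fan ?f" and ?Mz = "apply_matrix T M z"
  have fs: "spl ?f" by (rule spl_spline)
  obtain F q where F: "F \<in> T" "q \<in> corners" "G = F \<circ> quad q" using G by (rule refineE)
  have key: "subdiv (bc ?T ?w (G \<circ> d) (?w (Face G))) j k =
     loc (spline (dof ?T) (basis ?T xs' n tri') ?Mz) G d j k" if d: "d \<in> frames" and jk: "j \<le> 1" "k \<le> 1" for d j k
  proof (cases "G (d (0,0)) \<in> extraordinary ?T")
    case False
    have eq: "?Mz \<phi> = ?w \<phi>" if "\<phi> \<in> dof_star ?T" for \<phi> using M_star[OF that] .
    have "subdiv (bc ?T ?w (G \<circ> d) (?w (Face G))) j k = subdiv (bc ?T ?Mz (G \<circ> d) (?Mz (Face G))) j k"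
      by (rule subdiv_local_cong[OF jk])
         (use R.vc_ec_dof_star_cong[OF eq] frame_origin_vertex[OF G d] G d
           in \<open>simp_all add: bc_local dof_star_def eq\<close>)
    then show ?thesis using R.spline_local_ordinary[OF G d jk False, of xs' n tri' ?Mz] by simp
  next
    case True
    let ?pt = "G (d (0,0))"
    have pt: "?pt \<in> EV" using True by (simp add: extraordinary_refine)
    have dq: "d (0,0) = q" using refined_face_extraordinary[OF F(1,2), of "d (0,0)"] pt F d by simp
    then have G': "G = sub F d" "F (d (0,0)) = ?pt" using F by simp_all
    obtain L h where L: "linear L" "\<And>\<nu>. \<nu> \<in> {1,2,3} \<Longrightarrow> L (tri ?pt \<nu>) + h = z (Tri ?pt \<nu>)"
      "\<And>y. (y - vc T xs ?pt) \<bullet> n ?pt = 0 \<Longrightarrow> (\<Sum>\<nu>\<in>{1,2,3}. barycentric (tri ?pt) y \<nu> * z (Tri ?pt \<nu>)) = L y + h"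
      using input_affine[OF pt, where z = "\<lambda>\<nu>. z (Tri ?pt \<nu>)"] by blast
    \<comment> \<open>Agrees with \<open>?f\<close> on the blocks at \<open>?pt\<close>, which is
      all that the control points around \<open>?pt\<close> depend on.\<close>
    let ?g = "\<lambda>F s. L (x F s) + h"
    have Lx: "spl (\<lambda>F s. L (x F s))" by (rule spl_linear[OF x_spl L(1)])
    have hs: "spl (\<lambda>(F::'p face) (s::real\<times>real). h)" unfolding spl_def using bsp_const by metis
    have gC: "?g F (d s) = bsp (\<lambda>j k. L (lc F d j k) + h) s" if "F \<in> T" "d \<in> frames" for F d s
      using bsp_const[of h s] by (simp add: x_lc[OF that(2)] linear_bsp[OF L(1)]) (simp add: bsp_def distrib_left sum.distrib)
    have gs: "spl ?g" unfolding spl_def using gC[of _ id] by fastforce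
    have locg: "loc ?g F d j k = L (lc F d j k) + h" if "F \<in> T" "d \<in> frames" "j \<le> 1" "k \<le> 1" for F d j k
      by (subst subdiv_coeff_bsp[of _ "\<lambda>j k. L (lc F d j k) + h"]) (use gC that in simp_all)
    have loceq: "loc ?f F d j k = loc ?g F d j k" if "F \<in> T" "d \<in> frames" "F (d (0,0)) = ?pt" "j \<le> 1" "k \<le> 1" for F d j k
      using loc_extraordinary[OF that(1,2,4,5), of z] L(3)[of "lc F d j k"] lc_plane[OF that(1,2,4,5)] that(3) pt locg[OF that(1,2,4,5)]
      by simp
    have gval: "refined_points T fan ?g \<phi> = L (xs' \<phi>) + h" if "\<phi> \<in> dof_star ?T" for \<phi>
      using refined_add[OF Lx hs that] refined_linear[OF x_spl L(1) that] refined_const[OF that] by simp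
    have wf: "?w (Face (sub F' d')) = L (xs' (Face (sub F' d'))) + h"
      if h: "F' \<in> T" "d' \<in> frames" "F' (d' (0,0)) = ?pt" for F' d'
    proof -
      have "Face (sub F' d') \<in> dof_star ?T" using refineI[OF h(1), of "d' (0,0)"] h(2) by (simp add: dof_star_def)
      moreover have "?w (Face (sub F' d')) = refined_points T fan ?g (Face (sub F' d'))"
        by (rule refined_face_cong[OF fs gs h]) (rule loceq)
      ultimately show ?thesis using gval by simp
    qed
    have wb: "?w (BEdge (half F' d')) = L (xs' (BEdge (half F' d'))) + h"
      if h: "F' \<in> T" "d' \<in> frames" "F' (d' (0,0)) = ?pt" and b: "side F' d' \<in> BE" for F' d'
    proof -
      have "BEdge (half F' d') \<in> dof_star ?T" using half_boundary_iff[OF h(1,2)] b by (simp add: dof_star_def)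
      from gval[OF this] show ?thesis
        using refined_edge[OF fs h(1,2) b] refined_edge[OF gs h(1,2) b] loceq[OF h, of 1 0] by simp
    qed
    let ?p = "subdiv (bc ?T xs' (G \<circ> d) (xs' (Face G))) j k"
    have "subdiv (bc ?T ?w (sub F d \<circ> d) (?w (Face (sub F d)))) j k =
      L (subdiv (bc ?T xs' (sub F d \<circ> d) (xs' (Face (sub F d)))) j k) + h"
      by (rule refined_affine[OF pt L(1)]; (fact wf | fact wb | fact F(1) d G'(2) jk))
    then have "subdiv (bc ?T ?w (G \<circ> d) (?w (Face G))) j k = L ?p + h" using G'(1) by simp
    moreover have p: "R.lc G d j k = ?p" by (rule refined_lc[OF G d jk])
    moreover have "loc (spline (dof ?T) (basis ?T xs' n tri') ?Mz) G d j k =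
      (\<Sum>\<nu>\<in>{1,2,3}. barycentric (tri' ?pt) (R.lc G d j k) \<nu> *\<^sub>R ?Mz (Tri ?pt \<nu>))"
      by (rule R.loc_extraordinary[OF G d jk True])
    moreover have "(\<Sum>\<nu>\<in>{1,2,3}. barycentric (tri' ?pt) (R.lc G d j k) \<nu> *\<^sub>R ?Mz (Tri ?pt \<nu>)) =
       (\<Sum>\<nu>\<in>{1,2,3}. barycentric (tri' ?pt) (R.lc G d j k) \<nu> * (L (tri' ?pt \<nu>) + h))"
    proof (rule sum.cong[OF refl])
      fix \<nu> :: nat assume \<nu>: "\<nu> \<in> {1,2,3}"
      show "barycentric (tri' ?pt) (R.lc G d j k) \<nu> *\<^sub>R ?Mz (Tri ?pt \<nu>) = barycentric (tri' ?pt) (R.lc G d j k) \<nu> * (L (tri' ?pt \<nu>) + h)"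
        using M_tri[OF pt \<nu>, of z] L(3)[OF tri'_plane[OF pt \<nu>]] by simp
    qed
    moreover have "\<dots> = L (R.lc G d j k) + h"
      using affine_sum[OF L(1) R.barycentric_sums(1)[OF True R.lc_plane[OF G d jk True]], of "tri' ?pt" h]
        R.barycentric_sums(2)[OF True R.lc_plane[OF G d jk True]] by simp
    ultimately show ?thesis by simp
  qed
  have "star ?T ?w G s = bsp (subdiv (bc ?T ?w G (?w (Face G)))) s" by (simp add: R.star_bern[OF G] bern_subdiv)
  also have "\<dots> = bsp (loc (spline (dof ?T) (basis ?T xs' n tri') ?Mz) G id) s"
  proof (rule bsp_cong)
    fix j k :: nat assume jk: "j \<le> 3" "k \<le> 3"
    obtain d j0 k0 where d: "d \<in> frames" "j0 \<le> 1" "k0 \<le> 1" "idx 3 d j0 k0 = (j, k)" by (rule idx_corner[OF jk])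
    have 1: "loc (star ?T ?w) G d j0 k0 = act 3 d (subdiv (bc ?T ?w G (?w (Face G)))) j0 k0"
      by (rule subdiv_coeff_frame) (use G d in \<open>auto simp: R.star_bern bern_subdiv\<close>)
    have 2: "loc (star ?T ?w) G d j0 k0 = subdiv (bc ?T ?w (G \<circ> d) (?w (Face G))) j0 k0"
      by (rule R.star_subdiv[OF G d(1)]) (use d in auto)
    have 3: "loc (spline (dof ?T) (basis ?T xs' n tri') ?Mz) G (id \<circ> d) j0 k0 =
       act 3 d (loc (spline (dof ?T) (basis ?T xs' n tri') ?Mz) G id) j0 k0"
      by (rule R.loc_frame[OF R.spl_spline G _ d(1)]) (use d in auto)
    show "subdiv (bc ?T ?w G (?w (Face G))) j k = loc (spline (dof ?T) (basis ?T xs' n tri') ?Mz) G id j k"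
      using 1 2 3 key[OF d(1-3)] d(4) by (simp add: act_def)
  qed
  also have "\<dots> = spline (dof ?T) (basis ?T xs' n tri') ?Mz G s"
  proof -
    have "subdiv_coeff (spline (dof ?T) (basis ?T xs' n tri') ?Mz G) j k =
      (\<Sum>\<phi>\<in>dof ?T. bcoef ?T xs' n tri' \<phi> G j k *\<^sub>R ?Mz \<phi>)" if "j \<le> 3" "k \<le> 3" for j k
      by (subst subdiv_coeff_bsp[OF spline_basis_bsp]) (use that in simp)
    then show ?thesis unfolding spline_basis_bsp[of ?T] by (intro bsp_cong) (simp add: spline_basis_bsp[symmetric])
  qed
  finally show ?thesis by (simp add: refine_fun_def)
qed

lemma M_normalized: "\<phi> \<notin> dof T' \<or> \<psi> \<notin> dof T \<Longrightarrow> M \<phi> \<psi> = 0"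
  by (auto simp: M_def)

theorem refinement_matrix_M:
  "refinement_matrix T fan (basis T xs n tri) (basis T' xs' n tri') A \<longleftrightarrow> A = M"
proof
  assume A: "refinement_matrix T fan (basis T xs n tri) (basis T' xs' n tri') A"
  have "A \<phi> \<psi> = M \<phi> \<psi>" for \<phi> \<psi>
  proof (cases "\<phi> \<in> dof T' \<and> \<psi> \<in> dof T")
    case False
    then show ?thesis using A M_normalized by (auto simp: refinement_matrix_def)
  next
    case True
    \<comment> \<open>Unit coefficient vectors extract single columns, so equal splines give equal
      matrices by \<open>basis_independent\<close>.\<close>
    let ?z = "\<lambda>\<zeta>. if \<zeta> = \<psi> then 1 else (0::real)"
    have ap: "apply_matrix T C ?z \<zeta> = C \<zeta> \<psi>" for C \<zeta>
      using True by (simp add: apply_matrix_def if_distrib[of "\<lambda>x. _ * x"] cong: if_cong)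
    have "spline (dof T') (basis T' xs' n tri') (\<lambda>\<zeta>. A \<zeta> \<psi> - M \<zeta> \<psi>) G s = 0"
      if "G \<in> T'" "s \<in> sq" for G s
    proof -
      have "spline (dof T') (basis T' xs' n tri') (apply_matrix T A ?z) G s =
        spline (dof T') (basis T' xs' n tri') (apply_matrix T M ?z) G s"
        using A M_refines[OF that(1), of ?z s] that unfolding refinement_matrix_def by metis
      then show ?thesis unfolding ap by (simp add: spline_def right_diff_distrib sum_subtractf)
    qed
    from R.basis_independent[OF this] True show ?thesis by simp
  qed
  then show "A = M" by blast
next
  assume "A = M"
  then show "refinement_matrix T fan (basis T xs n tri) (basis T' xs' n tri') A"
    using M_normalized M_refines by (simp add: refinement_matrix_def)
qed

lemma M_control:
  assumes "\<phi> \<in> dof T'"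
  shows "control_point xs' tri' \<phi> = apply_matrix T M (control_point xs tri) \<phi>"
proof -
  consider "\<phi> \<in> dof_star T'" | pt \<nu> where "\<phi> = Tri pt \<nu>" "pt \<in> EV" "\<nu> \<in> {1,2,3}"
    using assms by (auto simp: dof_refine extraordinary_refine)
  then show ?thesis
  proof cases
    case 1
    have "spline (dof T) (basis T xs n tri) (control_point xs tri) = x"
      by (simp add: x_def almost_C1_geometry_def)
    then show ?thesis using M_star[OF 1, of "control_point xs tri"] 1 by (auto simp: control_point_def dof_star_def)
  next
    case 2
    then show ?thesis
      using M_tri[OF 2(2,3), of "control_point xs tri"] barycentric_sums(2)[OF 2(2) tri'_plane[OF 2(2,3)]]
      by (simp add: control_point_def)
  qed
qed

text \<open>The spline with all coefficients 1 has constant blocks: averages of 1 at ordinary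
  vertices, barycentric coordinates with sum 1 at extraordinary ones. The rule preserves
  this.\<close>

lemma M_row_sum:
  assumes "\<phi> \<in> dof T'"
  shows "(\<Sum>\<psi>\<in>dof T. M \<phi> \<psi>) = 1"
proof -
  have ap: "(\<Sum>\<psi>\<in>dof T. M \<phi> \<psi>) = apply_matrix T M (\<lambda>_. 1) \<phi>" by (simp add: apply_matrix_def)
  consider "\<phi> \<in> dof_star T'" | pt \<nu> where "\<phi> = Tri pt \<nu>" "pt \<in> EV" "\<nu> \<in> {1,2,3}"
    using assms by (auto simp: dof_refine extraordinary_refine)
  then show ?thesis
  proof cases
    case 1
    have "loc (spline (dof T) (basis T xs n tri) (\<lambda>_. 1::real)) F d j k = 1" if F: "F \<in> T" "d \<in> frames" and jk: "j \<le> 1" "k \<le> 1" for F d j k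
    proof (cases "F (d (0,0)) \<in> EV")
      case True
      show ?thesis unfolding loc_extraordinary[OF F jk True]
        using barycentric_sums(1)[OF True lc_plane[OF F jk True]] by simp
    next
      case False
      have "j = 0 \<or> j = Suc 0" "k = 0 \<or> k = Suc 0" using jk by auto
      then show ?thesis unfolding spline_local_ordinary[OF F jk False]
        using vc_one[OF frame_origin_vertex[OF F], of "1::real"] ec_one[OF F, of "1::real"] ec_one[OF F(1) frame_swp_frames[OF F(2)], of "1::real"]
        by (auto simp: subdiv_simps bc_local)
    qed
    from refined_local_const[OF spl_spline 1 this] show ?thesis unfolding ap M_star[OF 1] by simp
  next
    case 2
    then show ?thesis unfolding ap using M_tri[OF 2(2,3), of "\<lambda>_. 1::real"] barycentric_sums(1)[OF 2(2) tri'_plane[OF 2(2,3)]] by simp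
  qed
qed

lemma M_translation:
  fixes z :: "'p dof \<Rightarrow> 'a::real_vector"
  assumes "\<phi> \<in> dof T'"
  shows "apply_matrix T M (\<lambda>\<psi>. z \<psi> + w) \<phi> = apply_matrix T M z \<phi> + w"
  using M_row_sum[OF assms]
  by (simp add: apply_matrix_def scaleR_add_right sum.distrib flip: scaleR_sum_left)

end

lemma apply_matrix_rotation:
  fixes z :: "'p dof \<Rightarrow> real^3"
  shows "apply_matrix T A (\<lambda>\<psi>. R *v z \<psi>) \<phi> = R *v apply_matrix T A z \<phi>"
  unfolding apply_matrix_def
  by (simp add: linear_sum[OF matrix_vector_mul_linear] linear_scale[OF matrix_vector_mul_linear])

section \<open>One step of the refinement process near extraordinary vertices\<close>

text \<open>The B-spline with index 1, whose last piece 2(1-t)^2 would continue beyond 1, cut off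
  there by a truncated square. It is differentiable on the whole line and 0 from 1 on, so its
  dilates can be used on all of [0,1].\<close>

definition bump :: "real \<Rightarrow> real" where
  "bump t = bspline 1 t - 2 * (max 0 (t - 1))^2"

lemma bump_bspline: "t \<le> 1 \<Longrightarrow> bump t = bspline 1 t"
  by (simp add: bump_def)

lemma bump_ge: "1 \<le> t \<Longrightarrow> bump t = 0"
  by (simp add: bump_def bspline_def algebra_simps power2_eq_square)

lemma bump_0: "bump 0 = 0"
  by (simp add: bump_def bspline_def)

lemma bump_bound: assumes "0 \<le> t" shows "\<bar>bump t\<bar> \<le> 1"
proof -
  consider "t \<le> 1/2" | "1/2 < t" "t \<le> 1" | "1 \<le> t" by linarith
  then show ?thesis
  proof cases
    case 1
    have "0 \<le> 6 * (t - 1/3)^2" by simp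
    then have "2*t*(2-3*t) \<le> 1" by (simp add: power2_eq_square algebra_simps)
    moreover have "0 \<le> 2*t*(2-3*t)" using 1 assms by (intro mult_nonneg_nonneg) auto
    ultimately show ?thesis using 1 by (simp add: bump_bspline bspline_def)
  next
    case 2
    have "(1-t)^2 \<le> (1/2)^2" using 2 by (intro power_mono) auto
    then have "2 * (1-t)^2 \<le> 1" by (simp add: power2_eq_square)
    then show ?thesis using 2 by (simp add: bump_bspline bspline_def)
  qed (simp add: bump_ge)
qed

lemma bump_derivative: "(bump has_real_derivative dbspline 1 t - 2 * (2 * max 0 (t - 1))) (at t)"
proof -
  have "((\<lambda>t. bspline 1 t - 2 * (max 0 (t - 1))^2) has_real_derivative dbspline 1 t - 2 * (2 * max 0 (t - 1))) (at t)"
    by (intro DERIV_diff DERIV_cmult bspline_derivative has_real_derivative_pos_square) simp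
  then show ?thesis by (simp add: bump_def[abs_def])
qed

text \<open>The diagonal tensor product B-spline at the corner \<open>q\<close>, shrunk to the
  square of side 2^-k there; the reflected coordinates measure the distance from
  \<open>q\<close>.\<close>

definition corner_bump :: "nat \<Rightarrow> real \<times> real \<Rightarrow> real \<times> real \<Rightarrow> real" where
  "corner_bump k q s = bump (2^k * (fst q + (1 - 2 * fst q) * fst s)) * bump (2^k * (snd q + (1 - 2 * snd q) * snd s))"

lemma corner_bump_hder:
  fixes v :: "'a::real_normed_vector"
  shows "\<exists>D. hder (\<lambda>s. corner_bump k q s *\<^sub>R v) s D"
proof -
  have 1: "\<exists>D. ((\<lambda>s. bump (2^k * (fst q + (1 - 2 * fst q) * fst s))) has_derivative D) (at s within sq)"
    by (rule exI, rule DERIV_compose_FDERIV[OF bump_derivative]) (auto intro!: derivative_eq_intros)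
  have 2: "\<exists>D. ((\<lambda>s. bump (2^k * (snd q + (1 - 2 * snd q) * snd s))) has_derivative D) (at s within sq)"
    by (rule exI, rule DERIV_compose_FDERIV[OF bump_derivative]) (auto intro!: derivative_eq_intros)
  obtain D1 D2 where "((\<lambda>s. bump (2^k * (fst q + (1 - 2 * fst q) * fst s))) has_derivative D1) (at s within sq)"
    "((\<lambda>s. bump (2^k * (snd q + (1 - 2 * snd q) * snd s))) has_derivative D2) (at s within sq)"
    using 1 2 by blast
  from has_derivative_scaleR_left[OF has_derivative_mult[OF this], of v] show ?thesis
    unfolding corner_bump_def by blast
qed

lemma corner_bump_bound: "q \<in> corners \<Longrightarrow> s \<in> sq \<Longrightarrow> \<bar>corner_bump k q s\<bar> \<le> 1"
  unfolding corner_bump_def abs_mult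
  by (intro mult_le_one bump_bound) (auto simp: corners_def unit_square_def)

text \<open>\<open>bump\<close> vanishes at 0 and from 1 on. Corrections by such bumps never move
  the sides of the coarse faces, nor the derivatives along the sides at a corner.\<close>

lemma corner_bump_side:
  assumes "q \<in> corners" "s \<in> sq" "fst s \<in> {0,1} \<or> snd s \<in> {0,1}"
  shows "corner_bump k q s = 0"
  using assms by (auto simp: corner_bump_def corners_def bump_0 bump_ge)

lemma corner_bump_far:
  assumes "1 \<le> 2^k * (fst q + (1 - 2 * fst q) * fst s) \<or> 1 \<le> 2^k * (snd q + (1 - 2 * snd q) * snd s)"
  shows "corner_bump k q s = 0"
  using assms by (auto simp: corner_bump_def bump_ge)

section \<open>Dyadic cells of a coarse face as faces of the refined meshes\<close>

definition dyad :: "nat \<Rightarrow> nat \<Rightarrow> nat \<Rightarrow> real \<times> real \<Rightarrow> real \<times> real" where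
  "dyad k a b s = ((real a + fst s) / 2^k, (real b + snd s) / 2^k)"

definition zoom :: "nat \<Rightarrow> real \<times> real \<Rightarrow> real \<times> real \<Rightarrow> real \<times> real" where
  "zoom k q s = q + (1 / 2^k) *\<^sub>R (s - q)"

lemma nat_lt_pow: "a < 2^k \<Longrightarrow> real a + 1 \<le> 2^k"
proof -
  assume "a < 2^k"
  then have "real (a + 1) \<le> real (2^k)" by (intro of_nat_mono) simp
  then show ?thesis by simp
qed

lemma dyad_square: "a < 2^k \<Longrightarrow> b < 2^k \<Longrightarrow> s \<in> sq \<Longrightarrow> dyad k a b s \<in> sq"
  using nat_lt_pow[of a k] nat_lt_pow[of b k] by (auto simp: dyad_def unit_square_def)

lemma dyad_corner:
  assumes "a < 2^k" "b < 2^k" "q \<in> corners" "dyad k a b q \<in> corners"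
  shows "dyad k a b q = q"
  using assms nat_lt_pow[of a k] nat_lt_pow[of b k]
  by (cases q) (auto simp: dyad_def corners_iff divide_simps)

lemma dyad_zoom:
  assumes "dyad k a b q = q" shows "dyad k a b = zoom k q"
proof
  fix s
  have "real a = 2^k * fst q - fst q" "real b = 2^k * snd q - snd q"
    using arg_cong[OF assms, of fst] arg_cong[OF assms, of snd] by (simp_all add: dyad_def field_simps)
  then show "dyad k a b s = zoom k q s"
    by (simp add: dyad_def zoom_def prod_eq_iff diff_divide_distrib add_divide_distrib)
qed

text \<open>A cell whose end towards p is not p itself is separated from p by at least one grid
  step.\<close>

lemma grid_far:
  assumes a: "a < 2^k" and p: "p \<in> {0,1}" and t: "0 \<le> t" "t \<le> 1" and ne: "(real a + p) / 2^k \<noteq> p"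
  shows "1 \<le> 2^k * (p + (1 - 2 * p) * ((real a + t) / 2^k))"
proof (cases "p = 0")
  case True
  then show ?thesis using ne t by simp
next
  case False
  then have p: "p = 1" using p by simp
  then have "real (a + 1) \<noteq> real (2^k)" using ne by auto
  then have "a + 2 \<le> 2^k" using a of_nat_eq_iff[of "a + 1" "2^k", where 'a = real] by linarith
  then have "real (a + 2) \<le> real (2^k)" by (rule of_nat_mono)
  moreover have "2^k * (1 + (1 - 2) * ((real a + t) / 2^k)) = 2^k - real a - t" by (simp add: distrib_left)
  ultimately show ?thesis using t p by simp
qed

text \<open>The bump of level k is supported in the cell of level k at \<open>q\<close>, so a
  correction made in the coordinates of a fine face becomes a function on the coarse face.\<close>

lemma corner_bump_dyad:
  assumes ab: "a < 2^k" "b < 2^k" and q: "q \<in> corners" and t: "t \<in> sq"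
  shows "corner_bump k q (dyad k a b t) = (if dyad k a b q = q then corner_bump 0 q t else 0)"
proof (cases "dyad k a b q = q")
  case True
  have "real a = 2^k * fst q - fst q" "real b = 2^k * snd q - snd q"
    using arg_cong[OF True, of fst] arg_cong[OF True, of snd] by (simp_all add: dyad_def field_simps)
  moreover have scale: "2^k * (1 + (1 - 2^k - r) / 2^k) = 1 - r" for r :: real by (simp add: field_simps)
  ultimately have "2^k * (fst q + (1 - 2 * fst q) * fst (dyad k a b t)) = fst q + (1 - 2 * fst q) * fst t"
    "2^k * (snd q + (1 - 2 * snd q) * snd (dyad k a b t)) = snd q + (1 - 2 * snd q) * snd t"
    using q by (auto simp: dyad_def corners_def scale)
  then show ?thesis using True by (simp add: corner_bump_def)
next
  case False
  then have "(real a + fst q) / 2^k \<noteq> fst q \<or> (real b + snd q) / 2^k \<noteq> snd q" by (auto simp: dyad_def prod_eq_iff)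
  moreover have "fst q \<in> {0,1}" "snd q \<in> {0,1}" "0 \<le> fst t" "fst t \<le> 1" "0 \<le> snd t" "snd t \<le> 1"
    using q t by (auto simp: corners_def unit_square_def)
  ultimately have "1 \<le> 2^k * (fst q + (1 - 2 * fst q) * fst (dyad k a b t)) \<or> 1 \<le> 2^k * (snd q + (1 - 2 * snd q) * snd (dyad k a b t))"
    using grid_far[OF ab(1), of "fst q" "fst t"] grid_far[OF ab(2), of "snd q" "snd t"] unfolding dyad_def fst_conv snd_conv by blast
  then show ?thesis using False corner_bump_far by simp
qed

lemma dyad_quad:
  assumes "q \<in> corners"
  shows "\<exists>a' b'. dyad k a b \<circ> quad q = dyad (Suc k) a' b' \<and> (a < 2^k \<longrightarrow> a' < 2^Suc k) \<and> (b < 2^k \<longrightarrow> b' < 2^Suc k)"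
proof -
  obtain i j :: nat where q: "q = (real i, real j)" "i \<le> 1" "j \<le> 1"
  proof -
    have "q = (real (if fst q = 0 then 0 else 1), real (if snd q = 0 then 0 else 1))"
      using assms by (auto simp: corners_def)
    then show thesis by (rule that) auto
  qed
  have "dyad k a b \<circ> quad q = dyad (Suc k) (2 * a + i) (2 * b + j)"
    by (rule ext) (auto simp: dyad_def quad_def q field_simps)
  moreover have "a < 2^k \<longrightarrow> 2 * a + i < 2^Suc k" "b < 2^k \<longrightarrow> 2 * b + j < 2^Suc k" using q by auto
  ultimately show ?thesis by blast
qed

lemma mesh_seq_face: "K \<in> mesh_seq T k \<Longrightarrow> \<exists>F\<in>T. \<exists>a b. a < 2^k \<and> b < 2^k \<and> K = F \<circ> dyad k a b"
proof (induction k arbitrary: K)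
  case 0
  have "K \<circ> dyad 0 0 0 = K" by (rule ext) (simp add: dyad_def)
  then show ?case using 0 by (intro bexI[of _ K] exI[of _ 0]) auto
next
  case (Suc k)
  have "K \<in> refine (mesh_seq T k)" using Suc.prems by (simp add: mesh_seq_Suc)
  then obtain G q where G: "G \<in> mesh_seq T k" "q \<in> corners" "K = G \<circ> quad q" by (rule refineE)
  obtain F a b where F: "F \<in> T" "a < 2^k" "b < 2^k" "G = F \<circ> dyad k a b" using Suc.IH[OF G(1)] by blast
  obtain a' b' where "dyad k a b \<circ> quad q = dyad (Suc k) a' b'" "a' < 2^Suc k" "b' < 2^Suc k"
    using dyad_quad[OF G(2), of k a b] F by blast
  then show ?case using F G(3) by (intro bexI[of _ F] exI[of _ a'] exI[of _ b']) (auto simp: comp_assoc)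
qed

lemma mesh_seq_cover:
  assumes "F \<in> T" "s \<in> sq"
  shows "\<exists>a b t. a < 2^k \<and> b < 2^k \<and> t \<in> sq \<and> s = dyad k a b t \<and> F \<circ> dyad k a b \<in> mesh_seq T k"
proof (induction k)
  case 0
  have "F \<circ> dyad 0 0 0 = F" "s = dyad 0 0 0 s" by (auto simp: dyad_def)
  then show ?case using assms by (intro exI[of _ 0] exI[of _ s]) auto
next
  case (Suc k)
  then obtain a b t where ab: "a < 2^k" "b < 2^k" "t \<in> sq" "s = dyad k a b t" "F \<circ> dyad k a b \<in> mesh_seq T k" by blast
  obtain q t' where q: "q \<in> corners" "t' \<in> sq" "t = quad q t'" using ab(3) by (rule quad_cover)
  obtain a' b' where a': "dyad k a b \<circ> quad q = dyad (Suc k) a' b'" "a' < 2^Suc k" "b' < 2^Suc k"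
    using dyad_quad[OF q(1), of k a b] ab by blast
  have "F \<circ> dyad k a b \<circ> quad q \<in> mesh_seq T (Suc k)" unfolding mesh_seq_Suc using ab(5) q(1) by (rule refineI)
  then have "F \<circ> dyad (Suc k) a' b' \<in> mesh_seq T (Suc k)" by (simp add: comp_assoc a'(1))
  moreover have "s = dyad (Suc k) a' b' t'" using fun_cong[OF a'(1), of t'] ab(4) q(3) by simp
  ultimately show ?case using a' q by blast
qed

context refinement_step
begin

text \<open>The change, in one step, of the coefficient diagonally next to the corner \<open>q\<close>.\<close>

definition jump :: "'p face \<Rightarrow> real \<times> real \<Rightarrow> real^3" where
  "jump F q = (let j = if fst q = 0 then 1 else 2; k = if snd q = 0 then 1 else 2
     in joint xs' F j k - lc F id j k)"

lemma jump_frame: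
  assumes F: "F \<in> T" and d: "d \<in> frames"
  shows "jump F (d (0,0)) = act 3 d (joint xs' F) (Suc 0) (Suc 0) - lc F d (Suc 0) (Suc 0)"
proof -
  obtain a b w where dw: "d = fr a b w" using d by (rule frameE)
  have "lc F d (Suc 0) (Suc 0) = act 3 d (lc F id) (Suc 0) (Suc 0)" using lc_act[OF F d] by simp
  then show ?thesis by (simp add: jump_def dw act_def idx_fr Let_def)
qed

lemma jump_plane:
  assumes F: "F \<in> T" and d: "d \<in> frames" and pt: "F (d (0,0)) \<in> EV"
  shows "jump F (d (0,0)) \<bullet> n (F (d (0,0))) = 0"
  using joint_plane[OF F d pt, of "Suc 0" "Suc 0"] lc_plane[OF F d _ _ pt, of "Suc 0" "Suc 0"]
  by (simp add: jump_frame[OF F d] inner_diff_left)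

lemma jump_ordinary:
  assumes F: "F \<in> T" and d: "d \<in> frames" and pt: "F (d (0,0)) \<notin> EV"
  shows "jump F (d (0,0)) = 0"
  using joint_lc[OF F d, of "Suc 0" "Suc 0"] pt by (simp add: jump_frame[OF F d])

context
  assumes all_isolated: "\<forall>pt\<in>EV. isolated T pt"
begin

text \<open>With all extraordinary vertices isolated the spokes are kept by \<open>joint_lc\<close>,
  so only the four diagonal coefficients can change.\<close>

lemma joint_eq_outer:
  assumes F: "F \<in> T" and jk: "j \<le> 3" "k \<le> 3" and o: "\<not> (j \<in> {1,2} \<and> k \<in> {1,2})"
  shows "joint xs' F j k = lc F id j k"
proof -
  obtain d j0 k0 where d: "d \<in> frames" "j0 \<le> 1" "k0 \<le> 1" "idx 3 d j0 k0 = (j, k)" "d (0,0) = block_corner j k"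
    using jk by (rule idx_corner)
  have "\<not> (j0 = 1 \<and> k0 = 1)"
  proof
    assume "j0 = 1 \<and> k0 = 1"
    moreover obtain a b w where "d = fr a b w" using d(1) by (rule frameE)
    ultimately show False using d(4) o by (auto simp: idx_fr split: if_splits)
  qed
  then have "act 3 d (joint xs' F) j0 k0 = lc F d j0 k0" using all_isolated by (intro joint_lc[OF F d(1-3)]) blast
  also have "\<dots> = act 3 d (lc F id) j0 k0" using lc_act[OF F d(1)] d(2,3) by simp
  finally show ?thesis using d(4) by (simp add: act_def)
qed

lemma joint_jump:
  assumes F: "F \<in> T" and s: "s \<in> sq"
  shows "bsp (joint xs' F) s = x F s + (\<Sum>q\<in>corners. corner_bump 0 q s *\<^sub>R jump F q)"
proof -
  have b: "bspline (Suc 0) (1 - t) = bspline 2 t" for t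
    using bspline_flip[of 2 t] by (simp add: eval_nat_numeral)
  have "bsp (joint xs' F) s - x F s = bsp (\<lambda>j k. joint xs' F j k - lc F id j k) s"
    using x_lc[of id F s] by (simp add: bsp_diff)
  also have "\<dots> = (\<Sum>q\<in>corners. corner_bump 0 q s *\<^sub>R jump F q)"
    using s joint_eq_outer[OF F]
    by (cases s) (simp add: bsp_def sum_atMost_3 corners_def corner_bump_def jump_def bspline2_def bump_bspline sq_iff b)
  finally show ?thesis by (simp add: algebra_simps)
qed

text \<open>\<open>E\<close> bounds the spokes and \<open>B\<close> the diagonals relative to the
  vertex. Subdivision halves the spokes. A new diagonal is a quarter of the sum of two spokes and an
  inner point, at most (2E + 4mE + B)/4, and the margin (2 + 4m) E \<le> B turns this into B/2.
  Halving both bounds keeps the margin, so the estimate can be iterated.\<close>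

lemma step_bound:
  fixes m :: nat
  assumes m: "\<forall>pt\<in>EV. valence T pt \<le> m" and E0: "0 \<le> E" and B: "(2 + 4 * real m) * E \<le> B"
    and bound: "\<forall>F d. F \<in> T \<longrightarrow> d \<in> frames \<longrightarrow> F (d (0,0)) \<in> EV \<longrightarrow>
        norm (lc F d (Suc 0) 0 - vc T xs (F (d (0,0)))) \<le> E \<and>
        norm (lc F d (Suc 0) (Suc 0) - vc T xs (F (d (0,0)))) \<le> B"
    and F: "F \<in> T" "d \<in> frames" "F (d (0,0)) = pt" and pt: "pt \<in> EV"
  shows "norm (jump F (d (0,0))) \<le> 3 * B"
    "norm (R.lc (sub F d) d (Suc 0) 0 - vc T' xs' pt) \<le> E / 2"
    "norm (R.lc (sub F d) d (Suc 0) (Suc 0) - vc T' xs' pt) \<le> B / 2"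
proof -
  let ?c = "vc T xs pt" and ?G = "sub F d" and ?mu = "valence T pt" and ?cyc = "pt \<in> IV"
  note iso = bspec[OF all_isolated] and E = bound[rule_format]
  have v: "pt \<in> vertices T" using pt by (rule extraordinary_vertex)
  have vc': "vc T' xs' pt = ?c" using v by (rule refined_vertex)
  have G: "?G \<in> T'" using F by (intro refineI) auto
  have Go: "?G (d (0,0)) = pt" using F by simp
  obtain r where r: "r \<in> {1..?mu}" "fF pt r = F" "d = fd pt r \<or> d = fd pt r \<circ> swp"
    using spoke_cases[OF pt F] by blast
  have o: "d (0,0) = fd pt r (0,0)" using r(3) by auto
  let ?sp = "\<lambda>k. lc (fF pt k) (fd pt k) 0 (Suc 0)" and ?tw = "\<lambda>k. lc (fF pt k) (fd pt k) (Suc 0) (Suc 0)"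
  have X: "xs' (Face ?G) = inner_point ?cyc ?mu ?sp ?tw r"
    using refined_inner[OF pt iso[OF pt] r(1)] by (simp add: r(2) o inner_value_x[OF pt])
  have sp: "norm (?sp k - ?c) \<le> E" "norm (?tw k - ?c) \<le> B" if "k \<in> {1..?mu}" for k
  proof -
    note f = fan_face[OF pt that]
    have "?sp k = lc (fF pt k) (fd pt k \<circ> swp) (Suc 0) 0" using lc_swp[OF f(1,2)] by simp
    then show "norm (?sp k - ?c) \<le> E" using E[OF f(1), of "fd pt k \<circ> swp"] f pt by simp
    show "norm (?tw k - ?c) \<le> B" using E[OF f(1,2)] f(3) pt by simp
  qed
  have diff: "inner_point ?cyc ?mu ?sp ?tw r - ?c = inner_point ?cyc ?mu (\<lambda>k. ?sp k - ?c) (\<lambda>k. ?tw k - ?c) r"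
  proof -
    have "inner_point ?cyc ?mu (\<lambda>k. ?sp k - ?c) (\<lambda>k. ?tw k - ?c) r =
      inner_point ?cyc ?mu ?sp ?tw r - inner_point ?cyc ?mu (\<lambda>_. ?c) (\<lambda>_. ?c) r"
      by (simp add: inner_point_def scaleR_diff_right sum_subtractf)
    then show ?thesis using inner_point_const[OF r(1), of ?cyc ?c] by simp
  qed
  have "norm (xs' (Face ?G) - ?c) \<le> 4 * real ?mu * E + B"
    unfolding X diff by (rule inner_point_norm[OF r(1)]) (auto intro!: sp E0 split: if_splits)
  also have "\<dots> \<le> 4 * real m * E + B" using bspec[OF m pt] E0 by (intro add_right_mono mult_right_mono) auto
  finally have XB: "norm (xs' (Face ?G) - ?c) \<le> 4 * real m * E + B" .
  have BE2: "4 * real m * E + 2 * E \<le> B" using B by (simp add: algebra_simps)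
  \<comment> \<open>The jump is the new inner point minus the old diagonal, of size at most (4mE +
    B) + B, which the margin bounds by 3B.\<close>
  have j: "jump F (d (0,0)) = (xs' (Face ?G) - ?c) - (lc F d (Suc 0) (Suc 0) - ?c)"
    using jump_frame[OF F(1,2)] joint_local(4)[OF F(1,2), of xs'] by simp
  have "norm (jump F (d (0,0))) \<le> (4 * real m * E + B) + B"
    unfolding j using norm_triangle_ineq4 XB E[OF F(1,2)] F(3) pt by (smt (verit))
  then show "norm (jump F (d (0,0))) \<le> 3 * B" using BE2 E0 by linarith
  have e: "ec T' xs' (half F d) = lc F d (Suc 0) 0" "ec T' xs' (half F (d \<circ> swp)) = lc F (d \<circ> swp) (Suc 0) 0"
    using refined_half[OF F(1,2)] refined_half[OF F(1), of "d \<circ> swp"] F iso[OF pt] by auto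
  have hs: "side ?G d = half F d" "side ?G (d \<circ> swp) = half F (d \<circ> swp)" by (simp_all add: half_def)
  have 1: "R.lc ?G d (Suc 0) 0 - ?c = (1/2) *\<^sub>R (lc F d (Suc 0) 0 - ?c)"
    using refined_lc[OF G F(2), of "Suc 0" 0]
    by (simp add: subdiv_simps bc_local Go hs e vc' F(3) scaleR_diff_right scaleR_add_right)
  show "norm (R.lc ?G d (Suc 0) 0 - vc T' xs' pt) \<le> E / 2"
    unfolding vc' 1 using E[OF F(1,2)] F(3) pt by simp
  have "(1/4) *\<^sub>R ?c - ?c = - ((3/4) *\<^sub>R ?c)" using scaleR_diff_left[of "1/4" 1 ?c] by simp
  then have 2: "R.lc ?G d (Suc 0) (Suc 0) - ?c = (1/4) *\<^sub>R ((lc F d (Suc 0) 0 - ?c) + (lc F (d \<circ> swp) (Suc 0) 0 - ?c) + (xs' (Face ?G) - ?c))"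
    using refined_lc[OF G F(2), of "Suc 0" "Suc 0"]
    by (simp add: subdiv_simps bc_local Go hs e vc' F(3) scaleR_diff_right scaleR_add_right)
  have "norm ((lc F d (Suc 0) 0 - ?c) + (lc F (d \<circ> swp) (Suc 0) 0 - ?c) + (xs' (Face ?G) - ?c)) \<le> E + E + (4 * real m * E + B)"
    using E[OF F(1,2)] E[OF F(1), of "d \<circ> swp"] F pt by (intro norm_triangle_mono XB) auto
  then show "norm (R.lc ?G d (Suc 0) (Suc 0) - vc T' xs' pt) \<le> B / 2"
    unfolding vc' 2 using BE2 by simp
qed

end

end

section \<open>The limit surface\<close>

text \<open>Telescoping against the geometric series, of which 2C/2^k is the tail.\<close>

lemma geometric_limit:
  fixes f :: "nat \<Rightarrow> 'a::banach"
  assumes "\<And>k. norm (f (Suc k) - f k) \<le> C / 2^k"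
  shows "f \<longlonglongrightarrow> lim f" "norm (f k - lim f) \<le> 2 * C / 2^k"
proof -
  have t: "norm (f (k + m) - f k) \<le> 2 * C / 2^k - 2 * C / 2^(k + m)" for k m
  proof (induction m)
    case (Suc m)
    have "norm (f (k + Suc m) - f k) \<le> norm (f (Suc (k + m)) - f (k + m)) + norm (f (k + m) - f k)"
      using norm_triangle_ineq[of "f (Suc (k + m)) - f (k + m)" "f (k + m) - f k"] by simp
    also have "\<dots> \<le> C / 2^(k + m) + (2 * C / 2^k - 2 * C / 2^(k + m))" by (intro add_mono assms Suc)
    also have "\<dots> = 2 * C / 2^k - 2 * C / 2^(k + Suc m)" by simp
    finally show ?case .
  qed simp
  have C: "0 \<le> C" using order_trans[OF norm_ge_zero assms[of 0]] by simp
  have b: "norm (f (k + m) - f k) \<le> 2 * C / 2^k" for k m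
  proof -
    have "0 \<le> 2 * C / 2^(k + m)" using C by simp
    then show ?thesis using t[of k m] by linarith
  qed
  have "(\<lambda>k. 2 * C * (1/2)^k) \<longlonglongrightarrow> 2 * C * 0" by (intro tendsto_mult tendsto_const LIMSEQ_power_zero) simp
  then have z: "(\<lambda>k. 2 * C / 2^k) \<longlonglongrightarrow> 0" by (simp add: power_divide)
  have "Cauchy f"
  proof (rule metric_CauchyI)
    fix e :: real assume "0 < e"
    then obtain K where K: "\<And>k. k \<ge> K \<Longrightarrow> norm (2 * C / 2^k) < e / 2" using LIMSEQ_D[OF z, of "e/2"] by auto
    have "dist (f m) (f n) < e" if "m \<ge> K" "n \<ge> K" for m n
    proof -
      have "dist (f m) (f K) < e / 2" "dist (f n) (f K) < e / 2"
        using b[of K "m - K"] b[of K "n - K"] K[of K] abs_ge_self[of "2 * C / 2^K"] that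
        unfolding dist_norm real_norm_def by simp_all
      then show ?thesis by (rule dist_triangle_half_l)
    qed
    then show "\<exists>M. \<forall>m\<ge>M. \<forall>n\<ge>M. dist (f m) (f n) < e" by blast
  qed
  then show l: "f \<longlonglongrightarrow> lim f" by (simp add: Cauchy_convergent convergent_LIMSEQ_iff[symmetric])
  have "(\<lambda>m. norm (f k - f (m + k))) \<longlonglongrightarrow> norm (f k - lim f)"
    by (intro tendsto_norm tendsto_diff tendsto_const LIMSEQ_ignore_initial_segment[OF l])
  then show "norm (f k - lim f) \<le> 2 * C / 2^k"
    by (rule LIMSEQ_le_const2) (use b[of k] in \<open>auto simp: add.commute norm_minus_commute\<close>)
qed

text \<open>Only the deviation of \<open>f\<close> from \<open>W\<close> is controlled, by the
  Taylor remainder of a differentiable \<open>g\<close>. At an extraordinary vertex \<open>f\<close>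
  is the limit surface, which need not be differentiable, and \<open>g\<close> is the first refined
  geometry.\<close>

lemma touching_plane:
  fixes f g :: "real \<times> real \<Rightarrow> 'a::real_normed_vector"
  assumes g: "hder g s D" and le: "\<forall>\<^sub>F t in at s within sq. infdist (f t - f s) W \<le> norm (g t - g s - D (t - s))"
  shows "((\<lambda>t. infdist (f t - f s) W / dist t s) \<longlongrightarrow> 0) (at s within sq)"
proof -
  have "((\<lambda>t. norm (g t - g s - D (t - s)) / norm (t - s)) \<longlongrightarrow> 0) (at s within sq)"
    using g by (simp add: has_derivative_iff_norm)
  then show ?thesis
  proof (rule Lim_null_comparison[rotated])
    show "\<forall>\<^sub>F t in at s within sq. norm (infdist (f t - f s) W / dist t s) \<le> norm (g t - g s - D (t - s)) / norm (t - s)"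
      using le by eventually_elim (simp add: dist_norm divide_right_mono infdist_nonneg)
  qed
qed

lemma infdist_normal_plane:
  fixes v \<nu> :: "'a::real_inner"
  assumes "\<nu> \<noteq> 0"
  shows "infdist v {w. w \<bullet> \<nu> = 0} \<le> \<bar>v \<bullet> \<nu>\<bar> / norm \<nu>"
proof -
  let ?w = "v - ((v \<bullet> \<nu>) / (\<nu> \<bullet> \<nu>)) *\<^sub>R \<nu>"
  have "?w \<in> {w. w \<bullet> \<nu> = 0}" using assms by (simp add: inner_diff_left)
  then have "infdist v {w. w \<bullet> \<nu> = 0} \<le> dist v ?w" by (rule infdist_le)
  also have "\<dots> = \<bar>v \<bullet> \<nu>\<bar> / norm \<nu>"
    using assms by (simp add: dist_norm abs_mult power2_norm_eq_inner[symmetric] power2_eq_square)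
  finally show ?thesis .
qed

section \<open>Convergence of the process\<close>

locale process = qmesh T for T :: "'p mesh" +
  fixes n :: "'p \<Rightarrow> real^3" and Xs :: "nat \<Rightarrow> 'p dof \<Rightarrow> real^3" and Tr :: "nat \<Rightarrow> 'p \<Rightarrow> nat \<Rightarrow> real^3"
    and Fan :: "nat \<Rightarrow> 'p \<Rightarrow> ('p face \<times> frame) list"
  assumes process: "refinement_process T n Xs Tr Fan"
begin

abbreviation (input) "TT k \<equiv> mesh_seq T k"

abbreviation (input) "X k \<equiv> geometry.x (TT k) (Xs k) n (Tr k)"

lemma geo: "geometry (TT k) (Xs k) n (Tr k)"
  using process mesh_seq_mesh[of k] by (auto simp: refinement_process_def geometry_def geometry_axioms_def)

lemma X_eq: "X k = almost_C1_geometry (TT k) (Xs k) n (Tr k)"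
  by (rule geometry.x_def[OF geo])

lemma Xs_Suc: "Xs (Suc k) = refined_points (TT k) (Fan k) (X k)"
  using process unfolding X_eq refinement_process_def by blast

lemma step: "refinement_step (TT k) (Xs k) n (Tr k) (Fan k) (Tr (Suc k))"
proof -
  have 1: "fanned (TT k) (Fan k)"
    using process mesh_seq_mesh[of k] by (auto simp: refinement_process_def fanned_def fanned_axioms_def)
  then have "refinement (TT k) (Xs k) n (Tr k) (Fan k)" using geo by (simp add: refinement_def)
  moreover have "almost_C1_input (refine (TT k)) (refined_points (TT k) (Fan k) (X k)) n (Tr (Suc k))"
    using process unfolding Xs_Suc[symmetric] mesh_seq_Suc[symmetric] refinement_process_def by blast
  ultimately show ?thesis by (simp add: refinement_step_def refinement_step_axioms_def)
qed

lemma X_star: "G \<in> TT (Suc k) \<Longrightarrow> X (Suc k) G s = star (TT (Suc k)) (Xs (Suc k)) G s"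
  using refinement_step.refined_x[OF step, of G k s] by (simp add: mesh_seq_Suc Xs_Suc)

lemma X_unique:
  assumes "G \<in> TT (Suc k)" "G' \<in> TT (Suc k)" "t \<in> sq" "t' \<in> sq" "G t = G' t'"
  shows "X (Suc k) G t = X (Suc k) G' t'"
  using X_star[OF assms(1), of t] X_star[OF assms(2), of t'] qmesh.star_continuous[OF mesh_seq_mesh assms] by simp

text \<open>Indices are shifted by one, since \<open>X 0\<close> need not be single-valued on the surface.\<close>

definition val :: "nat \<Rightarrow> 'p \<Rightarrow> real^3" where
  "val k p = (SOME v. \<exists>G\<in>TT (Suc k). \<exists>t\<in>sq. G t = p \<and> v = X (Suc k) G t)"

lemma val_X: assumes "G \<in> TT (Suc k)" "t \<in> sq" shows "val k (G t) = X (Suc k) G t"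
proof -
  have "\<exists>G'\<in>TT (Suc k). \<exists>t'\<in>sq. G' t' = G t \<and> val k (G t) = X (Suc k) G' t'"
    unfolding val_def by (rule someI[of _ "X (Suc k) G t"]) (use assms in blast)
  then show ?thesis using X_unique[OF assms(1) _ assms(2)] by fastforce
qed

abbreviation (input) "jt k \<equiv> qmesh.joint (TT k) (Xs (Suc k))"

lemma val_joint:
  assumes F: "F \<in> TT k" and s: "s \<in> sq"
  shows "val k (F s) = bsp (jt k F) s"
proof -
  obtain q t where q: "q \<in> corners" "t \<in> sq" "s = quad q t" using s by (rule quad_cover)
  have "F \<circ> quad q \<in> TT (Suc k)" unfolding mesh_seq_Suc using F q(1) by (rule refineI)
  from val_X[OF this q(2)] refinement_step.refined_joint[OF step F q(1,2)] show ?thesis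
    by (simp add: q(3) mesh_seq_Suc Xs_Suc)
qed

lemma isolated_seq: "\<forall>pt\<in>extraordinary (TT (Suc k)). isolated (TT (Suc k)) pt"
  unfolding mesh_seq_Suc
  by (rule ballI, rule qmesh.isolated_refine[OF mesh_seq_mesh]) (simp add: qmesh.extraordinary_refine[OF mesh_seq_mesh])

abbreviation (input) "jmp k \<equiv> refinement_step.jump (TT k) (Xs k) n (Tr k) (Fan k)"

text \<open>The coefficient of the bump at \<open>q\<close>, where \<open>F \<circ> zoom (Suc k) q\<close> is the face of \<open>TT (Suc k)\<close>.\<close>

definition dl :: "nat \<Rightarrow> 'p face \<Rightarrow> real \<times> real \<Rightarrow> real^3" where
  "dl k F q = (if F q \<in> extraordinary T then jmp (Suc k) (F \<circ> zoom (Suc k) q) q else 0)"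

lemma jmp_ordinary:
  assumes "G \<in> TT k" "q \<in> corners" "G q \<notin> extraordinary T" shows "jmp k G q = 0"
proof -
  obtain d where "d \<in> frames" "d (0,0) = q" using assms(2) by (rule corner_frame)
  then show ?thesis
    using refinement_step.jump_ordinary[OF step assms(1), of d] assms(3) by (simp add: mesh_seq_extraordinary)
qed

lemma dyad_extraordinary:
  assumes "F \<in> T" "a < 2^k" "b < 2^k" "q \<in> corners" "F (dyad k a b q) \<in> extraordinary T"
  shows "dyad k a b q = q"
proof -
  have "dyad k a b q \<in> sq" using assms by (intro dyad_square) auto
  then have "dyad k a b q \<in> corners" using vertex_corner[OF extraordinary_vertex assms(1)] assms(5) by blast
  then show ?thesis using dyad_corner assms by blast
qed

text \<open>On each fine face the step adds corner bumps with the jumps as coefficients. Jumps at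
  ordinary corners vanish, and an extraordinary corner of a fine face is the same corner of the
  coarse face; so at most four bumps per coarse face remain, on ever smaller squares.\<close>

lemma val_step:
  assumes F: "F \<in> T" and s: "s \<in> sq"
  shows "val (Suc k) (F s) = val k (F s) + (\<Sum>q\<in>corners. corner_bump (Suc k) q s *\<^sub>R dl k F q)"
proof -
  obtain a b t where ab: "a < 2^Suc k" "b < 2^Suc k" and t: "t \<in> sq" "s = dyad (Suc k) a b t"
    and G: "F \<circ> dyad (Suc k) a b \<in> TT (Suc k)"
    using mesh_seq_cover[OF F s, of "Suc k"] by blast
  let ?G = "F \<circ> dyad (Suc k) a b"
  have "val (Suc k) (?G t) = val k (?G t) + (\<Sum>q\<in>corners. corner_bump 0 q t *\<^sub>R jmp (Suc k) ?G q)"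
    using val_joint[OF G t(1)] refinement_step.joint_jump[OF step isolated_seq G t(1)] val_X[OF G t(1)] by (simp add: Xs_Suc)
  moreover have "(\<Sum>q\<in>corners. corner_bump 0 q t *\<^sub>R jmp (Suc k) ?G q) = (\<Sum>q\<in>corners. corner_bump (Suc k) q s *\<^sub>R dl k F q)"
  proof (rule sum.cong[OF refl])
    fix q assume q: "q \<in> corners"
    show "corner_bump 0 q t *\<^sub>R jmp (Suc k) ?G q = corner_bump (Suc k) q s *\<^sub>R dl k F q"
    proof (cases "dyad (Suc k) a b q = q")
      case True
      then have "jmp (Suc k) ?G q = dl k F q"
        using jmp_ordinary[OF G q] dyad_zoom[OF True] by (auto simp: dl_def)
      then show ?thesis using corner_bump_dyad[OF ab q t(1)] True t(2) by simp
    next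
      case False
      then have "?G q \<notin> extraordinary T" using dyad_extraordinary[OF F ab q] by auto
      then show ?thesis using jmp_ordinary[OF G q] corner_bump_dyad[OF ab q t(1)] False t(2) by simp
    qed
  qed
  ultimately show ?thesis using t(2) by simp
qed

lemma zoom_face:
  assumes F: "F \<in> T" and q: "q \<in> corners"
  shows "F \<circ> zoom k q \<in> TT k"
proof (induction k)
  case 0
  have "F \<circ> zoom 0 q = F" by (rule ext) (simp add: zoom_def)
  then show ?case using F by simp
next
  case (Suc k)
  have "zoom (Suc k) q s = zoom k q (quad q s)" for s by (simp add: zoom_def quad_def prod_eq_iff field_simps)
  then have "F \<circ> zoom (Suc k) q = F \<circ> zoom k q \<circ> quad q" by auto
  then show ?case unfolding mesh_seq_Suc using Suc q refineI by metis
qed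

lemma zoom_self: "zoom k q q = q" by (simp add: zoom_def)

text \<open>Provides the constant m of \<open>step_bound\<close> independently of the level, as
  refinement keeps valences.\<close>

lemma valence_seq: "pt \<in> extraordinary T \<Longrightarrow> valence (TT k) pt \<le> card T"
proof (induction k)
  case 0
  show ?case unfolding valence_def by (simp add: card_mono faces_at_def)
next
  case (Suc k)
  have "pt \<in> vertices (TT k)" using Suc.prems qmesh.extraordinary_vertex[OF mesh_seq_mesh] mesh_seq_extraordinary by blast
  then show ?case using qmesh.valence_old[OF mesh_seq_mesh, of pt k] Suc by (simp add: mesh_seq_Suc valence_def)
qed

lemma dl_plane:
  assumes F: "F \<in> T" and q: "q \<in> corners" "F q \<in> extraordinary T"
  shows "dl k F q \<bullet> n (F q) = 0"
proof -
  obtain d where d: "d \<in> frames" "d (0,0) = q" using q(1) by (rule corner_frame)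
  show ?thesis
    using refinement_step.jump_plane[OF step zoom_face[OF F q(1)] d(1), of "Suc k"] q(2)
    by (simp add: dl_def d(2) zoom_self mesh_seq_extraordinary)
qed

abbreviation (input) "bounded_lc k E B \<equiv> \<forall>G d. G \<in> TT k \<longrightarrow> d \<in> frames \<longrightarrow> G (d (0,0)) \<in> extraordinary (TT k) \<longrightarrow>
  norm (geometry.lc (TT k) (Xs k) n (Tr k) G d (Suc 0) 0 - vc (TT k) (Xs k) (G (d (0,0)))) \<le> E \<and>
  norm (geometry.lc (TT k) (Xs k) n (Tr k) G d (Suc 0) (Suc 0) - vc (TT k) (Xs k) (G (d (0,0)))) \<le> B"

text \<open>A level has finitely many faces and frames, so sums serve as bounds. The second summand
  of \<open>B\<close> creates the margin that \<open>step_bound\<close> asks for.\<close>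

lemma bounded_lc_exists:
  obtains E B where "0 \<le> E" "(2 + 4 * real (card T)) * E \<le> B" "bounded_lc k E B"
proof -
  let ?lc = "geometry.lc (TT k) (Xs k) n (Tr k)"
  let ?g = "\<lambda>(G, d) j k'. norm (?lc G d j k' - vc (TT k) (Xs k) (G (d (0,0))))"
  let ?A = "TT k \<times> frames"
  define E where "E = (\<Sum>Gd\<in>?A. ?g Gd (Suc 0) 0)"
  define B where "B = (\<Sum>Gd\<in>?A. ?g Gd (Suc 0) (Suc 0)) + (2 + 4 * real (card T)) * E"
  have fin: "finite ?A" using qmesh.finite_faces[OF mesh_seq_mesh] finite_frames by blast
  have E0: "0 \<le> E" unfolding E_def by (rule sum_nonneg) auto
  have B0: "0 \<le> (2 + 4 * real (card T)) * E" using E0 by simp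
  have le: "?g (G,d) j k' \<le> (\<Sum>Gd\<in>?A. ?g Gd j k')" if "G \<in> TT k" "d \<in> frames" for G d j k'
    by (rule member_le_sum[OF _ _ fin]) (use that in auto)
  have "(2 + 4 * real (card T)) * E \<le> B" unfolding B_def by (simp add: sum_nonneg split_beta)
  moreover have "bounded_lc k E B"
    using le[of _ _ "Suc 0" 0] le[of _ _ "Suc 0" "Suc 0"] B0 unfolding E_def[symmetric] B_def by fastforce
  ultimately show thesis by (rule that[OF E0])
qed

lemma bounded_lc_step:
  assumes E: "0 \<le> E" "(2 + 4 * real (card T)) * E \<le> B" and b: "bounded_lc (Suc k) E B"
  shows "bounded_lc (Suc (Suc k)) (E / 2) (B / 2)" "F \<in> T \<Longrightarrow> q \<in> corners \<Longrightarrow> norm (dl k F q) \<le> 3 * B"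
proof -
  let ?k = "Suc k"
  have m: "\<forall>pt\<in>extraordinary (TT ?k). valence (TT ?k) pt \<le> card T"
    using valence_seq by (simp add: mesh_seq_extraordinary)
  note sb = refinement_step.step_bound[OF step isolated_seq m E b]
  show "bounded_lc (Suc ?k) (E / 2) (B / 2)"
  proof (intro allI impI)
    fix K e assume K: "K \<in> TT (Suc ?k)" "e \<in> frames" "K (e (0,0)) \<in> extraordinary (TT (Suc ?k))"
    then have "K \<in> refine (TT ?k)" by (simp add: mesh_seq_Suc)
    then obtain G q where G: "G \<in> TT ?k" "q \<in> corners" "K = G \<circ> quad q" by (rule refineE)
    have x: "K (e (0,0)) \<in> extraordinary (TT ?k)" using K(3) by (simp add: mesh_seq_extraordinary)
    have eq: "e (0,0) = q"
      using qmesh.refined_face_extraordinary[OF mesh_seq_mesh G(1,2), of "e (0,0)"] x G(3) K(2) by simp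
    have Ge: "G (e (0,0)) = K (e (0,0))" using G(3) eq by simp
    show "norm (geometry.lc (TT (Suc ?k)) (Xs (Suc ?k)) n (Tr (Suc ?k)) K e (Suc 0) 0 - vc (TT (Suc ?k)) (Xs (Suc ?k)) (K (e (0,0)))) \<le> E / 2 \<and>
      norm (geometry.lc (TT (Suc ?k)) (Xs (Suc ?k)) n (Tr (Suc ?k)) K e (Suc 0) (Suc 0) - vc (TT (Suc ?k)) (Xs (Suc ?k)) (K (e (0,0)))) \<le> B / 2"
      using sb(2,3)[OF G(1) K(2) Ge x] unfolding G(3)[folded eq, symmetric] Xs_Suc[of ?k, symmetric] mesh_seq_Suc[symmetric]
      by blast
  qed
  assume F: "F \<in> T" and q: "q \<in> corners"
  show "norm (dl k F q) \<le> 3 * B"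
  proof (cases "F q \<in> extraordinary T")
    case False
    have "0 \<le> (2 + 4 * real (card T)) * E" using E(1) by simp
    then have "0 \<le> B" using E(2) by linarith
    then show ?thesis using False by (simp add: dl_def)
  next
    case True
    obtain d where d: "d \<in> frames" "d (0,0) = q" using q by (rule corner_frame)
    have "F q \<in> extraordinary (TT ?k)" using True by (simp add: mesh_seq_extraordinary)
    then show ?thesis
      using sb(1)[OF zoom_face[OF F q] d(1), of "F q"] True by (simp add: dl_def d(2) zoom_self)
  qed
qed

text \<open>The iteration of \<open>step_bound\<close> starts at level 1, where all extraordinary
  vertices are known to be isolated.\<close>

lemma dl_bound: "\<exists>C. \<forall>k. \<forall>F\<in>T. \<forall>q\<in>corners. norm (dl k F q) \<le> C / 2^k"
proof -
  obtain E B where E: "0 \<le> E" "(2 + 4 * real (card T)) * E \<le> B" "bounded_lc (Suc 0) E B"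
    using bounded_lc_exists[of "Suc 0"] .
  have h: "0 \<le> E / 2^k" "(2 + 4 * real (card T)) * (E / 2^k) \<le> B / 2^k" for k
    using E(1) divide_right_mono[OF E(2), of "2^k"] by simp_all
  have b: "bounded_lc (Suc k) (E / 2^k) (B / 2^k)" for k
  proof (induction k)
    case 0 show ?case using E(3) by simp
  next
    case (Suc k)
    have "E / 2^k / 2 = E / 2^Suc k" "B / 2^k / 2 = B / 2^Suc k" by simp_all
    then show ?case using bounded_lc_step(1)[OF h Suc] by metis
  qed
  have "norm (dl k F q) \<le> (3 * B) / 2^k" if "F \<in> T" "q \<in> corners" for k F q
    using bounded_lc_step(2)[OF h b that] by simp
  then show ?thesis by blast
qed

definition limit :: "'p \<Rightarrow> real^3" where
  "limit p = lim (\<lambda>k. val k p)"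

lemma limit_bound:
  "\<exists>C. \<forall>F\<in>T. \<forall>s\<in>sq. (\<lambda>k. val k (F s)) \<longlonglongrightarrow> limit (F s) \<and>
     (\<forall>k. norm (val k (F s) - limit (F s)) \<le> C / 2^k)"
proof -
  obtain C where C: "\<And>k F q. F \<in> T \<Longrightarrow> q \<in> corners \<Longrightarrow> norm (dl k F q) \<le> C / 2^k" using dl_bound by blast
  \<comment> \<open>Four corners, each with a bump of absolute value at most 1.\<close>
  have st: "norm (val (Suc k) (F s) - val k (F s)) \<le> 4 * C / 2^k" if F: "F \<in> T" and s: "s \<in> sq" for F s k
  proof -
    have "norm (\<Sum>q\<in>corners. corner_bump (Suc k) q s *\<^sub>R dl k F q) \<le> (\<Sum>q\<in>corners. C / 2^k)"
    proof (rule sum_norm_le)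
      fix q assume q: "q \<in> corners"
      have "\<bar>corner_bump (Suc k) q s\<bar> * norm (dl k F q) \<le> 1 * (C / 2^k)"
        using corner_bump_bound[OF q s] C[OF F q] by (intro mult_mono) auto
      then show "norm (corner_bump (Suc k) q s *\<^sub>R dl k F q) \<le> C / 2^k" by simp
    qed
    also have "\<dots> = 4 * C / 2^k" by (simp add: corners_def)
    finally show ?thesis using val_step[OF F s, of k] by simp
  qed
  show ?thesis
  proof (intro exI[of _ "2 * (4 * C)"] ballI conjI allI)
    fix F s assume "F \<in> T" "s \<in> sq"
    note gl = geometric_limit[of "\<lambda>k. val k (F s)", OF st[OF this], folded limit_def]
    show "(\<lambda>k. val k (F s)) \<longlonglongrightarrow> limit (F s)" by (rule gl(1))
    show "norm (val k (F s) - limit (F s)) \<le> 2 * (4 * C) / 2^k" for k by (rule gl(2))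
  qed
qed

lemma limit_LIMSEQ: "F \<in> T \<Longrightarrow> s \<in> sq \<Longrightarrow> (\<lambda>k. val k (F s)) \<longlonglongrightarrow> limit (F s)"
  using limit_bound by blast

theorem converges: "converges_to T X limit"
  unfolding converges_to_def
proof (intro allI impI)
  fix \<epsilon> :: real assume e: "0 < \<epsilon>"
  obtain C where C: "\<And>F s k. F \<in> T \<Longrightarrow> s \<in> sq \<Longrightarrow> norm (val k (F s) - limit (F s)) \<le> C / 2^k"
    using limit_bound by blast
  have "(\<lambda>k. C * (1/2)^k) \<longlonglongrightarrow> C * 0" by (intro tendsto_mult tendsto_const LIMSEQ_power_zero) simp
  then have "(\<lambda>k. C / 2^k) \<longlonglongrightarrow> 0" by (simp add: power_divide)
  from LIMSEQ_D[OF this e] obtain K where K: "\<And>k. k \<ge> K \<Longrightarrow> norm (C / 2^k) < \<epsilon>" by auto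
  show "\<exists>K. \<forall>k\<ge>K. \<forall>G\<in>TT k. \<forall>t\<in>sq. dist (X k G t) (limit (G t)) < \<epsilon>"
  proof (intro exI allI impI ballI)
    \<comment> \<open>The index shift: \<open>val l\<close> is the geometry of level
      \<open>Suc l\<close>, so levels from \<open>Suc K\<close> on are considered.\<close>
    fix k G t assume k: "Suc K \<le> k" and G: "G \<in> TT k" and t: "t \<in> sq"
    then obtain l where l: "k = Suc l" "K \<le> l" by (cases k) auto
    obtain F a b where F: "F \<in> T" "a < 2^k" "b < 2^k" "G = F \<circ> dyad k a b" using mesh_seq_face[OF G] by blast
    have "dyad k a b t \<in> sq" using F t by (intro dyad_square)
    from C[OF F(1) this, of l] have "norm (val l (G t) - limit (G t)) \<le> C / 2^l" using F(4) by simp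
    moreover have "C / 2^l < \<epsilon>" using K[OF l(2)] abs_ge_self[of "C / 2^l"] unfolding real_norm_def by linarith
    ultimately show "dist (X k G t) (limit (G t)) < \<epsilon>"
      using val_X[of G l t] G t l by (simp add: dist_norm)
  qed
qed

end

section \<open>Tangent planes of the limit surface\<close>

text \<open>Smoothness across an edge with ordinary ends, with the transverse directions pointing
  away from each other. In the sum of the two patches the coefficients next to the edge add up to
  twice those on the edge, so there is no term linear in the distance from the edge.\<close>

lemma (in qmesh) star_edge:
  fixes z :: "'p dof \<Rightarrow> real^3"
  assumes F: "F \<in> T" "d \<in> frames" and G: "G \<in> T" "e \<in> frames" and g: "glued F d G e" and ne: "F \<noteq> G"
    and ord: "F (d (0,0)) \<notin> extraordinary T" "F (d (1,0)) \<notin> extraordinary T" and r: "0 \<le> r" "r \<le> 1"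
    and D: "hder (star T z F \<circ> d) (r,0) D" "hder (star T z G \<circ> e) (r,0) D'"
  shows "D' (1,0) = D (1,0)" "D' (0,1) = - D (0,1)"
proof -
  define c where "c = bc T z (F \<circ> d) (z (Face F))"
  define c' where "c' = bc T z (G \<circ> e) (z (Face G))"
  have fl: "bc T z (H \<circ> h) y 2 k = bc T z (H \<circ> (h \<circ> flip)) y 0 k" if "k \<le> 1" for H h y k
    using bc_frame[of flip 0 k T z "H \<circ> h" y] that by (simp add: act_def idx_fr comp_assoc)
  have gf: "glued F (d \<circ> flip) G (e \<circ> flip)" using g by (rule glued_flip)
  have o: "F (d (0,0)) = G (e (0,0))" "F (d (1,0)) = G (e (1,0))"
    using g by (auto simp: glued_def)
  have c0: "c 0 0 = c' 0 0" "c (Suc 0) 0 = c' (Suc 0) 0" "c 2 0 = c' 2 0"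
    using o glued_side[OF g] by (simp_all add: c_def c'_def fl bc_local)
  have "ec T z (side F (d \<circ> flip \<circ> swp)) + ec T z (side G (e \<circ> flip \<circ> swp)) = 2 *\<^sub>R vc T z (F (d (1,0)))"
    using opposite_coeff[OF F(1) G(1) _ _ gf ne] F G ord by simp
  then have c1: "c 0 (Suc 0) + c' 0 (Suc 0) = 2 *\<^sub>R c 0 0" "c (Suc 0) (Suc 0) + c' (Suc 0) (Suc 0) = 2 *\<^sub>R c (Suc 0) 0"
    "c 2 (Suc 0) + c' 2 (Suc 0) = 2 *\<^sub>R c 2 0"
    using opposite_coeff[OF F(1) G(1) F(2) G(2) g ne ord(1), of z] ec_glued[OF F(1) G(1) F(2) G(2) g ne, of z]
    by (simp_all add: c_def c'_def fl bc_local)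
  have s: "star T z F \<circ> d = bern c" "star T z G \<circ> e = bern c'"
    by (rule ext, simp add: c_def c'_def star_frame[OF F] star_frame[OF G])+
  have sq: "(r,0) \<in> sq" using r by (simp add: sq_iff)
  have p: "has_partials (bern c) (r,0) (D (1,0)) (D (0,1))" "has_partials (bern c') (r,0) (D' (1,0)) (D' (0,1))"
    using hder_partials[OF D(1) sq] hder_partials[OF D(2) sq] by (simp_all add: s)
  have "(\<lambda>t. bern c' (t,0)) = (\<lambda>t. bern c (t,0))"
    using c0 by (simp add: bern_nested sum_atMost_2 Bernstein_2)
  then have "((\<lambda>t. bern c (t,0)) has_vector_derivative D' (1,0)) (at r within {0..1})" using p(2) by (simp add: has_partials_def)
  moreover have "((\<lambda>t. bern c (t,0)) has_vector_derivative D (1,0)) (at r within {0..1})" using p(1) by (simp add: has_partials_def)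
  ultimately show "D' (1,0) = D (1,0)" using r by (intro vector_derivative_unique_within_closed_interval[of 0 1]) auto
  define C where "C k = (\<Sum>j\<le>2. Bernstein 2 j r *\<^sub>R (c j k + c' j k))" for k
  \<comment> \<open>Rows 0 and 1 of the summed coefficients agree, which makes the polynomial in t a
    constant plus a multiple of t^2.\<close>
  have 0: "C 1 = C 0" using c1 c0 by (simp add: C_def sum_atMost_2 scaleR_2)
  have "bern c (r,t) + bern c' (r,t) = C 0 + t^2 *\<^sub>R (C 2 - C 0)" for t
  proof -
    have "bern c (r,t) + bern c' (r,t) = (\<Sum>k\<le>2. Bernstein 2 k t *\<^sub>R C k)"
      by (simp add: bern_def C_def sum_atMost_2 scaleR_add_right algebra_simps)
    also have "\<dots> = (1 - t^2) *\<^sub>R C 0 + t^2 *\<^sub>R C 2"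
      using 0 by (simp add: sum_atMost_2 Bernstein_2 flip: scaleR_add_left) (simp add: power2_eq_square algebra_simps)
    finally show ?thesis by (simp add: algebra_simps)
  qed
  then have eq: "(\<lambda>t. bern c (r,t) + bern c' (r,t)) = (\<lambda>t. C 0 + t^2 *\<^sub>R (C 2 - C 0))" by (rule ext)
  have "((\<lambda>t. C 0 + t^2 *\<^sub>R (C 2 - C 0)) has_vector_derivative 0) (at 0 within {0..1})"
    by (auto intro!: derivative_eq_intros)
  moreover have "((\<lambda>t. C 0 + t^2 *\<^sub>R (C 2 - C 0)) has_vector_derivative D (0,1) + D' (0,1)) (at 0 within {0..1})"
    unfolding eq[symmetric] using p by (intro has_vector_derivative_add) (simp_all add: has_partials_def)
  ultimately have "D (0,1) + D' (0,1) = 0" by (intro vector_derivative_unique_within_closed_interval[of 0 1]) auto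
  then show "D' (0,1) = - D (0,1)" by (simp add: eq_neg_iff_add_eq_0 add.commute)
qed

lemma hder_transform:
  "hder f s D \<Longrightarrow> s \<in> sq \<Longrightarrow> (\<And>t. t \<in> sq \<Longrightarrow> g t = f t) \<Longrightarrow> hder g s D"
  by (rule has_derivative_transform)

lemma normal_cross:
  assumes "normal_vector T x p \<nu>" and F: "F \<in> T" "s \<in> sq" "F s = p" and D: "hder (x F) s D"
  shows "sgn (cross3 (D (1,0)) (D (0,1))) = \<nu> \<or> sgn (cross3 (D (1,0)) (D (0,1))) = - \<nu>"
proof -
  have "\<forall>F\<in>T. \<forall>s\<in>sq. F s = p \<longrightarrow> (\<exists>a b. has_partials (x F) s a b \<and> cross3 a b \<noteq> 0 \<and>
     (sgn (cross3 a b) = \<nu> \<or> sgn (cross3 a b) = - \<nu>))"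
    using assms(1) unfolding normal_vector_def by (rule conjunct2)
  from this[rule_format, OF F] obtain a b where "has_partials (x F) s a b" "sgn (cross3 a b) = \<nu> \<or> sgn (cross3 a b) = - \<nu>"
    by blast
  then show ?thesis by (simp add: hder_partials[OF D F(2)])
qed

text \<open>Covers the ways in which the point can be shared: one and the same face, a common
  vertex, where the normal vector exists by \<open>normal_exists\<close>, or a point of a common
  edge, treated by \<open>star_edge\<close>.\<close>

lemma (in geometry) cross_parallel:
  assumes st: "\<And>F s. F \<in> T \<Longrightarrow> s \<in> sq \<Longrightarrow> x F s = star T xs F s"
    and G: "G \<in> T" "t \<in> sq" "hder (x G) t D" and G': "G' \<in> T" "t' \<in> sq" "hder (x G') t' D'"
    and eq: "G t = p" "G' t' = p" and ord: "\<And>q. q \<in> corners \<Longrightarrow> G q \<notin> extraordinary T" and reg: "regular_at T x p"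
  shows "sgn (cross3 (D' (1,0)) (D' (0,1))) = sgn (cross3 (D (1,0)) (D (0,1))) \<or>
    sgn (cross3 (D' (1,0)) (D' (0,1))) = - sgn (cross3 (D (1,0)) (D (0,1)))"
proof (cases "G = G'")
  case True
  then have "t' = t" using face_eq[OF G(1,2) G'(2)] eq by simp
  then have "D' (1,0) = D (1,0) \<and> D' (0,1) = D (0,1)"
    using hder_partials[OF G(3,2)] hder_partials[OF G'(3,2)] True by blast
  then show ?thesis by simp
next
  case ne: False
  show ?thesis
  proof (cases "t \<in> corners \<and> t' \<in> corners")
    case True
    then have "p \<in> vertices T" unfolding eq(1)[symmetric] vertices_def using G(1) by blast
    then obtain \<nu> where \<nu>: "normal_vector T x p \<nu>" using normal_exists reg by blast
    show ?thesis using normal_cross[OF \<nu> G(1,2) eq(1) G(3)] normal_cross[OF \<nu> G'(1,2) eq(2) G'(3)] by auto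
  next
    case False
    have "G t = G' t'" using eq by simp
    obtain d e r where d: "d \<in> frames" "e \<in> frames" "glued G d G' e" "0 \<le> r" "r \<le> 1" "t = d (r,0)" "t' = e (r,0)"
      using meet[OF G(1) G'(1) G(2) G'(2) \<open>G t = G' t'\<close> ne False] .
    have sq: "(r,0) \<in> sq" using d by (simp add: sq_iff)
    have "hder (star T xs G \<circ> d) (r,0) (D \<circ> lin d)"
      by (rule hder_transform[OF hder_frame[OF G(3)[unfolded d(6)] d(1)] sq]) (use st[OF G(1)] d(1) in simp)
    moreover have "hder (star T xs G' \<circ> e) (r,0) (D' \<circ> lin e)"
      by (rule hder_transform[OF hder_frame[OF G'(3)[unfolded d(7)] d(2)] sq]) (use st[OF G'(1)] d(2) in simp)
    moreover have "G (d (0,0)) \<notin> extraordinary T" "G (d (1,0)) \<notin> extraordinary T"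
      using ord d(1) by (simp_all add: corners_def[symmetric] corners_iff)
    ultimately have "D' (lin e (1,0)) = D (lin d (1,0))" "D' (lin e (0,1)) = - D (lin d (0,1))"
      using star_edge[OF G(1) d(1) G'(1) d(2,3) ne _ _ d(4,5), of xs "D \<circ> lin d" "D' \<circ> lin e"] by simp_all
    then have "cross3 (D' (lin e (1,0))) (D' (lin e (0,1))) = - cross3 (D (lin d (1,0))) (D (lin d (0,1)))"
      by (simp add: cross_minus_right)
    then have "cross3 (D' (1,0)) (D' (0,1)) = cross3 (D (1,0)) (D (0,1)) \<or> cross3 (D' (1,0)) (D' (0,1)) = - cross3 (D (1,0)) (D (0,1))"
      using frame_cross[OF has_derivative_linear[OF G(3)] d(1)] frame_cross[OF has_derivative_linear[OF G'(3)] d(2)]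
      by (metis minus_minus)
    then show ?thesis by (auto simp: sgn_minus)
  qed
qed

lemma linear_span_pair:
  fixes D :: "real \<times> real \<Rightarrow> 'a::real_vector"
  assumes "linear D" shows "D h \<in> span {D (1,0), D (0,1)}"
proof -
  have "h = fst h *\<^sub>R (1,0) + snd h *\<^sub>R (0,1)" by (simp add: prod_eq_iff)
  then have "D h = fst h *\<^sub>R D (1,0) + snd h *\<^sub>R D (0,1)"
    by (metis linear_add[OF assms] linear_scale[OF assms])
  then show ?thesis by (simp add: span_add span_scale span_base)
qed

text \<open>The span condition alone fixes the plane, since one-sided partial derivatives are
  unique.\<close>

lemma tangent_plane_unique:
  assumes "p \<in> \<Union> (carrier_of ` T)" "tangent_plane T x p W" "tangent_plane T x p W'" shows "W' = W"
proof -
  obtain F s where F: "F \<in> T" "s \<in> sq" "F s = p" using assms(1) by (auto simp: carrier_of_def)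
  obtain a b where 1: "has_partials (x F) s a b" "span {a,b} = W"
    using assms(2) F unfolding tangent_plane_def by blast
  obtain a' b' where 2: "has_partials (x F) s a' b'" "span {a',b'} = W'"
    using assms(3) F unfolding tangent_plane_def by blast
  show ?thesis using has_partials_unique[OF 1(1) 2(1) F(2)] 1(2) 2(2) by simp
qed

lemma null_parallel:
  fixes a b :: "'a::real_inner"
  assumes "sgn a = sgn b \<or> sgn a = - sgn b" "a \<noteq> 0" "b \<noteq> 0" shows "v \<bullet> a = 0 \<longleftrightarrow> v \<bullet> b = 0"
proof -
  have "v \<bullet> c = 0 \<longleftrightarrow> v \<bullet> sgn c = 0" if "c \<noteq> 0" for c using that by (simp add: sgn_div_norm)
  then show ?thesis using assms by auto
qed

text \<open>Outside the closed square of side 2^-(k+1) at \<open>q\<close>, which carries the bump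
  of step k and of all later steps. The strict inequality makes the condition open, so that it
  persists near the point.\<close>

definition away :: "nat \<Rightarrow> real \<times> real \<Rightarrow> real \<times> real \<Rightarrow> bool" where
  "away k q s \<longleftrightarrow> 1 < 2^Suc k * (fst q + (1 - 2 * fst q) * fst s) \<or> 1 < 2^Suc k * (snd q + (1 - 2 * snd q) * snd s)"

lemma away_bump:
  assumes "away k q s" "k \<le> i" "q \<in> corners" "s \<in> sq" shows "corner_bump (Suc i) q s = 0"
proof -
  have p: "(2::real)^Suc k \<le> 2^Suc i" using assms(2) by (intro power_increasing) auto
  have "2^Suc k * c \<le> 2^Suc i * c" if "0 \<le> c" for c :: real using p that by (rule mult_right_mono)
  moreover have "0 \<le> fst q + (1 - 2 * fst q) * fst s" "0 \<le> snd q + (1 - 2 * snd q) * snd s"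
    using assms by (auto simp: corners_def unit_square_def)
  ultimately show ?thesis using assms(1) unfolding away_def by (intro corner_bump_far) (meson less_le_trans less_imp_le)
qed

lemma away_near:
  assumes "\<And>q. q \<in> Q \<Longrightarrow> away k q s" "finite Q"
  shows "\<forall>\<^sub>F t in at s within sq. t \<in> sq \<and> (\<forall>q\<in>Q. away k q t)"
proof -
  have "open {t. away k q t}" for q
    unfolding away_def by (intro open_Collect_disj open_Collect_less continuous_intros)
  then have "eventually (away k q) (at s within sq)" if "q \<in> Q" for q
    using assms(1)[OF that] by (intro eventually_at_topological[THEN iffD2] exI[of _ "{t. away k q t}"]) auto
  then have "\<forall>\<^sub>F t in at s within sq. \<forall>q\<in>Q. away k q t"
    using assms(2) by (simp add: eventually_ball_finite_distrib)
  moreover have "\<forall>\<^sub>F t in at s within sq. t \<in> sq"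
    by (simp add: eventually_at_filter)
  ultimately show ?thesis by eventually_elim simp
qed

lemma away_eventually:
  assumes "q \<in> corners" "s \<in> sq" "s \<noteq> q" shows "\<forall>\<^sub>F k in sequentially. away k q s"
proof -
  have pow: "\<forall>\<^sub>F k in sequentially. 1 < 2^Suc k * c" if "0 < c" for c :: real
  proof -
    obtain K where K: "1 / c < 2^K" using real_arch_pow[of 2 "1/c"] by auto
    show ?thesis
    proof (rule eventually_sequentiallyI[of K])
      fix k assume "K \<le> k"
      then have "(2::real)^K \<le> 2^Suc k" by (intro power_increasing) auto
      then have "1 / c < 2^Suc k" using K by linarith
      then show "1 < 2^Suc k * c" using that by (simp add: divide_less_eq)
    qed
  qed
  have "0 < fst q + (1 - 2 * fst q) * fst s \<or> 0 < snd q + (1 - 2 * snd q) * snd s"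
    using assms by (cases s) (auto simp: corners_def unit_square_def less_le)
  then show ?thesis
  proof
    assume "0 < fst q + (1 - 2 * fst q) * fst s"
    from pow[OF this] show ?thesis by eventually_elim (simp add: away_def)
  next
    assume "0 < snd q + (1 - 2 * snd q) * snd s"
    from pow[OF this] show ?thesis by eventually_elim (simp add: away_def)
  qed
qed

lemma dyad_away:
  assumes "dyad (Suc k) a b q = q" "q \<in> corners" "t \<in> sq" shows "\<not> away k q (dyad (Suc k) a b t)"
proof -
  have "real a = 2^Suc k * fst q - fst q" "real b = 2^Suc k * snd q - snd q"
    using arg_cong[OF assms(1), of fst] arg_cong[OF assms(1), of snd] by (simp_all add: dyad_def field_simps)
  moreover have "r * (1 + (1 - r - c) / r) = 1 - c" if "r \<noteq> 0" for r c :: real using that by (simp add: field_simps)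
  from this[of "2^Suc k"] have "2^Suc k * (1 + (1 - 2^Suc k - c) / 2^Suc k) = 1 - c" for c :: real by simp
  ultimately show ?thesis using assms(2,3)
    by (cases t) (auto simp: away_def dyad_def corners_def sq_iff simp del: power_Suc)
qed

section \<open>The limit near a given point\<close>

context process
begin

lemma val_sum:
  assumes "F \<in> T" "s \<in> sq"
  shows "val k (F s) = bsp (jt 0 F) s + (\<Sum>i<k. \<Sum>q\<in>corners. corner_bump (Suc i) q s *\<^sub>R dl i F q)"
  by (induction k) (use val_joint[of F 0 s] val_step[OF assms] assms in simp_all)

lemma val_hder:
  assumes "F \<in> T" "s \<in> sq" shows "\<exists>D. hder (\<lambda>s. val k (F s)) s D"
proof -
  obtain D0 where D0: "hder (bsp (jt 0 F)) s D0" by (rule bsp_hder)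
  have "\<forall>i q. \<exists>D. hder (\<lambda>s. corner_bump (Suc i) q s *\<^sub>R dl i F q) s D" using corner_bump_hder by blast
  then obtain D where "\<And>i q. hder (\<lambda>s. corner_bump (Suc i) q s *\<^sub>R dl i F q) s (D i q)" by metis
  then have "hder (\<lambda>s. bsp (jt 0 F) s + (\<Sum>i<k. \<Sum>q\<in>corners. corner_bump (Suc i) q s *\<^sub>R dl i F q)) s
     (\<lambda>h. D0 h + (\<Sum>i<k. \<Sum>q\<in>corners. D i q h))"
    by (intro has_derivative_add D0 has_derivative_sum)
  then have "hder (\<lambda>s. val k (F s)) s (\<lambda>h. D0 h + (\<Sum>i<k. \<Sum>q\<in>corners. D i q h))"
    by (rule hder_transform[OF _ assms(2)]) (rule val_sum[OF assms(1)])
  then show ?thesis by blast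
qed

lemma limit_val:
  assumes F: "F \<in> T" and s: "s \<in> sq"
    and z: "\<And>i q. k \<le> i \<Longrightarrow> q \<in> corners \<Longrightarrow> corner_bump (Suc i) q s *\<^sub>R dl i F q = 0"
  shows "limit (F s) = val k (F s)"
proof (rule LIMSEQ_unique[OF limit_LIMSEQ[OF F s]])
  have "val i (F s) = val k (F s)" if "k \<le> i" for i
    using that by (induction i rule: dec_induct) (simp_all add: val_step[OF F s] z)
  then show "(\<lambda>i. val i (F s)) \<longlonglongrightarrow> val k (F s)"
    by (intro tendsto_eventually eventually_sequentiallyI[of k])
qed

text \<open>Bumps with coefficients orthogonal to \<nu> do not change heights in direction \<nu>.
  With the normal of an extraordinary vertex this replaces the heights of the limit near it by those
  of the differentiable first refinement.\<close>

lemma limit_inner: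
  assumes F: "F \<in> T" and s: "s \<in> sq"
    and z: "\<And>i q. q \<in> corners \<Longrightarrow> corner_bump (Suc i) q s = 0 \<or> dl i F q \<bullet> \<nu> = 0"
  shows "limit (F s) \<bullet> \<nu> = bsp (jt 0 F) s \<bullet> \<nu>"
proof (rule LIMSEQ_unique[OF tendsto_inner[OF limit_LIMSEQ[OF F s] tendsto_const]])
  have "corner_bump (Suc i) q s * (dl i F q \<bullet> \<nu>) = 0" if "q \<in> corners" for i q using z[OF that] by auto
  then have "val i (F s) \<bullet> \<nu> = bsp (jt 0 F) s \<bullet> \<nu>" for i
    by (simp add: val_sum[OF F s] inner_add_left inner_sum_left sum.neutral)
  then show "(\<lambda>i. val i (F s) \<bullet> \<nu>) \<longlonglongrightarrow> bsp (jt 0 F) s \<bullet> \<nu>" by simp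
qed

lemma limit_side:
  assumes "F \<in> T" "s \<in> sq" "fst s \<in> {0,1} \<or> snd s \<in> {0,1}"
  shows "limit (F s) = bsp (jt 0 F) s"
  using limit_val[OF assms(1,2), of 0] corner_bump_side[OF _ assms(2,3)] val_joint[of F 0 s] assms by simp

lemma limit_away:
  assumes F: "F \<in> T" and s: "s \<in> sq" and a: "\<And>q. q \<in> corners \<Longrightarrow> F q \<in> extraordinary T \<Longrightarrow> away k q s"
  shows "limit (F s) = val k (F s)"
proof (rule limit_val[OF F s])
  fix i q assume "k \<le> i" "q \<in> corners"
  then show "corner_bump (Suc i) q s *\<^sub>R dl i F q = 0"
    using away_bump[OF a _ _ s] by (cases "F q \<in> extraordinary T") (auto simp: dl_def)
qed

context
  fixes p
  assumes p: "p \<in> \<Union> (carrier_of ` T)" and reg: "regular_at T (\<lambda>F s. limit (F s)) p"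
begin

text \<open>A single level has to serve all faces through \<open>p\<close> and all their
  extraordinary corners. There are finitely many of them, and each differs from the position of
  \<open>p\<close>.\<close>

lemma ordinary_level:
  assumes "p \<notin> extraordinary T"
  obtains k where "\<forall>F\<in>T. \<forall>q\<in>corners. \<forall>s\<in>sq. F s = p \<longrightarrow> F q \<in> extraordinary T \<longrightarrow> away k q s"
proof -
  have "\<forall>\<^sub>F k in sequentially. \<forall>s\<in>sq. F s = p \<longrightarrow> F q \<in> extraordinary T \<longrightarrow> away k q s"
    if F: "F \<in> T" and q: "q \<in> corners" for F q
  proof (cases "\<exists>s\<in>sq. F s = p \<and> F q \<in> extraordinary T")
    case True
    then obtain s where s: "s \<in> sq" "F s = p" "F q \<in> extraordinary T" by blast
    then have "s \<noteq> q" using assms by auto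
    from away_eventually[OF q s(1) this] show ?thesis
    proof eventually_elim
      case (elim k)
      show ?case
      proof (intro ballI impI)
        fix s' assume "s' \<in> sq" "F s' = p"
        then have "s' = s" using face_eq[OF F, of s' s] s by simp
        then show "away k q s'" using elim by simp
      qed
    qed
  qed (auto intro: always_eventually)
  note single = this
  have fin: "finite corners" by (simp add: corners_def)
  have "\<forall>\<^sub>F k in sequentially. \<forall>F\<in>T. \<forall>q\<in>corners. \<forall>s\<in>sq. F s = p \<longrightarrow> F q \<in> extraordinary T \<longrightarrow> away k q s"
    by (rule eventually_ball_finite[OF finite_faces], rule ballI, rule eventually_ball_finite[OF fin], rule ballI, rule single)
  then show thesis using that eventually_happens'[OF sequentially_bot] by blast
qed

text \<open>Near \<open>p\<close> the limit is the geometry of level \<open>Suc k\<close>. Its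
  tangent planes are compared on the fine faces of that level through \<open>p\<close>, whose
  corners are ordinary by the choice of k, so that \<open>cross_parallel\<close> applies; coarse and
  fine derivatives differ by the factor 2^-(k+1).\<close>

lemma ordinary_tangent_plane:
  assumes ord: "p \<notin> extraordinary T"
  shows "\<exists>W. tangent_plane T (\<lambda>F s. limit (F s)) p W"
proof -
  obtain k where k: "\<forall>F\<in>T. \<forall>q\<in>corners. \<forall>s\<in>sq. F s = p \<longrightarrow> F q \<in> extraordinary T \<longrightarrow> away k q s"
    using ordinary_level[OF ord] .
  have deriv: "\<exists>D. hder (\<lambda>s. limit (F s)) s D \<and> hder (\<lambda>s. val k (F s)) s D \<and> cross3 (D (1,0)) (D (0,1)) \<noteq> 0"
    if F: "F \<in> T" "s \<in> sq" "F s = p" for F s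
  proof -
    obtain D where D: "hder (\<lambda>s. val k (F s)) s D" using val_hder[OF F(1,2)] by blast
    have a: "away k q s" if "q \<in> {q \<in> corners. F q \<in> extraordinary T}" for q using k F that by blast
    have "\<forall>\<^sub>F t in at s within sq. val k (F t) = limit (F t)"
    proof (rule eventually_mono[OF away_near[OF a]])
      show "finite {q \<in> corners. F q \<in> extraordinary T}" by (simp add: corners_def)
      show "val k (F t) = limit (F t)" if "t \<in> sq \<and> (\<forall>q\<in>{q \<in> corners. F q \<in> extraordinary T}. away k q t)" for t
        by (rule limit_away[symmetric, OF F(1)]) (use that in auto)
    qed
    moreover have "val k (F s) = limit (F s)" by (rule limit_away[symmetric, OF F(1,2)]) (use a in auto)
    ultimately have D': "hder (\<lambda>s. limit (F s)) s D" using F(2) by (rule has_derivative_transform_eventually[OF D])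
    have "regular (\<lambda>s. limit (F s)) s" using reg F unfolding regular_at_def by blast
    moreover have "has_partials (\<lambda>s. limit (F s)) s (D (1,0)) (D (0,1))" by (simp add: hder_partials[OF D' F(2)])
    ultimately have "cross3 (D (1,0)) (D (0,1)) \<noteq> 0" unfolding regular_def by simp
    then show ?thesis using D D' by (intro exI[of _ D]) simp
  qed
  have cell: "\<exists>D. hder (X (Suc k) (F \<circ> dyad (Suc k) a b)) t (\<lambda>h. D ((1/2^Suc k) *\<^sub>R h)) \<and> hder (\<lambda>s. limit (F s)) (dyad (Suc k) a b t) D \<and>
      cross3 (D (1,0)) (D (0,1)) \<noteq> 0"
    if F: "F \<in> T" "a < 2^Suc k" "b < 2^Suc k" "t \<in> sq" "F (dyad (Suc k) a b t) = p"
      and G: "F \<circ> dyad (Suc k) a b \<in> TT (Suc k)" for F a b t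
  proof -
    let ?f = "dyad (Suc k) a b"
    have s: "?f t \<in> sq" using F by (intro dyad_square)
    obtain D where D: "hder (\<lambda>s. limit (F s)) (?f t) D" "hder (\<lambda>s. val k (F s)) (?f t) D" "cross3 (D (1,0)) (D (0,1)) \<noteq> 0"
      using deriv[OF F(1) s F(5)] by blast
    have "?f = (\<lambda>t. ?f (0,0) + (1/2^Suc k) *\<^sub>R t)" by (rule ext) (simp add: dyad_def prod_eq_iff add_divide_distrib)
    moreover have "((\<lambda>t. ?f (0,0) + (1/2^Suc k) *\<^sub>R t) has_derivative (\<lambda>h. 0 + (1/2^Suc k) *\<^sub>R h)) (at t within sq)"
      by (intro has_derivative_add has_derivative_const has_derivative_scaleR_right has_derivative_ident)
    ultimately have f: "(?f has_derivative (\<lambda>h. (1/2^Suc k) *\<^sub>R h)) (at t within sq)" by simp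
    have sub: "?f ` sq \<subseteq> sq" using F(2,3) dyad_square by (intro image_subsetI)
    have "hder ((\<lambda>s. val k (F s)) \<circ> ?f) t (D \<circ> (\<lambda>h. (1/2^Suc k) *\<^sub>R h))"
      by (rule diff_chain_within[OF f has_derivative_subset[OF D(2) sub]])
    then have "hder (X (Suc k) (F \<circ> ?f)) t (D \<circ> (\<lambda>h. (1/2^Suc k) *\<^sub>R h))"
      by (rule hder_transform[OF _ F(4)]) (use val_X[OF G] in simp)
    then show ?thesis using D by (intro exI[of _ D]) (simp add: comp_def)
  qed
  have scale: "cross3 (D ((1/2^Suc k) *\<^sub>R (1,0))) (D ((1/2^Suc k) *\<^sub>R (0,1))) = (1/2^Suc k * (1/2^Suc k)) *\<^sub>R cross3 (D (1,0)) (D (0,1))"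
    if "linear D" for D :: "real \<times> real \<Rightarrow> real^3"
    using linear_scale[OF that, of "1/2^Suc k" "(1,0)"] linear_scale[OF that, of "1/2^Suc k" "(0,1)"]
    by (simp add: cross_mult_left cross_mult_right)
  \<comment> \<open>Regularity is assumed of the limit in coarse coordinates; the comparison on the
    fine faces requires it of the geometry of that level.\<close>
  have reg': "regular_at (TT (Suc k)) (X (Suc k)) p"
    unfolding regular_at_def
  proof (intro ballI impI)
    fix G t assume G: "G \<in> TT (Suc k)" and t: "t \<in> sq" "G t = p"
    obtain F a b where F: "F \<in> T" "a < 2^Suc k" "b < 2^Suc k" "G = F \<circ> dyad (Suc k) a b" using mesh_seq_face[OF G] by blast
    obtain D where D: "hder (X (Suc k) G) t (\<lambda>h. D ((1/2^Suc k) *\<^sub>R h))" "hder (\<lambda>s. limit (F s)) (dyad (Suc k) a b t) D"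
      "cross3 (D (1,0)) (D (0,1)) \<noteq> 0"
      using cell[OF F(1-3) t(1)] t(2) F(4) G by auto
    show "regular (X (Suc k) G) t"
      unfolding regular_def hder_partials[OF D(1) t(1)] using scale[OF has_derivative_linear[OF D(2)]] D(3) by simp
  qed
  \<comment> \<open>A reference face through \<open>p\<close>; its cross product \<open>m\<close>
    fixes the plane for all other faces.\<close>
  obtain F0 s0 where F0: "F0 \<in> T" "s0 \<in> sq" "F0 s0 = p" using p by (auto simp: carrier_of_def)
  obtain D0 where D0: "hder (\<lambda>s. limit (F0 s)) s0 D0" "cross3 (D0 (1,0)) (D0 (0,1)) \<noteq> 0" using deriv[OF F0] by blast
  define m where "m = cross3 (D0 (1,0)) (D0 (0,1))"
  obtain a0 b0 t0 where c0: "a0 < 2^Suc k" "b0 < 2^Suc k" "t0 \<in> sq" "s0 = dyad (Suc k) a0 b0 t0"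
    "F0 \<circ> dyad (Suc k) a0 b0 \<in> TT (Suc k)" using mesh_seq_cover[OF F0(1,2), of "Suc k"] by blast
  have par: "\<exists>D. hder (\<lambda>s. limit (F s)) s D \<and> span {D (1,0), D (0,1)} = {v. v \<bullet> m = 0}" if F: "F \<in> T" "s \<in> sq" "F s = p" for F s
  proof -
    obtain a b t where c: "a < 2^Suc k" "b < 2^Suc k" "t \<in> sq" "s = dyad (Suc k) a b t"
      "F \<circ> dyad (Suc k) a b \<in> TT (Suc k)" using mesh_seq_cover[OF F(1,2), of "Suc k"] by blast
    obtain D where D: "hder (X (Suc k) (F \<circ> dyad (Suc k) a b)) t (\<lambda>h. D ((1/2^Suc k) *\<^sub>R h))" "hder (\<lambda>s. limit (F s)) s D"
      "cross3 (D (1,0)) (D (0,1)) \<noteq> 0"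
      using cell[OF F(1) c(1-3) _ c(5)] F(3) c(4) by auto
    obtain D1 where D1: "hder (X (Suc k) (F0 \<circ> dyad (Suc k) a0 b0)) t0 (\<lambda>h. D1 ((1/2^Suc k) *\<^sub>R h))" "hder (\<lambda>s. limit (F0 s)) s0 D1"
      using cell[OF F0(1) c0(1-3) _ c0(5)] F0(3) c0(4) by auto
    have "D1 (1,0) = D0 (1,0)" "D1 (0,1) = D0 (0,1)"
      using hder_partials[OF D0(1) F0(2)] hder_partials[OF D1(2) F0(2)] by blast+
    then have m1: "cross3 (D1 (1,0)) (D1 (0,1)) = m" by (simp add: m_def)
    have ord0: "(F0 \<circ> dyad (Suc k) a0 b0) q \<notin> extraordinary (TT (Suc k))" if q: "q \<in> corners" for q
    proof
      assume "(F0 \<circ> dyad (Suc k) a0 b0) q \<in> extraordinary (TT (Suc k))"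
      then have x: "F0 (dyad (Suc k) a0 b0 q) \<in> extraordinary T" by (simp add: mesh_seq_extraordinary)
      then have e: "dyad (Suc k) a0 b0 q = q" using dyad_extraordinary[OF F0(1) c0(1,2) q] by blast
      then have "away k q s0" using k F0 q x by simp
      then show False using dyad_away[OF e q c0(3)] c0(4) by simp
    qed
    have "(F0 \<circ> dyad (Suc k) a0 b0) t0 = p" "(F \<circ> dyad (Suc k) a b) t = p" using F(3) F0(3) c(4) c0(4) by simp_all
    from geometry.cross_parallel[OF geo X_star c0(5,3) D1(1) c(5,3) D(1) this ord0 reg']
    have "sgn (cross3 (D (1,0)) (D (0,1))) = sgn m \<or> sgn (cross3 (D (1,0)) (D (0,1))) = - sgn m"
      unfolding scale[OF has_derivative_linear[OF D(2)]] scale[OF has_derivative_linear[OF D1(2)]] m1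
      by (simp add: sgn_scaleR)
    then have "v \<bullet> cross3 (D (1,0)) (D (0,1)) = 0 \<longleftrightarrow> v \<bullet> m = 0" for v
      by (rule null_parallel[OF _ D(3)]) (use D0(2) in \<open>simp add: m_def\<close>)
    then show ?thesis using D(2) span_cross(1)[OF D(3)] by auto
  qed
  have "tangent_plane T (\<lambda>F s. limit (F s)) p {v. v \<bullet> m = 0}"
    unfolding tangent_plane_def
  proof (intro conjI ballI impI)
    show "subspace {v. v \<bullet> m = 0}" "dim {v. v \<bullet> m = 0} = 2" using span_cross(2,3)[OF D0(2)] by (simp_all add: m_def)
    fix F s assume F: "F \<in> T" "s \<in> sq" "F s = p"
    obtain D where D: "hder (\<lambda>s. limit (F s)) s D" "span {D (1,0), D (0,1)} = {v. v \<bullet> m = 0}" using par[OF F] by blast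
    then show "\<exists>a b. has_partials (\<lambda>s. limit (F s)) s a b \<and> span {a, b} = {v. v \<bullet> m = 0}"
      using hder_partials[OF D(1) F(2)] by blast
    show "((\<lambda>t. infdist (limit (F t) - limit (F s)) {v. v \<bullet> m = 0} / dist t s) \<longlongrightarrow> 0) (at s within sq)"
    proof (rule touching_plane[OF D(1)], rule always_eventually, rule allI)
      fix t
      have "D (t - s) \<in> {v. v \<bullet> m = 0}" using linear_span_pair[OF has_derivative_linear[OF D(1)]] D(2) by blast
      from infdist_le[OF this] show "infdist (limit (F t) - limit (F s)) {v. v \<bullet> m = 0} \<le> norm (limit (F t) - limit (F s) - D (t - s))"
        by (simp add: dist_norm)
    qed
  qed
  then show ?thesis by blast
qed

text \<open>The limit need not be differentiable here, so the plane is assembled from three facts: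
  the partial derivatives exist because bumps vanish on the sides, regularity identifies their span
  as the plane orthogonal to \<open>n p\<close>, and the heights over it are those of the first
  refinement.\<close>

lemma extraordinary_tangent_plane:
  assumes x: "p \<in> extraordinary T"
  shows "\<exists>W. tangent_plane T (\<lambda>F s. limit (F s)) p W"
proof -
  let ?W = "{v. v \<bullet> n p = 0}"
  have x0: "p \<in> extraordinary (TT 0)" using x by simp
  have n0: "n p \<noteq> 0" using geometry.input_vertex(1)[OF geo x0] .
  have main: "\<exists>D. hder (bsp (jt 0 F)) s D \<and> (\<forall>h. D h \<bullet> n p = 0) \<and> has_partials (\<lambda>s. limit (F s)) s (D (1,0)) (D (0,1)) \<and>
     cross3 (D (1,0)) (D (0,1)) \<noteq> 0 \<and> s \<in> corners"
    if F: "F \<in> T" "s \<in> sq" "F s = p" for F s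
  proof -
    have sc: "s \<in> corners" using vertex_corner[OF extraordinary_vertex[OF x] F] .
    then obtain d where d: "d \<in> frames" "d (0,0) = s" by (rule corner_frame)
    obtain e where e: "e \<in> frames" "\<And>s. e (d s) = s" "\<And>s. d (e s) = s" using frames_inverse[OF d(1)] by blast
    let ?C = "act 3 d (jt 0 F)"
    obtain D where D: "hder (bsp ?C) (0,0) D" "D (1,0) = 4 *\<^sub>R (?C 1 0 - ?C 0 0)" "D (0,1) = 4 *\<^sub>R (?C 0 1 - ?C 0 0)" by (rule bsp_hder_origin)
    have C: "(?C j k - vc T (Xs 0) p) \<bullet> n p = 0" if "j \<le> 1" "k \<le> 1" for j k
      using refinement.joint_plane[OF refinement_step.axioms(1)[OF step], of F 0 d j k] F d x that by (simp add: Xs_Suc)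
    have "D (1,0) \<bullet> n p = 0" "D (0,1) \<bullet> n p = 0" using C[of 1 0] C[of 0 0] C[of 0 1] by (simp_all add: D inner_diff_left)
    then have "span {D (1,0), D (0,1)} \<subseteq> {v. v \<bullet> n p = 0}"
      by (intro span_minimal) (auto simp: subspace_def inner_add_left)
    then have Dn: "D h \<bullet> n p = 0" for h using linear_span_pair[OF has_derivative_linear[OF D(1)], of h] by blast
    have "e s = (0,0)" using e(2)[of "(0,0)"] d(2) by simp
    then have "hder (bsp ?C \<circ> e) s (D \<circ> lin e)" using hder_frame[where g = "bsp ?C" and d = e and s = s and D = D] D(1) e(1) by simp
    moreover have "bsp ?C \<circ> e = bsp (jt 0 F)" by (rule ext) (simp add: bsp_frame[OF d(1), symmetric] e(3))
    ultimately have D': "hder (bsp (jt 0 F)) s (D \<circ> lin e)" by simp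
    have part: "has_partials (bsp (jt 0 F)) s ((D \<circ> lin e) (1,0)) ((D \<circ> lin e) (0,1))" using hder_partials[OF D' F(2)] by blast
    have s01: "fst s \<in> {0,1}" "snd s \<in> {0,1}" "fst s \<in> {0..1}" "snd s \<in> {0..1}" using sc by (auto simp: corners_def)
    \<comment> \<open>The partial derivatives at a corner see only the two sides through it, where
      the steps after the first refinement do not move the surface.\<close>
    have "limit (F (t, snd s)) = bsp (jt 0 F) (t, snd s)" "limit (F (fst s, t)) = bsp (jt 0 F) (fst s, t)" if "t \<in> {0..1}" for t
      using that s01 by (intro limit_side[OF F(1)]; simp add: sq_iff)+
    then have part': "has_partials (\<lambda>s. limit (F s)) s ((D \<circ> lin e) (1,0)) ((D \<circ> lin e) (0,1))"
      using part s01 unfolding has_partials_def by (auto intro: has_vector_derivative_transform)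
    moreover have "regular (\<lambda>s. limit (F s)) s" using reg F unfolding regular_at_def by blast
    ultimately have "cross3 ((D \<circ> lin e) (1,0)) ((D \<circ> lin e) (0,1)) \<noteq> 0" unfolding regular_def by simp
    then show ?thesis using D' Dn sc part' by (intro exI[of _ "D \<circ> lin e"]) simp
  qed
  have W: "{v. v \<bullet> cross3 a b = 0} = ?W" if "a \<bullet> n p = 0" "b \<bullet> n p = 0" "cross3 a b \<noteq> 0" for a b
  proof -
    have "v \<bullet> cross3 a b = 0 \<longleftrightarrow> v \<bullet> n p = 0" for v
      by (rule null_parallel[OF geometry.cross_plane_parallel[OF geo that(1,2) n0 that(3)] that(3) n0])
    then show ?thesis by simp
  qed
  obtain F0 s0 where F0: "F0 \<in> T" "s0 \<in> sq" "F0 s0 = p" using p by (auto simp: carrier_of_def)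
  from main[OF F0] obtain D0 where "hder (bsp (jt 0 F0)) s0 D0" and D0: "\<forall>h. D0 h \<bullet> n p = 0" and
    "has_partials (\<lambda>s. limit (F0 s)) s0 (D0 (1,0)) (D0 (0,1))" and D1: "cross3 (D0 (1,0)) (D0 (0,1)) \<noteq> 0" and "s0 \<in> corners"
    by (elim exE conjE)
  have "tangent_plane T (\<lambda>F s. limit (F s)) p ?W"
    unfolding tangent_plane_def
  proof (intro conjI ballI impI)
    show "subspace ?W" "dim ?W = 2" using span_cross(2,3)[OF D1] W[OF D0[rule_format] D0[rule_format] D1] by simp_all
    fix F s assume F: "F \<in> T" "s \<in> sq" "F s = p"
    from main[OF F] obtain D where D: "hder (bsp (jt 0 F)) s D" "\<forall>h. D h \<bullet> n p = 0" "has_partials (\<lambda>s. limit (F s)) s (D (1,0)) (D (0,1))"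
      "cross3 (D (1,0)) (D (0,1)) \<noteq> 0" "s \<in> corners"
      by (elim exE conjE)
    have "span {D (1,0), D (0,1)} = ?W"
      using span_cross(1)[OF D(4)] W[OF D(2)[rule_format] D(2)[rule_format] D(4)] by simp
    with D(3) show "\<exists>a b. has_partials (\<lambda>s. limit (F s)) s a b \<and> span {a, b} = ?W"
      by (intro exI[of _ "D (1,0)"] exI[of _ "D (0,1)"] conjI)
    show "((\<lambda>t. infdist (limit (F t) - limit (F s)) ?W / dist t s) \<longlongrightarrow> 0) (at s within sq)"
    proof (rule touching_plane[OF D(1)])
      \<comment> \<open>The squares at the other corners have side 1/2 and do not contain
        \<open>s\<close>, so near \<open>s\<close> only the bumps at \<open>s\<close> itself are
        active.\<close>
      have a: "away 0 q s" if "q \<in> corners - {s}" for q using that D(5) by (auto simp: away_def corners_def)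
      have "\<forall>\<^sub>F t in at s within sq. t \<in> sq \<and> (\<forall>q\<in>corners - {s}. away 0 q t)"
        by (rule away_near[OF a]) (simp_all add: corners_def)
      then show "\<forall>\<^sub>F t in at s within sq. infdist (limit (F t) - limit (F s)) ?W \<le>
          norm (bsp (jt 0 F) t - bsp (jt 0 F) s - D (t - s))"
      proof eventually_elim
        case (elim t)
        have near: "limit (F t') \<bullet> n p = bsp (jt 0 F) t' \<bullet> n p" if t': "t' \<in> sq" "\<forall>q\<in>corners - {s}. away 0 q t'" for t'
        proof (rule limit_inner[OF F(1) t'(1)])
          fix i q assume q: "q \<in> corners"
          show "corner_bump (Suc i) q t' = 0 \<or> dl i F q \<bullet> n p = 0"
          proof (cases "q = s")
            case True
            then show ?thesis using dl_plane[OF F(1) q] F(3) x by simp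
          next
            case False
            then show ?thesis using away_bump[of 0 q t' i] t' q by simp
          qed
        qed
        let ?r = "bsp (jt 0 F) t - bsp (jt 0 F) s - D (t - s)"
        have "(limit (F t) - limit (F s)) \<bullet> n p = ?r \<bullet> n p"
          using near[of t] near[of s] elim a F(2) D(2)[rule_format, of "t - s"] by (simp add: inner_diff_left)
        then have "infdist (limit (F t) - limit (F s)) ?W \<le> \<bar>?r \<bullet> n p\<bar> / norm (n p)"
          using infdist_normal_plane[OF n0, of "limit (F t) - limit (F s)"] by simp
        also have "\<dots> \<le> norm ?r" using Cauchy_Schwarz_ineq2[of ?r "n p"] n0 by (simp add: divide_le_eq)
        finally show ?case .
      qed
    qed
  qed
  then show ?thesis by blast
qed

theorem tangent_plane_ex1: "\<exists>!W. tangent_plane T (\<lambda>F s. limit (F s)) p W"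
  using ordinary_tangent_plane extraordinary_tangent_plane tangent_plane_unique[OF p] by blast

end

end

section \<open>The seven claims for one refinement step and for the repeated process\<close>

theorem proposition4p3:
  fixes T T' :: "'p mesh"
    and xs xs' :: "'p dof \<Rightarrow> real^3"
    and n :: "'p \<Rightarrow> real^3"
    and tri tri' :: "'p \<Rightarrow> nat \<Rightarrow> real^3"
    and fan :: "'p \<Rightarrow> ('p face \<times> frame) list"
    and x x' :: "('p, real^3) mesh_fun"
  assumes mesh: "quad_mesh T"
    and input: "almost_C1_input T xs n tri"
    and x: "x = almost_C1_geometry T xs n tri"
    and fan: "\<forall>\<gamma>\<in>extraordinary T. is_fan T \<gamma> (fan \<gamma>)"
    and T': "T' = refine T"
    and xs': "xs' = refined_points T fan x"
    and input': "almost_C1_input T' xs' n tri'"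
    and x': "x' = almost_C1_geometry T' xs' n tri'"
  shows
    \<comment> \<open>(a)\<close>
    "(\<exists>!A. refinement_matrix T fan (basis T xs n tri) (basis T' xs' n tri') A) \<and>
     (\<forall>A. refinement_matrix T fan (basis T xs n tri) (basis T' xs' n tri') A \<longrightarrow>
        (\<forall>\<phi>\<in>dof T'.
           control_point xs' tri' \<phi> = apply_matrix T A (control_point xs tri) \<phi> \<and>
           (\<forall>(z :: 'p dof \<Rightarrow> real^3) w.
              apply_matrix T A (\<lambda>\<psi>. z \<psi> + w) \<phi> = apply_matrix T A z \<phi> + w) \<and>
           (\<forall>(z :: 'p dof \<Rightarrow> real^3) (R :: real^3^3). rotation_matrix R \<longrightarrow>
              apply_matrix T A (\<lambda>\<psi>. R *v z \<psi>) \<phi> = R *v apply_matrix T A z \<phi>) \<and>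
           (\<Sum>\<psi>\<in>dof T. A \<phi> \<psi>) = 1)) \<and>
    \<comment> \<open>(b)\<close>
     (\<forall>F\<in>T. \<forall>d\<in>frames. side F d \<in> boundary_edges T \<longrightarrow>
        (\<forall>t\<in>{0..1}.
           x' (F \<circ> quad (d (0, 0))) (d (t, 0)) = x F (d (t / 2, 0)) \<and>
           x' (F \<circ> quad (d (1, 0))) (d (t, 0)) = x F (d ((1 + t) / 2, 0)))) \<and>
    \<comment> \<open>(c)\<close>
     (\<forall>F\<in>T. carrier_of F \<inter> extraordinary T = {} \<and>
            \<not> (\<exists>\<gamma>\<in>carrier_of F \<inter> corner_vertices T. valence T \<gamma> > 1) \<longrightarrow>
        (\<forall>q\<in>corners. \<forall>s\<in>unit_square. x' (F \<circ> quad q) s = x F (quad q s))) \<and>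
    \<comment> \<open>(d)\<close>
     (\<forall>\<gamma>\<in>extraordinary T.
        (\<forall>F\<in>faces_at T \<gamma>. carrier_of F \<inter> extraordinary T = {\<gamma>}) \<longrightarrow>
        (\<forall>F\<in>T. \<forall>d\<in>frames. F (d (0, 0)) = \<gamma> \<and> side F d \<in> interior_edges T \<longrightarrow>
           x' (F \<circ> quad (d (0, 0))) (d (1, 0)) = x F (d (1 / 2, 0)))) \<and>
    \<comment> \<open>(e)\<close>
     (\<forall>\<gamma>\<in>vertices T'. regular_at T' x' \<gamma> \<longrightarrow> (\<exists>\<nu>. normal_vector T' x' \<gamma> \<nu>)) \<and>
     (\<forall>\<gamma>\<in>vertices T. regular_at T x \<gamma> \<and> regular_at T' x' \<gamma> \<longrightarrow>
        (\<forall>\<nu>. normal_vector T' x' \<gamma> \<nu> \<longleftrightarrow> normal_vector T x \<gamma> \<nu>)) \<and>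
    \<comment> \<open>(f)\<close>
     dof T' = dof_star T' \<union> {Tri \<gamma> \<nu> | \<gamma> \<nu>. \<gamma> \<in> extraordinary T' \<and> \<nu> \<in> {1,2,3}} \<and>
     card (dof T') = card T' + card (boundary_edges T') + card (corner_vertices T')
                       + 3 * card (extraordinary T') \<and>
    \<comment> \<open>(g)\<close>
     (\<forall>Xs Tri_k Fan.
        Xs 0 = xs \<and> Tri_k 0 = tri \<and> refinement_process T n Xs Tri_k Fan \<longrightarrow>
        (\<exists>y. converges_to T (\<lambda>k. almost_C1_geometry (mesh_seq T k) (Xs k) n (Tri_k k)) y \<and>
             (\<forall>p\<in>\<Union> (carrier_of ` T).
                regular_at T (\<lambda>F s. y (F s)) p \<longrightarrow>
                (\<exists>!W. tangent_plane T (\<lambda>F s. y (F s)) p W))))"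
proof -
  interpret fanned T fan using mesh fan by unfold_locales
  interpret geometry T xs n tri using input by unfold_locales
  interpret refinement_step T xs n tri fan tri'
    using input' unfolding T' xs' x x_def[symmetric] by unfold_locales
  have x_eq: "x = local.x" and xs_eq: "xs' = refined_points T fan local.x"
    by (simp_all add: x xs' x_def)
  have x'_eq: "x' = R.x" by (simp add: x' T' xs_eq R.x_def)
  show ?thesis
    unfolding T' xs_eq x'_eq x_eq
  proof (intro conjI, goal_cases)
    case 1
    show ?case by (simp add: refinement_matrix_M)
  next
    case 2
    show ?case by (simp add: refinement_matrix_M M_control M_translation apply_matrix_rotation M_row_sum)
  next
    case 3
    show ?case using boundary_preserved by blast
  next
    case 4
    show ?case using structured_preserved by blast
  next
    case 5
    show ?case using spoke_midpoint by simp
  next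
    case 6
    show ?case using R.normal_exists by simp
  next
    case 7
    show ?case using normal_preserved by simp
  next
    case 8
    show ?case by (rule dof_refine)
  next
    case 9
    show ?case by (rule card_dof_refine)
  next
    case 10
    show ?case
    proof (intro allI impI)
      fix Xs Tri_k Fan assume "Xs 0 = xs \<and> Tri_k 0 = tri \<and> refinement_process T n Xs Tri_k Fan"
      then interpret L: process T n Xs Tri_k Fan by unfold_locales simp
      show "\<exists>y. converges_to T (\<lambda>k. almost_C1_geometry (mesh_seq T k) (Xs k) n (Tri_k k)) y \<and>
             (\<forall>p\<in>\<Union> (carrier_of ` T). regular_at T (\<lambda>F s. y (F s)) p \<longrightarrow> (\<exists>!W. tangent_plane T (\<lambda>F s. y (F s)) p W))"
        using L.converges L.tangent_plane_ex1 by (intro exI[of _ L.limit]) (simp add: L.X_eq)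
    qed
  qed
qed

end
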